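(* Let $[A,B]\in\mathcal{A}$ be arbitrary, and let $\phi\colon(\mathcal{P}_X,\nu_{\mathcal{P}})\to(\mathcal{T}_{AB},\nu_{\mathcal{T}})$ be an Edge correspondence, i.e. a bijection $\phi\colon\mathcal{P}_X\to\mathcal{T}_{AB}$ with $\nu_{\mathcal{T}}(\phi(\Pi),\phi(\Pi'))=\nu_{\mathcal{P}}(\Pi,\Pi')$ for all $\Pi,\Pi'\in\mathcal{P}_X$. Then the composite homomorphism $$\mathrm{P\Gamma U}(6,4)\xrightarrow{\ \rho_{\mathcal{P}}\ }\mathrm{Aut}(\mathcal{P}_X,\nu_{\mathcal{P}})\xrightarrow[\text{by }\phi]{\ \sim\ }\mathrm{Aut}(\mathcal{T}_{AB},\nu_{\mathcal{T}})\xrightarrow{\ \tau_{\mathcal{T}}\ }\mathrm{O}(\Lambda'_{AB})\xrightarrow[\sigma_{AB}^{-1}]{\ \sim\ }\circ 222_{AB}$$ is injective, has image of index $2$ in $\circ 222_{AB}$, and induces an isomorphism $\mathrm{PSU}(6,4)\cong\cdot 222_{AB}$.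
   Context: All groups act from the right. Geometric side: $\overline{\mathbb{F}}_2$ is an algebraically closed field of characteristic $2$; $X\subset\mathbb{P}^5$ is the Fermat cubic $4$-fold $x_1^3+\cdots+x_6^3=0$ over $\mathbb{F}_2$. $\mathcal{P}_X$ is the set of all linear planes ($2$-dimensional projective linear subspaces of $\mathbb{P}^5$) contained in $X\otimes\overline{\mathbb{F}}_2$; they are all defined over $\mathbb{F}_4$. For $\Pi,\Pi'\in\mathcal{P}_X$, $\nu_{\mathcal{P}}(\Pi,\Pi'):=\Pi\cdot\Pi'$ (intersection number of algebraic cycles on $X$) $=(1-(-2)^{\dim(\Pi\cap\Pi')+1})/3$, with $\dim(\emptyset)=-1$. $\mathrm{Aut}(\mathcal{P}_X,\nu_{\mathcal{P}})$ is the group of permutations of $\mathcal{P}_X$ preserving $\nu_{\mathcal{P}}$. For a matrix $g$ over $\overline{\mathbb{F}}_2$, $\bar g$ is obtained by applying $a\mapsto\bar a:=a^2$ to all entries. $\mathrm{GU}(6,4):=\{g\in\mathrm{GL}(6,\overline{\mathbb{F}}_2)\mid g\cdot{}^{T}\bar g=I_6\}$ (its elements have entries in $\mathbb{F}_4$), $\mathrm{PGU}(6,4):=\mathrm{GU}(6,4)/\mathbb{F}_4^\times$, and $\mathrm{PSU}(6,4)\subset\mathrm{PGU}(6,4)$ is the image of the subgroup of elements of $\mathrm{GU}(6,4)$ of determinant $1$. $\mathrm{PGU}(6,4)$ acts on the set $X(\mathbb{F}_4)$ of $\mathbb{F}_4$-rational points of $X$, and $\mathrm{P\Gamma U}(6,4)$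 is the subgroup of the full symmetric group of $X(\mathbb{F}_4)$ generated by the permutations induced by $\mathrm{PGU}(6,4)$ and by $\mathrm{Gal}(\mathbb{F}_4/\mathbb{F}_2)$; $\mathrm{PGU}(6,4)$ and $\mathrm{PSU}(6,4)$ are regarded as subgroups of it. $\rho_{\mathcal{P}}\colon\mathrm{P\Gamma U}(6,4)\to\mathrm{Aut}(\mathcal{P}_X,\nu_{\mathcal{P}})$ is the natural homomorphism given by the induced action on the planes. Lattice side: $\Lambda_{24}$ is the Leech lattice, i.e. the unique (up to isometry) positive-definite even unimodular lattice of rank $24$ with no vectors of square norm $2$, with inner product $\langle\ ,\ \rangle$; $O$ is its origin, and $\cdot 0:=\mathrm{O}(\Lambda_{24})$ is its orthogonal group. For points $P,Q$ of $\Lambda_{24}\otimes\mathbb{R}$, $PQ:=Q-P$ and $|PQ|:=\langle PQ,PQ\rangle^{1/2}$. $\mathcal{A}:=\{[A,B]\mid A,B\in\Lambda_{24},\ |OA|=|OB|=|AB|=2\}$. For $[A,B]\in\mathcal{A}$: $\mathcal{T}_{AB}:=\{T\in\Lambda_{24}\mid|OT|=|AT|=|BT|=2\}$; $\nu_{\mathcal{T}}(T,T'):=\langle CT,CT'\rangle=\langle OT,OT'\rangle-1$, where $C$ is the mid-point of an edge of the triangle $OAB$; $\mathrm{Aut}(\mathcal{T}_{AB},\nu_{\mathcal{T}})$ is the group of permutations of $\mathcal{T}_{AB}$ preserving $\nu_{\mathcal{T}}$; $\Lambda'_{AB}$ is the sublattice of $\Lambda_{24}$ generated by all vectors $TT'$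 with $T,T'\in\mathcal{T}_{AB}$; and $\tau_{\mathcal{T}}\colon\mathrm{Aut}(\mathcal{T}_{AB},\nu_{\mathcal{T}})\to\mathrm{O}(\Lambda'_{AB})$ is the natural homomorphism, sending $g$ to the isometry with $TT'\mapsto T^gT'^g$. The map "by $\phi$" is conjugation by $\phi$ (transport of permutations of $\mathcal{P}_X$ to permutations of $\mathcal{T}_{AB}$). $R_{AB}\subset\Lambda_{24}$ is the rank $2$ sublattice generated by $A,B$, and $R_{AB}^\perp$ is its orthogonal complement in $\Lambda_{24}$. Put $$\cdot 222_{AB}:=\{g\in\cdot 0\mid A^g=A,\ B^g=B\},\qquad \circ 222_{AB}:=\{g\in\cdot 0\mid R_{AB}^g=R_{AB}\}.$$ One has $\Lambda'_{AB}=R_{AB}^\perp$, and the restriction homomorphism $\sigma_{AB}\colon\circ 222_{AB}\to\mathrm{O}(R_{AB}^\perp)=\mathrm{O}(\Lambda'_{AB})$ is an isomorphism; $\sigma_{AB}^{-1}$ is its inverse. *)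

theory Defs
  imports
    "HOL-Analysis.Analysis"
    "HOL-Algebra.Bij"
    "HOL-Algebra.Coset"
    "HOL-Algebra.Generated_Groups"
    "HOL-Computational_Algebra.Polynomial"
    "HOL-Computational_Algebra.Group_Closure"
begin

section \<open>Groups of permutations acting from the right\<close>

text \<open>All groups act from the right: the product of \<open>f\<close> and \<open>g\<close> is ``first \<open>f\<close>, then \<open>g\<close>''. This is
  the opposite of the convention of \<^const>\<open>BijGroup\<close>; the underlying set is the same.\<close>

definition sym_group :: "'a set \<Rightarrow> ('a \<Rightarrow> 'a) monoid" where
  "sym_group S = \<lparr>carrier = Bij S, mult = (\<lambda>f g. compose S g f), one = (\<lambda>x\<in>S. x)\<rparr>"

definition aut_group :: "'a set \<Rightarrow> ('a \<Rightarrow> 'a \<Rightarrow> real) \<Rightarrow> ('a \<Rightarrow> 'a) monoid" where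
  "aut_group S \<nu> = (sym_group S)\<lparr>carrier := {f \<in> Bij S. \<forall>x\<in>S. \<forall>y\<in>S. \<nu> (f x) (f y) = \<nu> x y}\<rparr>"


section \<open>The Fermat cubic fourfold in characteristic 2\<close>

text \<open>The type \<open>'k\<close> is an algebraically closed field, to be assumed of characteristic 2 where these
  notions are used. Projective linear subspaces of \<open>\<P>\<^sup>5\<close> are represented by linear subspaces of
  \<open>'k ^ 6\<close> (of dimension one higher), and vectors are row vectors.\<close>

definition fermat_cone :: "('k::alg_closed_field ^ 6) set" where
  "fermat_cone = {x. (\<Sum>i\<in>UNIV. (x $ i) ^ 3) = 0}"

definition planes :: "('k::alg_closed_field ^ 6) set set" where
  "planes = {P. vec.subspace P \<and> vec.dim P = 3 \<and> P \<subseteq> fermat_cone}"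

text \<open>The intersection number of two planes on the cubic fourfold is
  \<open>(1 - (-2) ^ (d + 1)) / 3\<close>, where \<open>d\<close> is the dimension of the intersection as a projective space
  (\<open>-1\<close> if it is empty); \<open>d + 1\<close> is the vector space dimension below.\<close>

definition nu_P :: "('k::alg_closed_field ^ 6) set \<Rightarrow> ('k ^ 6) set \<Rightarrow> real" where
  "nu_P P P' = (1 - (- 2) ^ vec.dim (P \<inter> P')) / 3"

text \<open>The subfield with four elements.\<close>

definition F4 :: "'k::alg_closed_field set" where
  "F4 = {a. a ^ 4 = a}"

text \<open>The \<open>\<F>\<^sub>4\<close>-rational points of the cubic fourfold.\<close>

definition rational_points :: "('k::alg_closed_field ^ 6) set set" where
  "rational_points = {vec.span {v} |v. v \<noteq> 0 \<and> (\<forall>i. v $ i \<in> F4) \<and> v \<in> fermat_cone}"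

definition mat_bar :: "'k::alg_closed_field ^ 6 ^ 6 \<Rightarrow> 'k ^ 6 ^ 6" where
  "mat_bar = map_matrix (\<lambda>a. a\<^sup>2)"

definition GU :: "('k::alg_closed_field ^ 6 ^ 6) monoid" where
  "GU = \<lparr>carrier = {g. invertible g \<and> g ** transpose (mat_bar g) = mat 1},
         mult = (**), one = mat 1\<rparr>"

definition scalars :: "('k::alg_closed_field ^ 6 ^ 6) set" where
  "scalars = {mat c |c. c \<in> F4 \<and> c \<noteq> 0}"

definition PGU :: "('k::alg_closed_field ^ 6 ^ 6) set monoid" where
  "PGU = GU Mod scalars"

definition PSU :: "('k::alg_closed_field ^ 6 ^ 6) set monoid" where
  "PSU = PGU\<lparr>carrier := {scalars #>\<^bsub>GU\<^esub> g |g. g \<in> carrier GU \<and> det g = 1}\<rparr>"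

text \<open>The action of \<open>PGU\<close> on the rational points. An element \<open>U\<close> of \<open>PGU\<close> is a coset of the scalars;
  all its members map a given point, which is a line in \<open>'k ^ 6\<close>, to the same line.\<close>

definition pgu_perm ::
    "('k::alg_closed_field ^ 6 ^ 6) set \<Rightarrow> ('k ^ 6) set \<Rightarrow> ('k ^ 6) set" where
  "pgu_perm U = (\<lambda>L\<in>rational_points. \<Union>g\<in>U. (\<lambda>v. v v* g) ` L)"

text \<open>The permutation given by the generator of the Galois group of \<open>\<F>\<^sub>4\<close> over \<open>\<F>\<^sub>2\<close>.\<close>

definition frob_perm :: "('k::alg_closed_field ^ 6) set \<Rightarrow> ('k ^ 6) set" where
  "frob_perm = (\<lambda>L\<in>rational_points. (\<lambda>v. \<chi> i. (v $ i)\<^sup>2) ` L)"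

definition PGammaU :: "(('k::alg_closed_field ^ 6) set \<Rightarrow> ('k ^ 6) set) monoid" where
  "PGammaU = subgroup_generated (sym_group rational_points)
               (insert frob_perm (pgu_perm ` carrier PGU))"

text \<open>The planes are defined over \<open>\<F>\<^sub>4\<close>, so each of them is spanned by the rational points it
  contains; a permutation \<open>p\<close> in \<open>PGammaU\<close> maps the rational points of a plane to those of a plane.\<close>

definition rho_P ::
    "(('k::alg_closed_field ^ 6) set \<Rightarrow> ('k ^ 6) set) \<Rightarrow> ('k ^ 6) set \<Rightarrow> ('k ^ 6) set" where
  "rho_P p = (\<lambda>P\<in>planes. vec.span (\<Union>{p L |L. L \<in> rational_points \<and> L \<subseteq> P}))"


section \<open>The Leech lattice\<close>

text \<open>Up to isometry, the positive-definite lattices of rank 24 are the subgroups of the Euclidean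
  space \<open>\<real>\<^sup>2\<^sup>4\<close> generated by a basis.\<close>

definition leech_lattice :: "(real ^ 24) set \<Rightarrow> bool" where
  "leech_lattice \<Lambda> \<longleftrightarrow>
     (\<exists>E. independent E \<and> span E = UNIV \<and> \<Lambda> = group_closure E) \<and>
     (\<forall>x\<in>\<Lambda>. \<exists>n::int. x \<bullet> x = 2 * of_int n) \<and>
     {y. \<forall>x\<in>\<Lambda>. x \<bullet> y \<in> \<int>} = \<Lambda> \<and>
     (\<forall>x\<in>\<Lambda>. x \<bullet> x \<noteq> 2)"

definition orth_group :: "(real ^ 24) set \<Rightarrow> (real ^ 24 \<Rightarrow> real ^ 24) monoid" where
  "orth_group M = (sym_group M)\<lparr>carrier :=
     {f \<in> Bij M. (\<forall>x\<in>M. \<forall>y\<in>M. f (x + y) = f x + f y) \<and> (\<forall>x\<in>M. \<forall>y\<in>M. f x \<bullet> f y = x \<bullet> y)}\<rparr>"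

definition edge_pairs :: "(real ^ 24) set \<Rightarrow> ((real ^ 24) \<times> (real ^ 24)) set" where
  "edge_pairs \<Lambda> = {(A, B). A \<in> \<Lambda> \<and> B \<in> \<Lambda> \<and> dist 0 A = 2 \<and> dist 0 B = 2 \<and> dist A B = 2}"

definition T_set :: "(real ^ 24) set \<Rightarrow> real ^ 24 \<Rightarrow> real ^ 24 \<Rightarrow> (real ^ 24) set" where
  "T_set \<Lambda> A B = {T \<in> \<Lambda>. dist 0 T = 2 \<and> dist A T = 2 \<and> dist B T = 2}"

text \<open>The reference point is the mid-point of the edge \<open>OA\<close>; the lemma \<open>nu_T_eq\<close> shows that every
  edge of the triangle \<open>OAB\<close> gives the same form.\<close>

definition nu_T :: "real ^ 24 \<Rightarrow> real ^ 24 \<Rightarrow> real ^ 24 \<Rightarrow> real" where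
  "nu_T A T T' = (T - midpoint 0 A) \<bullet> (T' - midpoint 0 A)"

lemma nu_T_eq:
  assumes "(A, B) \<in> edge_pairs \<Lambda>" "T \<in> T_set \<Lambda> A B" "T' \<in> T_set \<Lambda> A B"
    and "C \<in> {midpoint 0 A, midpoint 0 B, midpoint A B}"
  shows "(T - C) \<bullet> (T' - C) = T \<bullet> T' - 1" and "nu_T A T T' = T \<bullet> T' - 1"
proof -
  have sq: "x \<bullet> x - 2 * (x \<bullet> y) + y \<bullet> y = 4" if "dist x y = 2" for x y :: "real ^ 24"
  proof -
    have "(x - y) \<bullet> (x - y) = 2\<^sup>2"
      using that by (metis dist_norm power2_norm_eq_inner)
    then show ?thesis
      by (simp add: inner_diff_left inner_diff_right inner_commute)
  qed
  have d: "dist 0 A = 2" "dist 0 B = 2" "dist A B = 2" "dist 0 T = 2" "dist A T = 2" "dist B T = 2"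
    "dist 0 T' = 2" "dist A T' = 2" "dist B T' = 2"
    using assms by (auto simp: edge_pairs_def T_set_def)
  have *: "(T - C) \<bullet> (T' - C) = T \<bullet> T' - 1"
    if "C \<in> {midpoint 0 A, midpoint 0 B, midpoint A B}" for C
    using that d[THEN sq]
    by (auto simp: midpoint_def inner_diff_left inner_diff_right inner_add_left inner_add_right
        inner_commute field_simps)
  show "(T - C) \<bullet> (T' - C) = T \<bullet> T' - 1"
    using * assms(4) by blast
  show "nu_T A T T' = T \<bullet> T' - 1"
    unfolding nu_T_def using * by blast
qed

definition Lambda_AB :: "(real ^ 24) set \<Rightarrow> real ^ 24 \<Rightarrow> real ^ 24 \<Rightarrow> (real ^ 24) set" where
  "Lambda_AB \<Lambda> A B = group_closure {T' - T |T T'. T \<in> T_set \<Lambda> A B \<and> T' \<in> T_set \<Lambda> A B}"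

definition tau_T :: "(real ^ 24) set \<Rightarrow> real ^ 24 \<Rightarrow> real ^ 24 \<Rightarrow>
    (real ^ 24 \<Rightarrow> real ^ 24) \<Rightarrow> (real ^ 24 \<Rightarrow> real ^ 24)" where
  "tau_T \<Lambda> A B g = (THE h. h \<in> carrier (orth_group (Lambda_AB \<Lambda> A B)) \<and>
     (\<forall>T\<in>T_set \<Lambda> A B. \<forall>T'\<in>T_set \<Lambda> A B. h (T' - T) = g T' - g T))"

definition R_AB :: "real ^ 24 \<Rightarrow> real ^ 24 \<Rightarrow> (real ^ 24) set" where
  "R_AB A B = group_closure {A, B}"

definition R_perp :: "(real ^ 24) set \<Rightarrow> real ^ 24 \<Rightarrow> real ^ 24 \<Rightarrow> (real ^ 24) set" where
  "R_perp \<Lambda> A B = {x \<in> \<Lambda>. \<forall>r\<in>R_AB A B. x \<bullet> r = 0}"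

definition dot222 ::
    "(real ^ 24) set \<Rightarrow> real ^ 24 \<Rightarrow> real ^ 24 \<Rightarrow> (real ^ 24 \<Rightarrow> real ^ 24) monoid" where
  "dot222 \<Lambda> A B = (orth_group \<Lambda>)\<lparr>carrier := {g \<in> carrier (orth_group \<Lambda>). g A = A \<and> g B = B}\<rparr>"

definition circ222 ::
    "(real ^ 24) set \<Rightarrow> real ^ 24 \<Rightarrow> real ^ 24 \<Rightarrow> (real ^ 24 \<Rightarrow> real ^ 24) monoid" where
  "circ222 \<Lambda> A B =
     (orth_group \<Lambda>)\<lparr>carrier := {g \<in> carrier (orth_group \<Lambda>). g ` R_AB A B = R_AB A B}\<rparr>"

definition sigma_AB :: "(real ^ 24) set \<Rightarrow> real ^ 24 \<Rightarrow> real ^ 24 \<Rightarrow>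
    (real ^ 24 \<Rightarrow> real ^ 24) \<Rightarrow> (real ^ 24 \<Rightarrow> real ^ 24)" where
  "sigma_AB \<Lambda> A B g = restrict g (R_perp \<Lambda> A B)"


section \<open>Edge correspondences and the composite homomorphism\<close>

definition edge_correspondence :: "(real ^ 24) set \<Rightarrow> real ^ 24 \<Rightarrow> real ^ 24 \<Rightarrow>
    (('k::alg_closed_field ^ 6) set \<Rightarrow> real ^ 24) \<Rightarrow> bool" where
  "edge_correspondence \<Lambda> A B \<phi> \<longleftrightarrow>
     bij_betw \<phi> planes (T_set \<Lambda> A B) \<and>
     (\<forall>P\<in>planes. \<forall>P'\<in>planes. nu_T A (\<phi> P) (\<phi> P') = nu_P P P')"

definition by_phi :: "(real ^ 24) set \<Rightarrow> real ^ 24 \<Rightarrow> real ^ 24 \<Rightarrow>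
    (('k::alg_closed_field ^ 6) set \<Rightarrow> real ^ 24) \<Rightarrow>
    (('k ^ 6) set \<Rightarrow> ('k ^ 6) set) \<Rightarrow> (real ^ 24 \<Rightarrow> real ^ 24)" where
  "by_phi \<Lambda> A B \<phi> f = (\<lambda>T\<in>T_set \<Lambda> A B. \<phi> (f (inv_into planes \<phi> T)))"

text \<open>The composite of \<open>rho_P\<close>, \<open>by_phi\<close>, \<open>tau_T\<close> and the inverse of the isomorphism \<open>sigma_AB\<close> from
  \<open>circ222\<close> onto the orthogonal group of \<open>R_perp = Lambda_AB\<close>.\<close>

definition edge_hom :: "(real ^ 24) set \<Rightarrow> real ^ 24 \<Rightarrow> real ^ 24 \<Rightarrow>
    (('k::alg_closed_field ^ 6) set \<Rightarrow> real ^ 24) \<Rightarrow>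
    (('k ^ 6) set \<Rightarrow> ('k ^ 6) set) \<Rightarrow> (real ^ 24 \<Rightarrow> real ^ 24)" where
  "edge_hom \<Lambda> A B \<phi> p =
     inv_into (carrier (circ222 \<Lambda> A B)) (sigma_AB \<Lambda> A B)
       (tau_T \<Lambda> A B (by_phi \<Lambda> A B \<phi> (rho_P p)))"

end

theory Submission
  imports Defs
begin

text \<open>
  Put \<open>G = (A + B) / 3\<close>. The vectors \<open>tt P = \<phi> P - G\<close> are orthogonal to \<open>A\<close> and \<open>B\<close>, and their inner
  products depend only on \<open>dim (P \<inter> Q)\<close>. The whole theorem is obtained by comparing two explicit
  descriptions of the same configuration, one over the field with four elements and one inside the
  Leech lattice, in coordinates adapted to a pair of disjoint planes.

  \<^emph>\<open>Coordinates on the planes.\<close> Writing a vector of the six-dimensional space as \<open>J x y\<close> with \<open>x\<close> and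
  \<open>y\<close> of dimension 3, the cubic form becomes the hyperbolic Hermitian form. A plane of the cubic is a
  maximal totally isotropic subspace. The planes used as coordinates are \<open>Winf = {J 0 y}\<close>, the graphs
  \<open>W H\<close> of Hermitian matrices \<open>H\<close> (exactly the planes disjoint from \<open>Winf\<close>), and for each point \<open>s\<close> of
  the projective plane over the field with four elements the two further planes \<open>Psa s 0\<close> and
  \<open>Psa s 1\<close> that meet \<open>Winf\<close> in the line polar to \<open>s\<close>.
  The vectors \<open>u0\<close> (from \<open>Winf\<close>) and \<open>u s\<close> (from \<open>Psa s 0\<close> and \<open>Psa s 1\<close>) form, with two vectors
  spanning the plane of the triangle, an orthogonal basis of the 24-dimensional space, and \<open>W H\<close>
  corresponds to \<open>u0 + (\<Sum>s. \<plusminus> u s)\<close> with signs given by the values of the Hermitian form \<open>q H s\<close>.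

  \<^emph>\<open>The lattice generated by the planes is all of \<open>R_perp\<close>\<close> (\<open>M_eq_L\<close>). The
  coordinates of a lattice vector modulo 4 define a set of points of the projective plane;
  subtracting vectors attached to lines shrinks it until no line meets it in more than two points.
  It is then empty or a hyperoval with six points (\<open>hyperoval_size\<close>), and evenness of the norm
  excludes the hyperoval.

  \<^emph>\<open>Symmetries of the planes.\<close> A permutation of the planes that preserves the dimensions of
  intersections is induced by a semilinear isometry (\<open>fundamental\<close>): after moving two
  disjoint planes to \<open>Winf\<close> and \<open>W 0\<close> it permutes the 21 points and preserves collinearity, hence
  after composition with explicit isometries it fixes every point, thus the orthogonal frame, thus
  every plane.

  \<^emph>\<open>Lifting to the lattice.\<close> The vectors \<open>vertex 0\<close>, \<open>vertex 1\<close>, \<open>vertex 2\<close> are the vertices of the triangle seen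
  from its centre. The Leech lattice is glued from \<open>R_perp\<close> and the plane of the triangle, and the
  three glue classes of order 2 are indexed by these vertices. Therefore a symmetry of the planes extends to exactly
  one isometry of the Leech lattice that permutes the three vertices (\<open>lift_exists\<close>,
  \<open>lift_unique\<close>), and the composite homomorphism sends a semilinear isometry to its lift
  (\<open>edge_map_perm\<close>). An isometry that preserves the lattice of the triangle permutes the vertices up to a
  common sign (\<open>circ_cases\<close>), and \<open>-1\<close> does not permute them, so the image has index 2.

  \<^emph>\<open>Which lifts fix the triangle pointwise.\<close> The three vertices are distinguished by
  three classes of hyperovals: the vector \<open>oval_vec\<close> of a hyperoval is a glue vector, and two of them lie
  in the same class exactly if their inner product is an integer (\<open>glue_inner\<close>). On these vectors the
  effect of an isometry can be computed. The generators \<open>U H\<close> and \<open>swI {i}\<close> fix the three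
  vertices and have determinant 1, the diagonal maps \<open>Dg (dd \<delta>)\<close> with
  \<open>\<delta> \<noteq> 1\<close> and all semilinear maps move a vertex. Since every isometry is
  a product of generators and one \<open>Dg (dd \<delta>)\<close>, whose determinant is \<open>\<delta>\<^sup>2\<close>, the stabilizer of the three vertices
  consists of the isometries of determinant 1 (\<open>fixes_vertices_det\<close>, \<open>fixes_vertices_semi\<close>).
\<close>

section \<open>The field with four elements and the Hermitian form\<close>

definition herm :: "'k::comm_ring_1 ^ 'n \<Rightarrow> 'k ^ 'n \<Rightarrow> 'k" where
  "herm x y = (\<Sum>i\<in>UNIV. x $ i * (y $ i)\<^sup>2)"

definition sqv :: "'k::comm_ring_1 ^ 'n \<Rightarrow> 'k ^ 'n" where
  "sqv x = (\<chi> i. (x $ i)\<^sup>2)"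

definition F4v :: "('k::alg_closed_field ^ 'n) set" where
  "F4v = {x. \<forall>i. x $ i \<in> F4}"

lemma UNIV_6: "UNIV = {1, 2, 3, 4, 5, 6::6}"
proof -
  have "x = 1 \<or> x = 2 \<or> x = 3 \<or> x = 4 \<or> x = 5 \<or> x = 6" for x :: 6
  proof (induct x)
    case (of_int z)
    then have "z = 0 \<or> z = 1 \<or> z = 2 \<or> z = 3 \<or> z = 4 \<or> z = 5" by fastforce
    then show ?case by auto
  qed
  then show ?thesis by blast
qed

lemma sum_6: "sum f (UNIV::6 set) = f 1 + f 2 + f 3 + f 4 + f 5 + f 6"
  unfolding UNIV_6 by (simp add: ac_simps)

lemma forall_6: "(\<forall>i::6. P i) \<longleftrightarrow> P 1 \<and> P 2 \<and> P 3 \<and> P 4 \<and> P 5 \<and> P 6"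
  by (metis UNIV_6 UNIV_I insertE singletonD)

text \<open>The hypothesis on \<open>l\<close> is plain additivity and homogeneity, so that it
  applies to functionals such as \<open>\<lambda>x. herm x v\<close>.\<close>

lemma dim_kernel_functional:
  fixes l :: "'k::field ^ 'n \<Rightarrow> 'k"
  assumes S: "vec.subspace S" and add: "\<And>x y. l (x + y) = l x + l y"
    and scale: "\<And>c x. l (c *s x) = c * l x" and x0: "x0 \<in> S" "l x0 \<noteq> 0"
  shows "vec.dim S = vec.dim {x \<in> S. l x = 0} + 1"
proof -
  let ?K = "{x \<in> S. l x = 0}"
  have l0: "l 0 = 0" using scale[of 0 0] by simp
  have ld: "l (x - y) = l x - l y" for x y
    using add[of "x - y" y] by simp
  have K: "vec.subspace ?K"
    using S by (auto simp: vec.subspace_def add scale l0)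
  have spK: "vec.span ?K = ?K" using K by (simp add: vec.span_eq_iff)
  have "S \<subseteq> vec.span (insert x0 ?K)"
  proof
    fix x assume x: "x \<in> S"
    let ?c = "l x / l x0"
    have "x - ?c *s x0 \<in> ?K"
      using x x0 S by (auto simp: ld scale vec.subspace_diff vec.subspace_scale)
    then show "x \<in> vec.span (insert x0 ?K)"
      unfolding vec.span_breakdown_eq spK by blast
  qed
  moreover have "vec.span (insert x0 ?K) \<subseteq> S"
    using S x0 by (intro vec.span_minimal) auto
  ultimately have "S = vec.span (insert x0 ?K)" by blast
  then have "vec.dim S = vec.dim (insert x0 ?K)" by (metis vec.dim_span)
  also have "\<dots> = vec.dim ?K + 1"
    using x0 by (simp add: vec.dim_insert spK)
  finally show ?thesis .
qed

lemma dim_semilinear_le: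
  fixes m :: "'k::field ^ 'n \<Rightarrow> 'k ^ 'm"
  assumes add: "\<And>x y. m (x + y) = m x + m y" and scale: "\<And>c x. m (c *s x) = \<sigma> c *s m x"
  shows "vec.dim (m ` S) \<le> vec.dim S"
proof -
  obtain B where B: "B \<subseteq> S" "vec.independent B" "S \<subseteq> vec.span B" "card B = vec.dim S"
    using vec.basis_exists by blast
  have fB: "finite B" using B(2) vec.finiteI_independent by blast
  have m0: "m 0 = 0" using add[of 0 0] by simp
  have "m x \<in> vec.span (m ` B)" if "x \<in> vec.span B" for x
    using that
  proof (induction rule: vec.span_induct_alt)
    case base then show ?case by (simp add: m0 vec.span_zero)
  next
    case (step c x y)
    then show ?case by (simp add: add scale vec.span_add vec.span_base vec.span_scale)
  qed
  then have "m ` S \<subseteq> vec.span (m ` B)" using B(3) by blast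
  then have "vec.dim (m ` S) \<le> card (m ` B)" using fB by (simp add: vec.dim_le_card)
  also have "\<dots> \<le> card B" using fB by (rule card_image_le)
  finally show ?thesis using B by simp
qed

text \<open>A primitive cube root of unity \<open>w\<close> is fixed: \<open>{0, 1, w, w +
  1}\<close> is the subfield with four elements.\<close>

locale char2_field =
  fixes w :: "'k::alg_closed_field"
  assumes char2: "CHAR('k) = 2" and w2: "w * w = w + 1"
begin

lemma add_self [simp]: "(x::'k) + x = 0"
proof -
  have "of_nat 2 = (0::'k)" using char2 by (metis of_nat_CHAR)
  then have "(1::'k) + 1 = 0" by simp
  then have "x * (1 + 1) = 0" by simp
  then show ?thesis by (simp only: distrib_left mult_1_right)
qed

lemma two_eq_0 [simp]: "(2::'k) = 0"
  using add_self[of 1] by (simp only: one_add_one)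

lemma uminus_id [simp]: "- (x::'k) = x"
  using add_self[of x] by (metis add_eq_0_iff)

lemma diff_eq_add: "(x::'k) - y = x + y"
  by (metis uminus_id diff_conv_add_uminus)

lemma add_self_assoc [simp]: "(x::'k) + (x + y) = y"
  by (simp add: add.assoc[symmetric])

lemma add_eq_0_iff_eq: "(x::'k) + y = 0 \<longleftrightarrow> x = y"
  by (metis add_self add_right_imp_eq)

lemma sq_add: "((x::'k) + y)\<^sup>2 = x\<^sup>2 + y\<^sup>2"
proof -
  have "(x + y)\<^sup>2 = x\<^sup>2 + y\<^sup>2 + (x * y + x * y)" by (simp add: power2_eq_square algebra_simps)
  then show ?thesis by simp
qed

lemma w_sq: "w\<^sup>2 = w + 1" by (simp add: power2_eq_square w2)

lemma w_neq [simp]: "w \<noteq> 0" "w \<noteq> 1" "w + 1 \<noteq> 0" "0 \<noteq> w" "1 \<noteq> w" "w + 1 \<noteq> 1"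
  "w + 1 \<noteq> w"
proof -
  show "w \<noteq> 0" "w \<noteq> 1" using w2 by auto
  then show "w + 1 \<noteq> 0" "0 \<noteq> w" "1 \<noteq> w" "w + 1 \<noteq> 1" "w + 1 \<noteq> w" by (auto simp: add_eq_0_iff_eq)
qed

lemma ww1: "w * (w + 1) = 1" "(w + 1) * w = 1" "(w + 1) * (w + 1) = w"
  by (simp_all add: algebra_simps w2)

lemma sq_sum: "(sum f S :: 'k)\<^sup>2 = (\<Sum>i\<in>S. (f i)\<^sup>2)"
  by (induction S rule: infinite_finite_induct) (auto simp: sq_add)

lemma sq_inj [simp]: "(x::'k)\<^sup>2 = y\<^sup>2 \<longleftrightarrow> x = y"
proof
  assume "x\<^sup>2 = y\<^sup>2"
  then have "(x + y)\<^sup>2 = 0" by (simp add: sq_add)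
  then show "x = y" by (simp add: add_eq_0_iff_eq)
qed simp

lemma sq_surj: "\<exists>y::'k. y\<^sup>2 = x"
proof -
  have "\<exists>y. y ^ 2 = x" by (rule nth_root_exists) simp
  then show ?thesis by blast
qed

lemma F4_eq: "(F4 :: 'k set) = {0, 1, w, w + 1}"
proof -
  have e: "a ^ 4 - a = a * (a + 1) * (a + w) * (a + (w + 1))" for a :: 'k
  proof -
    have "(a + w) * (a + (w + 1)) = a * a + a * (w + w) + a + w * (w + 1)"
      by (simp only: algebra_simps mult_1_left mult_1_right)
    then have q: "(a + w) * (a + (w + 1)) = a * a + a + 1" by (simp add: ww1)
    have "a * (a + 1) * ((a + w) * (a + (w + 1)))
      = a ^ 4 + (a ^ 3 + a ^ 3) + (a\<^sup>2 + a\<^sup>2) + a"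
      unfolding q by (simp add: algebra_simps eval_nat_numeral)
    then show ?thesis by (simp add: diff_eq_add mult.assoc)
  qed
  have "a ^ 4 = a \<longleftrightarrow> a \<in> {0, 1, w, w + 1}" for a :: 'k
  proof -
    have "a ^ 4 = a \<longleftrightarrow> a * (a + 1) * (a + w) * (a + (w + 1)) = 0"
      unfolding e[symmetric] by simp
    then show ?thesis by (simp add: add_eq_0_iff_eq disj_assoc)
  qed
  then show ?thesis by (auto simp: F4_def)
qed

lemma F4_iff: "a \<in> F4 \<longleftrightarrow> a = 0 \<or> a = 1 \<or> a = w \<or> a = w + 1"
  by (auto simp: F4_eq)

lemma F4_sq_sq: "a \<in> F4 \<longleftrightarrow> (a\<^sup>2)\<^sup>2 = (a::'k)"
  by (simp add: F4_def power_mult[symmetric])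

lemma F4_intros [simp, intro]: "(0::'k) \<in> F4" "(1::'k) \<in> F4" "w \<in> F4" "w + 1 \<in> F4"
  by (auto simp: F4_eq)

lemma F4_add [intro]: "a \<in> F4 \<Longrightarrow> b \<in> F4 \<Longrightarrow> (a::'k) + b \<in> F4"
  by (simp add: F4_sq_sq sq_add)

lemma F4_mult [intro]: "a \<in> F4 \<Longrightarrow> b \<in> F4 \<Longrightarrow> (a::'k) * b \<in> F4"
  by (simp add: F4_sq_sq power_mult_distrib)

lemma F4_sq [intro]: "a \<in> F4 \<Longrightarrow> (a::'k)\<^sup>2 \<in> F4"
  by (simp add: F4_sq_sq)

lemma F4_inverse [intro]: "a \<in> F4 \<Longrightarrow> inverse (a::'k) \<in> F4"
  by (simp add: F4_sq_sq power_inverse)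

lemma F4_divide [intro]: "a \<in> F4 \<Longrightarrow> b \<in> F4 \<Longrightarrow> (a::'k) / b \<in> F4"
  by (simp add: divide_inverse F4_mult F4_inverse)

lemma F4_sum [intro]: "(\<And>i. i \<in> S \<Longrightarrow> f i \<in> F4) \<Longrightarrow> (sum f S :: 'k) \<in> F4"
  by (induction S rule: infinite_finite_induct) auto

text \<open>The norm to the prime field is \<open>a \<mapsto> a\<^sup>3\<close>, and it is 1 on
  all nonzero elements.\<close>

lemma F4_norm: "a \<in> F4 \<Longrightarrow> (a::'k) \<noteq> 0 \<Longrightarrow> a * a\<^sup>2 = 1"
  by (auto simp: F4_iff w_sq ww1 sq_add)

lemma F4_inverse_eq: "a \<in> F4 \<Longrightarrow> (a::'k) \<noteq> 0 \<Longrightarrow> inverse a = a\<^sup>2"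
  using F4_norm by (metis inverse_unique)

lemma herm_add_left: "herm (x + y) z = herm x z + herm y (z :: 'k^'n)"
  by (simp add: herm_def distrib_right sum.distrib)

lemma herm_add_right: "herm z (x + y) = herm z x + herm z (y :: 'k^'n)"
  by (simp add: herm_def distrib_left sq_add sum.distrib)

lemma herm_scale_left: "herm (c *s x) z = c * herm x (z :: 'k^'n)"
  by (simp add: herm_def sum_distrib_left mult_ac)

lemma herm_scale_right: "herm z (c *s x) = c\<^sup>2 * herm z (x :: 'k^'n)"
  by (simp add: herm_def sum_distrib_left mult_ac power_mult_distrib)

lemma herm_zero [simp]: "herm 0 x = 0" "herm x 0 = (0::'k)"
  by (simp_all add: herm_def)

lemmas herm_simps = herm_add_left herm_add_right herm_scale_left herm_scale_right

lemma herm_axis_right [simp]: "herm x (axis i 1) = (x $ i :: 'k)"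
  by (simp add: herm_def axis_def if_distrib[of "\<lambda>a. a\<^sup>2"] if_distrib[of "\<lambda>a. _ * a"] cong: if_cong)

lemma herm_axis_left [simp]: "herm (axis i 1) y = ((y $ i)\<^sup>2 :: 'k)"
  by (simp add: herm_def axis_def if_distrib[of "\<lambda>a. a * _"] cong: if_cong)

lemma herm_nondegenerate_left: "(\<And>y. herm x y = (0::'k)) \<Longrightarrow> x = 0"
  by (metis herm_axis_right vec_eq_iff zero_index)

lemma herm_nondegenerate_right: "(\<And>x. herm x y = (0::'k)) \<Longrightarrow> y = 0"
  by (metis herm_axis_left vec_eq_iff zero_index zero_eq_power2)

lemma herm_sqv: "herm (sqv x) (sqv y) = (herm x y :: 'k)\<^sup>2"
  by (simp add: herm_def sqv_def sq_sum power_mult_distrib)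

lemma sqv_add: "sqv (x + y) = sqv x + sqv (y::'k^'n)"
  by (simp add: sqv_def vec_eq_iff sq_add)

lemma sqv_scale: "sqv (c *s x) = c\<^sup>2 *s sqv (x::'k^'n)"
  by (simp add: sqv_def vec_eq_iff power_mult_distrib)

lemma sqv_inj [simp]: "sqv x = sqv y \<longleftrightarrow> x = (y::'k^'n)"
  by (simp add: sqv_def vec_eq_iff)

lemma sqv_zero [simp]: "sqv 0 = (0::'k^'n)" by (simp add: sqv_def vec_eq_iff)

lemma sqv_surj: "\<exists>y::'k^'n. sqv y = x"
proof -
  have "\<forall>i. \<exists>y. y\<^sup>2 = x $ i" using sq_surj by blast
  then obtain f where "\<And>i. (f i)\<^sup>2 = x $ i" by metis
  then have "sqv (\<chi> i. f i) = x" by (simp add: sqv_def vec_eq_iff)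
  then show ?thesis by blast
qed

lemma sqv_sqv_F4v: "x \<in> F4v \<longleftrightarrow> sqv (sqv x) = (x::'k^'n)"
  by (auto simp: F4v_def sqv_def F4_sq_sq vec_eq_iff)

lemma F4v_0 [simp]: "(0::'k^'n) \<in> F4v" by (simp add: F4v_def)

lemma F4v_add: "x \<in> F4v \<Longrightarrow> y \<in> F4v \<Longrightarrow> x + y \<in> (F4v::('k^'n) set)" by (auto simp: F4v_def)

lemma F4v_scale: "c \<in> F4 \<Longrightarrow> x \<in> F4v \<Longrightarrow> c *s x \<in> (F4v::('k^'n) set)" by (auto simp: F4v_def)

lemma F4v_sqv: "x \<in> F4v \<Longrightarrow> sqv x \<in> (F4v::('k^'n) set)" by (auto simp: F4v_def sqv_def)

lemma F4v_axis [simp]: "axis i 1 \<in> (F4v::('k^'n) set)" by (auto simp: F4v_def axis_def)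

text \<open>On vectors over the field with four elements squaring is the conjugation, so
  \<open>herm\<close> is Hermitian there; over the whole field it is only sesquilinear.\<close>

lemma herm_conj: "x \<in> F4v \<Longrightarrow> y \<in> F4v \<Longrightarrow> herm y x = (herm x y :: 'k)\<^sup>2"
  by (simp add: herm_def sq_sum power_mult_distrib F4v_def F4_sq_sq mult.commute)

lemma herm_F4: "x \<in> F4v \<Longrightarrow> y \<in> F4v \<Longrightarrow> (herm x y :: 'k) \<in> F4"
  unfolding herm_def F4v_def by (intro F4_sum) auto

lemma fermat_cone_iff: "v \<in> fermat_cone \<longleftrightarrow> herm v v = (0::'k)"
  by (simp add: fermat_cone_def herm_def power2_eq_square power3_eq_cube mult.assoc)

text \<open>Coordinates in which the standard Hermitian form is hyperbolic: on each pair of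
  coordinates the vectors \<open>(1, 1)\<close> and \<open>(w, w + 1)\<close> are isotropic with
  product 1.\<close>

definition J :: "'k^3 \<Rightarrow> 'k^3 \<Rightarrow> 'k^6" where
  "J x y = (\<chi> i. if i = 1 then x$1 + w * y$1 else if i = 2 then x$1 + (w+1) * y$1
     else if i = 3 then x$2 + w * y$2 else if i = 4 then x$2 + (w+1) * y$2
     else if i = 5 then x$3 + w * y$3 else x$3 + (w+1) * y$3)"

lemma J_nth [simp]: "J x y $ 1 = x$1 + w * y$1" "J x y $ 2 = x$1 + (w+1) * y$1"
  "J x y $ 3 = x$2 + w * y$2" "J x y $ 4 = x$2 + (w+1) * y$2"
  "J x y $ 5 = x$3 + w * y$3" "J x y $ 6 = x$3 + (w+1) * y$3"
  by (simp_all add: J_def)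

definition px :: "'k^6 \<Rightarrow> 'k^3" where
  "px v = (\<chi> i. if i = 1 then (w+1) * v$1 + w * v$2 else if i = 2 then (w+1) * v$3 + w * v$4
     else (w+1) * v$5 + w * v$6)"

definition py :: "'k^6 \<Rightarrow> 'k^3" where
  "py v = (\<chi> i. if i = 1 then v$1 + v$2 else if i = 2 then v$3 + v$4 else v$5 + v$6)"

lemma px_J [simp]: "px (J x y) = x"
proof -
  have "(w+1) * (a + w * b) + w * (a + (w+1) * b) = a" for a b
  proof -
    have "(w+1) * (a + w * b) + w * (a + (w+1) * b) = (w * a + w * a) + a + (((w+1)*w) * b + (w * (w+1)) * b)"
      by (simp only: algebra_simps mult_1_left mult_1_right)
    then show ?thesis by (simp add: ww1)
  qed
  then show ?thesis by (simp add: px_def vec_eq_iff forall_3)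
qed

lemma py_J [simp]: "py (J x y) = y"
proof -
  have "(a + w * b) + (a + (w+1) * b) = b" for a b
    by (simp add: algebra_simps)
  then show ?thesis by (simp add: py_def vec_eq_iff forall_3)
qed

lemma J_px_py [simp]: "J (px v) (py v) = v"
proof -
  have "(w+1) * a + w * b + w * (a + b) = a" for a b
  proof -
    have "(w+1) * a + w * b + w * (a + b) = a + (w * a + w * a) + (w * b + w * b)"
      by (simp only: algebra_simps mult_1_left mult_1_right)
    then show ?thesis by simp
  qed
  moreover have "(w+1) * a + w * b + (w+1) * (a + b) = b" for a b
  proof -
    have "(w+1) * a + w * b + (w+1) * (a + b) = b + ((w+1) * a + (w+1) * a) + (w * b + w * b)"
      by (simp only: algebra_simps mult_1_left mult_1_right)
    then show ?thesis by simp
  qed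
  ultimately show ?thesis by (simp add: vec_eq_iff forall_6 px_def py_def)
qed

lemma J_cases: obtains x y where "v = J x y" by (metis J_px_py)

lemma J_eq [simp]: "J x y = J x' y' \<longleftrightarrow> x = x' \<and> y = y'" by (metis px_J py_J)

lemma J_add: "J x y + J x' y' = J (x + x') (y + y')"
  by (simp add: vec_eq_iff forall_6 algebra_simps)

lemma J_scale: "c *s J x y = J (c *s x) (c *s y)"
  by (simp add: vec_eq_iff forall_6 algebra_simps)

lemma J_0: "J 0 0 = 0" by (simp add: vec_eq_iff forall_6)

lemma J_eq_0 [simp]: "J x y = 0 \<longleftrightarrow> x = 0 \<and> y = 0" by (metis J_0 J_eq)

lemma px_lin: "px (u + v) = px u + px v" "px (c *s v) = c *s px v"
  by (metis J_add J_px_py px_J, metis J_scale J_px_py px_J)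

lemma py_lin: "py (u + v) = py u + py v" "py (c *s v) = c *s py v"
  by (metis J_add J_px_py py_J, metis J_scale J_px_py py_J)

lemma F4v_J: "J x y \<in> F4v \<longleftrightarrow> x \<in> F4v \<and> y \<in> F4v"
proof
  assume "x \<in> F4v \<and> y \<in> F4v"
  then show "J x y \<in> F4v" by (auto simp: F4v_def forall_6 intro!: F4_add F4_mult)
next
  assume "J x y \<in> F4v"
  then have "px (J x y) \<in> F4v \<and> py (J x y) \<in> F4v"
    unfolding F4v_def px_def py_def by (auto simp: forall_3 forall_6 simp del: J_nth intro!: F4_add F4_mult)
  then show "x \<in> F4v \<and> y \<in> F4v" by simp
qed

lemma herm_J: "herm (J x y) (J x' y') = herm x y' + herm y x'"
proof -
  have *: "(a + w * b) * (a' + w * b')\<^sup>2 + (a + (w+1) * b) * (a' + (w+1) * b')\<^sup>2 = a * b'\<^sup>2 + b * a'\<^sup>2"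
    for a b a' b'
  proof -
    have s: "(w+1)\<^sup>2 = w" "w\<^sup>2 = w + 1" by (simp_all add: power2_eq_square ww1 w2)
    have "(a + w * b) * (a' + w * b')\<^sup>2 + (a + (w+1) * b) * (a' + (w+1) * b')\<^sup>2
      = (a + w * b) * (a'\<^sup>2 + (w+1) * b'\<^sup>2) + (a + (w+1) * b) * (a'\<^sup>2 + w * b'\<^sup>2)"
      by (simp add: sq_add power_mult_distrib s)
    also have "\<dots> = (a * a'\<^sup>2 + a * a'\<^sup>2) + (w * (b * a'\<^sup>2) + w * (b * a'\<^sup>2))
        + (w * (a * b'\<^sup>2) + w * (a * b'\<^sup>2)) + ((w * (w+1)) * (b * b'\<^sup>2) + ((w + 1) * w) * (b * b'\<^sup>2))
        + (a * b'\<^sup>2 + b * a'\<^sup>2)"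
      by (simp only: algebra_simps mult_1_left mult_1_right)
    finally show ?thesis by (simp add: ww1)
  qed
  show ?thesis
    unfolding herm_def sum_6 sum_3 J_nth
    using *[of "x$1" "y$1" "x'$1" "y'$1"] *[of "x$2" "y$2" "x'$2" "y'$2"] *[of "x$3" "y$3" "x'$3" "y'$3"]
    by (simp add: add.assoc[symmetric])
qed

section \<open>Coordinates for the planes\<close>

lemma planes_iff: "P \<in> planes \<longleftrightarrow> vec.subspace P \<and> vec.dim P = 3 \<and> (\<forall>v\<in>P. herm v v = (0::'k))"
  by (auto simp: planes_def fermat_cone_iff)

lemma plane_isotropic:
  assumes "P \<in> planes" "x \<in> P" "y \<in> P"
  shows "herm x y = (0::'k)"
proof -
  have sub: "vec.subspace P" and z: "\<And>v. v \<in> P \<Longrightarrow> herm v v = 0"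
    using assms(1) by (auto simp: planes_iff)
  have *: "t * herm y x + t\<^sup>2 * herm x y = 0" for t
  proof -
    have "x + t *s y \<in> P" using sub assms by (simp add: vec.subspace_add vec.subspace_scale)
    from z[OF this] z[OF assms(2)] z[OF assms(3)] show ?thesis
      by (simp add: herm_simps algebra_simps)
  qed
  from *[of 1] have "herm y x = herm x y" by (simp add: add_eq_0_iff_eq)
  with *[of w] have "(w + w\<^sup>2) * herm x y = 0" by (simp add: algebra_simps)
  then show ?thesis by (simp add: w_sq)
qed

text \<open>The coordinate planes. With the form written as \<open>herm x y' + herm y x'\<close>,
  a subspace complementary to \<open>{J 0 y}\<close> is isotropic exactly if it is the graph of a
  Hermitian matrix.\<close>

definition Winf :: "('k^6) set" where "Winf = {J 0 y |y. True}"

definition Herm :: "('k^3^3) set" where "Herm = {H. \<forall>i j. H$j$i = (H$i$j)\<^sup>2}"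

definition W :: "'k^3^3 \<Rightarrow> ('k^6) set" where "W H = {J x (x v* H) |x. True}"

text \<open>The planes through \<open>{J 0 y | herm y s = 0}\<close> other than
  \<open>Winf\<close>; the parameter \<open>a\<close> ranges over 0 and 1.\<close>

definition Psa :: "'k^3 \<Rightarrow> 'k \<Rightarrow> ('k^6) set" where
  "Psa s a = {J (l *s s) y |l y. herm y s = a * l}"

text \<open>The Hermitian form of \<open>H\<close> at the point \<open>s\<close>; its values lie
  in the prime field (\<open>q_F2\<close>).\<close>

definition q :: "'k^3^3 \<Rightarrow> 'k^3 \<Rightarrow> 'k" where "q H s = herm (s v* H) s"

text \<open>The Hermitian matrix of rank one whose form is the norm of \<open>herm s
  v\<close>.\<close>

definition R1 :: "'k^3 \<Rightarrow> 'k^3^3" where "R1 v = (\<chi> i j. (v$i)\<^sup>2 * v$j)"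

lemma HermD: "H \<in> Herm \<Longrightarrow> (H$i$j)\<^sup>2 = H$j$i"
  unfolding Herm_def mem_Collect_eq by metis

lemma HermI: "(\<And>i j. (H$i$j)\<^sup>2 = H$j$i) \<Longrightarrow> H \<in> Herm"
  unfolding Herm_def mem_Collect_eq by metis

lemma herm_Herm:
  assumes "H \<in> Herm"
  shows "herm x (y v* H) = herm (x v* H) y"
proof -
  have H: "(H$i$j)\<^sup>2 = H$j$i" for i j using assms by (rule HermD)
  have "herm x (y v* H) = (\<Sum>i\<in>UNIV. \<Sum>j\<in>UNIV. x$i * ((y$j)\<^sup>2 * H$i$j))"
    by (simp add: herm_def vector_matrix_mult_def sq_sum power_mult_distrib H sum_distrib_left)
  also have "\<dots> = (\<Sum>j\<in>UNIV. \<Sum>i\<in>UNIV. x$i * ((y$j)\<^sup>2 * H$i$j))"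
    by (rule sum.swap)
  also have "\<dots> = herm (x v* H) y"
    unfolding herm_def vector_matrix_mult_def vec_lambda_beta sum_distrib_right
    by (intro sum.cong refl) (simp only: mult_ac)
  finally show ?thesis .
qed

lemma Herm_F4: "H \<in> Herm \<Longrightarrow> H$i$j \<in> F4"
  unfolding F4_sq_sq by (simp only: HermD)

lemma Herm_0 [simp]: "0 \<in> Herm" by (rule HermI) simp

lemma R1_Herm: "v \<in> F4v \<Longrightarrow> R1 v \<in> Herm"
  by (rule HermI) (simp add: R1_def power_mult_distrib F4v_def F4_sq_sq mult.commute)

lemma vm_R1: "x v* R1 v = herm x v *s v"
  by (simp add: vec_eq_iff vector_matrix_mult_def R1_def herm_def sum_distrib_right sum_distrib_left mult_ac)

lemma vm_F4v: "s \<in> F4v \<Longrightarrow> H \<in> Herm \<Longrightarrow> s v* H \<in> F4v"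
  by (auto simp: F4v_def vector_matrix_mult_def intro!: F4_sum F4_mult Herm_F4)

lemma q_F2: assumes "s \<in> F4v" "H \<in> Herm" shows "q H s = 0 \<or> q H s = 1"
proof -
  have "(q H s)\<^sup>2 = q H s"
    unfolding q_def using assms herm_conj[OF vm_F4v[OF assms] assms(1)] herm_Herm[OF assms(2), of s s]
    by simp
  then show ?thesis by (simp add: power2_eq_square)
qed

lemma q_R1: "s \<in> F4v \<Longrightarrow> v \<in> F4v \<Longrightarrow> q (R1 v) s = (if herm s v = 0 then 0 else 1)"
  using F4_norm[OF herm_F4[of s v]] herm_conj[of s v]
  by (simp add: q_def vm_R1 herm_scale_left)

lemma dim_linear_image:
  fixes f :: "'k^3 \<Rightarrow> 'k^6"
  assumes "\<And>x y. f (x + y) = f x + f y" "\<And>c x. f (c *s x) = c *s f x" "inj f"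
  shows "vec.dim (f ` S) = vec.dim S"
proof -
  have "Vector_Spaces.linear (*s) (*s) f"
    using assms by (simp add: Vector_Spaces.linear_iff vec.vector_space_axioms)
  then show ?thesis using assms(3) by (intro vec.dim_image_eq) (auto intro: inj_on_subset)
qed

lemma J0_lin: "J 0 (x + y) = J 0 x + J 0 y" "J 0 (c *s x) = c *s J 0 x" "inj (J 0)"
  by (simp_all add: J_add J_scale inj_def)

lemma WH_lin: "J (x + y) ((x + y) v* H) = J x (x v* H) + J y (y v* H)"
  "J (c *s x) ((c *s x) v* H) = c *s J x (x v* H)" "inj (\<lambda>x. J x (x v* H))"
  by (simp_all add: J_add J_scale inj_def vector_matrix_left_distrib scalar_vector_matrix_assoc)

lemma vec_dim3: "vec.dim (UNIV::('k^3) set) = 3"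
  by (simp only: vec_dim_card) simp

lemma Winf_image: "Winf = J 0 ` UNIV" by (auto simp: Winf_def)

lemma W_image: "W H = (\<lambda>x. J x (x v* H)) ` UNIV" by (auto simp: W_def)

lemma subspace_Winf: "vec.subspace Winf"
  unfolding vec.subspace_def Winf_def
  by (auto simp: J_add J_scale)

lemma subspace_W: "vec.subspace (W H)"
  unfolding vec.subspace_def W_def
proof (intro conjI allI impI ballI; clarify?)
  show "\<exists>x. 0 = J x (x v* H) \<and> True" by (intro exI[of _ 0]) (simp add: J_0)
qed (metis WH_lin(1), metis WH_lin(2))

lemma Winf_plane: "Winf \<in> planes"
  unfolding planes_iff
  using subspace_Winf dim_linear_image[OF J0_lin, of UNIV]
  unfolding Winf_image vec_dim3 by (auto simp: herm_J)

lemma W_plane: "H \<in> Herm \<Longrightarrow> W H \<in> planes"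
  unfolding planes_iff
  using subspace_W[of H] dim_linear_image[of "\<lambda>x. J x (x v* H)" UNIV, OF WH_lin]
  unfolding W_image vec_dim3 by (auto simp: herm_J herm_Herm)

lemma dim_perp: fixes s :: "'k^3" assumes "s \<noteq> 0" shows "vec.dim {y. herm y s = (0::'k)} = 2"
proof -
  obtain y0 where "herm y0 s \<noteq> 0" using assms herm_nondegenerate_right[of s] by blast
  then have "vec.dim (UNIV::('k^3) set) = vec.dim {y \<in> UNIV. herm y s = 0} + 1"
    by (intro dim_kernel_functional[of UNIV "\<lambda>y. herm y s" y0]) (simp_all add: herm_simps)
  then show ?thesis unfolding vec_dim3 by simp
qed

lemma subspace_perp: fixes s :: "'k^'n" shows "vec.subspace {y. herm y s = (0::'k)}"
  by (auto simp: vec.subspace_def herm_simps)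

lemma perp_imp_proportional:
  fixes s s' :: "'k^'n"
  assumes s: "s \<noteq> 0" and *: "\<And>y. herm y s = 0 \<Longrightarrow> herm y s' = (0::'k)"
  shows "\<exists>c. s' = c *s s"
proof -
  obtain y1 where y1: "herm y1 s \<noteq> 0" using s herm_nondegenerate_right[of s] by blast
  obtain c where c: "c\<^sup>2 = herm y1 s' / herm y1 s" using sq_surj by blast
  have "herm y (s' + c *s s) = 0" for y
  proof -
    have "herm (y + (herm y s / herm y1 s) *s y1) s = 0"
      using y1 by (simp add: herm_simps)
    from *[OF this] show ?thesis using y1 by (simp add: herm_simps c mult.commute)
  qed
  then have "s' + c *s s = 0" by (rule herm_nondegenerate_right)
  then have "s' = c *s s" by (simp add: vec_eq_iff add_eq_0_iff_eq)
  then show ?thesis by blast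
qed

lemma dim_perp2:
  fixes s s' :: "'k^3"
  assumes s: "s \<noteq> 0" and n: "\<And>c. s' \<noteq> c *s s"
  shows "vec.dim {y. herm y s = (0::'k) \<and> herm y s' = 0} = 1"
proof -
  obtain y0 where y0: "herm y0 s = 0" "herm y0 s' \<noteq> 0"
    using perp_imp_proportional[OF s, of s'] n by blast
  have "vec.dim {y. herm y s = 0} = vec.dim {y \<in> {y. herm y s = 0}. herm y s' = 0} + 1"
    using y0 by (intro dim_kernel_functional[OF subspace_perp, where l = "\<lambda>y. herm y s'" and ?x0.0 = y0])
      (simp_all add: herm_simps)
  then show ?thesis by (simp add: dim_perp[OF s])
qed

lemma Winf_Psa: "s \<noteq> 0 \<Longrightarrow> Winf \<inter> Psa s a = J 0 ` {y. herm y s = 0}"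
  by (auto simp: Winf_def Psa_def)

lemma Psa_Psa: "s \<noteq> 0 \<Longrightarrow> a \<noteq> b \<Longrightarrow> Psa s a \<inter> Psa s b = J 0 ` {y. herm y s = 0}"
  by (auto simp: Psa_def)

lemma Psa_Psa': 
  assumes s: "s \<noteq> 0" "s' \<noteq> 0" and n: "\<And>c. s' \<noteq> c *s s"
  shows "Psa s a \<inter> Psa s' b = J 0 ` {y. herm y s = 0 \<and> herm y s' = 0}"
proof -
  have z: "l = 0 \<and> l' = 0" if "l *s s = l' *s s'" for l l'
  proof -
    have "l' = 0"
    proof (rule ccontr)
      assume "l' \<noteq> 0"
      then have "s' = (l / l') *s s"
        using arg_cong[OF that, of "\<lambda>v. inverse l' *s v"] by (simp add: vec_eq_iff field_simps)
      with n show False by blast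
    qed
    with that s show ?thesis by simp
  qed
  show ?thesis
  proof
    show "Psa s a \<inter> Psa s' b \<subseteq> J 0 ` {y. herm y s = 0 \<and> herm y s' = 0}"
    proof
      fix v assume "v \<in> Psa s a \<inter> Psa s' b"
      then obtain l l' y y' where *: "v = J (l *s s) y" "herm y s = a * l"
        "v = J (l' *s s') y'" "herm y' s' = b * l'"
        unfolding Psa_def by blast
      then have "l *s s = l' *s s'" "y' = y" by simp_all
      with z[OF this(1)] * show "v \<in> J 0 ` {y. herm y s = 0 \<and> herm y s' = 0}" by simp
    qed
  qed (auto simp: Psa_def)
qed

lemma Winf_W: "Winf \<inter> W H = {0}"
  by (auto simp: Winf_def W_def J_0)

lemma W_Psa: "s \<noteq> 0 \<Longrightarrow> W H \<inter> Psa s a = (if q H s = a then vec.span {J s (s v* H)} else {0})"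
proof -
  assume s: "s \<noteq> 0"
  have "W H \<inter> Psa s a = {J (l *s s) ((l *s s) v* H) |l. l * q H s = a * l}"
    by (auto simp: W_def Psa_def q_def scalar_vector_matrix_assoc herm_simps)
  also have "\<dots> = (if q H s = a then vec.span {J s (s v* H)} else {0})"
    by (auto simp: vec.span_singleton J_scale[symmetric] scalar_vector_matrix_assoc)
  finally show ?thesis .
qed

lemma W_W0: "W H \<inter> W 0 = (\<lambda>x. J x 0) ` {x. x v* H = 0}"
  by (auto simp: W_def)

lemma dim_W_R1: "v \<noteq> 0 \<Longrightarrow> vec.dim (W (R1 v) \<inter> W 0) = 2"
proof -
  assume v: "v \<noteq> 0"
  have "W (R1 v) \<inter> W 0 = (\<lambda>x. J x 0) ` {x. herm x v = 0}"
    using v by (auto simp: W_W0 vm_R1)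
  then show ?thesis using v
    by (simp add: dim_linear_image[of "\<lambda>x. J x 0"] dim_perp J_add J_scale inj_def)
qed

lemma dim_Winf_W: "vec.dim (Winf \<inter> W H) = 0" by (simp add: Winf_W)

lemma dim_Winf_Psa: "s \<noteq> 0 \<Longrightarrow> vec.dim (Winf \<inter> Psa s a) = 2"
  by (simp add: Winf_Psa dim_linear_image[OF J0_lin] dim_perp)

lemma dim_Psa_Psa: "s \<noteq> 0 \<Longrightarrow> a \<noteq> b \<Longrightarrow> vec.dim (Psa s a \<inter> Psa s b) = 2"
  by (simp add: Psa_Psa dim_linear_image[OF J0_lin] dim_perp)

lemma dim_Psa_Psa': "s \<noteq> 0 \<Longrightarrow> s' \<noteq> 0 \<Longrightarrow> (\<And>c. s' \<noteq> c *s s) \<Longrightarrow> vec.dim (Psa s a \<inter> Psa s' b) = 1"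
  by (simp add: Psa_Psa' dim_linear_image[OF J0_lin] dim_perp2)

lemma dim_W_Psa: "s \<noteq> 0 \<Longrightarrow> vec.dim (W H \<inter> Psa s a) = (if q H s = a then 1 else 0)"
  by (simp add: W_Psa J_0)

lemma subspace_Psa: "vec.subspace (Psa s a)"
  unfolding vec.subspace_def
proof (intro conjI allI impI ballI)
  show "0 \<in> Psa s a" unfolding Psa_def by (auto intro!: exI[of _ 0] simp: J_0)
next
  fix x y assume "x \<in> Psa s a" "y \<in> Psa s a"
  then show "x + y \<in> Psa s a" unfolding Psa_def
    by (auto simp: J_add) (metis distrib_left herm_add_left vector_sadd_rdistrib)
next
  fix c x assume "x \<in> Psa s a"
  then show "c *s x \<in> Psa s a" unfolding Psa_def
    by (auto simp: J_scale) (metis herm_scale_left mult.left_commute vector_smult_assoc)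
qed

lemma Psa_plane:
  assumes s: "s \<in> F4v" "s \<noteq> 0" and a: "a = 0 \<or> a = 1"
  shows "Psa s a \<in> planes"
proof -
  obtain y0 where y0: "herm y0 s \<noteq> 0" using s herm_nondegenerate_right[of s] by blast
  obtain i where i: "s $ i \<noteq> 0" using s by (auto simp: vec_eq_iff)
  let ?v = "J s ((a / herm y0 s) *s y0)"
  have v: "?v \<in> Psa s a" using y0 unfolding Psa_def
    by (auto intro!: exI[of _ 1] simp: herm_simps)
  have "vec.dim (Psa s a) = vec.dim {v \<in> Psa s a. px v $ i = 0} + 1"
    using v i by (intro dim_kernel_functional[OF subspace_Psa, where l = "\<lambda>v. px v $ i" and ?x0.0 = ?v])
      (simp_all add: px_lin)
  also have "{v \<in> Psa s a. px v $ i = 0} = Winf \<inter> Psa s a"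
    using i by (auto simp: Psa_def Winf_def)
  finally have "vec.dim (Psa s a) = 3" using s by (simp add: dim_Winf_Psa)
  moreover have "herm v v = 0" if "v \<in> Psa s a" for v
  proof -
    from that obtain l y where v: "v = J (l *s s) y" and y: "herm y s = a * l" by (auto simp: Psa_def)
    have "herm s y = (herm y s)\<^sup>2"
      using s(1) by (simp add: herm_def sq_sum power_mult_distrib F4v_def F4_sq_sq mult.commute)
    then show ?thesis using y a by (auto simp: v herm_J herm_simps power2_eq_square)
  qed
  ultimately show ?thesis using subspace_Psa by (simp add: planes_iff)
qed

lemma Psa_scale: assumes c: "c \<in> F4" "c \<noteq> 0" shows "Psa (c *s s) a = Psa s a"
proof -
  have *: "Psa s a \<subseteq> Psa (d *s s) a" if d: "d \<in> F4" "d \<noteq> 0" for d s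
  proof
    fix v assume "v \<in> Psa s a"
    then obtain l y where v: "v = J (l *s s) y" and y: "herm y s = a * l" by (auto simp: Psa_def)
    have dd: "d\<^sup>2 * d = 1" using F4_norm[OF d] by (simp add: mult.commute)
    have "v = J ((l * d\<^sup>2) *s (d *s s)) y" using dd by (simp add: v mult.assoc)
    moreover have "herm y (d *s s) = a * (l * d\<^sup>2)" using y by (simp add: herm_simps)
    ultimately show "v \<in> Psa (d *s s) a" by (auto simp: Psa_def)
  qed
  have "inverse c \<in> F4" "inverse c \<noteq> 0" using c by auto
  from *[OF this, of "c *s s"] *[OF c, of s] c show ?thesis by (simp add: vector_smult_assoc)
qed

section \<open>Linear isometries\<close>

definition LI :: "('k^6 \<Rightarrow> 'k^6) set" where
  "LI = {m. (\<forall>x y. m (x + y) = m x + m y) \<and> (\<forall>c x. m (c *s x) = c *s m x) \<and>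
    (\<forall>x y. herm (m x) (m y) = herm x y)}"

lemma LI_add: "m \<in> LI \<Longrightarrow> m (x + y) = m x + m y" by (simp add: LI_def)

lemma LI_scale: "m \<in> LI \<Longrightarrow> m (c *s x) = c *s m x" by (simp add: LI_def)

lemma LI_herm: "m \<in> LI \<Longrightarrow> herm (m x) (m y) = herm x y" by (simp add: LI_def)

lemma LI_0: "m \<in> LI \<Longrightarrow> m 0 = 0" using LI_scale[of m 0 0] by simp

lemma LI_linear: "m \<in> LI \<Longrightarrow> Vector_Spaces.linear (*s) (*s) m"
  by (simp add: Vector_Spaces.linear_iff vec.vector_space_axioms LI_add LI_scale)

lemma LI_inj: assumes "m \<in> LI" shows "inj m"
proof (rule injI)
  fix x y assume e: "m x = m y"
  have "herm (x + y) z = 0" for z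
  proof -
    have "herm (x + y) z = herm (m x + m y) (m z)"
      using assms by (simp add: LI_herm LI_add[symmetric])
    also have "m x + m y = 0" using e by (simp add: vec_eq_iff)
    finally show ?thesis by simp
  qed
  then have "x + y = 0" by (rule herm_nondegenerate_left)
  then show "x = y" by (simp add: vec_eq_iff add_eq_0_iff_eq)
qed

lemma LI_bij: assumes "m \<in> LI" shows "bij m"
  using LI_inj[OF assms] vec.linear_injective_imp_surjective[OF LI_linear[OF assms]]
  by (simp add: bij_def)

lemma LI_comp: "m \<in> LI \<Longrightarrow> n \<in> LI \<Longrightarrow> m \<circ> n \<in> LI" by (simp add: LI_def)

lemma LI_id: "id \<in> LI" by (simp add: LI_def)

text \<open>An isometry of the nondegenerate form is injective, hence bijective by
  dimension.\<close>

lemma LI_inv: assumes "m \<in> LI" shows "inv_into UNIV m \<in> LI"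
proof -
  have b: "bij m" by (rule LI_bij[OF assms])
  have i [simp]: "m (inv_into UNIV m x) = x" for x using b by (simp add: bij_is_surj surj_f_inv_f)
  have j: "inv_into UNIV m (m x) = x" for x using b by (simp add: bij_is_inj)
  have "inv_into UNIV m (x + y) = inv_into UNIV m x + inv_into UNIV m y" for x y
    using j[of "inv_into UNIV m x + inv_into UNIV m y"] assms by (simp add: LI_add)
  moreover have "inv_into UNIV m (c *s x) = c *s inv_into UNIV m x" for c x
    using j[of "c *s inv_into UNIV m x"] assms by (simp add: LI_scale)
  moreover have "herm (inv_into UNIV m x) (inv_into UNIV m y) = herm x y" for x y
    using LI_herm[OF assms, of "inv_into UNIV m x" "inv_into UNIV m y"] by simp
  ultimately show ?thesis by (simp add: LI_def)
qed

text \<open>Rationality can be read off from the form: conjugate symmetry of \<open>herm\<close>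
  on a vector, tested against the axis vectors, forces its coordinates into the field with four
  elements. This is why every isometry over the algebraically closed field has rational
  entries.\<close>

lemma F4v_iff_herm: "x \<in> F4v \<longleftrightarrow> (\<forall>v::'k^'n. herm x v = (herm v x)\<^sup>2)"
proof
  assume "x \<in> F4v"
  then show "\<forall>v. herm x v = (herm v x)\<^sup>2"
    by (simp add: herm_def sq_sum power_mult_distrib F4v_def F4_sq_sq mult.commute)
next
  assume "\<forall>v::'k^'n. herm x v = (herm v x)\<^sup>2"
  then have "herm x (axis i 1) = (herm (axis i 1) x)\<^sup>2" for i by blast
  then show "x \<in> F4v" by (simp add: F4v_def F4_sq_sq)
qed

lemma LI_F4v: assumes m: "m \<in> LI" shows "m x \<in> F4v \<longleftrightarrow> x \<in> F4v"
proof -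
  have s: "surj m" using LI_bij[OF m] by (simp add: bij_is_surj)
  have "m x \<in> F4v \<longleftrightarrow> (\<forall>v. herm (m x) (m v) = (herm (m v) (m x))\<^sup>2)"
    unfolding F4v_iff_herm using s by (metis surjD)
  then show ?thesis by (simp add: LI_herm[OF m] F4v_iff_herm)
qed

lemma LI_subspace: "m \<in> LI \<Longrightarrow> vec.subspace S \<Longrightarrow> vec.subspace (m ` S)"
  by (intro vec.linear_subspace_image LI_linear)

lemma LI_dim: assumes "m \<in> LI" shows "vec.dim (m ` S) = vec.dim S"
  using LI_inj[OF assms] by (intro vec.dim_image_eq LI_linear assms) (auto intro: inj_on_subset)

lemma LI_plane: assumes "m \<in> LI" "P \<in> planes" shows "m ` P \<in> planes"
  using assms unfolding planes_iff by (auto simp: LI_subspace LI_dim LI_herm)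

lemma LI_dim_Int: assumes "m \<in> LI" shows "vec.dim (m ` P \<inter> m ` Q) = vec.dim (P \<inter> Q)"
  using LI_inj[OF assms] LI_dim[OF assms, of "P \<inter> Q"] by (simp add: image_Int)

text \<open>These unipotent maps translate the graphs: \<open>U H\<close> sends \<open>W
  H'\<close> to \<open>W (H' + H)\<close> and fixes \<open>Winf\<close> pointwise.\<close>

definition U :: "'k^3^3 \<Rightarrow> 'k^6 \<Rightarrow> 'k^6" where "U H v = J (px v) (py v + px v v* H)"

definition swI :: "3 set \<Rightarrow> 'k^6 \<Rightarrow> 'k^6" where
  "swI I v = J (\<chi> k. if k \<in> I then py v $ k else px v $ k) (\<chi> k. if k \<in> I then px v $ k else py v $ k)"

definition Dg :: "'k^3 \<Rightarrow> 'k^6 \<Rightarrow> 'k^6" where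
  "Dg c v = J (\<chi> k. c $ k * px v $ k) (\<chi> k. c $ k * py v $ k)"

lemma U_J [simp]: "U H (J x y) = J x (y + x v* H)" by (simp add: U_def)

lemma U_LI: assumes "H \<in> Herm" shows "U H \<in> LI"
proof -
  have "U H (u + v) = U H u + U H v" for u v
    by (simp add: U_def px_lin py_lin J_add vector_matrix_left_distrib add_ac)
  moreover have "U H (c *s u) = c *s U H u" for c u
    by (simp add: U_def px_lin py_lin J_scale scalar_vector_matrix_assoc vector_add_ldistrib)
  moreover have "herm (U H (J x y)) (U H (J x' y')) = herm (J x y) (J x' y')" for x y x' y'
    using herm_Herm[OF assms, of x x']
    by (simp add: herm_J herm_simps add_ac)
  then have "herm (U H u) (U H v) = herm u v" for u v
    by (metis J_px_py)
  ultimately show ?thesis by (simp add: LI_def)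
qed

lemma U_U: "U H (U H' v) = U (H + H') v"
  by (simp add: U_def vector_matrix_mult_add_rdistrib add_ac)

lemma U_0: "U 0 v = v" by (simp add: U_def)

lemma U_invol: "U H (U H v) = v"
proof -
  have "H + H = 0" by (simp add: vec_eq_iff)
  then show ?thesis by (simp add: U_U U_0)
qed

lemma swI_LI: "swI I \<in> LI"
proof -
  have "swI I (u + v) = swI I u + swI I v" for u v
    by (simp add: swI_def px_lin py_lin J_add) (auto simp: vec_eq_iff px_lin py_lin)
  moreover have "swI I (c *s u) = c *s swI I u" for c u
    by (simp add: swI_def px_lin py_lin J_scale) (auto simp: vec_eq_iff px_lin py_lin)
  moreover have "herm (swI I (J x y)) (swI I (J x' y')) = herm (J x y) (J x' y')" for x y x' y'
    unfolding swI_def herm_J px_J py_J unfolding herm_def sum.distrib[symmetric]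
    by (intro sum.cong refl) (auto simp: add.commute)
  then have "herm (swI I u) (swI I v) = herm u v" for u v
    by (metis J_px_py)
  ultimately show ?thesis by (simp add: LI_def)
qed

lemma swI_invol: "swI I (swI I v) = v"
proof -
  have "swI I (swI I v) = J (px v) (py v)"
    by (simp add: swI_def del: J_px_py) (auto simp: vec_eq_iff)
  then show ?thesis by simp
qed

lemma swI_insert: "i \<notin> I \<Longrightarrow> swI (insert i I) = swI {i} \<circ> swI I"
  by (rule ext) (simp add: swI_def, auto simp: vec_eq_iff)

lemma swI_empty: "swI {} = id"
  by (rule ext) (auto simp: swI_def vec_lambda_eta)

lemma Dg_J [simp]: "Dg c (J x y) = J (\<chi> k. c $ k * x $ k) (\<chi> k. c $ k * y $ k)"
  by (simp add: Dg_def)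

lemma Dg_LI: assumes "c \<in> F4v" "\<And>k. c $ k \<noteq> 0" shows "Dg c \<in> LI"
proof -
  have "Dg c (u + v) = Dg c u + Dg c v" for u v
    by (simp add: Dg_def px_lin py_lin J_add distrib_left) (auto simp: vec_eq_iff)
  moreover have "Dg c (a *s u) = a *s Dg c u" for a u
    by (simp add: Dg_def px_lin py_lin J_scale mult_ac) (auto simp: vec_eq_iff)
  moreover have "herm (Dg c (J x y)) (Dg c (J x' y')) = herm (J x y) (J x' y')" for x y x' y'
  proof -
    have n: "(c$k * a) * (c$k * b)\<^sup>2 = a * b\<^sup>2" for k a b
    proof -
      have "(c$k * a) * (c$k * b)\<^sup>2 = (c$k * (c$k)\<^sup>2) * (a * b\<^sup>2)"
        by (simp add: power_mult_distrib mult_ac)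
      also have "c$k * (c$k)\<^sup>2 = 1" using assms F4_norm[of "c$k"] by (simp add: F4v_def)
      finally show ?thesis by simp
    qed
    show ?thesis by (simp add: herm_J) (simp add: herm_def n)
  qed
  then have "herm (Dg c u) (Dg c v) = herm u v" for u v
    by (metis J_px_py)
  ultimately show ?thesis by (simp add: LI_def)
qed

text \<open>The group generated by the involutions \<open>U H\<close> and the swaps of a single
  coordinate pair. It is transitive on pairs of disjoint planes, and all of its elements turn out
  to have determinant 1.\<close>

inductive_set NN :: "('k^6 \<Rightarrow> 'k^6) set" where
  id: "id \<in> NN"
| U: "n \<in> NN \<Longrightarrow> H \<in> Herm \<Longrightarrow> U H \<circ> n \<in> NN"
| sw: "n \<in> NN \<Longrightarrow> swI {i} \<circ> n \<in> NN"

lemma NN_comp: "m \<in> NN \<Longrightarrow> n \<in> NN \<Longrightarrow> m \<circ> n \<in> NN"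
  by (induction rule: NN.induct) (simp, metis comp_assoc NN.U, metis comp_assoc NN.sw)

lemma NN_LI: "n \<in> NN \<Longrightarrow> n \<in> LI"
  by (induction rule: NN.induct) (blast intro: LI_id LI_comp U_LI swI_LI)+

lemma NN_U: "H \<in> Herm \<Longrightarrow> U H \<in> NN" using NN.U[OF NN.id] by simp

lemma NN_sw1: "swI {i} \<in> NN" using NN.sw[OF NN.id] by simp

lemma NN_swI: "swI I \<in> NN"
proof -
  have "finite I" by simp
  then show ?thesis
  proof (induction I rule: finite_induct)
    case empty then show ?case unfolding swI_empty by (rule NN.id)
  next
    case (insert i I) then show ?case unfolding swI_insert[OF insert(2)] by (intro NN_comp NN_sw1)
  qed
qed

text \<open>The projection of such a plane to the first block is bijective, so the plane is a
  graph; isotropy says that its matrix is Hermitian.\<close>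

lemma plane_disjoint_Winf:
  assumes P: "(P::('k^6) set) \<in> planes" and d: "P \<inter> Winf \<subseteq> {0}"
  shows "\<exists>H\<in>Herm. P = W H"
proof -
  have sub: "vec.subspace P" and dim: "vec.dim P = 3" using P by (auto simp: planes_iff)
  have lin: "Vector_Spaces.linear (*s) (*s) px"
    by (simp add: Vector_Spaces.linear_iff vec.vector_space_axioms px_lin)
  have inj: "inj_on px P"
  proof (rule inj_onI)
    fix u v assume uv: "u \<in> P" "v \<in> P" "px u = px v"
    then have "u - v \<in> P" using sub by (simp add: vec.subspace_diff)
    moreover have "px (u - v) = 0"
      using px_lin(1)[of "u - v" v] uv(3) by simp
    then have "u - v \<in> Winf" unfolding Winf_def by (metis (mono_tags, lifting) J_px_py mem_Collect_eq)
    ultimately show "u = v" using d by auto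
  qed
  have "vec.dim (px ` P) = 3"
    using vec.dim_image_eq[OF lin, of P] inj sub dim by (simp add: vec.span_eq_iff[THEN iffD2])
  moreover have "vec.subspace (px ` P)" using lin sub by (rule vec.linear_subspace_image)
  ultimately have "px ` P = UNIV"
    using vec.subspace_dim_equal[of "px ` P" UNIV] vec_dim3 by auto
  then have "\<forall>i. \<exists>v\<in>P. px v = axis i 1" by (metis UNIV_I imageE)
  then obtain b where b: "\<And>i. b i \<in> P" "\<And>i. px (b i) = axis i 1" by metis
  define H :: "'k^3^3" where "H = (\<chi> i. py (b i))"
  have bJ: "b i = J (axis i 1) (H $ i)" for i
    using b(2)[of i] by (metis H_def J_px_py vec_lambda_beta)
  have "J x (x v* H) = (\<Sum>i\<in>UNIV. x$i *s b i)" for x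
  proof -
    have "x v* H = (\<Sum>i\<in>UNIV. x$i *s H$i)"
      by (simp add: vec_eq_iff vector_matrix_mult_def)
    moreover have "x = (\<Sum>i\<in>UNIV. x$i *s axis i 1)" by (simp add: basis_expansion)
    ultimately have "J x (x v* H) = J (\<Sum>i\<in>UNIV. x$i *s axis i 1) (\<Sum>i\<in>UNIV. x$i *s H$i)" by simp
    also have "\<dots> = (\<Sum>i\<in>UNIV. J (x$i *s axis i 1) (x$i *s H$i))"
      unfolding sum_3 by (simp add: J_add)
    finally show ?thesis by (simp add: bJ J_scale)
  qed
  then have WP: "W H \<subseteq> P"
    unfolding W_def using b(1) sub by (auto intro!: vec.subspace_sum vec.subspace_scale)
  have "vec.dim (W H) = 3"
    unfolding W_image using dim_linear_image[OF WH_lin, of H UNIV] vec_dim3 by simp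
  then have "P = W H"
    using vec.subspace_dim_equal[OF subspace_W sub WP] dim by simp
  moreover have "H \<in> Herm"
  proof (rule HermI)
    fix i j
    have "herm (b j) (b i) = 0" using plane_isotropic[OF P b(1) b(1)] .
    then have "(H$i$j)\<^sup>2 + H$j$i = 0" by (simp add: bJ herm_J)
    then show "(H$i$j)\<^sup>2 = H$j$i" by (simp add: add_eq_0_iff_eq)
  qed
  ultimately show ?thesis by blast
qed

text \<open>Take a maximal set \<open>I\<close> of coordinates such that no nonzero vector of
  \<open>P \<inter> Winf\<close> is supported in \<open>I\<close>, and swap the coordinates
  outside \<open>I\<close>. Maximality provides for each \<open>k\<close> outside \<open>I\<close>
  a vector of \<open>P \<inter> Winf\<close> supported in \<open>insert k I\<close>; isotropy
  pairs it with a vector of the new intersection and shows that the latter vanishes at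
  \<open>k\<close>.\<close>

lemma plane_swap_disjoint:
  assumes P: "(P::('k^6) set) \<in> planes"
  shows "\<exists>I. swI I ` P \<inter> Winf \<subseteq> {0}"
proof -
  define good where "good I \<longleftrightarrow> (\<forall>y. J 0 y \<in> P \<longrightarrow> (\<forall>k. k \<notin> I \<longrightarrow> y$k = 0) \<longrightarrow> y = 0)" for I :: "3 set"
  have "finite (Collect good)" by simp
  moreover have "good {}" by (auto simp: good_def vec_eq_iff)
  ultimately obtain I where I: "good I" and max: "\<And>I'. good I' \<Longrightarrow> I \<subseteq> I' \<Longrightarrow> I' = I"
    using finite_has_maximal2[of "Collect good" "{}"] by (metis mem_Collect_eq)
  have z: "u = 0" if u: "u \<in> P" "swI (- I) u \<in> Winf" for u
  proof -
    obtain x y where u': "u = J x y" by (rule J_cases)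
    have "px (swI (- I) u) = 0" using u(2) by (auto simp: Winf_def)
    then have xy: "\<And>k. k \<notin> I \<Longrightarrow> y$k = 0" "\<And>k. k \<in> I \<Longrightarrow> x$k = 0"
      by (auto simp: u' swI_def vec_eq_iff split: if_splits)
    have "x $ k = 0" for k
    proof (cases "k \<in> I")
      case False
      then have "\<not> good (insert k I)" using max[of "insert k I"] by auto
      then obtain y' where y': "J 0 y' \<in> P" "\<And>j. j \<notin> insert k I \<Longrightarrow> y'$j = 0" "y' \<noteq> 0"
        by (auto simp: good_def)
      have yk: "y' $ k \<noteq> 0"
      proof
        assume "y' $ k = 0"
        then have "\<And>j. j \<notin> I \<Longrightarrow> y'$j = 0" using y'(2) by (metis insertE)
        then show False using I y' by (auto simp: good_def)
      qed
      have "herm u (J 0 y') = 0" by (rule plane_isotropic[OF P u(1) y'(1)])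
      then have "herm x y' = 0" by (simp add: u' herm_J)
      moreover have "herm x y' = x$k * (y'$k)\<^sup>2"
      proof -
        have "(\<Sum>i\<in>UNIV. x $ i * (y' $ i)\<^sup>2) = (\<Sum>i\<in>{k}. x $ i * (y' $ i)\<^sup>2)"
          using xy(2) y'(2) by (intro sum.mono_neutral_right) auto
        then show ?thesis by (simp add: herm_def)
      qed
      ultimately show ?thesis using yk by simp
    qed (use xy in auto)
    then have x: "x = 0" by (simp add: vec_eq_iff)
    then have "y = 0" using I u(1) xy(1) by (auto simp: good_def u')
    with x show "u = 0" by (simp add: u')
  qed
  have "swI (- I) ` P \<inter> Winf \<subseteq> {0}"
    using z LI_0[OF swI_LI] by auto
  then show ?thesis by blast
qed

lemma U_W: "H \<in> Herm \<Longrightarrow> U H ` W H' = W (H' + H)"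
  by (auto simp: W_def image_iff vector_matrix_mult_add_rdistrib) (metis U_J)+

lemma U_Winf: "U H ` Winf = Winf"
  by (auto simp: Winf_def image_iff) (metis U_J vector_matrix_mult_0 add.right_neutral)+

lemma swI_W0: "swI UNIV ` W 0 = Winf"
  by (auto simp: Winf_def W_def image_iff swI_def vec_lambda_eta zero_vec_def[symmetric])
    (metis px_J py_J vec_lambda_eta)

lemma swI_UNIV_J: "swI UNIV (J x y) = J y x"
  by (simp add: swI_def vec_lambda_eta)

lemma H_add_self: "(H::'k^3^3) + H = 0" by (simp add: vec_eq_iff)

lemma NN_plane_to_Winf:
  assumes P: "(P::('k^6) set) \<in> planes" shows "\<exists>n\<in>NN. n ` P = Winf"
proof -
  obtain I where I: "swI I ` P \<inter> Winf \<subseteq> {0}" using plane_swap_disjoint[OF P] by blast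
  then obtain H where H: "H \<in> Herm" "swI I ` P = W H"
    using plane_disjoint_Winf[OF LI_plane[OF swI_LI P]] by blast
  have "(swI UNIV \<circ> (U H \<circ> swI I)) ` P = swI UNIV ` U H ` W H" using H by (simp only: image_comp[symmetric])
  also have "\<dots> = Winf" using U_W[OF H(1), of H] by (simp add: H_add_self swI_W0)
  finally show ?thesis using H(1) by (meson NN_comp NN_U NN_swI)
qed

text \<open>First move \<open>P\<close> to \<open>Winf\<close>; the image of \<open>Q\<close> is
  then some \<open>W H\<close>, and \<open>U H\<close> moves it to \<open>W 0\<close>.\<close>

lemma NN_plane_pair:
  assumes P: "(P::('k^6) set) \<in> planes" and Q: "(Q::('k^6) set) \<in> planes" and d: "vec.dim (P \<inter> Q) = 0"
  shows "\<exists>n\<in>NN. n ` P = Winf \<and> n ` Q = W 0"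
proof -
  obtain n where n: "n \<in> NN" "n ` P = Winf" using NN_plane_to_Winf[OF P] by blast
  have nL: "n \<in> LI" using n NN_LI by blast
  have "vec.dim (n ` P \<inter> n ` Q) = 0" using d LI_dim_Int[OF nL] by simp
  then have "n ` Q \<inter> Winf \<subseteq> {0}" using n(2) by auto
  then obtain H where H: "H \<in> Herm" "n ` Q = W H"
    using plane_disjoint_Winf[OF LI_plane[OF nL Q]] by blast
  have "(U H \<circ> n) ` P = Winf" "(U H \<circ> n) ` Q = W 0"
    using n H U_Winf[of H] U_W[OF H(1), of H] by (simp_all only: image_comp[symmetric] H_add_self)
  then show ?thesis using NN.U[OF n(1) H(1)] by blast
qed

lemma Winf_span: "vec.span (Winf \<inter> F4v) = Winf"
proof
  show "vec.span (Winf \<inter> F4v) \<subseteq> Winf"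
    by (intro vec.span_minimal subspace_Winf) auto
  show "Winf \<subseteq> vec.span (Winf \<inter> F4v)"
  proof
    fix v assume "v \<in> Winf"
    then obtain y where v: "v = J 0 y" by (auto simp: Winf_def)
    have "y = (\<Sum>i\<in>UNIV. y$i *s axis i 1)" by (simp add: basis_expansion)
    then have "v = J 0 (\<Sum>i\<in>UNIV. y$i *s axis i 1)" using v by simp
    also have "\<dots> = (\<Sum>i\<in>UNIV. y$i *s J 0 (axis i 1))"
      unfolding sum_3 by (simp add: J_add J_scale)
    also have "\<dots> \<in> vec.span (Winf \<inter> F4v)"
      by (intro vec.span_sum vec.span_scale vec.span_base) (auto simp: Winf_def F4v_J)
    finally show "v \<in> vec.span (Winf \<inter> F4v)" .
  qed
qed

text \<open>True for \<open>Winf\<close>, and every plane is an image of \<open>Winf\<close> under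
  a rational isometry.\<close>

lemma plane_span_F4v:
  assumes P: "(P::('k^6) set) \<in> planes" shows "vec.span (P \<inter> F4v) = P"
proof -
  obtain n where n: "n \<in> NN" "n ` P = Winf" using NN_plane_to_Winf[OF P] by blast
  have nL: "n \<in> LI" using n NN_LI by blast
  have "n ` (P \<inter> F4v) = Winf \<inter> F4v" using LI_F4v[OF nL] unfolding n(2)[symmetric] by auto
  then have "n ` vec.span (P \<inter> F4v) = n ` P"
    using vec.linear_span_image[OF LI_linear[OF nL], of "P \<inter> F4v"] Winf_span n(2) by simp
  then show ?thesis using LI_inj[OF nL] by (simp add: inj_image_eq_iff)
qed

abbreviation ax :: "3 \<Rightarrow> 'k^3" where "ax i \<equiv> axis i 1"

lemma swI_J: "swI I (J x y) = J (\<chi> k. if k \<in> I then y $ k else x $ k) (\<chi> k. if k \<in> I then x $ k else y $ k)"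
  unfolding swI_def px_J py_J ..

section \<open>Gaussian elimination and diagonal representatives\<close>

text \<open>Elementary matrices acting on the first block (and contragrediently on the second),
  obtained by conjugating a \<open>U H\<close> by a swap. They make Gaussian elimination available
  inside \<open>NN\<close>.\<close>

definition El :: "3 \<Rightarrow> 3 \<Rightarrow> 'k \<Rightarrow> 'k^6 \<Rightarrow> 'k^6" where
  "El i j a = swI {j} \<circ> U (\<chi> k l. if k = i \<and> l = j then a else if k = j \<and> l = i then a\<^sup>2 else 0) \<circ> swI {j}"

lemma El_Herm: assumes "i \<noteq> j" "a \<in> F4"
  shows "(\<chi> k l. if k = i \<and> l = j then a else if k = j \<and> l = i then a\<^sup>2 else 0) \<in> Herm"
  using assms by (intro HermI) (auto simp: F4_sq_sq)

lemma El_NN: "i \<noteq> j \<Longrightarrow> a \<in> F4 \<Longrightarrow> El i j a \<in> NN"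
  unfolding El_def by (intro NN_comp NN_sw1 NN_U El_Herm)

lemma El_J: assumes "i \<noteq> j"
  shows "El i j a (J x y) = J (x + axis j (a * x$i)) (y + axis i (a\<^sup>2 * y$j))"
proof -
  have v: "z v* (\<chi> k l. if k = i \<and> l = j then a else if k = j \<and> l = i then a\<^sup>2 else 0)
    = axis j (a * z$i) + axis i (a\<^sup>2 * z$j)" for z :: "'k^3"
  proof -
    have "(\<Sum>k\<in>UNIV. z $ k * (if k = i \<and> l = j then a else if k = j \<and> l = i then a\<^sup>2 else 0))
      = (\<Sum>k\<in>UNIV. (if k = i then (if l = j then a * z$i else 0) else 0) + (if k = j then (if l = i then a\<^sup>2 * z$j else 0) else 0))" for l
      using assms by (intro sum.cong) auto
    then show ?thesis
      by (simp add: vec_eq_iff vector_matrix_mult_def sum.distrib axis_def)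
  qed
  show ?thesis using assms
    unfolding El_def comp_apply swI_J U_J v J_eq by (auto simp: vec_eq_iff axis_def)
qed

text \<open>The block diagonal elements of \<open>NN\<close>, acting on the first block by a
  matrix and on the second by its conjugate inverse transpose.\<close>

definition BL :: "('k^6 \<Rightarrow> 'k^6) set" where
  "BL = {n \<in> NN. n ` Winf = Winf \<and> n ` W 0 = W 0}"

lemma BL_comp: "m \<in> BL \<Longrightarrow> n \<in> BL \<Longrightarrow> m \<circ> n \<in> BL"
  unfolding BL_def mem_Collect_eq image_comp[symmetric] by (metis NN_comp)

lemma W0_iff: "v \<in> W 0 \<longleftrightarrow> (\<exists>x. v = J x 0)" by (auto simp: W_def)

lemma Winf_iff: "v \<in> Winf \<longleftrightarrow> (\<exists>y. v = J 0 y)" by (auto simp: Winf_def)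

lemma image_eq_if_invol: "(\<And>v. v \<in> S \<Longrightarrow> f v \<in> S) \<Longrightarrow> (\<And>v. f (f v) = v) \<Longrightarrow> f ` S = S"
  by (metis image_subset_iff image_eqI subsetI subset_antisym)

lemma El_invol: assumes "i \<noteq> j" shows "El i j a (El i j a v) = v"
  by (simp add: El_def swI_invol U_invol)

lemma El_BL: assumes "i \<noteq> j" "a \<in> F4" shows "El i j a \<in> BL"
proof -
  have "El i j a ` Winf = Winf"
    by (rule image_eq_if_invol) (use assms in \<open>auto simp: Winf_iff El_J El_invol axis_def zero_vec_def[symmetric]\<close>)
  moreover have "El i j a ` W 0 = W 0"
    by (rule image_eq_if_invol) (use assms in \<open>auto simp: W0_iff El_J El_invol axis_def zero_vec_def[symmetric]\<close>)
  ultimately show ?thesis using assms El_NN by (simp add: BL_def)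
qed

lemma BL_LI: "n \<in> BL \<Longrightarrow> n \<in> LI" by (simp add: BL_def NN_LI)

lemma El_J0: "i \<noteq> j \<Longrightarrow> El i j a (J x 0) = J (x + axis j (a * x$i)) 0"
  by (simp add: El_J)

lemma ax_expand: "(x::'k^3) = x$1 *s ax 1 + x$2 *s ax 2 + x$3 *s ax 3"
  by (simp add: vec_eq_iff forall_3 axis_def)

lemma vec3_eqI: "x$1 = y$1 \<Longrightarrow> x$2 = y$2 \<Longrightarrow> x$3 = y$3 \<Longrightarrow> x = (y::'k^3)"
  by (simp add: vec_eq_iff forall_3)

lemma move1:
  assumes v: "v \<in> F4v" "v \<noteq> 0"
  shows "\<exists>n\<in>BL. n (J v 0) = J (ax 1) 0"
proof -
  have F: "v$k \<in> F4" for k using v by (simp add: F4v_def)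
  have A: "\<exists>n\<in>BL. n (J v 0) = J (ax 1) 0" if v: "v \<in> F4v" "v$1 = 1" for v
  proof (intro bexI[of _ "El 1 3 (v$3) \<circ> El 1 2 (v$2)"])
    show "El 1 3 (v$3) \<circ> El 1 2 (v$2) \<in> BL"
      using v by (intro BL_comp El_BL) (auto simp: F4v_def)
    show "(El 1 3 (v$3) \<circ> El 1 2 (v$2)) (J v 0) = J (ax 1) 0"
      using v by (simp add: El_J0) (rule vec3_eqI; simp add: axis_def)
  qed
  have B: "\<exists>n\<in>BL. n (J v 0) = J (ax 1) 0" if v: "v \<in> F4v" "v$j \<noteq> 0" "j \<noteq> 1" for v j
  proof -
    let ?a = "(1 + v$1) / v$j" let ?v = "v + axis 1 (?a * v$j)"
    have a: "?a \<in> F4" using v by (auto simp: F4v_def)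
    have "?v$1 = 1" "?v \<in> F4v"
      using v a by (auto simp: axis_def F4v_def add.commute intro!: F4_add)
    from A[OF this(2,1)] obtain n where n: "n \<in> BL" "n (J ?v 0) = J (ax 1) 0" by blast
    have "(n \<circ> El j 1 ?a) (J v 0) = J (ax 1) 0" using n v by (simp add: El_J0)
    moreover have "n \<circ> El j 1 ?a \<in> BL" using n a v by (intro BL_comp El_BL) auto
    ultimately show ?thesis by blast
  qed
  show ?thesis
  proof (cases "v$2 = 0 \<and> v$3 = 0")
    case False
    then show ?thesis using B[OF v(1), of 2] B[OF v(1), of 3] by auto
  next
    case True
    then have v1: "v$1 \<noteq> 0" using v by (auto simp: vec_eq_iff forall_3)
    let ?v = "v + axis 2 (v$1)"
    have "?v \<in> F4v" "?v$2 \<noteq> 0" using v v1 True by (auto simp: F4v_def axis_def intro!: F4_add)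
    from B[OF this] obtain n where n: "n \<in> BL" "n (J ?v 0) = J (ax 1) 0" by auto
    have "(n \<circ> El 1 2 1) (J v 0) = J (ax 1) 0" using n by (simp add: El_J0)
    moreover have "n \<circ> El 1 2 1 \<in> BL" using n by (intro BL_comp El_BL) auto
    ultimately show ?thesis by blast
  qed
qed

lemma move2:
  assumes v: "v \<in> F4v" "v$2 \<noteq> 0 \<or> v$3 \<noteq> 0"
  shows "\<exists>n\<in>BL. n (J (ax 1) 0) = J (ax 1) 0 \<and> n (J v 0) = J (ax 2) 0"
proof -
  have fix1: "El i j a (J (ax 1) 0) = J (ax 1) 0" if "i \<noteq> 1" "i \<noteq> j" for i j a
    using that by (simp add: El_J0) (simp add: vec_eq_iff axis_def)
  have A: "\<exists>n\<in>BL. n (J (ax 1) 0) = J (ax 1) 0 \<and> n (J v 0) = J (ax 2) 0" if v: "v \<in> F4v" "v$2 = 1" for v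
  proof (intro bexI[of _ "El 2 3 (v$3) \<circ> El 2 1 (v$1)"] conjI)
    show "El 2 3 (v$3) \<circ> El 2 1 (v$1) \<in> BL"
      using v by (intro BL_comp El_BL) (auto simp: F4v_def)
    show "(El 2 3 (v$3) \<circ> El 2 1 (v$1)) (J v 0) = J (ax 2) 0"
      using v by (simp add: El_J0) (rule vec3_eqI; simp add: axis_def)
  qed (simp add: fix1)
  have B: "\<exists>n\<in>BL. n (J (ax 1) 0) = J (ax 1) 0 \<and> n (J v 0) = J (ax 2) 0" if v: "v \<in> F4v" "v$3 \<noteq> 0" for v
  proof -
    let ?a = "(1 + v$2) / v$3" let ?v = "v + axis 2 (?a * v$3)"
    have a: "?a \<in> F4" using v by (auto simp: F4v_def)
    have "?v$2 = 1" "?v \<in> F4v"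
      using v a by (auto simp: axis_def F4v_def add.commute intro!: F4_add)
    from A[OF this(2,1)] obtain n where n: "n \<in> BL" "n (J (ax 1) 0) = J (ax 1) 0" "n (J ?v 0) = J (ax 2) 0" by blast
    have "(n \<circ> El 3 2 ?a) (J v 0) = J (ax 2) 0" "(n \<circ> El 3 2 ?a) (J (ax 1) 0) = J (ax 1) 0"
      using n v by (simp_all add: El_J0[of 3 2 ?a v] fix1)
    moreover have "n \<circ> El 3 2 ?a \<in> BL" using n a v by (intro BL_comp El_BL) auto
    ultimately show ?thesis by blast
  qed
  show ?thesis
  proof (cases "v$3 = 0")
    case False
    then show ?thesis using B[OF v(1)] by auto
  next
    case True
    then have v1: "v$2 \<noteq> 0" using v by auto
    let ?v = "v + axis 3 (v$2)"
    have "?v \<in> F4v" "?v$3 \<noteq> 0" using v v1 True by (auto simp: F4v_def axis_def intro!: F4_add)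
    from B[OF this] obtain n where n: "n \<in> BL" "n (J (ax 1) 0) = J (ax 1) 0" "n (J ?v 0) = J (ax 2) 0" by auto
    have "(n \<circ> El 2 3 1) (J v 0) = J (ax 2) 0" "(n \<circ> El 2 3 1) (J (ax 1) 0) = J (ax 1) 0"
      using n by (simp_all add: El_J0[of 2 3 1 v] fix1)
    moreover have "n \<circ> El 2 3 1 \<in> BL" using n by (intro BL_comp El_BL) auto
    ultimately show ?thesis by blast
  qed
qed

lemma move3:
  assumes v: "v \<in> F4v" "v$3 \<noteq> 0"
  shows "\<exists>n\<in>BL. n (J (ax 1) 0) = J (ax 1) 0 \<and> n (J (ax 2) 0) = J (ax 2) 0 \<and> n (J v 0) = J (v$3 *s ax 3) 0"
proof (intro bexI[of _ "El 3 2 (v$2 / v$3) \<circ> El 3 1 (v$1 / v$3)"] conjI)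
  show "El 3 2 (v$2 / v$3) \<circ> El 3 1 (v$1 / v$3) \<in> BL"
    using v by (intro BL_comp El_BL) (auto simp: F4v_def)
  show "(El 3 2 (v$2 / v$3) \<circ> El 3 1 (v$1 / v$3)) (J v 0) = J (v$3 *s ax 3) 0"
    using v by (simp add: El_J0) (rule vec3_eqI; simp add: axis_def)
qed ((simp add: El_J0, simp add: vec_eq_iff axis_def)+)

lemma BL_px: "n \<in> BL \<Longrightarrow> n (J x 0) = J (px (n (J x 0))) 0"
proof -
  assume "n \<in> BL"
  then have "n (J x 0) \<in> W 0" unfolding BL_def W0_iff[of "J x 0"] using W0_iff by blast
  then show ?thesis by (auto simp: W0_iff)
qed

text \<open>Column operations of determinant 1 transform any basis to the standard one up to a
  scalar factor of the last vector.\<close>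

lemma frame_to_standard:
  assumes F: "a \<in> F4v" "b \<in> F4v" "c \<in> F4v"
    and ind: "\<And>\<alpha> \<beta> \<gamma>. \<alpha> *s a + \<beta> *s b + \<gamma> *s c = 0 \<Longrightarrow> \<alpha> = 0 \<and> \<beta> = 0 \<and> \<gamma> = (0::'k)"
  shows "\<exists>n\<in>BL. \<exists>\<delta>\<in>F4. \<delta> \<noteq> 0 \<and> n (J a 0) = J (ax 1) 0 \<and> n (J b 0) = J (ax 2) 0 \<and> n (J c 0) = J (\<delta> *s ax 3) 0"
proof -
  have "a \<noteq> 0" using ind[of 1 0 0] by auto
  from move1[OF F(1) this] obtain n1 where n1: "n1 \<in> BL" "n1 (J a 0) = J (ax 1) 0" by blast
  define b1 where "b1 = px (n1 (J b 0))"
  have b1: "n1 (J b 0) = J b1 0" using BL_px[OF n1(1)] by (simp add: b1_def)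
  have b1F: "b1 \<in> F4v" using LI_F4v[OF BL_LI[OF n1(1)], of "J b 0"] F by (simp add: b1 F4v_J)
  have ind': "\<alpha> = 0 \<and> \<beta> = 0 \<and> \<gamma> = 0"
    if "n \<in> BL" "n (J (\<alpha> *s a + \<beta> *s b + \<gamma> *s c) 0) = 0" for n \<alpha> \<beta> \<gamma>
  proof -
    have "J (\<alpha> *s a + \<beta> *s b + \<gamma> *s c) 0 = 0"
      using LI_inj[OF BL_LI[OF that(1)]] LI_0[OF BL_LI[OF that(1)]] that(2) by (metis injD)
    then show ?thesis by (intro ind) simp
  qed
  have lin: "n (J (\<alpha> *s a + \<beta> *s b + \<gamma> *s c) 0) = \<alpha> *s n (J a 0) + \<beta> *s n (J b 0) + \<gamma> *s n (J c 0)"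
    if "n \<in> BL" for n \<alpha> \<beta> \<gamma>
  proof -
    have "J (\<alpha> *s a + \<beta> *s b + \<gamma> *s c) 0 = \<alpha> *s J a 0 + \<beta> *s J b 0 + \<gamma> *s J c 0"
      by (simp add: J_add J_scale)
    then show ?thesis using BL_LI[OF that] by (simp add: LI_add LI_scale)
  qed
  have "b1$2 \<noteq> 0 \<or> b1$3 \<noteq> 0"
  proof (rule ccontr)
    assume "\<not> ?thesis"
    then have "n1 (J (b1$1 *s a + 1 *s b + 0 *s c) 0) = 0"
      unfolding lin[OF n1(1)] n1 b1 by (simp add: J_scale J_add) (simp add: vec_eq_iff forall_3 axis_def)
    from ind'[OF n1(1) this] show False by simp
  qed
  from move2[OF b1F this] obtain n2 where n2: "n2 \<in> BL" "n2 (J (ax 1) 0) = J (ax 1) 0" "n2 (J b1 0) = J (ax 2) 0" by blast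
  define n where "n = n2 \<circ> n1"
  have n: "n \<in> BL" "n (J a 0) = J (ax 1) 0" "n (J b 0) = J (ax 2) 0"
    using n1 n2 b1 by (auto simp: n_def intro: BL_comp)
  define c1 where "c1 = px (n (J c 0))"
  have c1: "n (J c 0) = J c1 0" using BL_px[OF n(1)] by (simp add: c1_def)
  have c1F: "c1 \<in> F4v" using LI_F4v[OF BL_LI[OF n(1)], of "J c 0"] F by (simp add: c1 F4v_J)
  have c3: "c1$3 \<noteq> 0"
  proof
    assume "c1$3 = 0"
    then have "n (J (c1$1 *s a + c1$2 *s b + 1 *s c) 0) = 0"
      unfolding lin[OF n(1)] n c1 by (simp add: J_scale J_add) (simp add: vec_eq_iff forall_3 axis_def)
    from ind'[OF n(1) this] show False by simp
  qed
  from move3[OF c1F c3] obtain n3 where n3: "n3 \<in> BL" "n3 (J (ax 1) 0) = J (ax 1) 0" "n3 (J (ax 2) 0) = J (ax 2) 0"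
    "n3 (J c1 0) = J (c1$3 *s ax 3) 0" by blast
  have "n3 \<circ> n \<in> BL" by (intro BL_comp n3 n)
  moreover have "c1$3 \<in> F4" using c1F by (simp add: F4v_def)
  ultimately show ?thesis using c3 n n3 c1 by (metis comp_apply)
qed

text \<open>\<open>Dg (dd \<delta>)\<close> represents the cosets of \<open>NN\<close> in the
  group of all linear isometries.\<close>

definition dd :: "'k \<Rightarrow> 'k^3" where "dd \<delta> = (\<chi> k. if k = 3 then \<delta> else 1)"

lemma dd_F4v: "\<delta> \<in> F4 \<Longrightarrow> dd \<delta> \<in> F4v" by (simp add: dd_def F4v_def)

lemma dd_nz: "\<delta> \<noteq> 0 \<Longrightarrow> dd \<delta> $ k \<noteq> 0" by (simp add: dd_def)

lemma Dg_dd_LI: "\<delta> \<in> F4 \<Longrightarrow> \<delta> \<noteq> 0 \<Longrightarrow> Dg (dd \<delta>) \<in> LI" by (intro Dg_LI dd_F4v dd_nz)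

lemma LI_eqI:
  assumes "m \<in> LI" "n \<in> LI" "\<And>i. m (J (ax i) 0) = n (J (ax i) 0)" "\<And>i. m (J 0 (ax i)) = n (J 0 (ax i))"
  shows "m = n"
proof
  fix v
  obtain x y where v: "v = J x y" by (rule J_cases)
  have "J x y = (x$1 *s J (ax 1) 0 + x$2 *s J (ax 2) 0 + x$3 *s J (ax 3) 0) +
      (y$1 *s J 0 (ax 1) + y$2 *s J 0 (ax 2) + y$3 *s J 0 (ax 3))"
    using ax_expand[of x] ax_expand[of y] by (simp add: J_add J_scale)
  then show "m v = n v" using assms by (simp add: v LI_add LI_scale)
qed

text \<open>Move the images of \<open>Winf\<close> and \<open>W 0\<close> back to these planes.
  What remains is determined by its action on the first block, and Gaussian elimination reduces
  that to a diagonal matrix.\<close>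

lemma LI_decomp:
  assumes m: "m \<in> LI"
  shows "\<exists>n\<in>NN. \<exists>\<delta>\<in>F4. \<delta> \<noteq> 0 \<and> n \<circ> m = Dg (dd \<delta>)"
proof -
  have "vec.dim (m ` Winf \<inter> m ` W 0) = 0" using LI_dim_Int[OF m] by (simp add: dim_Winf_W)
  from NN_plane_pair[OF LI_plane[OF m Winf_plane] LI_plane[OF m W_plane[OF Herm_0]] this]
  obtain n1 where n1: "n1 \<in> NN" "n1 ` m ` Winf = Winf" "n1 ` m ` W 0 = W 0" by blast
  define m1 where "m1 = n1 \<circ> m"
  have m1: "m1 \<in> LI" "m1 ` Winf = Winf" "m1 ` W 0 = W 0"
    using n1 LI_comp[OF NN_LI[OF n1(1)] m] unfolding m1_def by (simp_all only: image_comp[symmetric])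
  define L where "L x = px (m1 (J x 0))" for x
  have L: "m1 (J x 0) = J (L x) 0" for x
  proof -
    have "m1 (J x 0) \<in> m1 ` W 0" by (auto simp: W0_iff)
    then show ?thesis unfolding m1 by (auto simp: L_def W0_iff)
  qed
  have LF: "L x \<in> F4v" if "x \<in> F4v" for x
    using LI_F4v[OF m1(1), of "J x 0"] that by (simp add: L F4v_J)
  have Llin: "L (x + y) = L x + L y" "L (c *s x) = c *s L x" for x y c
  proof -
    have "m1 (J (x + y) 0) = m1 (J x 0) + m1 (J y 0)" using m1(1) by (simp add: LI_add[symmetric] J_add)
    then show "L (x + y) = L x + L y" by (simp add: L J_add)
    have "m1 (J (c *s x) 0) = c *s m1 (J x 0)" using m1(1) by (simp add: LI_scale[symmetric] J_scale)
    then show "L (c *s x) = c *s L x" by (simp add: L J_scale)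
  qed
  have ind: "\<alpha> = 0 \<and> \<beta> = 0 \<and> \<gamma> = 0" if "\<alpha> *s L (ax 1) + \<beta> *s L (ax 2) + \<gamma> *s L (ax 3) = 0" for \<alpha> \<beta> \<gamma>
  proof -
    let ?x = "\<alpha> *s ax 1 + \<beta> *s ax 2 + \<gamma> *s ax 3"
    have "L ?x = 0" using that by (simp add: Llin)
    then have "m1 (J ?x 0) = m1 0" using L[of ?x] LI_0[OF m1(1)] by simp
    then have "?x = 0" using LI_inj[OF m1(1)] by (metis J_eq_0 injD)
    then show ?thesis by (simp add: vec_eq_iff forall_3 axis_def)
  qed
  from frame_to_standard[of "L (ax 1)" "L (ax 2)" "L (ax 3)"] LF ind
  have "\<exists>n\<in>BL. \<exists>\<delta>\<in>F4. \<delta> \<noteq> 0 \<and> n (J (L (ax 1)) 0) = J (ax 1) 0 \<and>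
      n (J (L (ax 2)) 0) = J (ax 2) 0 \<and> n (J (L (ax 3)) 0) = J (\<delta> *s ax 3) 0"
    by simp
  then obtain n2 \<delta> where n2: "n2 \<in> BL" and d: "\<delta> \<in> F4" "\<delta> \<noteq> 0"
    and e: "n2 (J (L (ax 1)) 0) = J (ax 1) 0" "n2 (J (L (ax 2)) 0) = J (ax 2) 0" "n2 (J (L (ax 3)) 0) = J (\<delta> *s ax 3) 0"
    by auto
  define m2 where "m2 = n2 \<circ> m1"
  have m2: "m2 \<in> LI" "m2 ` Winf = Winf"
    using m1 n2 LI_comp[OF BL_LI[OF n2] m1(1)] unfolding m2_def BL_def by (simp_all only: image_comp[symmetric]) auto
  have e2: "m2 (J (ax 1) 0) = J (ax 1) 0" "m2 (J (ax 2) 0) = J (ax 2) 0" "m2 (J (ax 3) 0) = J (\<delta> *s ax 3) 0"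
    using e by (simp_all add: m2_def L)
  have "m2 = Dg (dd \<delta>)"
  proof (rule LI_eqI[OF m2(1) Dg_dd_LI[OF d]])
    fix i
    show "m2 (J (ax i) 0) = Dg (dd \<delta>) (J (ax i) 0)"
      using exhaust_3[of i]
      by (elim disjE; simp only: e2 Dg_J J_eq; simp add: vec_eq_iff dd_def axis_def)
    have "m2 (J 0 (ax i)) \<in> m2 ` Winf" by (auto simp: Winf_iff)
    then obtain y where y: "m2 (J 0 (ax i)) = J 0 y" unfolding m2 by (auto simp: Winf_iff)
    have h: "herm (m2 (J (ax j) 0)) (J 0 y) = (if i = j then 1 else 0)" for j
      unfolding y[symmetric] LI_herm[OF m2(1)] by (simp add: herm_J) (simp add: axis_def)
    have "(y$1)\<^sup>2 = (if i = 1 then 1 else 0)\<^sup>2" "(y$2)\<^sup>2 = (if i = 2 then 1 else 0)\<^sup>2" "\<delta> * (y$3)\<^sup>2 = (if i = 3 then 1 else 0)"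
      using h[of 1] h[of 2] h[of 3] by (simp_all add: e2 herm_J herm_simps split: if_splits)
    moreover have "\<delta> * \<delta>\<^sup>2 = 1" using d by (rule F4_norm)
    then have "\<delta> * (y$3)\<^sup>2 = (if i = 3 then 1 else 0) \<longleftrightarrow> (y$3)\<^sup>2 = (if i = 3 then \<delta> else 0)\<^sup>2"
      using d by (auto) (metis mult_cancel_left sq_inj)
    ultimately have "y = (\<chi> k. dd \<delta> $ k * ax i $ k)"
      unfolding sq_inj by (intro vec3_eqI) (auto simp: dd_def axis_def)
    then show "m2 (J 0 (ax i)) = Dg (dd \<delta>) (J 0 (ax i))"
      by (simp add: y) (simp add: vec_eq_iff)
  qed
  moreover have "n2 \<circ> n1 \<in> NN" using n2 n1 by (simp add: BL_def NN_comp)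
  ultimately show ?thesis using d unfolding m2_def m1_def comp_assoc[symmetric] by blast
qed

section \<open>Semilinear isometries and the groups acting on the rational points\<close>

text \<open>Linear isometries, possibly composed with the Frobenius map. This set is closed under
  composition only up to the square of the Frobenius map, which acts trivially on rational
  vectors; this is why the group laws below are stated for the induced permutations.\<close>

definition SM :: "('k^6 \<Rightarrow> 'k^6) set" where
  "SM = LI \<union> {m \<circ> sqv |m. m \<in> LI}"

lemma SM_LI: "m \<in> LI \<Longrightarrow> m \<in> SM" by (simp add: SM_def)

lemma SM_sq: "m \<in> LI \<Longrightarrow> m \<circ> sqv \<in> SM" by (auto simp: SM_def)

lemma sqv_SM: "sqv \<in> SM" using SM_sq[OF LI_id] by simp

lemma bij_sqv: "bij (sqv :: 'k^'n \<Rightarrow> 'k^'n)"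
  by (rule bijI) (simp add: inj_def, metis sqv_surj surjI surj_def)

lemma SM_cases [consumes 1, case_names lin semi]:
  assumes "m \<in> SM"
  obtains "m \<in> LI" | m' where "m' \<in> LI" "m = m' \<circ> sqv"
  using assms by (auto simp: SM_def)

lemma SM_bij: "m \<in> SM \<Longrightarrow> bij m"
  by (erule SM_cases) (auto intro: LI_bij bij_comp bij_sqv)

lemma SM_add: "m \<in> SM \<Longrightarrow> m (x + y) = m x + m y"
  by (erule SM_cases) (auto simp: LI_add sqv_add)

lemma SM_0: "m \<in> SM \<Longrightarrow> m 0 = 0" using SM_add[of m 0 0] by simp

lemma SM_eq_0: "m \<in> SM \<Longrightarrow> m x = 0 \<longleftrightarrow> x = 0"
  by (metis SM_0 SM_bij bij_is_inj injD)

lemma SM_scale: "m \<in> SM \<Longrightarrow> \<exists>\<sigma>. bij \<sigma> \<and> \<sigma> 0 = 0 \<and> (\<forall>c x. m (c *s x) = \<sigma> c *s m x)"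
proof (erule SM_cases)
  assume "m \<in> LI"
  then show ?thesis by (intro exI[of _ id]) (simp add: LI_scale)
next
  fix m' assume m': "m' \<in> LI" "m = m' \<circ> sqv"
  have "bij (\<lambda>c::'k. c\<^sup>2)" by (rule bijI) (simp add: inj_def, metis sq_surj surj_def)
  then show ?thesis using m' by (intro exI[of _ "\<lambda>c. c\<^sup>2"]) (simp add: LI_scale sqv_scale)
qed

lemma SM_F4v: "m \<in> SM \<Longrightarrow> m x \<in> F4v \<longleftrightarrow> x \<in> F4v"
proof -
  have "sqv x \<in> F4v \<longleftrightarrow> x \<in> F4v" for x :: "'k^6"
    by (metis F4v_sqv sqv_inj sqv_sqv_F4v)
  then show "m \<in> SM \<Longrightarrow> ?thesis" by (erule_tac SM_cases) (auto simp: LI_F4v)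
qed

lemma SM_herm_0: "m \<in> SM \<Longrightarrow> herm (m x) (m y) = 0 \<longleftrightarrow> herm x y = 0"
  by (erule SM_cases) (auto simp: LI_herm herm_sqv)

lemma SM_subspace: assumes "m \<in> SM" "vec.subspace S" shows "vec.subspace (m ` S)"
proof -
  obtain \<sigma> where s: "bij \<sigma>" "\<And>c x. m (c *s x) = \<sigma> c *s m x" using SM_scale[OF assms(1)] by blast
  have "c *s m x \<in> m ` S" if "x \<in> S" for c x
  proof -
    obtain d where "\<sigma> d = c" using s(1) by (metis bij_is_surj surjD)
    then have "c *s m x = m (d *s x)" by (simp add: s)
    then show ?thesis using assms(2) that by (auto simp: vec.subspace_scale)
  qed
  moreover have "0 \<in> m ` S" using SM_0[OF assms(1)] assms(2) vec.subspace_0 by (metis image_eqI)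
  moreover have "m x + m y \<in> m ` S" if "x \<in> S" "y \<in> S" for x y
    using that assms by (auto simp: SM_add[symmetric] vec.subspace_add)
  ultimately show ?thesis by (auto simp: vec.subspace_def)
qed

lemma dim_semilinear_bij:
  fixes m :: "'k^6 \<Rightarrow> 'k^6"
  assumes b: "bij m" and add: "\<And>x y. m (x + y) = m x + m y" and s: "bij \<sigma>" and scale: "\<And>c x. m (c *s x) = \<sigma> c *s m x"
  shows "vec.dim (m ` S) = vec.dim S"
proof (rule antisym)
  show "vec.dim (m ` S) \<le> vec.dim S" by (rule dim_semilinear_le[OF add scale])
  let ?n = "inv_into UNIV m" and ?t = "inv_into UNIV \<sigma>"
  have i: "m (?n x) = x" "?n (m x) = x" for x
    using b by (simp_all add: bij_is_surj surj_f_inv_f bij_is_inj)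
  have t: "\<sigma> (?t c) = c" for c using s by (simp add: bij_is_surj surj_f_inv_f)
  have "?n (x + y) = ?n x + ?n y" for x y by (metis add i)
  moreover have "?n (c *s x) = ?t c *s ?n x" for c x by (metis scale i t)
  ultimately have "vec.dim (?n ` m ` S) \<le> vec.dim (m ` S)" by (rule dim_semilinear_le)
  then show "vec.dim S \<le> vec.dim (m ` S)" by (simp add: image_image i)
qed

lemma SM_dim: "m \<in> SM \<Longrightarrow> vec.dim (m ` S) = vec.dim S"
proof -
  assume m: "m \<in> SM"
  obtain \<sigma> where "bij \<sigma>" "\<And>c x. m (c *s x) = \<sigma> c *s m x" using SM_scale[OF m] by blast
  then show ?thesis by (rule dim_semilinear_bij[OF SM_bij[OF m] SM_add[OF m]])
qed

lemma SM_plane: assumes "m \<in> SM" "P \<in> planes" shows "m ` P \<in> planes"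
  using assms unfolding planes_iff by (auto simp: SM_subspace SM_dim SM_herm_0)

lemma SM_dim_Int: assumes "m \<in> SM" shows "vec.dim (m ` P \<inter> m ` Q) = vec.dim (P \<inter> Q)"
  using SM_bij[OF assms] SM_dim[OF assms, of "P \<inter> Q"] by (simp add: image_Int bij_is_inj)

lemma SM_span: assumes "m \<in> SM" shows "vec.span (m ` S) = m ` vec.span S"
proof
  show "vec.span (m ` S) \<subseteq> m ` vec.span S"
    by (intro vec.span_minimal SM_subspace assms vec.subspace_span image_mono vec.span_superset)
  obtain \<sigma> where s: "\<And>c x. m (c *s x) = \<sigma> c *s m x" using SM_scale[OF assms(1)] by blast
  have "m x \<in> vec.span (m ` S)" if "x \<in> vec.span S" for x
    using that
  proof (induction rule: vec.span_induct_alt)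
    case base then show ?case by (simp add: SM_0[OF assms] vec.span_zero)
  next
    case (step c x y)
    then show ?case by (simp add: SM_add[OF assms] s vec.span_add vec.span_base vec.span_scale)
  qed
  then show "m ` vec.span S \<subseteq> vec.span (m ` S)" by blast
qed

text \<open>Conjugation by the Frobenius map preserves the linear isometries.\<close>

lemma sqv_LI_commute: assumes "m \<in> LI" shows "\<exists>m'\<in>LI. sqv \<circ> m = m' \<circ> sqv"
proof -
  let ?i = "inv_into UNIV (sqv :: 'k^6 \<Rightarrow> 'k^6)" let ?m = "\<lambda>v. sqv (m (?i v))"
  have i: "sqv (?i x) = x" "?i (sqv x) = x" for x :: "'k^6"
    by (simp_all add: bij_is_surj[OF bij_sqv] surj_f_inv_f bij_is_inj[OF bij_sqv])
  have "?m (sqv x + sqv y) = ?m (sqv x) + ?m (sqv y)" for x y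
    by (simp add: sqv_add[symmetric] i LI_add[OF assms, symmetric])
  then have "?m (x + y) = ?m x + ?m y" for x y by (metis i(1))
  moreover have "?m (c\<^sup>2 *s sqv x) = c\<^sup>2 *s ?m (sqv x)" for c x
    by (simp add: sqv_scale[symmetric] i LI_scale[OF assms])
  then have "?m (c *s x) = c *s ?m x" for c x by (metis i(1) sq_surj)
  moreover have "herm (?m (sqv x)) (?m (sqv y)) = herm (sqv x) (sqv y)" for x y
    by (simp add: herm_sqv i LI_herm[OF assms])
  then have "herm (?m x) (?m y) = herm x y" for x y by (metis i(1))
  ultimately have "?m \<in> LI" by (simp add: LI_def)
  moreover have "sqv \<circ> m = ?m \<circ> sqv" by (rule ext) (simp add: i)
  ultimately show ?thesis by blast
qed

definition perm :: "('k^6 \<Rightarrow> 'k^6) \<Rightarrow> ('k^6) set \<Rightarrow> ('k^6) set" where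
  "perm m = (\<lambda>L\<in>rational_points. m ` L)"

lemma rational_points_iff:
  "L \<in> rational_points \<longleftrightarrow> (\<exists>v. L = vec.span {v} \<and> v \<noteq> 0 \<and> v \<in> F4v \<and> herm v v = (0::'k))"
  by (auto simp: rational_points_def F4v_def fermat_cone_iff)

lemma SM_rational: assumes "m \<in> SM" "L \<in> rational_points" shows "m ` L \<in> rational_points"
proof -
  obtain v where v: "L = vec.span {v}" "v \<noteq> 0" "v \<in> F4v" "herm v v = 0"
    using assms(2) by (auto simp: rational_points_iff)
  have "m ` L = vec.span {m v}" using SM_span[OF assms(1), of "{v}"] v by simp
  then show ?thesis unfolding rational_points_iff
    using v assms(1) by (intro exI[of _ "m v"]) (simp add: SM_eq_0 SM_F4v SM_herm_0)
qed

lemma perm_apply: "L \<in> rational_points \<Longrightarrow> perm m L = m ` L" by (simp add: perm_def)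

lemma perm_comp: assumes "n \<in> SM" shows "compose rational_points (perm m) (perm n) = perm (m \<circ> n)"
  unfolding perm_def compose_def using SM_rational[OF assms] by (auto simp: fun_eq_iff image_image)

lemma LI_inv_comp: assumes "m \<in> LI" shows "inv_into UNIV m \<circ> m = id" "m \<circ> inv_into UNIV m = id"
  using inv_o_cancel[OF LI_inj[OF assms]] LI_bij[OF assms] by (simp_all only: bij_def surj_iff)

lemma LI_inv_image: assumes "m \<in> LI" shows "inv_into UNIV m ` m ` S = S" "m ` inv_into UNIV m ` S = S"
  unfolding image_comp LI_inv_comp[OF assms] by simp_all

lemma sqv_sqv_rational: assumes "L \<in> rational_points" shows "sqv ` sqv ` L = (L :: ('k^6) set)"
proof -
  obtain v where v: "L = vec.span {v}" "v \<in> F4v" using assms unfolding rational_points_iff by blast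
  have "sqv ` sqv ` L = vec.span {sqv (sqv v)}"
    using SM_span[OF sqv_SM, of "{v}"] SM_span[OF sqv_SM, of "{sqv v}"] v(1) by simp
  then show ?thesis using v sqv_sqv_F4v[of v] by simp
qed

lemma perm_eq_iff: "perm m = perm n \<longleftrightarrow> (\<forall>L\<in>rational_points. m ` L = n ` L)"
proof
  assume e: "perm m = perm n"
  show "\<forall>L\<in>rational_points. m ` L = n ` L"
    using e by (metis perm_apply)
qed (simp add: perm_def restrict_def fun_eq_iff)

text \<open>The only case that needs an argument is that of two semilinear maps: the square of the
  Frobenius map fixes every rational point.\<close>

lemma perm_SM_comp: assumes "m \<in> SM" "n \<in> SM" shows "\<exists>p\<in>SM. compose rational_points (perm m) (perm n) = perm p"
proof -
  have LL: "perm (m \<circ> n) = perm p \<Longrightarrow> p \<in> SM \<Longrightarrow> ?thesis" for p using perm_comp[OF assms(2)] by auto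
  show ?thesis
    using assms(1)
  proof (cases rule: SM_cases)
    case lin
    show ?thesis using assms(2)
    proof (cases rule: SM_cases)
      case lin with \<open>m \<in> LI\<close> show ?thesis by (intro LL[OF refl] SM_LI LI_comp)
    next
      case (semi n') with \<open>m \<in> LI\<close> show ?thesis
        by (intro LL[OF refl]) (simp add: comp_assoc[symmetric] SM_sq LI_comp)
    qed
  next
    case (semi m')
    show ?thesis using assms(2)
    proof (cases rule: SM_cases)
      case lin
      then obtain n' where n': "n' \<in> LI" "sqv \<circ> n = n' \<circ> sqv" using sqv_LI_commute by blast
      have "m \<circ> n = (m' \<circ> n') \<circ> sqv" using semi n' by (simp add: comp_assoc)
      with semi n' show ?thesis by (intro LL[OF refl]) (simp add: SM_sq LI_comp)
    next
      case (semi n')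
      obtain n'' where n'': "n'' \<in> LI" "sqv \<circ> n' = n'' \<circ> sqv" using semi(1) sqv_LI_commute by blast
      have "perm (m \<circ> n) = perm (m' \<circ> n'')"
        unfolding perm_eq_iff
      proof
        fix L :: "('k^6) set" assume L: "L \<in> rational_points"
        have "(m \<circ> n) ` L = m' ` (sqv \<circ> n') ` sqv ` L"
          unfolding \<open>m = m' \<circ> sqv\<close> semi(2) by (simp only: image_comp[symmetric])
        also have "\<dots> = m' ` n'' ` sqv ` sqv ` L" unfolding n''(2) by (simp only: image_comp[symmetric])
        finally show "(m \<circ> n) ` L = (m' \<circ> n'') ` L"
          unfolding sqv_sqv_rational[OF L] by (simp only: image_comp[symmetric])
      qed
      then show ?thesis by (rule LL) (intro SM_LI LI_comp n'' \<open>m' \<in> LI\<close>)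
    qed
  qed
qed

lemma perm_id: "perm id = (\<lambda>L\<in>rational_points. L)" by (simp add: perm_def)

lemma perm_SM_inv: assumes "m \<in> SM"
  shows "\<exists>p\<in>SM. compose rational_points (perm p) (perm m) = (\<lambda>L\<in>rational_points. L) \<and>
     compose rational_points (perm m) (perm p) = (\<lambda>L\<in>rational_points. L)"
proof -
  have "\<exists>p\<in>SM. \<forall>L\<in>rational_points. (p \<circ> m) ` L = id ` L \<and> (m \<circ> p) ` L = id ` L"
    using assms
  proof (cases rule: SM_cases)
    case lin
    then show ?thesis
      by (intro bexI[of _ "inv_into UNIV m"] ballI conjI SM_LI LI_inv) (simp_all only: LI_inv_comp)
  next
    case (semi m')
    let ?n = "inv_into UNIV m'"
    obtain n' where n': "n' \<in> LI" "sqv \<circ> ?n = n' \<circ> sqv" using sqv_LI_commute[OF LI_inv[OF semi(1)]] by blast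
    have "sqv \<circ> ?n \<in> SM" unfolding n'(2) by (rule SM_sq[OF n'(1)])
    moreover have "((sqv \<circ> ?n) \<circ> m) ` L = id ` L \<and> (m \<circ> (sqv \<circ> ?n)) ` L = id ` L" if L: "L \<in> rational_points" for L
    proof -
      have "?n ` L \<in> rational_points" by (rule SM_rational[OF SM_LI[OF LI_inv[OF semi(1)]] L])
      then have q: "sqv ` sqv ` ?n ` L = ?n ` L" by (rule sqv_sqv_rational)
      have "((sqv \<circ> ?n) \<circ> m) ` L = sqv ` ?n ` m' ` sqv ` L" unfolding semi(2) by (simp only: image_comp[symmetric])
      moreover have "(m \<circ> (sqv \<circ> ?n)) ` L = m' ` sqv ` sqv ` ?n ` L" unfolding semi(2) by (simp only: image_comp[symmetric])
      ultimately show ?thesis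
        by (simp only: LI_inv_image[OF semi(1)] sqv_sqv_rational[OF L] q image_id id_apply)
    qed
    ultimately show ?thesis by blast
  qed
  then obtain p where p0: "p \<in> SM" "\<forall>L\<in>rational_points. (p \<circ> m) ` L = id ` L \<and> (m \<circ> p) ` L = id ` L"
    by (elim bexE)
  have p: "p \<in> SM" "perm (p \<circ> m) = perm id" "perm (m \<circ> p) = perm id"
    unfolding perm_eq_iff using p0 by simp_all
  show ?thesis
    by (rule bexI[OF _ p(1)]) (simp only: perm_comp[OF assms] perm_comp[OF p(1)] p perm_id)
qed

lemma perm_Bij: assumes "m \<in> SM" shows "perm m \<in> Bij rational_points"
proof -
  obtain p where p: "p \<in> SM" "compose rational_points (perm p) (perm m) = (\<lambda>L\<in>rational_points. L)"
     "compose rational_points (perm m) (perm p) = (\<lambda>L\<in>rational_points. L)"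
    using perm_SM_inv[OF assms] by blast
  have 1: "perm p (perm m L) = L" "perm m (perm p L) = L" if "L \<in> rational_points" for L
    using p(2,3)[THEN fun_cong, of L] that by (simp_all add: compose_eq)
  have "bij_betw (perm m) rational_points rational_points"
    by (rule bij_betw_byWitness[of _ "perm p"])
      (use 1 SM_rational assms p(1) in \<open>auto simp: perm_apply\<close>)
  then show ?thesis by (simp add: Bij_def perm_def)
qed

definition act :: "'k^6^6 \<Rightarrow> 'k^6 \<Rightarrow> 'k^6" where "act g v = v v* g"

lemma herm_act: "herm (axis i 1 v* g) (axis j 1 v* h) = (g ** transpose (mat_bar h)) $ i $ j"
  for g h :: "'k^6^6"
  by (simp add: herm_def vector_matrix_mult_def axis_def matrix_matrix_mult_def transpose_def
      mat_bar_def map_matrix_def if_distrib[of "\<lambda>a. a * _"] cong: if_cong)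

text \<open>The defining equation of the unitary group says that the rows form an orthonormal
  basis for \<open>herm\<close>.\<close>

lemma act_LI_iff: "act g \<in> LI \<longleftrightarrow> g \<in> carrier GU"
proof
  assume g: "act g \<in> LI"
  have e: "g ** transpose (mat_bar g) = mat 1"
    using LI_herm[OF g, of "axis _ 1" "axis _ 1"]
    by (simp add: vec_eq_iff herm_act[symmetric] act_def mat_def) (simp add: axis_def)
  then have "invertible g" using invertible_right_inverse by blast
  with e show "g \<in> carrier GU" by (simp add: GU_def)
next
  assume "g \<in> carrier GU"
  then have e: "g ** transpose (mat_bar g) = mat 1" by (simp add: GU_def)
  have x: "x = (\<Sum>i\<in>UNIV. x$i *s axis i 1)" for x :: "'k^6" by (simp add: basis_expansion)
  have lin: "act g (x + y) = act g x + act g y" "act g (c *s x) = c *s act g x" for c x y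
    by (simp_all add: act_def vector_matrix_left_distrib scalar_vector_matrix_assoc)
  have "herm (act g (axis i 1)) (act g (axis j 1)) = herm (axis i 1) (axis j 1)" for i j
    unfolding act_def herm_act e by (simp add: mat_def) (simp add: axis_def)
  then have 1: "herm (act g (axis i 1)) (act g y) = herm (axis i 1) y" for i y
    by (subst (1 2) x[of y]) (simp add: sum_6 lin herm_simps)
  have "herm (act g x) (act g y) = herm x y" for x y
    by (subst (1 2) x[of x]) (simp add: sum_6 lin herm_simps 1)
  with lin show "act g \<in> LI" by (simp add: LI_def)
qed

lemma LI_imp_act: assumes m: "m \<in> LI" shows "\<exists>g\<in>carrier GU. m = act g"
proof -
  define g :: "'k^6^6" where "g = (\<chi> i. m (axis i 1))"
  have "m v = act g v" for v
  proof -
    have "m v = m (\<Sum>i\<in>UNIV. v$i *s axis i 1)" by (simp add: basis_expansion)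
    also have "\<dots> = (\<Sum>i\<in>UNIV. v$i *s m (axis i 1))"
      unfolding sum_6 by (simp add: LI_add[OF m] LI_scale[OF m])
    also have "\<dots> = act g v"
      by (simp add: act_def g_def vec_eq_iff vector_matrix_mult_def)
    finally show ?thesis .
  qed
  then have "m = act g" by blast
  with m act_LI_iff show ?thesis by blast
qed

lemma act_mult: "act (g ** h) = act h \<circ> act g"
  by (rule ext) (simp add: act_def vector_matrix_mul_assoc)

lemma act_inj: "act g = act h \<Longrightarrow> g = h"
proof -
  assume "act g = act h"
  then have "act g (axis i 1) = act h (axis i 1)" for i by simp
  then show ?thesis
    by (simp add: act_def vec_eq_iff vector_matrix_mult_def axis_def if_distrib[of "\<lambda>a. a * _"] cong: if_cong)
qed

lemma act_mat: "act (mat c) v = c *s v"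
  by (simp add: act_def vec_eq_iff vector_matrix_mult_def mat_def if_distrib[of "\<lambda>a. _ * a"] mult.commute cong: if_cong)

lemma coset_eq: "scalars #>\<^bsub>GU\<^esub> g = {mat c ** g |c. c \<in> F4 \<and> c \<noteq> 0}"
  for g :: "'k^6^6"
  by (auto simp: r_coset_def scalars_def GU_def)

lemma act_scalar: "act (mat c ** g) v = act g (c *s v)" by (simp add: act_mult act_mat)

lemma pgu_perm_coset:
  assumes "g \<in> carrier GU" shows "pgu_perm (scalars #>\<^bsub>GU\<^esub> g) = perm (act g)"
proof -
  have "(\<Union>h\<in>scalars #>\<^bsub>GU\<^esub> g. (\<lambda>v. v v* h) ` L) = act g ` L" if L: "L \<in> rational_points" for L
  proof -
    have sc: "c *s v \<in> L" if "v \<in> L" for c v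
      using L that by (auto simp: rational_points_iff vec.span_scale)
    have "(\<lambda>v. v v* h) ` L \<subseteq> act g ` L" if "h \<in> scalars #>\<^bsub>GU\<^esub> g" for h
    proof -
      obtain c where "h = mat c ** g" using \<open>h \<in> _\<close> by (auto simp: coset_eq)
      then have "v v* h = act g (c *s v)" for v using act_scalar[of c g v] by (simp add: act_def)
      then show ?thesis using sc by auto
    qed
    moreover have "g \<in> scalars #>\<^bsub>GU\<^esub> g"
      unfolding coset_eq by (intro CollectI exI[of _ 1]) simp
    ultimately show ?thesis unfolding act_def by blast
  qed
  then show ?thesis unfolding pgu_perm_def perm_def by (intro restrict_ext) simp
qed

lemma carrier_PGU: "carrier PGU = {scalars #>\<^bsub>GU\<^esub> g |g. g \<in> carrier (GU::('k^6^6) monoid)}"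
  by (auto simp: PGU_def FactGroup_def RCOSETS_def)

lemma pgu_perm_PGU: "pgu_perm ` carrier PGU = perm ` LI"
proof -
  have "pgu_perm ` carrier PGU = {perm (act g) |g. g \<in> carrier GU}"
    unfolding carrier_PGU using pgu_perm_coset by force
  also have "\<dots> = perm ` LI" using act_LI_iff LI_imp_act by auto
  finally show ?thesis .
qed

lemma frob_perm_eq: "frob_perm = perm sqv"
  unfolding frob_perm_def perm_def sqv_def ..

lemma sym_group_group: "group (sym_group S)"
proof (rule groupI, unfold sym_group_def monoid.simps partial_object.simps)
  show "(\<lambda>x\<in>S. x) \<in> Bij S" by (rule id_Bij)
next
  fix x y assume "x \<in> Bij S" "y \<in> Bij S"
  then show "compose S y x \<in> Bij S" by (intro compose_Bij)
next
  fix x y z assume "x \<in> Bij S" "y \<in> Bij S" "z \<in> Bij S"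
  then show "compose S z (compose S y x) = compose S (compose S z y) x"
    by (intro compose_assoc[of x S S] Bij_imp_funcset)
next
  fix x assume "x \<in> Bij S"
  then show "compose S x (\<lambda>x\<in>S. x) = x"
    by (intro compose_Id[of x S S] Bij_imp_funcset Bij_imp_extensional)
next
  fix x assume x: "x \<in> Bij S"
  then have "x ` S = S" unfolding Bij_def bij_betw_def by blast
  then have "compose S x (restrict (inv_into S x) S) = (\<lambda>x\<in>S. x)"
    unfolding compose_def by (intro restrict_ext) (simp add: f_inv_into_f)
  then show "\<exists>y\<in>Bij S. compose S x y = (\<lambda>x\<in>S. x)"
    using restrict_inv_into_Bij[OF x] by blast
qed

text \<open>The permutations induced by \<open>SM\<close> are closed under the group operations,
  contain the generators, and are products of them.\<close>

lemma carrier_PGammaU: "carrier PGammaU = perm ` SM"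
proof -
  let ?S = "sym_group (rational_points :: ('k^6) set set)"
  interpret S: group ?S by (rule sym_group_group)
  have sub: "insert frob_perm (pgu_perm ` carrier PGU) \<subseteq> perm ` SM"
    unfolding pgu_perm_PGU frob_perm_eq using sqv_SM SM_LI by auto
  have car: "perm ` SM \<subseteq> carrier ?S" using perm_Bij by (auto simp: sym_group_def)
  have eq: "carrier PGammaU = generate ?S (insert frob_perm (pgu_perm ` carrier PGU))"
    unfolding PGammaU_def subgroup_generated_def using subset_trans[OF sub car] by (simp add: Int_absorb1)
  have mult: "f \<otimes>\<^bsub>?S\<^esub> g = compose rational_points g f" for f g by (simp add: sym_group_def)
  have one: "\<one>\<^bsub>?S\<^esub> = (\<lambda>L\<in>rational_points. L)" by (simp add: sym_group_def)
  have "generate ?S (insert frob_perm (pgu_perm ` carrier PGU)) \<subseteq> perm ` SM"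
  proof
    fix p assume "p \<in> generate ?S (insert frob_perm (pgu_perm ` carrier PGU))"
    then show "p \<in> perm ` SM"
    proof (induction rule: generate.induct)
      case one
      have "perm id = (\<lambda>L\<in>rational_points. L)" by (simp add: perm_def)
      then show ?case unfolding \<open>\<one>\<^bsub>?S\<^esub> = _\<close> using SM_LI[OF LI_id] by (metis image_eqI)
    next
      case (incl h) then show ?case using sub by blast
    next
      case (inv h)
      then obtain m where m: "m \<in> SM" "h = perm m" using sub by blast
      obtain p where p: "p \<in> SM" "compose rational_points (perm p) (perm m) = (\<lambda>L\<in>rational_points. L)"
        "compose rational_points (perm m) (perm p) = (\<lambda>L\<in>rational_points. L)"
        using perm_SM_inv[OF m(1)] by blast
      have "inv\<^bsub>?S\<^esub> h = perm p"
        by (rule S.inv_equality) (use p m car in \<open>auto simp: mult one\<close>)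
      then show ?case using p by blast
    next
      case (eng h1 h2)
      then obtain m1 m2 where m: "m1 \<in> SM" "m2 \<in> SM" "h1 = perm m1" "h2 = perm m2" by blast
      obtain p where "p \<in> SM" "compose rational_points (perm m2) (perm m1) = perm p"
        using perm_SM_comp[OF m(2,1)] by blast
      then show ?case unfolding mult m by blast
    qed
  qed
  moreover have "perm ` SM \<subseteq> generate ?S (insert frob_perm (pgu_perm ` carrier PGU))"
  proof
    fix p assume "p \<in> perm ` SM"
    then obtain m where m: "m \<in> SM" "p = perm m" by blast
    show "p \<in> generate ?S (insert frob_perm (pgu_perm ` carrier PGU))"
      using m(1)
    proof (cases rule: SM_cases)
      case lin
      then show ?thesis unfolding m pgu_perm_PGU by (intro generate.incl) blast
    next
      case (semi m')
      have "perm m = perm sqv \<otimes>\<^bsub>?S\<^esub> perm m'" unfolding mult perm_comp[OF sqv_SM] semi ..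
      moreover have "perm sqv \<in> generate ?S (insert frob_perm (pgu_perm ` carrier PGU))"
        unfolding frob_perm_eq by (intro generate.incl) blast
      moreover have "perm m' \<in> generate ?S (insert frob_perm (pgu_perm ` carrier PGU))"
        unfolding pgu_perm_PGU using semi by (intro generate.incl) blast
      ultimately show ?thesis unfolding m by (metis generate.eng)
    qed
  qed
  ultimately show ?thesis unfolding eq by blast
qed

text \<open>A plane is spanned by its rational vectors, so the map on planes induced by the
  permutation of points is the image under the semilinear map.\<close>

lemma rho_P_perm: assumes m: "m \<in> SM" shows "rho_P (perm m) = (\<lambda>P\<in>planes. m ` P)"
  unfolding rho_P_def
proof (rule restrict_ext)
  fix P :: "('k^6) set" assume P: "P \<in> planes"
  let ?S = "\<Union>{L. L \<in> rational_points \<and> L \<subseteq> P}"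
  have sub: "vec.subspace P" using P by (simp add: planes_iff)
  have "\<Union>{perm m L |L. L \<in> rational_points \<and> L \<subseteq> P} = m ` ?S"
  proof -
    have "{perm m L |L. L \<in> rational_points \<and> L \<subseteq> P} = (\<lambda>L. m ` L) ` {L. L \<in> rational_points \<and> L \<subseteq> P}"
    proof -
      have "{perm m L |L. L \<in> rational_points \<and> L \<subseteq> P} = perm m ` {L. L \<in> rational_points \<and> L \<subseteq> P}"
        by (rule setcompr_eq_image)
      also have "\<dots> = (\<lambda>L. m ` L) ` {L. L \<in> rational_points \<and> L \<subseteq> P}"
        by (intro image_cong) (simp_all add: perm_apply)
      finally show ?thesis .
    qed
    then show ?thesis by (simp add: image_Union)
  qed
  then have "vec.span (\<Union>{perm m L |L. L \<in> rational_points \<and> L \<subseteq> P}) = m ` vec.span ?S"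
    using SM_span[OF m] by simp
  also have "vec.span ?S = P"
  proof
    show "vec.span ?S \<subseteq> P" by (intro vec.span_minimal sub) auto
    have "v \<in> vec.span ?S" if v: "v \<in> P \<inter> F4v" for v
    proof (cases "v = 0")
      case False
      have "vec.span {v} \<in> rational_points" unfolding rational_points_iff
        using v False plane_isotropic[OF P, of v v] by blast
      moreover have "vec.span {v} \<subseteq> P" using v by (intro vec.span_minimal sub) auto
      ultimately have "v \<in> ?S" using vec.span_base[of v "{v}"] by blast
      then show ?thesis by (rule vec.span_base)
    qed (simp add: vec.span_zero)
    then have "vec.span (P \<inter> F4v) \<subseteq> vec.span ?S" by (intro vec.span_minimal) auto
    then show "P \<subseteq> vec.span ?S" using plane_span_F4v[OF P] by simp
  qed
  finally show "vec.span (\<Union>{perm m L |L. L \<in> rational_points \<and> L \<subseteq> P}) = m ` P" .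
qed

section \<open>Faithfulness on the planes\<close>

lemma span_image_fixed:
  assumes m: "m \<in> SM" and "P \<in> planes" "Q \<in> planes" "m ` P = P" "m ` Q = Q" "P \<inter> Q = vec.span {v}"
  shows "\<exists>c. m v = c *s v"
proof -
  have "m ` (P \<inter> Q) = P \<inter> Q" using image_Int[OF bij_is_inj[OF SM_bij[OF m]], of P Q] assms(4,5) by simp
  moreover have "v \<in> vec.span {v}" by (rule vec.span_base) simp
  ultimately have "m v \<in> vec.span {v}" using assms(6) by blast
  then show ?thesis by (auto simp: vec.span_singleton)
qed

text \<open>Intersections of fixed planes are fixed, so every vector \<open>J s 0\<close> and
  every \<open>J 0 s\<close> is an eigenvector; additivity makes the eigenvalues in each block
  equal. The plane \<open>W (mat 1)\<close>, the diagonal, links the two blocks. A properly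
  semilinear map does not have \<open>J (ax 2 + w *s ax 1) 0\<close> as an eigenvector.\<close>

lemma SM_fix_planes_scalar:
  assumes m: "m \<in> SM" and fx: "\<And>P. P \<in> planes \<Longrightarrow> m ` P = P"
  shows "\<exists>c\<in>F4. c \<noteq> 0 \<and> m = (\<lambda>v. c *s v)"
proof -
  have e1: "\<exists>c. m (J s 0) = J (c *s s) 0" if s: "s \<in> F4v" "s \<noteq> 0" for s
  proof -
    have "W 0 \<inter> Psa s 0 = vec.span {J s 0}" using W_Psa[OF s(2), of 0 0] by (simp add: q_def)
    from span_image_fixed[OF m W_plane[OF Herm_0] Psa_plane[OF s] fx[OF W_plane[OF Herm_0]] fx[OF Psa_plane[OF s]] this]
    show ?thesis by (simp add: J_scale)
  qed
  have e2: "\<exists>c. m (J 0 s) = J 0 (c *s s)" if s: "s \<in> F4v" "s \<noteq> 0" for s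
  proof -
    have p: "swI UNIV ` W 0 \<in> planes" "swI UNIV ` Psa s 0 \<in> planes"
      by (intro LI_plane swI_LI W_plane Herm_0 Psa_plane s; simp)+
    have "swI UNIV ` W 0 \<inter> swI UNIV ` Psa s 0 = swI UNIV ` (W 0 \<inter> Psa s 0)"
      using LI_inj[OF swI_LI] by (simp add: image_Int)
    also have "\<dots> = swI UNIV ` vec.span {J s 0}" using W_Psa[OF s(2), of 0 0] by (simp add: q_def)
    also have "\<dots> = vec.span {J 0 s}"
      using SM_span[OF SM_LI[OF swI_LI[of UNIV]], of "{J s 0}"] by (simp add: swI_UNIV_J)
    finally have "swI UNIV ` W 0 \<inter> swI UNIV ` Psa s 0 = vec.span {J 0 s}" .
    from span_image_fixed[OF m p fx[OF p(1)] fx[OF p(2)] this]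
    show ?thesis by (simp add: J_scale)
  qed
  have uni: "\<exists>c. \<forall>i. f (ax i) = c *s ax i"
    if ad: "\<And>x y. f (x + y) = f x + f y" and sc: "\<And>s. s \<in> F4v \<Longrightarrow> s \<noteq> 0 \<Longrightarrow> \<exists>c. f s = c *s s" for f :: "'k^3 \<Rightarrow> 'k^3"
  proof -
    have nz: "ax i \<noteq> 0" for i by (simp add: axis_eq_0_iff)
    let ?u = "ax 1 + ax 2 + ax 3"
    have "?u \<in> F4v" by (intro F4v_add F4v_axis)
    moreover have "?u \<noteq> 0" by (simp add: vec_eq_iff forall_3 axis_def)
    ultimately obtain c where c: "f ?u = c *s ?u" using sc by blast
    obtain d where d: "\<And>i. f (ax i) = d i *s ax i" using sc[OF F4v_axis nz] by metis
    have "d 1 *s ax 1 + d 2 *s ax 2 + d 3 *s ax 3 = c *s ?u" using c by (simp add: ad d)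
    then have "d 1 = c \<and> d 2 = c \<and> d 3 = c" by (simp add: vec_eq_iff forall_3 axis_def)
    then have "f (ax i) = c *s ax i" for i using d[of i] exhaust_3[of i] by auto
    then show ?thesis by blast
  qed
  have "\<exists>c. \<forall>i. px (m (J (ax i) 0)) = c *s ax i"
  proof (rule uni[of "\<lambda>x. px (m (J x 0))"])
    fix x y show "px (m (J (x + y) 0)) = px (m (J x 0)) + px (m (J y 0))"
      using SM_add[OF m, of "J x 0" "J y 0"] by (simp add: J_add px_lin)
  qed (use e1 in force)
  then obtain c where "\<And>i. px (m (J (ax i) 0)) = c *s ax i" by blast
  moreover have nz: "ax i \<noteq> 0" for i by (simp add: axis_eq_0_iff)
  ultimately have c: "m (J (ax i) 0) = J (c *s ax i) 0" for i
    using e1[OF F4v_axis nz, of i] by (metis px_J)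
  have "\<exists>d. \<forall>i. py (m (J 0 (ax i))) = d *s ax i"
  proof (rule uni[of "\<lambda>x. py (m (J 0 x))"])
    fix x y show "py (m (J 0 (x + y))) = py (m (J 0 x)) + py (m (J 0 y))"
      using SM_add[OF m, of "J 0 x" "J 0 y"] by (simp add: J_add py_lin)
  qed (use e2 in force)
  then obtain d where "\<And>i. py (m (J 0 (ax i))) = d *s ax i" by blast
  then have d: "m (J 0 (ax i)) = J 0 (d *s ax i)" for i
    using e2[OF F4v_axis nz, of i] by (metis py_J)
  have I: "mat 1 \<in> Herm" by (rule HermI) (auto simp: mat_def)
  have "J (ax 1) (ax 1) \<in> W (mat 1)" unfolding W_def by (auto intro!: exI[of _ "ax 1"])
  then have "m (J (ax 1) (ax 1)) \<in> W (mat 1)" using fx[OF W_plane[OF I]] by blast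
  moreover have "m (J (ax 1) (ax 1)) = J (c *s ax 1) (d *s ax 1)"
    using SM_add[OF m, of "J (ax 1) 0" "J 0 (ax 1)"] by (simp add: J_add c d)
  ultimately have "c *s ax 1 = d *s ax 1" by (auto simp: W_def)
  then have cd: "d = c" by (simp add: vec_eq_iff axis_def split: if_splits)
  have cF: "c \<in> F4"
  proof -
    have "c *s ax 1 \<in> F4v" using SM_F4v[OF m, of "J (ax 1) 0"] by (simp add: c F4v_J)
    then have "(c *s ax 1) $ 1 \<in> F4" unfolding F4v_def by blast
    then show ?thesis by (simp add: axis_def)
  qed
  have c0: "c \<noteq> 0"
  proof
    assume "c = 0"
    then have "m (J (ax 1) 0) = 0" by (simp add: c)
    then show False using SM_eq_0[OF m] nz by simp
  qed
  have lin: "m \<in> LI"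
    using m
  proof (cases rule: SM_cases)
    case (semi m')
    have "m (w *s J (ax 1) 0) = w\<^sup>2 *s m (J (ax 1) 0)" using semi by (simp add: sqv_scale LI_scale)
    moreover obtain e where "m (J (ax 2 + w *s ax 1) 0) = J (e *s (ax 2 + w *s ax 1)) 0"
      using e1[of "ax 2 + w *s ax 1"] by (auto simp: vec_eq_iff forall_3 axis_def F4v_def) 
    ultimately have "J (c *s ax 2 + (w\<^sup>2 * c) *s ax 1) 0 = J (e *s (ax 2 + w *s ax 1)) 0"
      using SM_add[OF m, of "J (ax 2) 0" "w *s J (ax 1) 0"] by (simp add: J_add J_scale c)
    then have v: "c *s ax 2 + (w\<^sup>2 * c) *s ax 1 = e *s (ax 2 + w *s ax 1)" by simp
    from arg_cong[OF v, of "\<lambda>v. v $ 2"] have ec: "e = c" by (simp add: axis_def)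
    from arg_cong[OF v, of "\<lambda>v. v $ 1"] have "c * w\<^sup>2 = c * w"
      unfolding ec by (simp add: axis_def mult.commute)
    then have "w\<^sup>2 = w" using c0 by simp
    then show ?thesis by (simp add: w_sq)
  qed
  have "m = Dg (\<chi> i. c)"
  proof (rule LI_eqI[OF lin])
    show "Dg (\<chi> i. c) \<in> LI" using cF c0 by (intro Dg_LI) (auto simp: F4v_def)
  qed (simp_all add: c d cd, simp_all add: vec_eq_iff)
  moreover have "Dg (\<chi> i. c) v = c *s v" for v
  proof -
    have "Dg (\<chi> i. c) v = c *s J (px v) (py v)" unfolding Dg_def J_scale by (simp add: vector_scalar_mult_def)
    then show ?thesis by simp
  qed
  ultimately show ?thesis using cF c0 by auto
qed

section \<open>The projective plane of order four\<close>

definition v3 :: "'k \<Rightarrow> 'k \<Rightarrow> 'k \<Rightarrow> 'k^3" where "v3 a b c = vector [a, b, c]"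

lemma v3_nth [simp]: "v3 a b c $ 1 = a" "v3 a b c $ 2 = b" "v3 a b c $ 3 = c"
  by (simp_all add: v3_def vector_3)

lemma v3_eq [simp]: "v3 a b c = v3 a' b' c' \<longleftrightarrow> a = a' \<and> b = b' \<and> c = c'"
  by (auto simp: vec_eq_iff forall_3)

lemma v3_eta: "v3 (x$1) (x$2) (x$3) = x" by (simp add: vec_eq_iff forall_3)

lemma v3_F4v: "v3 a b c \<in> F4v \<longleftrightarrow> a \<in> F4 \<and> b \<in> F4 \<and> c \<in> F4"
  by (simp add: F4v_def forall_3)

lemma v3_0 [simp]: "v3 a b c = 0 \<longleftrightarrow> a = 0 \<and> b = 0 \<and> c = 0" by (auto simp: vec_eq_iff forall_3)

lemma herm3: "herm x y = x$1 * (y$1)\<^sup>2 + x$2 * (y$2)\<^sup>2 + x$3 * (y$3)\<^sup>2" for x y :: "'k^3"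
  by (simp add: herm_def sum_3)

lemma scale_v3: "d *s v3 a b c = v3 (d * a) (d * b) (d * c)" by (simp add: vec_eq_iff forall_3)

text \<open>Representatives of the 21 points, normalized so that the first nonzero coordinate is
  1.\<close>

definition pts :: "('k^3) set" where
  "pts = {s \<in> F4v. s$1 = 1 \<or> s$1 = 0 \<and> (s$2 = 1 \<or> s$2 = 0 \<and> s$3 = 1)}"

text \<open>Lines are indexed by their polar points.\<close>

definition line :: "'k^3 \<Rightarrow> ('k^3) set" where "line v = {s \<in> pts. herm s v = 0}"

lemma ptsD: "s \<in> pts \<Longrightarrow> s \<in> F4v" "s \<in> pts \<Longrightarrow> s \<noteq> 0" by (auto simp: pts_def)

lemma F4_finite [simp]: "finite (F4 :: 'k set)" by (simp add: F4_eq)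

lemma F4_card: "card (F4 :: 'k set) = 4"
proof -
  have "card (F4 :: 'k set) = card {0, 1, w, w + 1}" by (simp only: F4_eq)
  also have "\<dots> = 4" using w_neq by (subst card_insert_disjoint; simp)+
  finally show ?thesis .
qed

lemma v3_pts: "v3 x y z \<in> pts \<longleftrightarrow> x = 1 \<and> y \<in> F4 \<and> z \<in> F4 \<or> x = 0 \<and> y = 1 \<and> z \<in> F4 \<or> x = 0 \<and> y = 0 \<and> z = 1"
  unfolding pts_def mem_Collect_eq v3_F4v v3_nth by auto

lemma pts_eq: "pts = (\<lambda>(a, b). v3 1 a b) ` (F4 \<times> F4) \<union> (\<lambda>a. v3 0 1 a) ` F4 \<union> {v3 0 0 1}"
proof (rule Set.set_eqI)
  fix s :: "'k^3"
  obtain a b c where s: "s = v3 a b c" by (metis v3_eta)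
  show "s \<in> pts \<longleftrightarrow> s \<in> (\<lambda>(a, b). v3 1 a b) ` (F4 \<times> F4) \<union> (\<lambda>a. v3 0 1 a) ` F4 \<union> {v3 0 0 1}"
    by (auto simp: s pts_def v3_F4v image_iff)
qed

lemma pts_finite [simp]: "finite pts" by (simp add: pts_eq)

lemma line_finite [simp]: "finite (line v)" by (simp add: line_def)

lemma pts_card: "card pts = 21"
proof -
  have "card ((\<lambda>(a, b). v3 1 a b) ` (F4 \<times> F4)) = 16"
    by (subst card_image) (auto simp: inj_on_def card_cartesian_product F4_card)
  moreover have "card ((\<lambda>a. v3 0 1 a) ` F4) = 4" by (subst card_image) (auto simp: inj_on_def F4_card)
  moreover have "card ((\<lambda>(a, b). v3 1 a b) ` (F4 \<times> F4) \<union> (\<lambda>a. v3 0 1 a) ` F4)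
     = card ((\<lambda>(a, b). v3 1 a b) ` (F4 \<times> F4)) + card ((\<lambda>a. v3 0 1 a) ` F4)"
    by (rule card_Un_disjoint) auto
  moreover have "card pts = card ((\<lambda>(a, b). v3 1 a b) ` (F4 \<times> F4) \<union> (\<lambda>a. v3 0 1 a) ` F4) + card {v3 0 0 1}"
    unfolding pts_eq by (rule card_Un_disjoint) auto
  ultimately show ?thesis by simp
qed

lemma pts_proportional: "s \<in> pts \<Longrightarrow> s' \<in> pts \<Longrightarrow> s' = c *s s \<Longrightarrow> s' = s"
  by (auto simp: pts_def vec_eq_iff forall_3)

lemma pts_rep: assumes "s \<in> F4v" "s \<noteq> 0" shows "\<exists>p\<in>pts. \<exists>c\<in>F4. c \<noteq> 0 \<and> s = c *s p"
proof -
  have F: "s$k \<in> F4" for k using assms by (simp add: F4v_def)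
  have A: ?thesis if "s$k \<noteq> 0" "inverse (s$k) *s s \<in> pts" for k
    using that F by (intro bexI[of _ "inverse (s$k) *s s"] bexI[of _ "s$k"]) (auto simp: vector_smult_assoc)
  have I: "inverse (s$k) *s s \<in> F4v" for k using assms F by (intro F4v_scale) auto
  show ?thesis
  proof (cases "s$1 = 0")
    case False then show ?thesis using I by (intro A[of 1]) (auto simp: pts_def)
  next
    case 1: True
    show ?thesis
    proof (cases "s$2 = 0")
      case False then show ?thesis using 1 I by (intro A[of 2]) (auto simp: pts_def)
    next
      case True
      then have "s$3 \<noteq> 0" using 1 assms by (auto simp: vec_eq_iff forall_3)
      then show ?thesis using 1 True I by (intro A[of 3]) (auto simp: pts_def)
    qed
  qed
qed

lemma line_card: assumes v: "v \<in> F4v" "v \<noteq> 0" shows "card (line v) = 5"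
proof -
  obtain a b c where e: "v = v3 a b c" by (metis v3_eta)
  have F: "a \<in> F4" "b \<in> F4" "c \<in> F4" using v by (auto simp: e v3_F4v)
  have card5: "card (f ` F4 \<union> {z}) = 5" if "inj f" "z \<notin> f ` F4" for f :: "'k \<Rightarrow> 'k^3" and z
  proof -
    have "card (f ` F4) = 4" using that(1) by (subst card_image) (auto intro: inj_on_subset simp: F4_card)
    then show ?thesis using that(2) by simp
  qed
  consider "c \<noteq> 0" | "c = 0" "b \<noteq> 0" | "c = 0" "b = 0" "a \<noteq> 0" using v e by auto
  then show ?thesis
  proof cases
    case 1
    have "line v = (\<lambda>t. v3 1 t ((a\<^sup>2 + t * b\<^sup>2) / c\<^sup>2)) ` F4 \<union> {v3 0 1 (b\<^sup>2 / c\<^sup>2)}"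
    proof (rule Set.set_eqI)
      fix s :: "'k^3"
      obtain x y z where s: "s = v3 x y z" by (metis v3_eta)
      have z: "z * c\<^sup>2 + u = 0 \<longleftrightarrow> z = u / c\<^sup>2" for u using 1 by (auto simp: add_eq_0_iff_eq field_simps)
      have 0: "x * a\<^sup>2 + y * b\<^sup>2 + z * c\<^sup>2 = 0 \<longleftrightarrow> z = (x * a\<^sup>2 + y * b\<^sup>2) / c\<^sup>2"
        using z[of "x * a\<^sup>2 + y * b\<^sup>2"] by (simp only: add.commute[of "z * c\<^sup>2"])
      have f: "t \<in> F4 \<Longrightarrow> (a\<^sup>2 + t * b\<^sup>2) / c\<^sup>2 \<in> F4" "b\<^sup>2 / c\<^sup>2 \<in> F4" for t using F by auto
      show "s \<in> line v \<longleftrightarrow> s \<in> (\<lambda>t. v3 1 t ((a\<^sup>2 + t * b\<^sup>2) / c\<^sup>2)) ` F4 \<union> {v3 0 1 (b\<^sup>2 / c\<^sup>2)}"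
      proof -
        have "s \<in> (\<lambda>t. v3 1 t ((a\<^sup>2 + t * b\<^sup>2) / c\<^sup>2)) ` F4 \<longleftrightarrow> x = 1 \<and> y \<in> F4 \<and> z = (a\<^sup>2 + y * b\<^sup>2) / c\<^sup>2"
          unfolding s by (auto simp: image_iff)
        moreover have "s \<in> line v \<longleftrightarrow> s \<in> pts \<and> z = (x * a\<^sup>2 + y * b\<^sup>2) / c\<^sup>2"
          unfolding line_def mem_Collect_eq s e herm3 v3_nth 0 ..
        moreover have "s \<in> pts \<and> z = (x * a\<^sup>2 + y * b\<^sup>2) / c\<^sup>2 \<longleftrightarrow>
            x = 1 \<and> y \<in> F4 \<and> z = (a\<^sup>2 + y * b\<^sup>2) / c\<^sup>2 \<or> x = 0 \<and> y = 1 \<and> z = b\<^sup>2 / c\<^sup>2"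
        proof -
          have "y \<in> F4 \<Longrightarrow> z = (a\<^sup>2 + y * b\<^sup>2) / c\<^sup>2 \<Longrightarrow> z \<in> F4" "z = b\<^sup>2 / c\<^sup>2 \<Longrightarrow> z \<in> F4"
            using f by simp_all
          moreover have "x = 1 \<Longrightarrow> (x * a\<^sup>2 + y * b\<^sup>2) / c\<^sup>2 = (a\<^sup>2 + y * b\<^sup>2) / c\<^sup>2"
            "x = 0 \<Longrightarrow> y = 1 \<Longrightarrow> (x * a\<^sup>2 + y * b\<^sup>2) / c\<^sup>2 = b\<^sup>2 / c\<^sup>2"
            "x = 0 \<Longrightarrow> y = 0 \<Longrightarrow> (x * a\<^sup>2 + y * b\<^sup>2) / c\<^sup>2 = 0" by simp_all
          ultimately show ?thesis unfolding s v3_pts by (metis zero_neq_one)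
        qed
        ultimately show ?thesis unfolding s by auto
      qed
    qed
    then show ?thesis by (simp add: card5 inj_def image_iff del: Un_insert_right)
  next
    case 2
    have "line v = (\<lambda>t. v3 1 (a\<^sup>2 / b\<^sup>2) t) ` F4 \<union> {v3 0 0 1}"
    proof (rule Set.set_eqI)
      fix s :: "'k^3"
      obtain x y z where s: "s = v3 x y z" by (metis v3_eta)
      have 0: "x * a\<^sup>2 + y * b\<^sup>2 + z * c\<^sup>2 = 0 \<longleftrightarrow> y = (x * a\<^sup>2) / b\<^sup>2" using 2 by (auto simp: add_eq_0_iff_eq field_simps)
      have f: "a\<^sup>2 / b\<^sup>2 \<in> F4" using F by auto
      show "s \<in> line v \<longleftrightarrow> s \<in> (\<lambda>t. v3 1 (a\<^sup>2 / b\<^sup>2) t) ` F4 \<union> {v3 0 0 1}"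
      proof -
        have "s \<in> (\<lambda>t. v3 1 (a\<^sup>2 / b\<^sup>2) t) ` F4 \<longleftrightarrow> x = 1 \<and> y = a\<^sup>2 / b\<^sup>2 \<and> z \<in> F4"
          unfolding s by (auto simp: image_iff)
        moreover have "s \<in> line v \<longleftrightarrow> s \<in> pts \<and> y = (x * a\<^sup>2) / b\<^sup>2"
          unfolding line_def mem_Collect_eq s e herm3 v3_nth 0 ..
        moreover have "s \<in> pts \<and> y = (x * a\<^sup>2) / b\<^sup>2 \<longleftrightarrow>
            x = 1 \<and> y = a\<^sup>2 / b\<^sup>2 \<and> z \<in> F4 \<or> x = 0 \<and> y = 0 \<and> z = 1"
        proof -
          have "y = a\<^sup>2 / b\<^sup>2 \<Longrightarrow> y \<in> F4" using f by simp
          moreover have "x = 1 \<Longrightarrow> (x * a\<^sup>2) / b\<^sup>2 = a\<^sup>2 / b\<^sup>2" "x = 0 \<Longrightarrow> (x * a\<^sup>2) / b\<^sup>2 = 0" by simp_all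
          ultimately show ?thesis unfolding s v3_pts by (metis zero_neq_one)
        qed
        ultimately show ?thesis unfolding s by auto
      qed
    qed
    then show ?thesis by (simp add: card5 inj_def image_iff del: Un_insert_right)
  next
    case 3
    have "line v = (\<lambda>t. v3 0 1 t) ` F4 \<union> {v3 0 0 1}"
    proof (rule Set.set_eqI)
      fix s :: "'k^3"
      obtain x y z where s: "s = v3 x y z" by (metis v3_eta)
      show "s \<in> line v \<longleftrightarrow> s \<in> (\<lambda>t. v3 0 1 t) ` F4 \<union> {v3 0 0 1}"
      proof -
        have "s \<in> (\<lambda>t. v3 0 1 t) ` F4 \<longleftrightarrow> x = 0 \<and> y = 1 \<and> z \<in> F4"
          unfolding s by (auto simp: image_iff)
        moreover have "s \<in> line v \<longleftrightarrow> s \<in> pts \<and> x = 0"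
          unfolding line_def mem_Collect_eq s e herm3 v3_nth using 3 by simp
        ultimately show ?thesis unfolding s v3_pts by auto
      qed
    qed
    then show ?thesis by (simp add: card5 inj_def image_iff del: Un_insert_right)
  qed
qed

definition cross :: "'k^3 \<Rightarrow> 'k^3 \<Rightarrow> 'k^3" where
  "cross a b = v3 (a$2 * b$3 + a$3 * b$2) (a$1 * b$3 + a$3 * b$1) (a$1 * b$2 + a$2 * b$1)"

text \<open>The determinant of three vectors in characteristic 2; it vanishes exactly on collinear
  triples of points.\<close>

definition det3 :: "'k^3 \<Rightarrow> 'k^3 \<Rightarrow> 'k^3 \<Rightarrow> 'k" where
  "det3 a b c = cross a b $ 1 * c$1 + cross a b $ 2 * c$2 + cross a b $ 3 * c$3"

lemma herm_sqv3: "y \<in> F4v \<Longrightarrow> herm x (sqv y) = y$1 * x$1 + y$2 * x$2 + y$3 * x$3" for x y :: "'k^3"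
  by (simp add: herm3 sqv_def F4v_def F4_sq_sq mult.commute)

lemma cross_F4v: "a \<in> F4v \<Longrightarrow> b \<in> F4v \<Longrightarrow> cross a b \<in> F4v"
  unfolding cross_def v3_F4v by (auto simp: F4v_def intro!: F4_add F4_mult)

lemma cross_0: assumes "cross a b = 0" "a \<noteq> 0" shows "\<exists>c. b = c *s a"
proof -
  have c: "a$2 * b$3 = a$3 * b$2" "a$1 * b$3 = a$3 * b$1" "a$1 * b$2 = a$2 * b$1"
    using assms(1) by (simp_all add: cross_def add_eq_0_iff_eq)
  consider "a$1 \<noteq> 0" | "a$2 \<noteq> 0" | "a$3 \<noteq> 0" using assms(2) by (auto simp: vec_eq_iff forall_3)
  then show ?thesis
  proof cases
    case 1 with c show ?thesis by (intro exI[of _ "b$1 / a$1"]) (simp add: vec_eq_iff forall_3 field_simps)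
  next
    case 2 with c show ?thesis by (intro exI[of _ "b$2 / a$2"]) (simp add: vec_eq_iff forall_3 field_simps)
  next
    case 3 with c show ?thesis by (intro exI[of _ "b$3 / a$3"]) (simp add: vec_eq_iff forall_3 field_simps)
  qed
qed

lemma det3_cases: "det3 a b c = a$1 * (b$2 * c$3 + b$3 * c$2) + a$2 * (b$1 * c$3 + b$3 * c$1) + a$3 * (b$1 * c$2 + b$2 * c$1)"
  by (simp add: det3_def cross_def algebra_simps)

lemma det3_lin: "det3 (x + y) b c = det3 x b c + det3 y b c" "det3 (t *s x) b c = t * det3 x b c"
  "det3 b (x + y) c = det3 b x c + det3 b y c" "det3 b (t *s x) c = t * det3 b x c"
  "det3 b c (x + y) = det3 b c x + det3 b c y" "det3 b c (t *s x) = t * det3 b c x"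
  by (simp_all add: det3_cases algebra_simps)

lemma det3_eq_0 [simp]: "det3 a a b = 0" "det3 a b a = 0" "det3 b a a = 0"
proof -
  have "det3 a b a = a$1 * a$2 * b$3 + a$1 * a$2 * b$3 + (a$1 * a$3 * b$2 + a$1 * a$3 * b$2) + (a$2 * a$3 * b$1 + a$2 * a$3 * b$1)"
    unfolding det3_cases by (simp only: algebra_simps)
  then show "det3 a b a = 0" by simp
  have "det3 a a b = a$1 * a$2 * b$3 + a$1 * a$2 * b$3 + (a$1 * a$3 * b$2 + a$1 * a$3 * b$2) + (a$2 * a$3 * b$1 + a$2 * a$3 * b$1)"
    unfolding det3_cases by (simp only: algebra_simps)
  then show "det3 a a b = 0" by simp
qed (simp add: det3_cases mult.commute)

lemma det3_perp: assumes "herm a v = 0" "herm b v = 0" "herm c v = 0" "v \<noteq> 0" shows "det3 a b c = 0"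
proof (rule ccontr)
  assume d: "det3 a b c \<noteq> 0"
  define X Y Z where XYZ: "X = (v$1)\<^sup>2" "Y = (v$2)\<^sup>2" "Z = (v$3)\<^sup>2"
  have eq: "a$1 * X = a$2 * Y + a$3 * Z" "b$1 * X = b$2 * Y + b$3 * Z" "c$1 * X = c$2 * Y + c$3 * Z"
    using assms(1-3) by (simp_all add: herm3 XYZ add.assoc add_eq_0_iff_eq)
  have eqY: "a$2 * Y = a$1 * X + a$3 * Z" "b$2 * Y = b$1 * X + b$3 * Z" "c$2 * Y = c$1 * X + c$3 * Z"
    using eq by (simp_all add: add.assoc)
  have eqZ: "a$3 * Z = a$1 * X + a$2 * Y" "b$3 * Z = b$1 * X + b$2 * Y" "c$3 * Z = c$1 * X + c$2 * Y"
    using eq by (simp_all add: add.assoc[symmetric] add.commute)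
  have "det3 a b c * X = 0 \<and> det3 a b c * Y = 0 \<and> det3 a b c * Z = 0"
  proof (intro conjI)
    have "det3 a b c * X = (a$1 * X) * (b$2 * c$3 + b$3 * c$2) + a$2 * ((b$1 * X) * c$3 + b$3 * (c$1 * X)) + a$3 * ((b$1 * X) * c$2 + b$2 * (c$1 * X))"
      by (simp add: det3_cases algebra_simps)
    also have "\<dots> = 0" unfolding eq by (simp add: algebra_simps)
    finally show "det3 a b c * X = 0" .
    have "det3 a b c * Y = a$1 * ((b$2 * Y) * c$3 + b$3 * (c$2 * Y)) + (a$2 * Y) * (b$1 * c$3 + b$3 * c$1) + a$3 * (b$1 * (c$2 * Y) + (b$2 * Y) * c$1)"
      by (simp add: det3_cases algebra_simps)
    also have "\<dots> = 0" unfolding eqY by (simp add: algebra_simps)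
    finally show "det3 a b c * Y = 0" .
    have "det3 a b c * Z = a$1 * (b$2 * (c$3 * Z) + (b$3 * Z) * c$2) + a$2 * (b$1 * (c$3 * Z) + (b$3 * Z) * c$1) + (a$3 * Z) * (b$1 * c$2 + b$2 * c$1)"
      by (simp add: det3_cases algebra_simps)
    also have "\<dots> = 0" unfolding eqZ by (simp add: algebra_simps)
    finally show "det3 a b c * Z = 0" .
  qed
  then have "v = 0" using d by (simp add: XYZ vec_eq_iff forall_3)
  with assms show False by simp
qed

lemma det3_0_imp_perp:
  assumes F: "a \<in> F4v" "b \<in> F4v" and a: "a \<noteq> 0" and n: "\<And>t. b \<noteq> t *s a" and d: "det3 a b c = 0"
  shows "\<exists>v\<in>F4v. v \<noteq> 0 \<and> herm a v = 0 \<and> herm b v = 0 \<and> herm c v = 0"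
proof (intro bexI[of _ "sqv (cross a b)"] conjI)
  have h: "herm x (sqv (cross a b)) = det3 a b x" for x
    using herm_sqv3[OF cross_F4v[OF F], of x] by (simp add: det3_def)
  show "herm a (sqv (cross a b)) = 0" "herm b (sqv (cross a b)) = 0" "herm c (sqv (cross a b)) = 0"
    using d by (simp_all add: h)
  show "sqv (cross a b) \<noteq> 0" using cross_0[OF _ a, of b] n sqv_inj[of "cross a b" 0] by auto
  show "sqv (cross a b) \<in> F4v" by (intro F4v_sqv cross_F4v F)
qed

lemma perp_unique:
  assumes "s \<in> pts" "s' \<in> pts" "s \<noteq> s'" and v: "v \<in> pts" "v' \<in> pts"
    and h: "herm s v = 0" "herm s' v = 0" "herm s v' = 0" "herm s' v' = 0"
  shows "v = v'"
proof (rule ccontr)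
  assume ne: "v \<noteq> v'"
  have pts_not_proportional: "v' \<noteq> c *s v" for c using pts_proportional[OF v, of c] ne by auto
  let ?D = "{y. herm y v = 0 \<and> herm y v' = 0}"
  have "vec.dim ?D = 1" by (rule dim_perp2[OF ptsD(2)[OF v(1)] pts_not_proportional])
  moreover have "vec.dim (vec.span {s}) = 1" using ptsD(2)[OF assms(1)] by simp
  moreover have "vec.subspace ?D" by (auto simp: vec.subspace_def herm_simps)
  moreover have "vec.span {s} \<subseteq> ?D" using h calculation(3) by (intro vec.span_minimal) auto
  ultimately have "vec.span {s} = ?D"
    using vec.subspace_dim_equal[OF vec.subspace_span, of ?D "{s}"] by simp
  then have "s' \<in> vec.span {s}" using h by blast
  then obtain c where "s' = c *s s" by (auto simp: vec.span_singleton)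
  from pts_proportional[OF assms(1,2) this] assms(3) show False by simp
qed

lemma common_line:
  assumes "s \<in> pts" "s' \<in> pts" "s \<noteq> s'"
  shows "\<exists>v\<in>pts. herm s v = 0 \<and> herm s' v = 0"
proof -
  have F: "s \<in> F4v" "s' \<in> F4v" "s \<noteq> 0" using assms ptsD by auto
  have pts_not_proportional: "s' \<noteq> c *s s" for c using pts_proportional[OF assms(1,2), of c] assms(3) by auto
  obtain v where v: "v \<in> F4v" "v \<noteq> 0" "herm s v = 0" "herm s' v = 0"
    using det3_0_imp_perp[OF F pts_not_proportional det3_eq_0(2)] by blast
  obtain p c where p: "p \<in> pts" "c \<noteq> 0" "v = c *s p" using pts_rep[OF v(1,2)] by blast
  have "herm x v = c\<^sup>2 * herm x p" for x unfolding p(3) by (rule herm_scale_right)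
  then show ?thesis using p v by (intro bexI[of _ p]) auto
qed

lemma line_sym: "s \<in> pts \<Longrightarrow> v \<in> pts \<Longrightarrow> s \<in> line v \<longleftrightarrow> v \<in> line s"
  using herm_conj[of s v] ptsD[of s] ptsD[of v] by (auto simp: line_def)

lemma exists_line_avoiding: assumes "p \<in> pts" shows "\<exists>v\<in>pts. p \<notin> line v"
proof -
  have "\<not> pts \<subseteq> line p"
  proof
    assume "pts \<subseteq> line p"
    then have "card pts \<le> card (line p)" by (intro card_mono) auto
    then show False using line_card[OF ptsD[OF assms]] pts_card by simp
  qed
  then obtain v where "v \<in> pts" "v \<notin> line p" by blast
  then show ?thesis using line_sym[OF assms] by blast
qed

text \<open>All lines meet \<open>Z\<close> in 0, 1 or 2 points, and the parity is that of
  \<open>card Z\<close>. If it is odd, no line joins two points of \<open>Z\<close>, and a line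
  that avoids the only point gives a contradiction. If it is even, each of the five lines through
  a point of \<open>Z\<close> contains exactly one other point of \<open>Z\<close>.\<close>

lemma hyperoval_size:
  assumes Z: "Z \<subseteq> pts" and ev: "\<And>v. v \<in> pts \<Longrightarrow> even (card (Z - line v))"
    and le: "\<And>v. v \<in> pts \<Longrightarrow> card (Z \<inter> line v) \<le> 2"
  shows "Z = {} \<or> card Z = 6"
proof (rule disjCI)
  assume "card Z \<noteq> 6"
  show "Z = {}"
  proof (rule ccontr)
    assume "Z \<noteq> {}"
    then obtain p where p: "p \<in> Z" "p \<in> pts" using Z by blast
    have fin: "finite Z" using Z pts_finite by (rule finite_subset)
    have sum: "card Z = card (Z - line v) + card (Z \<inter> line v)" for v
    proof -
      have "card ((Z - line v) \<union> (Z \<inter> line v)) = card (Z - line v) + card (Z \<inter> line v)"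
        using fin by (intro card_Un_disjoint) auto
      moreover have "(Z - line v) \<union> (Z \<inter> line v) = Z" by blast
      ultimately show ?thesis by simp
    qed
    have par: "even (card (Z \<inter> line v)) \<longleftrightarrow> even (card Z)" if "v \<in> pts" for v
      using sum[of v] ev[OF that] by simp
    show False
    proof (cases "even (card Z)")
      case False
      have "Z = {p}"
      proof (rule ccontr)
        assume "Z \<noteq> {p}"
        then obtain x where x: "x \<in> Z" "x \<noteq> p" using p by blast
        obtain v where v: "v \<in> pts" "herm p v = 0" "herm x v = 0"
          using common_line[of p x] x p Z by blast
        have "{p, x} \<subseteq> Z \<inter> line v" using v x p Z by (auto simp: line_def)
        then have "2 \<le> card (Z \<inter> line v)" using card_mono[of "Z \<inter> line v" "{p, x}"] fin x by simp
        then have "card (Z \<inter> line v) = 2" using le[OF v(1)] by simp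
        then show False using par[OF v(1)] False by simp
      qed
      moreover obtain v where v: "v \<in> pts" "p \<notin> line v" using exists_line_avoiding[OF p(2)] by blast
      ultimately have "Z \<inter> line v = {}" by simp
      then show False using par[OF v(1)] False by simp
    next
      case True
      have two: "card (Z \<inter> line v) = 2" if v: "v \<in> line p" for v
      proof -
        have vp: "v \<in> pts" using v by (simp add: line_def)
        then have "p \<in> Z \<inter> line v" using v p line_sym by blast
        then have "card (Z \<inter> line v) \<noteq> 0" using fin by auto
        moreover have "even (card (Z \<inter> line v))" using par[OF vp] True by simp
        ultimately show ?thesis using le[OF vp] by presburger
      qed
      have pl: "p \<in> line v" "v \<in> pts" if "v \<in> line p" for v using that p line_sym by (auto simp: line_def)
      have "Z - {p} = (\<Union>v\<in>line p. Z \<inter> line v - {p})"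
      proof
        show "Z - {p} \<subseteq> (\<Union>v\<in>line p. Z \<inter> line v - {p})"
        proof
          fix x assume x: "x \<in> Z - {p}"
          obtain v where v: "v \<in> pts" "herm p v = 0" "herm x v = 0"
            using common_line[of p x] x p Z by blast
          then have "p \<in> line v" "x \<in> line v" using x p Z by (auto simp: line_def)
          then show "x \<in> (\<Union>v\<in>line p. Z \<inter> line v - {p})" using x v(1) line_sym[OF p(2) v(1)] by blast
        qed
      qed auto
      then have "card (Z - {p}) = card (\<Union>v\<in>line p. Z \<inter> line v - {p})" by simp
      also have "\<dots> = (\<Sum>v\<in>line p. card (Z \<inter> line v - {p}))"
      proof (rule card_UN_disjoint)
        show "\<forall>i\<in>line p. \<forall>j\<in>line p. i \<noteq> j \<longrightarrow> (Z \<inter> line i - {p}) \<inter> (Z \<inter> line j - {p}) = {}"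
        proof (intro ballI impI)
          fix i j assume ij: "i \<in> line p" "j \<in> line p" "i \<noteq> j"
          have "x = p" if "x \<in> Z" "x \<in> line i" "x \<in> line j" for x
          proof (rule ccontr)
            assume ne: "x \<noteq> p"
            have l: "x \<in> pts" "herm x i = 0" "herm x j = 0" using that by (simp_all add: line_def)
            have l2: "herm p i = 0" "herm p j = 0" "i \<in> pts" "j \<in> pts"
              using pl[OF ij(1)] pl[OF ij(2)] by (simp_all add: line_def)
            from perp_unique[OF l(1) p(2) ne l2(3,4) l(2) l2(1) l(3) l2(2)] ij(3) show False by simp
          qed
          then show "(Z \<inter> line i - {p}) \<inter> (Z \<inter> line j - {p}) = {}" by blast
        qed
      qed (use fin in auto)
      also have "\<dots> = (\<Sum>v\<in>line p. 1)"
        using two pl p fin by (intro sum.cong) auto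
      also have "\<dots> = 5" using line_card[OF ptsD[OF p(2)]] by simp
      finally have "card Z = 6" using p fin by simp
      with \<open>card Z \<noteq> 6\<close> show False by simp
    qed
  qed
qed

text \<open>The kernel of \<open>H\<close> has dimension 2, so the form vanishes exactly on the
  kernel, which is the orthogonal space of a nonzero row of \<open>H\<close>.\<close>

lemma rank1_zero_set:
  assumes H: "H \<in> Herm" and d: "vec.dim (W H \<inter> W 0) = 2"
  shows "\<exists>v\<in>F4v. v \<noteq> 0 \<and> (\<forall>s. q H s = 0 \<longrightarrow> herm s v = 0)"
proof -
  let ?K = "{x. x v* H = 0}"
  have K: "vec.subspace ?K"
    by (auto simp: vec.subspace_def vector_matrix_left_distrib scalar_vector_matrix_assoc)
  have dK: "vec.dim ?K = 2" using d unfolding W_W0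
    by (subst (asm) dim_linear_image) (auto simp: J_add J_scale inj_def)
  have "H \<noteq> 0"
  proof
    assume "H = 0"
    then have "?K = UNIV" by simp
    then show False using dK unfolding \<open>?K = UNIV\<close> vec_dim3 by simp
  qed
  then obtain j where j: "H $ j \<noteq> 0" by (auto simp: vec_eq_iff)
  have "herm s (H $ j) = (s v* H) $ j" for s
    by (simp add: herm_def vector_matrix_mult_def HermD[OF H])
  then have ker: "herm s (H $ j) = 0" if "s v* H = 0" for s using that by simp
  have "s v* H = 0" if q0: "q H s = 0" for s
  proof (rule ccontr)
    assume s: "s v* H \<noteq> 0"
    then have sK: "s \<notin> ?K" by simp
    have "vec.dim (insert s ?K) = 3" using sK K dK by (simp add: vec.dim_insert vec.span_eq_iff[THEN iffD2])
    then have "vec.span (insert s ?K) = UNIV"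
      using vec.subspace_dim_equal[OF vec.subspace_span vec.subspace_UNIV, of "insert s ?K"] vec_dim3 by simp
    moreover have "vec.span (insert s ?K) \<subseteq> {y. herm y (s v* H) = 0}"
    proof (intro vec.span_minimal subspace_perp)
      have "herm y (s v* H) = 0" if "y v* H = 0" for y using herm_Herm[OF H, of y s] that by simp
      moreover have "herm s (s v* H) = 0" using herm_Herm[OF H, of s s] q0 by (simp add: q_def)
      ultimately show "insert s ?K \<subseteq> {y. herm y (s v* H) = 0}" by auto
    qed
    ultimately have "herm y (s v* H) = 0" for y by blast
    then have "s v* H = 0" by (rule herm_nondegenerate_right)
    with s show False by simp
  qed
  moreover have "H $ j \<in> F4v" using Herm_F4[OF H] by (simp add: F4v_def)
  ultimately show ?thesis using j ker by blast
qed

text \<open>The fixed points are propagated: the intersection point of two lines joining fixed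
  points is fixed. The four points of the standard frame generate the subplane of order two, and
  one further fixed point generates everything.\<close>

lemma collineation_id:
  assumes P: "\<And>s. s \<in> pts \<Longrightarrow> \<pi> s \<in> pts" and inj: "inj_on \<pi> pts"
    and col: "\<And>a b c. a \<in> pts \<Longrightarrow> b \<in> pts \<Longrightarrow> c \<in> pts \<Longrightarrow> det3 a b c = 0 \<Longrightarrow> det3 (\<pi> a) (\<pi> b) (\<pi> c) = 0"
    and fx: "\<pi> (v3 1 0 0) = v3 1 0 0" "\<pi> (v3 0 1 0) = v3 0 1 0" "\<pi> (v3 0 0 1) = v3 0 0 1"
      "\<pi> (v3 1 1 1) = v3 1 1 1" "\<pi> (v3 1 w 0) = v3 1 w 0"
    and s: "s \<in> pts"
  shows "\<pi> s = s"
proof -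
  have meet: "\<pi> X = Y" if "X \<in> pts" "a \<in> pts" "b \<in> pts" "c \<in> pts" "d \<in> pts"
    "\<pi> a = a" "\<pi> b = b" "\<pi> c = c" "\<pi> d = d" "det3 a b X = 0" "det3 c d X = 0"
    "\<And>x y z. v3 x y z \<in> pts \<Longrightarrow> det3 a b (v3 x y z) = 0 \<Longrightarrow> det3 c d (v3 x y z) = 0 \<Longrightarrow> v3 x y z = Y"
    for X Y a b c d
  proof -
    obtain x y z where e: "\<pi> X = v3 x y z" by (metis v3_eta)
    have "det3 a b (\<pi> X) = 0" "det3 c d (\<pi> X) = 0"
      using col[of a b X] col[of c d X] that by simp_all
    then show ?thesis using that(12)[of x y z] P[OF that(1)] unfolding e by simp
  qed
  have f110: "\<pi> (v3 1 1 0) = v3 1 1 0"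
    by (rule meet[of _ "v3 1 0 0" "v3 0 1 0" "v3 0 0 1" "v3 1 1 1"])
      (auto simp: v3_pts fx det3_cases add_eq_0_iff_eq)
  have f1a0: "\<pi> (v3 1 a 0) = v3 1 a 0" if a: "a \<in> F4" for a
  proof -
    have "\<pi> (v3 1 (w+1) 0) = v3 1 (w+1) 0"
    proof -
      obtain x y z where e: "\<pi> (v3 1 (w+1) 0) = v3 x y z" by (metis v3_eta)
      have p: "v3 1 (w+1) 0 \<in> pts" by (simp add: v3_pts)
      have "det3 (\<pi> (v3 1 0 0)) (\<pi> (v3 0 1 0)) (\<pi> (v3 1 (w+1) 0)) = 0"
        by (rule col) (simp_all add: v3_pts det3_cases)
      then have z: "z = 0" by (simp add: fx e det3_cases)
      have ne: "v3 x y z \<noteq> t" if "t \<in> pts" "\<pi> t = t" "t \<noteq> v3 1 (w+1) 0" for t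
        using inj_onD[OF inj _ p that(1)] e that by metis
      have "v3 x y z \<in> pts" using P[OF p] by (simp add: e)
      moreover have "v3 x y z \<noteq> v3 1 0 0" "v3 x y z \<noteq> v3 0 1 0" "v3 x y z \<noteq> v3 1 1 0" "v3 x y z \<noteq> v3 1 w 0"
        by (rule ne; simp add: v3_pts fx f110)+
      ultimately show ?thesis by (auto simp: e z v3_pts F4_iff)
    qed
    then show ?thesis using a fx f110 by (auto simp: F4_iff)
  qed
  have f011: "\<pi> (v3 0 1 1) = v3 0 1 1"
    by (rule meet[of _ "v3 0 1 0" "v3 0 0 1" "v3 1 0 0" "v3 1 1 1"])
      (auto simp: v3_pts fx det3_cases add_eq_0_iff_eq)
  have f1aa: "\<pi> (v3 1 a a) = v3 1 a a" if a: "a \<in> F4" for a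
    by (rule meet[of _ "v3 1 0 0" "v3 0 1 1" "v3 0 0 1" "v3 1 a 0"])
      (auto simp: v3_pts fx f011 f1a0 a det3_cases add_eq_0_iff_eq)
  have f10a: "\<pi> (v3 1 0 a) = v3 1 0 a" if a: "a \<in> F4" for a
    by (rule meet[of _ "v3 1 0 0" "v3 0 0 1" "v3 0 1 0" "v3 1 a a"])
      (auto simp: v3_pts fx f1aa a det3_cases add_eq_0_iff_eq)
  have f1ab: "\<pi> (v3 1 a b) = v3 1 a b" if a: "a \<in> F4" "b \<in> F4" for a b
    by (rule meet[of _ "v3 0 0 1" "v3 1 a 0" "v3 0 1 0" "v3 1 0 b"])
      (auto simp: v3_pts fx f10a f1a0 a det3_cases add_eq_0_iff_eq)
  have f01a: "\<pi> (v3 0 1 a) = v3 0 1 a" if a: "a \<in> F4" for a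
    by (rule meet[of _ "v3 0 1 0" "v3 0 0 1" "v3 1 0 0" "v3 1 1 a"])
      (auto simp: v3_pts fx f1ab a det3_cases add_eq_0_iff_eq)
  show ?thesis using s f1ab f01a fx unfolding pts_eq by auto
qed

end

section \<open>The vectors of the planes in the Leech lattice\<close>

lemma gc_scaleR_int:
  fixes x :: "'a::real_vector"
  assumes "x \<in> group_closure S" shows "of_int n *\<^sub>R x \<in> group_closure S"
proof (induction n rule: int_induct[of _ 0])
  case base then show ?case by simp
next
  case (step1 i) then show ?case using assms by (simp add: scaleR_add_left group_closure_add)
next
  case (step2 i) then show ?case using assms by (simp add: scaleR_diff_left group_closure.diff)
qed

lemma gc_sum: "(\<And>i. i \<in> I \<Longrightarrow> f i \<in> group_closure S) \<Longrightarrow> sum f I \<in> group_closure S"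
  by (induction I rule: infinite_finite_induct) (auto intro: group_closure_add)

lemma gc_mono_closed:
  assumes "x \<in> group_closure S" "S \<subseteq> D" "0 \<in> D" "\<And>a b. a \<in> D \<Longrightarrow> b \<in> D \<Longrightarrow> a - b \<in> D"
  shows "x \<in> D"
  using assms(1) by (induction rule: group_closure.induct) (use assms in auto)

text \<open>The setting of the theorem, together with the chosen root of unity.\<close>

locale edge = char2_field w
  for w :: "'k::alg_closed_field" +
  fixes \<Lambda> :: "(real ^ 24) set" and A B :: "real ^ 24"
    and \<phi> :: "('k ^ 6) set \<Rightarrow> real ^ 24"
  assumes leech: "leech_lattice \<Lambda>" and edge: "(A, B) \<in> edge_pairs \<Lambda>"
    and corr: "edge_correspondence \<Lambda> A B \<phi>"
begin

lemma L_closed: "0 \<in> \<Lambda>" "x \<in> \<Lambda> \<Longrightarrow> y \<in> \<Lambda> \<Longrightarrow> x - y \<in> \<Lambda>" "x \<in> \<Lambda> \<Longrightarrow> y \<in> \<Lambda> \<Longrightarrow> x + y \<in> \<Lambda>"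
  "x \<in> \<Lambda> \<Longrightarrow> - x \<in> \<Lambda>" "x \<in> \<Lambda> \<Longrightarrow> of_int n *\<^sub>R x \<in> \<Lambda>"
proof -
  obtain E where "\<Lambda> = group_closure E" using leech by (auto simp: leech_lattice_def)
  then show "0 \<in> \<Lambda>" "x \<in> \<Lambda> \<Longrightarrow> y \<in> \<Lambda> \<Longrightarrow> x - y \<in> \<Lambda>" "x \<in> \<Lambda> \<Longrightarrow> y \<in> \<Lambda> \<Longrightarrow> x + y \<in> \<Lambda>"
    "x \<in> \<Lambda> \<Longrightarrow> - x \<in> \<Lambda>" "x \<in> \<Lambda> \<Longrightarrow> of_int n *\<^sub>R x \<in> \<Lambda>"
    by (auto intro: group_closure.diff group_closure_add gc_scaleR_int)
qed

lemma L_dual: "{y. \<forall>x\<in>\<Lambda>. x \<bullet> y \<in> \<int>} = \<Lambda>" using leech by (simp add: leech_lattice_def)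

lemma L_int: "x \<in> \<Lambda> \<Longrightarrow> y \<in> \<Lambda> \<Longrightarrow> x \<bullet> y \<in> \<int>" using L_dual by blast

lemma L_unimodular: "(\<And>x. x \<in> \<Lambda> \<Longrightarrow> x \<bullet> y \<in> \<int>) \<Longrightarrow> y \<in> \<Lambda>" using L_dual by blast

lemma L_even: "x \<in> \<Lambda> \<Longrightarrow> \<exists>n::int. x \<bullet> x = 2 * of_int n" using leech by (simp add: leech_lattice_def)

lemma dist_2_inner: "dist x y = 2 \<Longrightarrow> x \<bullet> x - 2 * (x \<bullet> y) + y \<bullet> y = 4" for x y :: "real ^ 24"
proof -
  assume "dist x y = 2"
  then have "(x - y) \<bullet> (x - y) = 2\<^sup>2" by (metis dist_norm power2_norm_eq_inner)
  then show ?thesis by (simp add: inner_diff_left inner_diff_right inner_commute)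
qed

lemma AB: "A \<in> \<Lambda>" "B \<in> \<Lambda>" using edge by (auto simp: edge_pairs_def)

lemma AB_inner: "A \<bullet> A = 4" "B \<bullet> B = 4" "A \<bullet> B = 2" "B \<bullet> A = 2"
  using edge dist_2_inner[of 0 A] dist_2_inner[of 0 B] dist_2_inner[of A B]
  by (auto simp: edge_pairs_def inner_commute)

lemma T_setD: assumes "T \<in> T_set \<Lambda> A B" shows "T \<in> \<Lambda>" "T \<bullet> T = 4" "T \<bullet> A = 2" "T \<bullet> B = 2"
  using assms dist_2_inner[of 0 T] dist_2_inner[of A T] dist_2_inner[of B T] AB_inner
  by (auto simp: T_set_def inner_commute)

lemma T_setI: assumes "T \<in> \<Lambda>" "T \<bullet> T = 4" "T \<bullet> A = 2" "T \<bullet> B = 2" shows "T \<in> T_set \<Lambda> A B"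
proof -
  have d: "dist x y = 2" if "(x - y) \<bullet> (x - y) = 2\<^sup>2" for x y :: "real ^ 24"
    using that unfolding dist_norm norm_eq_sqrt_inner by simp
  have "dist 0 T = 2" "dist A T = 2" "dist B T = 2"
    by (rule d, simp add: inner_diff_left inner_diff_right inner_commute assms AB_inner
        assms(3)[unfolded inner_commute[of T]] assms(4)[unfolded inner_commute[of T]])+
  then show ?thesis using assms(1) by (simp add: T_set_def)
qed

text \<open>The centre of the triangle, from which all vectors are measured.\<close>

definition G :: "real ^ 24" where "G = (1/3) *\<^sub>R (A + B)"

definition tt :: "('k ^ 6) set \<Rightarrow> real ^ 24" where "tt P = \<phi> P - G"

lemma phi_T: "P \<in> planes \<Longrightarrow> \<phi> P \<in> T_set \<Lambda> A B"
  using corr by (auto simp: edge_correspondence_def bij_betw_def)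

lemma G_inner: "G \<bullet> A = 2" "G \<bullet> B = 2" "G \<bullet> G = 4/3" "A \<bullet> G = 2" "B \<bullet> G = 2"
  by (simp_all add: G_def inner_add_left inner_add_right AB_inner)

lemma tt_perp: "P \<in> planes \<Longrightarrow> tt P \<bullet> A = 0" "P \<in> planes \<Longrightarrow> tt P \<bullet> B = 0"
  using T_setD[OF phi_T] by (simp_all add: tt_def inner_diff_left G_inner)

text \<open>All inner products among these vectors are thus known: \<open>- 1/3\<close>,
  \<open>2/3\<close>, \<open>- 4/3\<close> and \<open>8/3\<close> for intersections of vector
  space dimension 0, 1, 2, 3.\<close>

lemma tt_inner: assumes "P \<in> planes" "Q \<in> planes"
  shows "tt P \<bullet> tt Q = - ((- 2) ^ vec.dim (P \<inter> Q)) / 3"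
proof -
  have "nu_T A (\<phi> P) (\<phi> Q) = nu_P P Q" using corr assms by (simp add: edge_correspondence_def)
  then have "\<phi> P \<bullet> \<phi> Q - 1 = nu_P P Q"
    using nu_T_eq(2)[OF edge phi_T[OF assms(1)] phi_T[OF assms(2)], of "midpoint 0 A"] by simp
  moreover have "\<phi> P \<bullet> G = 4/3" "G \<bullet> \<phi> Q = 4/3"
    using T_setD[OF phi_T[OF assms(1)]] T_setD[OF phi_T[OF assms(2)]]
    by (simp_all add: G_def inner_add_left inner_add_right inner_commute)
  ultimately show ?thesis
    by (simp add: tt_def inner_diff_left inner_diff_right G_inner nu_P_def field_simps)
qed

lemma tt_norm: "P \<in> planes \<Longrightarrow> tt P \<bullet> tt P = 8/3"
  using tt_inner[of P P] by (simp add: planes_iff)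

lemma tt_inj: assumes "P \<in> planes" "Q \<in> planes" "tt P = tt Q" shows "P = Q"
proof -
  have "\<phi> P = \<phi> Q" using assms by (simp add: tt_def)
  then show ?thesis using corr assms by (auto simp: edge_correspondence_def bij_betw_def inj_on_def)
qed

text \<open>Together with the 21 vectors \<open>u s\<close> this gives an orthogonal frame of the
  orthogonal complement of the triangle.\<close>

definition u0 :: "real ^ 24" where "u0 = - (1/8) *\<^sub>R tt Winf"

definition u :: "'k^3 \<Rightarrow> real ^ 24" where "u s = (1/8) *\<^sub>R (tt (Psa s 0) - tt (Psa s 1))"

lemma PsaP: "s \<in> F4v \<Longrightarrow> s \<noteq> 0 \<Longrightarrow> Psa s 0 \<in> planes" "s \<in> F4v \<Longrightarrow> s \<noteq> 0 \<Longrightarrow> Psa s 1 \<in> planes"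
  by (simp_all add: Psa_plane)

lemma tt_Winf_Psa: "s \<in> F4v \<Longrightarrow> s \<noteq> 0 \<Longrightarrow> a = 0 \<or> a = 1 \<Longrightarrow> tt Winf \<bullet> tt (Psa s a) = - 4/3"
  using tt_inner[OF Winf_plane Psa_plane] by (auto simp: dim_Winf_Psa)

lemma tt_Psa_Psa: "s \<in> F4v \<Longrightarrow> s \<noteq> 0 \<Longrightarrow> tt (Psa s 0) \<bullet> tt (Psa s 1) = - 4/3"
  using tt_inner[OF PsaP] by (auto simp: dim_Psa_Psa)

lemma tt_Winf_W: "H \<in> Herm \<Longrightarrow> tt (W H) \<bullet> tt Winf = - 1/3"
  using tt_inner[OF W_plane Winf_plane, of H] by (simp add: Int_commute[of _ Winf] dim_Winf_W)

lemma tt_W_Psa: "H \<in> Herm \<Longrightarrow> s \<in> F4v \<Longrightarrow> s \<noteq> 0 \<Longrightarrow> a = 0 \<or> a = 1 \<Longrightarrow>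
    tt (W H) \<bullet> tt (Psa s a) = (if q H s = a then 2/3 else - 1/3)"
  using tt_inner[OF W_plane Psa_plane, of H s a] by (auto simp: dim_W_Psa)

text \<open>Three planes through a common line have inner products \<open>8/3\<close> on the
  diagonal and \<open>- 4/3\<close> off it, so their sum has norm 0.\<close>

lemma tt_line: assumes s: "s \<in> F4v" "s \<noteq> 0" shows "tt Winf + tt (Psa s 0) + tt (Psa s 1) = 0"
proof -
  have "(tt Winf + tt (Psa s 0) + tt (Psa s 1)) \<bullet> (tt Winf + tt (Psa s 0) + tt (Psa s 1)) = 0"
    using tt_norm[OF Winf_plane] tt_norm[OF PsaP(1)[OF s]] tt_norm[OF PsaP(2)[OF s]]
      tt_Winf_Psa[OF s, of 0] tt_Winf_Psa[OF s, of 1] tt_Psa_Psa[OF s]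
    by (simp add: inner_add_left inner_add_right inner_commute)
  then show ?thesis by simp
qed

lemma tt_Winf: "tt Winf = - 8 *\<^sub>R u0" by (simp add: u0_def)

lemma tt_Psa: assumes s: "s \<in> F4v" "s \<noteq> 0"
  shows "tt (Psa s 0) = 4 *\<^sub>R u0 + 4 *\<^sub>R u s" "tt (Psa s 1) = 4 *\<^sub>R u0 - 4 *\<^sub>R u s"
proof -
  have e: "tt Winf = - tt (Psa s 0) - tt (Psa s 1)" using tt_line[OF s] by (simp add: algebra_simps eq_neg_iff_add_eq_0)
  have 4: "4 *\<^sub>R u0 = (1/2) *\<^sub>R tt (Psa s 0) + (1/2) *\<^sub>R tt (Psa s 1)"
    unfolding u0_def e by (simp add: algebra_simps)
  have 5: "4 *\<^sub>R u s = (1/2) *\<^sub>R tt (Psa s 0) - (1/2) *\<^sub>R tt (Psa s 1)"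
    unfolding u_def by (simp add: algebra_simps)
  have h: "(1/2) *\<^sub>R x + (1/2) *\<^sub>R x = x" for x :: "real^24" by (simp flip: scaleR_add_left)
  show "tt (Psa s 0) = 4 *\<^sub>R u0 + 4 *\<^sub>R u s" "tt (Psa s 1) = 4 *\<^sub>R u0 - 4 *\<^sub>R u s"
    unfolding 4 5 using h[of "tt (Psa s 0)"] h[of "tt (Psa s 1)"] by (simp_all add: algebra_simps)
qed

lemma u0_u0: "u0 \<bullet> u0 = 1/24" using tt_norm[OF Winf_plane] by (simp add: u0_def)

lemma u0_u: "s \<in> F4v \<Longrightarrow> s \<noteq> 0 \<Longrightarrow> u0 \<bullet> u s = 0"
  using tt_Winf_Psa[of s 0] tt_Winf_Psa[of s 1] by (simp add: u0_def u_def inner_diff_right)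

lemma u_u: "s \<in> F4v \<Longrightarrow> s \<noteq> 0 \<Longrightarrow> u s \<bullet> u s = 1/8"
  using tt_Psa_Psa[of s] tt_norm[OF PsaP(1), of s] tt_norm[OF PsaP(2), of s]
  by (simp add: u_def inner_diff_right inner_diff_left inner_commute)

lemma u_u': assumes "s \<in> pts" "s' \<in> pts" "s \<noteq> s'" shows "u s \<bullet> u s' = 0"
proof -
  have pts_not_proportional: "s' \<noteq> c *s s" for c using pts_proportional[OF assms(1,2), of c] assms(3) by auto
  have z: "tt (Psa s a) \<bullet> tt (Psa s' b) = 2/3" if "a = 0 \<or> a = 1" "b = 0 \<or> b = 1" for a b
    using tt_inner[OF Psa_plane Psa_plane, of s a s' b] ptsD assms that
    by (simp add: dim_Psa_Psa'[OF _ _ pts_not_proportional])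
  show ?thesis using z[of 0 0] z[of 0 1] z[of 1 0] z[of 1 1]
    by (simp add: u_def inner_diff_right inner_diff_left)
qed

lemma u0_perp: "u0 \<bullet> A = 0" "u0 \<bullet> B = 0" using tt_perp[OF Winf_plane] by (simp_all add: u0_def)

lemma u_perp: "s \<in> F4v \<Longrightarrow> s \<noteq> 0 \<Longrightarrow> u s \<bullet> A = 0" "s \<in> F4v \<Longrightarrow> s \<noteq> 0 \<Longrightarrow> u s \<bullet> B = 0"
  using tt_perp[OF PsaP(1)] tt_perp[OF PsaP(2)] by (simp_all add: u_def inner_diff_left)

text \<open>The 24 vectors are nonzero and pairwise orthogonal. The vector \<open>B - A/2\<close>
  is the component of \<open>B\<close> orthogonal to \<open>A\<close>.\<close>

lemma frame_span: "span (insert u0 (u ` pts) \<union> {A, B - (1/2) *\<^sub>R A}) = UNIV"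
proof -
  let ?C = "B - (1/2) *\<^sub>R A" let ?S = "insert u0 (u ` pts) \<union> {A, ?C}"
  have C: "?C \<bullet> ?C = 3" "A \<bullet> ?C = 0" "?C \<bullet> A = 0"
    by (simp_all add: inner_diff_left inner_diff_right AB_inner)
  have uC: "u0 \<bullet> ?C = 0" "\<And>s. s \<in> pts \<Longrightarrow> u s \<bullet> ?C = 0"
    using u0_perp u_perp ptsD by (simp_all add: inner_diff_right)
  have nz: "0 \<notin> ?S"
  proof -
    have "u0 \<noteq> 0" using u0_u0 by auto
    moreover have "u s \<noteq> 0" if "s \<in> pts" for s using u_u[OF ptsD[OF that]] by auto
    moreover have "A \<noteq> 0" using AB_inner(1) by auto
    moreover have "?C \<noteq> 0" using C(1) by (metis inner_zero_left zero_neq_numeral)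
    ultimately show ?thesis by (auto simp del: right_minus_eq)
  qed
  have orth: "pairwise orthogonal ?S"
    unfolding pairwise_def orthogonal_def
    using C uC u0_perp u_perp ptsD u0_u u_u' by (auto simp: inner_commute) (metis u_u')+
  have inj: "inj_on u pts"
    by (rule inj_onI) (metis ptsD u_u u_u' zero_neq_one divide_eq_0_iff zero_neq_numeral)
  have c1: "card (u ` pts) = 21" using card_image[OF inj] pts_card by simp
  have n1: "u0 \<notin> u ` pts" using u0_u u0_u0 ptsD by auto
  have n2: "A \<notin> insert u0 (u ` pts)" "?C \<notin> insert A (insert u0 (u ` pts))"
  proof -
    have zA: "z \<bullet> A = 0" "z \<bullet> ?C = 0" if "z \<in> insert u0 (u ` pts)" for z
      using that u0_perp u_perp ptsD uC by auto
    show "A \<notin> insert u0 (u ` pts)" using zA(1)[of A] AB_inner(1) by (metis zero_neq_numeral)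
    moreover have "?C \<noteq> A" using C(3) AB_inner(1) by (metis zero_neq_numeral)
    moreover have "?C \<notin> insert u0 (u ` pts)" using zA(2)[of ?C] C(1) by (metis zero_neq_numeral)
    ultimately show "?C \<notin> insert A (insert u0 (u ` pts))" by blast
  qed
  have "card ?S = 24"
  proof -
    have "?S = insert ?C (insert A (insert u0 (u ` pts)))" by auto
    then show ?thesis using n1 n2 c1 by (simp only: card_insert_disjoint finite_insert finite_imageI pts_finite) simp
  qed
  moreover have "independent ?S" using pairwise_orthogonal_independent[OF orth nz] .
  ultimately show ?thesis
    using card_ge_dim_independent[of ?S UNIV] by auto
qed

lemma perp_frame_0:
  assumes "x \<bullet> A = 0" "x \<bullet> B = 0" "x \<bullet> u0 = 0" "\<And>s. s \<in> pts \<Longrightarrow> x \<bullet> u s = 0"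
  shows "x = 0"
proof -
  have "orthogonal x y" if "y \<in> insert u0 (u ` pts) \<union> {A, B - (1/2) *\<^sub>R A}" for y
    using that assms by (auto simp: orthogonal_def inner_diff_right)
  then have "orthogonal x y" if "y \<in> span (insert u0 (u ` pts) \<union> {A, B - (1/2) *\<^sub>R A})" for y
    using orthogonal_to_span that by blast
  then have "orthogonal x x" unfolding frame_span by blast
  then show ?thesis by (simp add: orthogonal_def)
qed

lemma sum_u_inner: assumes "s \<in> pts" shows "(\<Sum>t\<in>pts. f t *\<^sub>R u t) \<bullet> u s = f s / 8"
proof -
  have "(\<Sum>t\<in>pts. f t *\<^sub>R u t) \<bullet> u s = (\<Sum>t\<in>pts. if t = s then f s / 8 else 0)"
    unfolding inner_sum_left by (intro sum.cong) (use assms u_u u_u' ptsD in auto)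
  then show ?thesis using assms by simp
qed

lemma expansion:
  assumes "x \<bullet> A = 0" "x \<bullet> B = 0"
  shows "x = (24 * (x \<bullet> u0)) *\<^sub>R u0 + (\<Sum>s\<in>pts. (8 * (x \<bullet> u s)) *\<^sub>R u s)"
proof -
  let ?y = "(24 * (x \<bullet> u0)) *\<^sub>R u0 + (\<Sum>s\<in>pts. (8 * (x \<bullet> u s)) *\<^sub>R u s)"
  have "(\<Sum>s\<in>pts. (8 * (x \<bullet> u s)) *\<^sub>R u s) \<bullet> v = 0" if "\<And>s. s \<in> pts \<Longrightarrow> u s \<bullet> v = 0" for v
    using that by (simp add: inner_sum_left)
  then have z: "(\<Sum>s\<in>pts. (8 * (x \<bullet> u s)) *\<^sub>R u s) \<bullet> v = 0" if "v = A \<or> v = B \<or> v = u0" for v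
    using that u_perp u0_u ptsD by (auto simp: inner_commute)
  have "x - ?y = 0"
  proof (rule perp_frame_0)
    show "(x - ?y) \<bullet> A = 0" "(x - ?y) \<bullet> B = 0" "(x - ?y) \<bullet> u0 = 0"
      using assms z by (simp_all add: inner_diff_left inner_add_left u0_perp u0_u0)
    show "(x - ?y) \<bullet> u s = 0" if "s \<in> pts" for s
      using that sum_u_inner[OF that, of "\<lambda>s. 8 * (x \<bullet> u s)"] u0_u[of s] ptsD
      by (simp add: inner_diff_left inner_add_left)
  qed
  then show ?thesis by simp
qed

lemma inner_expansion:
  assumes "x \<bullet> A = 0" "x \<bullet> B = 0"
  shows "x \<bullet> y = 24 * (x \<bullet> u0) * (y \<bullet> u0) + (\<Sum>s\<in>pts. 8 * (x \<bullet> u s) * (y \<bullet> u s))"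
  by (subst expansion[OF assms]) (simp add: inner_add_left inner_sum_left inner_commute[of y] mult_ac)

text \<open>The sign with which \<open>u s\<close> enters the vector of the plane \<open>W
  H\<close>.\<close>

definition sg :: "'k^3^3 \<Rightarrow> 'k^3 \<Rightarrow> real" where "sg H s = (if q H s = 0 then 1 else - 1)"

lemma tt_W_u0: "H \<in> Herm \<Longrightarrow> tt (W H) \<bullet> u0 = 1/24"
  using tt_Winf_W[of H] by (simp add: u0_def)

lemma tt_W_u: "H \<in> Herm \<Longrightarrow> s \<in> F4v \<Longrightarrow> s \<noteq> 0 \<Longrightarrow> tt (W H) \<bullet> u s = sg H s / 8"
  using q_F2[of s H] tt_W_Psa[of H s 0] tt_W_Psa[of H s 1]
  by (auto simp: u_def inner_diff_right sg_def)

abbreviation "L \<equiv> R_perp \<Lambda> A B"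

abbreviation "M \<equiv> Lambda_AB \<Lambda> A B"

section \<open>The lattice generated by the planes\<close>

lemma L_iff: "x \<in> L \<longleftrightarrow> x \<in> \<Lambda> \<and> x \<bullet> A = 0 \<and> x \<bullet> B = 0"
proof
  assume "x \<in> L"
  moreover have "A \<in> R_AB A B" "B \<in> R_AB A B" unfolding R_AB_def by (auto intro: group_closure.base)
  ultimately show "x \<in> \<Lambda> \<and> x \<bullet> A = 0 \<and> x \<bullet> B = 0" by (auto simp: R_perp_def)
next
  assume x: "x \<in> \<Lambda> \<and> x \<bullet> A = 0 \<and> x \<bullet> B = 0"
  have "r \<in> {r. x \<bullet> r = 0}" if "r \<in> R_AB A B" for r
    using that unfolding R_AB_def by (rule gc_mono_closed) (use x in \<open>auto simp: inner_diff_right\<close>)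
  then show "x \<in> L" using x by (auto simp: R_perp_def)
qed

lemma Lp_closed: "0 \<in> L" "x \<in> L \<Longrightarrow> y \<in> L \<Longrightarrow> x - y \<in> L" "x \<in> L \<Longrightarrow> y \<in> L \<Longrightarrow> x + y \<in> L" "x \<in> L \<Longrightarrow> of_int n *\<^sub>R x \<in> L"
  using L_closed by (auto simp: L_iff inner_diff_left inner_add_left)

lemma M_closed: "0 \<in> M" "x \<in> M \<Longrightarrow> y \<in> M \<Longrightarrow> x - y \<in> M" "x \<in> M \<Longrightarrow> y \<in> M \<Longrightarrow> x + y \<in> M" "x \<in> M \<Longrightarrow> of_int n *\<^sub>R x \<in> M"
  unfolding Lambda_AB_def by (auto intro: group_closure.diff group_closure_add gc_scaleR_int)

text \<open>All vectors of \<open>T_set\<close> have the same inner products with \<open>A\<close>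
  and \<open>B\<close>.\<close>

lemma M_sub_L: "M \<subseteq> L"
proof
  fix x assume "x \<in> M"
  then show "x \<in> L" unfolding Lambda_AB_def
    by (rule gc_mono_closed) (auto simp: L_iff inner_diff_left T_setD L_closed)
qed

lemma M_tt_diff: "P \<in> planes \<Longrightarrow> Q \<in> planes \<Longrightarrow> tt P - tt Q \<in> M"
  unfolding Lambda_AB_def tt_def using phi_T by (auto intro!: group_closure.base)

text \<open>The three planes on the right are those through a common line; their vectors add up to
  0.\<close>

lemma tt_triple: assumes s: "s \<in> F4v" "s \<noteq> 0"
  shows "(tt P - tt Winf) + (tt P - tt (Psa s 0)) + (tt P - tt (Psa s 1)) = 3 *\<^sub>R tt P"
proof -
  have "(tt P - tt Winf) + (tt P - tt (Psa s 0)) + (tt P - tt (Psa s 1))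
     = (tt P + tt P + tt P) - (tt Winf + tt (Psa s 0) + tt (Psa s 1))"
    by (simp add: algebra_simps)
  moreover have "tt P + tt P + tt P = 3 *\<^sub>R tt P" using scaleR_add_left[of 2 1 "tt P"] scaleR_2[of "tt P"] by simp
  ultimately show ?thesis using tt_line[OF s] by simp
qed

text \<open>The planes with explicit coordinates; they already generate the lattice.\<close>

definition frame_planes :: "('k^6) set set" where
  "frame_planes = insert Winf (W ` Herm \<union> {Psa s a |s a. s \<in> pts \<and> (a = 0 \<or> a = 1)})"

definition frame_lattice :: "(real ^ 24) set" where
  "frame_lattice = group_closure {tt P - tt Q |P Q. P \<in> frame_planes \<and> Q \<in> frame_planes}"

lemma frame_planesI: "Winf \<in> frame_planes" "H \<in> Herm \<Longrightarrow> W H \<in> frame_planes"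
  "s \<in> pts \<Longrightarrow> Psa s 0 \<in> frame_planes" "s \<in> pts \<Longrightarrow> Psa s 1 \<in> frame_planes"
  unfolding frame_planes_def by blast+

lemma frame_planes_sub: "frame_planes \<subseteq> planes"
  unfolding frame_planes_def using Winf_plane W_plane Psa_plane ptsD by blast

lemma frame_lattice_closed: "0 \<in> frame_lattice" "x \<in> frame_lattice \<Longrightarrow> y \<in> frame_lattice \<Longrightarrow> x - y \<in> frame_lattice" "x \<in> frame_lattice \<Longrightarrow> y \<in> frame_lattice \<Longrightarrow> x + y \<in> frame_lattice"
  "x \<in> frame_lattice \<Longrightarrow> of_int n *\<^sub>R x \<in> frame_lattice"
  unfolding frame_lattice_def by (auto intro: group_closure.diff group_closure_add gc_scaleR_int)

lemma frame_lattice_sub_M: "frame_lattice \<subseteq> M"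
proof
  fix x assume "x \<in> frame_lattice"
  then show "x \<in> M" unfolding frame_lattice_def
    by (rule gc_mono_closed) (use frame_planes_sub in \<open>auto intro: M_closed M_tt_diff\<close>)
qed

lemma frame_lattice_tt_diff: "P \<in> frame_planes \<Longrightarrow> Q \<in> frame_planes \<Longrightarrow> tt P - tt Q \<in> frame_lattice"
  unfolding frame_lattice_def by (auto intro!: group_closure.base)

lemma frame_lattice_3tt: assumes P: "P \<in> frame_planes" shows "3 *\<^sub>R tt P \<in> frame_lattice"
proof -
  have s: "ax 1 \<in> F4v" "ax 1 \<noteq> 0" "ax 1 \<in> pts" by (simp_all add: axis_eq_0_iff pts_def)
  have "(tt P - tt Winf) + (tt P - tt (Psa (ax 1) 0)) + (tt P - tt (Psa (ax 1) 1)) \<in> frame_lattice"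
    by (intro frame_lattice_closed frame_lattice_tt_diff P frame_planesI s)
  then show ?thesis by (simp only: tt_triple[OF s(1,2)])
qed

lemma M_3tt: assumes P: "P \<in> planes" shows "3 *\<^sub>R tt P \<in> M"
proof -
  have s: "ax 1 \<in> F4v" "ax 1 \<noteq> 0" by (simp_all add: axis_eq_0_iff)
  have "(tt P - tt Winf) + (tt P - tt (Psa (ax 1) 0)) + (tt P - tt (Psa (ax 1) 1)) \<in> M"
    by (intro M_closed M_tt_diff P Winf_plane PsaP s)
  then show ?thesis by (simp only: tt_triple[OF s])
qed

lemma L_tt_int: assumes "x \<in> L" "P \<in> planes" shows "x \<bullet> tt P \<in> \<int>"
proof -
  have "x \<bullet> tt P = x \<bullet> \<phi> P" using assms(1) by (simp add: tt_def inner_diff_right G_def inner_add_right L_iff)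
  then show ?thesis using L_int assms T_setD(1)[OF phi_T[OF assms(2)]] L_iff by metis
qed

text \<open>\<open>coord0\<close> and \<open>coord\<close> are the coordinates of a lattice vector in the
  frame, scaled to be integers.\<close>

definition coord0 :: "real ^ 24 \<Rightarrow> int" where "coord0 x = \<lfloor>8 * (x \<bullet> u0)\<rfloor>"

definition coord :: "real ^ 24 \<Rightarrow> 'k^3 \<Rightarrow> int" where "coord x s = \<lfloor>8 * (x \<bullet> u s)\<rfloor>"

lemma coord0: assumes "x \<in> L" shows "real_of_int (coord0 x) = 8 * (x \<bullet> u0)"
proof -
  have "8 * (x \<bullet> u0) = - (x \<bullet> tt Winf)" by (simp add: tt_Winf)
  then have "8 * (x \<bullet> u0) \<in> \<int>" using L_tt_int[OF assms Winf_plane] by simp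
  then show ?thesis unfolding coord0_def by (simp add: of_int_floor)
qed

lemma coord: assumes "x \<in> L" "s \<in> pts" shows "real_of_int (coord x s) = 8 * (x \<bullet> u s)"
proof -
  have "8 * (x \<bullet> u s) = x \<bullet> tt (Psa s 0) - x \<bullet> tt (Psa s 1)" by (simp add: u_def inner_diff_right)
  then have "8 * (x \<bullet> u s) \<in> \<int>" using L_tt_int[OF assms(1) PsaP(1)] L_tt_int[OF assms(1) PsaP(2)] ptsD[OF assms(2)] by simp
  then show ?thesis unfolding coord_def by (simp add: of_int_floor)
qed

text \<open>Integrality of the inner product with \<open>Psa s 0\<close>.\<close>

lemma parity: assumes "x \<in> L" "s \<in> pts" shows "even (coord0 x + coord x s)"
proof -
  have "x \<bullet> tt (Psa s 0) \<in> \<int>" using L_tt_int[OF assms(1) PsaP(1)] ptsD[OF assms(2)] by simp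
  then obtain n where n: "x \<bullet> tt (Psa s 0) = real_of_int n" by (auto elim: Ints_cases)
  have "2 * (x \<bullet> tt (Psa s 0)) = real_of_int (coord0 x) + real_of_int (coord x s)"
    using tt_Psa(1)[OF ptsD[OF assms(2)]] by (simp add: coord0[OF assms(1)] coord[OF assms] inner_add_right)
  then have "real_of_int (coord0 x + coord x s) = real_of_int (2 * n)" by (simp add: n)
  then have "coord0 x + coord x s = 2 * n" by (simp only: of_int_eq_iff)
  then show ?thesis by simp
qed

lemma coord0_diff: "x \<in> L \<Longrightarrow> y \<in> L \<Longrightarrow> coord0 (x - y) = coord0 x - coord0 y"
proof -
  assume "x \<in> L" "y \<in> L"
  then have "real_of_int (coord0 (x - y)) = real_of_int (coord0 x - coord0 y)" by (simp add: coord0 Lp_closed inner_diff_left)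
  then show ?thesis by (simp only: of_int_eq_iff)
qed

lemma coord_diff: "x \<in> L \<Longrightarrow> y \<in> L \<Longrightarrow> s \<in> pts \<Longrightarrow> coord (x - y) s = coord x s - coord y s"
proof -
  assume "x \<in> L" "y \<in> L" "s \<in> pts"
  then have "real_of_int (coord (x - y) s) = real_of_int (coord x s - coord y s)" by (simp add: coord Lp_closed inner_diff_left)
  then show ?thesis by (simp only: of_int_eq_iff)
qed

lemma sg_0: "sg 0 s = 1" by (simp add: sg_def q_def)

lemma frame_lattice_sub_L: "frame_lattice \<subseteq> L" using frame_lattice_sub_M M_sub_L by blast

text \<open>A vector attached to the line polar to \<open>v\<close>: its coordinates are 2 modulo
  4 on the line and 0 modulo 4 elsewhere.\<close>

definition lam :: "'k^3 \<Rightarrow> real ^ 24" where "lam v = 6 *\<^sub>R tt (W 0) - (tt (W 0) - tt (W (R1 v)))"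

lemma lam_frame_lattice: "v \<in> pts \<Longrightarrow> lam v \<in> frame_lattice"
proof -
  assume v: "v \<in> pts"
  have "of_int 2 *\<^sub>R (3 *\<^sub>R tt (W 0)) \<in> frame_lattice" by (intro frame_lattice_closed frame_lattice_3tt frame_planesI Herm_0)
  then have "6 *\<^sub>R tt (W 0) \<in> frame_lattice" by simp
  then show ?thesis unfolding lam_def by (intro frame_lattice_closed frame_lattice_tt_diff frame_planesI Herm_0 R1_Herm ptsD v)
qed

lemma coord0_lam: "v \<in> pts \<Longrightarrow> coord0 (lam v) = 2"
proof -
  assume v: "v \<in> pts"
  have "real_of_int (coord0 (lam v)) = 2"
    using coord0[of "lam v"] lam_frame_lattice[OF v] frame_lattice_sub_L tt_W_u0[OF Herm_0] tt_W_u0[OF R1_Herm[OF ptsD(1)[OF v]]]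
    by (auto simp: lam_def inner_diff_left)
  then show ?thesis by simp
qed

lemma coord_lam: assumes "v \<in> pts" "s \<in> pts" shows "coord (lam v) s = (if s \<in> line v then 6 else 4)"
proof -
  have "real_of_int (coord (lam v) s) = 8 * (lam v \<bullet> u s)" using coord lam_frame_lattice frame_lattice_sub_L assms by blast
  also have "\<dots> = 5 + sg (R1 v) s"
    using tt_W_u[OF Herm_0 ptsD[OF assms(2)]] tt_W_u[OF R1_Herm[OF ptsD(1)[OF assms(1)]] ptsD[OF assms(2)]]
    by (simp add: lam_def inner_diff_left sg_0)
  also have "\<dots> = (if s \<in> line v then 6 else 4)"
    using assms by (simp add: sg_def q_R1 ptsD line_def)
  finally show ?thesis by (simp split: if_splits)
qed

text \<open>Integrality of the inner product with \<open>W 0 - W H\<close>.\<close>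

lemma sum_q: assumes x: "x \<in> L" "even (coord0 x)" and H: "H \<in> Herm"
  shows "even (\<Sum>s\<in>{s\<in>pts. q H s \<noteq> 0}. coord x s div 2)"
proof -
  have "tt (W 0) - tt (W H) \<in> M" by (intro M_tt_diff W_plane H Herm_0)
  then have "x \<bullet> (tt (W 0) - tt (W H)) \<in> \<int>"
    using L_int x M_sub_L by (auto simp: L_iff)
  then obtain n where n: "x \<bullet> (tt (W 0) - tt (W H)) = real_of_int n" by (auto elim: Ints_cases)
  have "x \<bullet> (tt (W 0) - tt (W H)) = (\<Sum>s\<in>pts. 8 * (x \<bullet> u s) * ((1 - sg H s) / 8))"
    using inner_expansion[of x "tt (W 0) - tt (W H)"] x H
    by (simp add: L_iff inner_diff_left tt_W_u0 tt_W_u ptsD sg_0 diff_divide_distrib)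
  also have "\<dots> = (\<Sum>s\<in>pts. if q H s \<noteq> 0 then real_of_int (coord x s div 2) / 2 else 0)"
  proof (rule sum.cong)
    fix s assume s: "s \<in> pts"
    have "coord x s = 2 * (coord x s div 2)" using parity[OF x(1) s] x(2) by simp
    then have "real_of_int (coord x s) = 2 * real_of_int (coord x s div 2)" by (metis of_int_mult of_int_numeral)
    then show "8 * (x \<bullet> u s) * ((1 - sg H s) / 8) = (if q H s \<noteq> 0 then real_of_int (coord x s div 2) / 2 else 0)"
      using coord[OF x(1) s] by (simp add: sg_def)
  qed simp
  also have "\<dots> = (\<Sum>s\<in>{s\<in>pts. q H s \<noteq> 0}. real_of_int (coord x s div 2) / 2)"
    by (rule sum.mono_neutral_cong_right) auto
  also have "\<dots> = real_of_int (\<Sum>s\<in>{s\<in>pts. q H s \<noteq> 0}. coord x s div 2) / 2"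
    by (simp add: sum_divide_distrib)
  finally have "real_of_int (\<Sum>s\<in>{s\<in>pts. q H s \<noteq> 0}. coord x s div 2) = real_of_int (2 * n)" using n by simp
  then show ?thesis by (simp only: of_int_eq_iff dvd_triv_left)
qed

text \<open>The coordinates of a vector with \<open>coord0\<close> even are even; this is the set of
  points at which they are 2 modulo 4.\<close>

definition odd_points :: "real ^ 24 \<Rightarrow> ('k^3) set" where "odd_points x = {s \<in> pts. odd (coord x s div 2)}"

lemma odd_points_sub: "odd_points x \<subseteq> pts" "finite (odd_points x)" by (auto simp: odd_points_def)

text \<open>The case of rank one matrices in \<open>sum_q\<close>: the form of \<open>R1 v\<close>
  is nonzero exactly off the line of \<open>v\<close>.\<close>

lemma odd_points_even: assumes x: "x \<in> L" "even (coord0 x)" and v: "v \<in> pts" shows "even (card (odd_points x - line v))"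
proof -
  have "{s \<in> pts. q (R1 v) s \<noteq> 0} = pts - line v"
    using v by (auto simp: q_R1 ptsD line_def)
  then have "even (\<Sum>s\<in>pts - line v. coord x s div 2)" using sum_q[OF x R1_Herm[OF ptsD(1)[OF v]]] by simp
  then have "even (card {s \<in> pts - line v. odd (coord x s div 2)})" by (subst (asm) even_sum_iff) auto
  moreover have "{s \<in> pts - line v. odd (coord x s div 2)} = odd_points x - line v" by (auto simp: odd_points_def)
  ultimately show ?thesis by simp
qed

lemma sq_mod4: "(z::int) ^ 2 mod 4 = (if odd z then 1 else 0)"
proof (cases "even z")
  case True then obtain k where "z = 2 * k" by blast
  then show ?thesis by (simp add: power2_eq_square)
next
  case False then obtain k where k: "z = 2 * k + 1" by (meson oddE)
  have "z ^ 2 = 4 * (k ^ 2 + k) + 1" unfolding k by (simp add: power2_eq_square algebra_simps)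
  then show ?thesis using False by presburger
qed

text \<open>The norm of \<open>x\<close> is even, which makes the sum of the squared halved
  coordinates divisible by 4. The squares are 1 modulo 4 on \<open>odd_points x\<close> and 0 elsewhere,
  so \<open>card (odd_points x)\<close> is divisible by 4.\<close>

lemma odd_points_card_ne6: assumes x: "x \<in> L" "even (coord0 x)" shows "card (odd_points x) \<noteq> 6"
proof
  assume c: "card (odd_points x) = 6"
  define z where "z s = coord x s div 2" for s
  define v where "v = coord0 x div 2"
  have Xz: "8 * (x \<bullet> u s) = 2 * real_of_int (z s)" if s: "s \<in> pts" for s
  proof -
    have "coord x s = 2 * z s" using parity[OF x(1) s] x(2) by (simp add: z_def)
    then show ?thesis using coord[OF x(1) s] by simp
  qed
  have jv: "8 * (x \<bullet> u0) = 2 * real_of_int v" using coord0[OF x(1)] x(2) by (auto simp: v_def)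
  have "x \<bullet> x = 24 * (x \<bullet> u0) * (x \<bullet> u0) + (\<Sum>s\<in>pts. 8 * (x \<bullet> u s) * (x \<bullet> u s))"
    using inner_expansion[of x x] x(1) by (simp add: L_iff)
  also have "\<dots> = 3 / 8 * (8 * (x \<bullet> u0))\<^sup>2 + (\<Sum>s\<in>pts. (8 * (x \<bullet> u s))\<^sup>2 / 8)"
    by (simp add: power2_eq_square mult.assoc)
  also have "\<dots> = 3 / 8 * (2 * real_of_int v)\<^sup>2 + (\<Sum>s\<in>pts. (2 * real_of_int (z s))\<^sup>2 / 8)"
    unfolding jv by (intro arg_cong2[of _ _ _ _ "(+)"] sum.cong refl) (simp only: Xz)
  also have "\<dots> = real_of_int (3 * v\<^sup>2 + (\<Sum>s\<in>pts. (z s)\<^sup>2)) / 2"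
    by (simp add: power_mult_distrib sum_divide_distrib add_divide_distrib)
  finally have n1: "x \<bullet> x = real_of_int (3 * v\<^sup>2 + (\<Sum>s\<in>pts. (z s)\<^sup>2)) / 2" .
  obtain n where "x \<bullet> x = 2 * of_int n" using L_even x(1) L_iff by blast
  then have "real_of_int (3 * v\<^sup>2 + (\<Sum>s\<in>pts. (z s)\<^sup>2)) = real_of_int (4 * n)" using n1 by simp
  then have e1: "3 * v\<^sup>2 + (\<Sum>s\<in>pts. (z s)\<^sup>2) = 4 * n" by (simp only: of_int_eq_iff)
  have "x \<bullet> tt (W 0) = 24 * (x \<bullet> u0) * (1/24) + (\<Sum>s\<in>pts. 8 * (x \<bullet> u s) * (1/8))"
    using inner_expansion[of x "tt (W 0)"] x(1) by (simp add: L_iff tt_W_u0 tt_W_u ptsD sg_0)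
  also have "\<dots> = (8 * (x \<bullet> u0)) / 8 + (\<Sum>s\<in>pts. 2 * real_of_int (z s) * (1/8))"
    by (intro arg_cong2[of _ _ _ _ "(+)"] sum.cong refl) (simp, simp only: Xz)
  also have "\<dots> = real_of_int (v + (\<Sum>s\<in>pts. z s)) / 4"
    unfolding jv by (simp add: sum_divide_distrib add_divide_distrib)
  finally have n2: "x \<bullet> tt (W 0) = real_of_int (v + (\<Sum>s\<in>pts. z s)) / 4" .
  obtain m where "x \<bullet> tt (W 0) = of_int m" using L_tt_int[OF x(1) W_plane[OF Herm_0]] by (auto elim: Ints_cases)
  then have "real_of_int (v + (\<Sum>s\<in>pts. z s)) = real_of_int (4 * m)" using n2 by simp
  then have e2: "v + (\<Sum>s\<in>pts. z s) = 4 * m" by (simp only: of_int_eq_iff)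
  have Z: "{s \<in> pts. odd (z s)} = odd_points x" by (simp add: odd_points_def z_def)
  have "even (\<Sum>s\<in>pts. z s)" using even_sum_iff[OF pts_finite, of z] c Z by simp
  then have "even v" using e2 by presburger
  then have "4 dvd v\<^sup>2" by (auto simp: power2_eq_square elim!: evenE)
  then have "4 dvd (\<Sum>s\<in>pts. (z s)\<^sup>2)" using e1 by presburger
  moreover have "(\<Sum>s\<in>pts. (z s)\<^sup>2) mod 4 = (\<Sum>s\<in>pts. (z s)\<^sup>2 mod 4) mod 4" by (simp add: mod_sum_eq)
  moreover have "(\<Sum>s\<in>pts. (z s)\<^sup>2 mod 4) = (\<Sum>s\<in>pts. if odd (z s) then 1 else 0)" by (simp add: sq_mod4)
  moreover have "\<dots> = int (card {s \<in> pts. odd (z s)})" by (simp add: sum.If_cases Int_def)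
  ultimately show False using c Z by simp
qed

text \<open>All coordinates divisible by 4 can be removed with differences \<open>Psa s 0 -
  Winf\<close>; a multiple of \<open>u0\<close> remains, and integrality against \<open>W
  0\<close> shows that it is a multiple of \<open>3 Winf\<close>.\<close>

lemma even_coords_in_frame_lattice:
  assumes x: "x \<in> L" "even (coord0 x)" and Z: "odd_points x = {}"
  shows "x \<in> frame_lattice"
proof -
  define m where "m s = coord x s div 4" for s
  have Xm: "8 * (x \<bullet> u s) = 4 * real_of_int (m s)" if s: "s \<in> pts" for s
  proof -
    have "even (coord x s div 2)" "even (coord x s)" using Z s parity[OF x(1) s] x(2) by (auto simp: odd_points_def)
    then have "coord x s = 4 * m s" unfolding m_def by presburger
    then show ?thesis using coord[OF x(1) s] by simp
  qed
  define y where "y = (\<Sum>s\<in>pts. of_int (m s) *\<^sub>R (tt (Psa s 0) - tt Winf))"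
  have yM: "y \<in> frame_lattice" unfolding y_def frame_lattice_def
    using frame_lattice_closed(4) frame_lattice_tt_diff[OF frame_planesI(3,1)] unfolding frame_lattice_def by (intro gc_sum) blast
  have y: "y = (12 * (\<Sum>s\<in>pts. real_of_int (m s))) *\<^sub>R u0 + (\<Sum>s\<in>pts. (4 * real_of_int (m s)) *\<^sub>R u s)"
  proof -
    have "y = (\<Sum>s\<in>pts. (12 * real_of_int (m s)) *\<^sub>R u0 + (4 * real_of_int (m s)) *\<^sub>R u s)"
      unfolding y_def
    proof (rule sum.cong)
      fix s assume s: "s \<in> pts"
      have "tt (Psa s 0) - tt Winf = 12 *\<^sub>R u0 + 4 *\<^sub>R u s"
        using tt_Psa(1)[OF ptsD[OF s]] by (simp add: tt_Winf algebra_simps flip: scaleR_add_left)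
      then show "of_int (m s) *\<^sub>R (tt (Psa s 0) - tt Winf) = (12 * real_of_int (m s)) *\<^sub>R u0 + (4 * real_of_int (m s)) *\<^sub>R u s"
        by (simp add: scaleR_add_right mult.commute)
    qed simp
    then show ?thesis by (simp add: sum.distrib scaleR_sum_left sum_distrib_left)
  qed
  have x': "x = (24 * (x \<bullet> u0)) *\<^sub>R u0 + (\<Sum>s\<in>pts. (4 * real_of_int (m s)) *\<^sub>R u s)"
    using expansion[of x] x(1) Xm by (simp add: L_iff)
  define c where "c = 24 * (x \<bullet> u0) - 12 * (\<Sum>s\<in>pts. real_of_int (m s))"
  have xy: "x - y = c *\<^sub>R u0" unfolding y c_def by (subst x') (simp add: scaleR_diff_left)
  have "x - y \<in> L" using x yM frame_lattice_sub_L by (intro Lp_closed) auto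
  then have "(x - y) \<bullet> tt (W 0) \<in> \<int>" by (intro L_tt_int W_plane Herm_0)
  moreover have "(x - y) \<bullet> tt (W 0) = c / 24"
    unfolding xy using tt_W_u0[OF Herm_0] by (simp add: inner_commute)
  ultimately obtain n where n: "c / 24 = real_of_int n" by (auto elim: Ints_cases)
  have "x - y = of_int (- n) *\<^sub>R (3 *\<^sub>R tt Winf)" unfolding xy tt_Winf using n by simp
  also have "\<dots> \<in> frame_lattice" by (intro frame_lattice_closed frame_lattice_3tt frame_planesI)
  finally have "(x - y) + y \<in> frame_lattice" using yM by (rule frame_lattice_closed(3))
  then show ?thesis by simp
qed

text \<open>Induction on the size of \<open>odd_points x\<close>. Subtracting the vector of a line
  replaces \<open>odd_points x\<close> by its symmetric difference with the line. As lines have five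
  points, this makes the set smaller as long as some line meets it in at least three
  points.\<close>

lemma even_in_frame_lattice: "x \<in> L \<Longrightarrow> even (coord0 x) \<Longrightarrow> x \<in> frame_lattice"
proof (induction "card (odd_points x)" arbitrary: x rule: less_induct)
  case less
  show ?case
  proof (cases "\<exists>v\<in>pts. 3 \<le> card (odd_points x \<inter> line v)")
    case True
    then obtain v where v: "v \<in> pts" "3 \<le> card (odd_points x \<inter> line v)" by blast
    let ?y = "x - lam v"
    have lL: "lam v \<in> L" using lam_frame_lattice[OF v(1)] frame_lattice_sub_L by blast
    have y: "?y \<in> L" "even (coord0 ?y)"
      using less lL v by (auto simp: Lp_closed coord0_diff coord0_lam)
    have Zy: "odd_points ?y = (odd_points x - line v) \<union> (line v - odd_points x)"
    proof -
      have o: "even (coord ?y s div 2) \<longleftrightarrow> (if s \<in> line v then odd (coord x s div 2) else even (coord x s div 2))" if "s \<in> pts" for s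
        using that less(2,3) lL v parity[OF less(2) that] by (simp add: coord_diff coord_lam)
      show ?thesis by (auto simp: odd_points_def o line_def split: if_splits)
    qed
    have fin: "finite (odd_points x)" "finite (line v)" by (simp_all add: odd_points_sub)
    have "card (odd_points ?y) = card (odd_points x - line v) + card (line v - odd_points x)"
      unfolding Zy using fin by (intro card_Un_disjoint) auto
    moreover have "card (odd_points x - line v) = card (odd_points x) - card (odd_points x \<inter> line v)"
      using fin by (simp add: card_Diff_subset_Int)
    moreover have "card (line v - odd_points x) = 5 - card (odd_points x \<inter> line v)"
      using fin line_card[OF ptsD[OF v(1)]] by (simp add: card_Diff_subset_Int Int_commute)
    moreover have "card (odd_points x \<inter> line v) \<le> card (odd_points x)" using fin by (simp add: card_mono)
    ultimately have "card (odd_points ?y) < card (odd_points x)" using v(2) by linarith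
    from less(1)[OF this y] have "?y + lam v \<in> frame_lattice" using lam_frame_lattice[OF v(1)] by (rule frame_lattice_closed(3))
    then show ?thesis by simp
  next
    case False
    then have "card (odd_points x \<inter> line v) \<le> 2" if "v \<in> pts" for v using that by force
    then have "odd_points x = {} \<or> card (odd_points x) = 6"
      by (intro hyperoval_size odd_points_sub odd_points_even less)
    then show ?thesis using odd_points_card_ne6[OF less(2,3)] even_coords_in_frame_lattice[OF less(2,3)] by blast
  qed
qed

text \<open>Vectors with \<open>coord0\<close> odd are reduced to the even case by \<open>W 0 -
  Winf\<close>, whose coordinate \<open>coord0\<close> is 3.\<close>

lemma frame_lattice_eq_L: "frame_lattice = L"
proof
  show "L \<subseteq> frame_lattice"
  proof
    fix x assume x: "x \<in> L"
    show "x \<in> frame_lattice"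
    proof (cases "even (coord0 x)")
      case True then show ?thesis using x even_in_frame_lattice by blast
    next
      case False
      let ?d = "tt (W 0) - tt Winf"
      have d: "?d \<in> frame_lattice" "?d \<in> L" using frame_lattice_tt_diff[OF frame_planesI(2)[OF Herm_0] frame_planesI(1)] frame_lattice_sub_L by auto
      have "real_of_int (coord0 ?d) = 3"
        using coord0[OF d(2)] tt_W_u0[OF Herm_0] by (simp add: inner_diff_left inner_add_left tt_Winf u0_u0)
      then have "coord0 ?d = 3" by simp
      then have "even (coord0 (x - ?d))" using False coord0_diff[OF x d(2)] by simp
      then have "x - ?d \<in> frame_lattice" using even_in_frame_lattice[OF Lp_closed(2)[OF x d(2)]] by simp
      from frame_lattice_closed(3)[OF this d(1)] show ?thesis by simp
    qed
  qed
qed (rule frame_lattice_sub_L)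

theorem M_eq_L: "M = L"
  using frame_lattice_eq_L frame_lattice_sub_M M_sub_L by blast

end

section \<open>Gluing along the triangle\<close>

lemma isometry_extension:
  fixes f :: "'a::euclidean_space \<Rightarrow> 'a"
  assumes S: "span S = UNIV" and f: "\<And>x y. x \<in> S \<Longrightarrow> y \<in> S \<Longrightarrow> f x \<bullet> f y = x \<bullet> y"
  shows "\<exists>F. orthogonal_transformation F \<and> (\<forall>x\<in>S. F x = f x)"
proof -
  obtain B where B: "B \<subseteq> S" "independent B" "S \<subseteq> span B"
    using maximal_independent_subset[of S] by blast
  have sB: "span B = UNIV"
    using S span_mono[OF B(3)] by (auto simp: span_span)
  obtain g where g: "linear g" "\<And>x. x \<in> B \<Longrightarrow> g x = f x"
    using linear_independent_extend[OF B(2), of f] by blast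
  have 1: "g x \<bullet> f s = x \<bullet> s" if s: "s \<in> S" for x s
  proof (rule linear_eq_on_span[of "\<lambda>x. g x \<bullet> f s" "\<lambda>x. x \<bullet> s" B])
    show "linear (\<lambda>x. g x \<bullet> f s)" using g(1) by (intro linearI) (simp_all add: linear_add linear_scale inner_add_left)
    show "linear (\<lambda>x. x \<bullet> s)" by (intro linearI) (simp_all add: inner_add_left)
  qed (use g B f s sB in auto)
  have 2: "g x \<bullet> g y = x \<bullet> y" for x y
  proof (rule linear_eq_on_span[of "\<lambda>x. g x \<bullet> g y" "\<lambda>x. x \<bullet> y" B])
    show "linear (\<lambda>x. g x \<bullet> g y)" using g(1) by (intro linearI) (simp_all add: linear_add linear_scale inner_add_left)
    show "linear (\<lambda>x. x \<bullet> y)" by (intro linearI) (simp_all add: inner_add_left)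
    show "g x \<bullet> g y = x \<bullet> y" if "x \<in> B" for x
      using 1[of x y] that B g(2) by (metis inner_commute subsetD)
  qed (use sB in auto)
  have "g s = f s" if s: "s \<in> S" for s
  proof -
    have "(g s - f s) \<bullet> (g s - f s) = 0"
      using 1[OF s, of s] 2[of s s] f[OF s s] by (simp add: inner_diff_left inner_diff_right inner_commute)
    then show ?thesis by simp
  qed
  moreover have "orthogonal_transformation g" using g 2 by (simp add: orthogonal_transformation_def)
  ultimately show ?thesis by blast
qed

context edge begin

text \<open>The vertices \<open>0\<close>, \<open>A\<close>, \<open>B\<close> of the triangle,
  seen from its centre.\<close>

definition vertex :: "nat \<Rightarrow> real ^ 24" where "vertex i = (if i = 0 then - G else if i = 1 then A - G else B - G)"

lemma all_less3: "(\<forall>i<3. Q i) \<longleftrightarrow> Q 0 \<and> Q 1 \<and> Q (2::nat)"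
  by (simp add: numeral_3_eq_3 numeral_2_eq_2 All_less_Suc2)

lemma less3: "i < 3 \<Longrightarrow> i = 0 \<or> i = 1 \<or> i = (2::nat)" by auto

lemma vertex_simps: "vertex 0 = - G" "vertex 1 = A - G" "vertex (Suc 0) = A - G" "vertex 2 = B - G" by (simp_all add: vertex_def)

lemma vertex_inner: "i < 3 \<Longrightarrow> j < 3 \<Longrightarrow> vertex i \<bullet> vertex j = (if i = j then 4/3 else - 2/3)"
  by (drule less3, drule less3, elim disjE) (simp_all add: vertex_simps inner_diff_left inner_diff_right AB_inner G_inner)

lemma vertex_sum: "vertex 0 + vertex 1 + vertex 2 = 0"
proof -
  have "3 *\<^sub>R G = A + B" by (simp add: G_def)
  moreover have "vertex 0 + vertex 1 + vertex 2 = A + B - (G + G + G)" by (simp add: vertex_simps algebra_simps)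
  moreover have "G + G + G = 3 *\<^sub>R G" using scaleR_add_left[of 2 1 G] scaleR_2[of G] by simp
  ultimately show ?thesis by simp
qed

lemma perp_vertex: "x \<bullet> A = 0 \<Longrightarrow> x \<bullet> B = 0 \<Longrightarrow> x \<bullet> vertex i = 0" "x \<bullet> A = 0 \<Longrightarrow> x \<bullet> B = 0 \<Longrightarrow> x \<bullet> G = 0"
  by (auto simp: vertex_def G_def inner_diff_right inner_add_right)

lemma vertex_diff: "i < 3 \<Longrightarrow> j < 3 \<Longrightarrow> vertex i - vertex j \<in> \<Lambda>"
proof -
  assume ij: "i < 3" "j < 3"
  have "A - B \<in> \<Lambda>" "B - A \<in> \<Lambda>" "- A \<in> \<Lambda>" "- B \<in> \<Lambda>" using AB L_closed by simp_all
  then show ?thesis using less3[OF ij(1)] less3[OF ij(2)] AB L_closed(1)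
    by (elim disjE) (simp_all add: vertex_simps)
qed

lemma av3: "i < 3 \<Longrightarrow> 3 *\<^sub>R vertex i \<in> \<Lambda>"
proof -
  assume i: "i < 3"
  have d: "vertex i - vertex 0 \<in> \<Lambda>" "vertex i - vertex 1 \<in> \<Lambda>" "vertex i - vertex 2 \<in> \<Lambda>" using vertex_diff[OF i] by simp_all
  have e: "3 *\<^sub>R vertex i = (vertex i - vertex 0) + (vertex i - vertex 1) + (vertex i - vertex 2) + (vertex 0 + vertex 1 + vertex 2)"
    using scaleR_add_left[of 2 1 "vertex i"] scaleR_2[of "vertex i"] by simp
  show ?thesis unfolding e vertex_sum add_0_right by (intro L_closed(3) d)
qed

lemma even_norm_int: "x \<in> \<Lambda> \<Longrightarrow> x \<bullet> x = of_int n \<Longrightarrow> even n"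
proof -
  assume "x \<in> \<Lambda>" "x \<bullet> x = of_int n"
  then obtain m where "real_of_int n = real_of_int (2 * m)" using L_even[of x] by auto
  then have "n = 2 * m" by (simp only: of_int_eq_iff)
  then show ?thesis by simp
qed

text \<open>If all inner products with \<open>v\<close> were even, half of \<open>v\<close> would
  lie in the lattice by unimodularity, with the odd norm 1 or 3.\<close>

lemma half_not_in: assumes "v \<in> \<Lambda>" "v \<bullet> v = 4 \<or> v \<bullet> v = 12"
  shows "\<exists>x\<in>\<Lambda>. \<exists>n. x \<bullet> v = of_int n \<and> odd n"
proof (rule ccontr)
  assume *: "\<not> ?thesis"
  have "(1/2) *\<^sub>R v \<in> \<Lambda>"
  proof (rule L_unimodular)
    fix x assume x: "x \<in> \<Lambda>"
    obtain n where n: "x \<bullet> v = of_int n" using L_int[OF x assms(1)] by (auto elim: Ints_cases)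
    then have "even n" using * x by auto
    then obtain m where "n = 2 * m" by blast
    then show "x \<bullet> (1/2) *\<^sub>R v \<in> \<int>" by (simp add: n)
  qed
  moreover have "((1/2) *\<^sub>R v) \<bullet> ((1/2) *\<^sub>R v) = of_int (if v \<bullet> v = 4 then 1 else 3)"
    using assms(2) by auto
  ultimately have "even (if v \<bullet> v = 4 then 1 else 3 :: int)" by (rule even_norm_int)
  then show False by (simp split: if_splits)
qed

text \<open>Unimodularity makes the inner products with \<open>A\<close>, \<open>B\<close> and
  \<open>A + B\<close> take odd values, so every pair of residues modulo 2 is attained by a
  lattice vector; adding vectors \<open>A - T\<close>, \<open>B - T\<close> with \<open>T\<close>
  in \<open>T_set\<close> adjusts the pair by any even amounts.\<close>

lemma glue_vectors: "\<exists>xx. \<forall>i<3. xx i \<in> \<Lambda> \<and> (xx i - (3/2) *\<^sub>R vertex i) \<bullet> A = 0 \<and> (xx i - (3/2) *\<^sub>R vertex i) \<bullet> B = 0"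
proof -
  define par where "par x m n \<longleftrightarrow> x \<in> \<Lambda> \<and> x \<bullet> A = of_int m \<and> x \<bullet> B = of_int n" for x and m n :: int
  have ex: "\<exists>m n. par x m n" if "x \<in> \<Lambda>" for x
    using L_int[OF that AB(1)] L_int[OF that AB(2)] that by (auto simp: par_def elim!: Ints_cases)
  have pd: "par (x - y) (m - m') (n - n')" if "par x m n" "par y m' n'" for x y m n m' n'
    using that L_closed by (auto simp: par_def inner_diff_left)
  have "A + B \<in> \<Lambda>" "(A + B) \<bullet> (A + B) = 12" using AB L_closed by (auto simp: inner_add_left inner_add_right AB_inner)
  from half_not_in[of "A + B"] this obtain z n where z: "z \<in> \<Lambda>" "z \<bullet> (A + B) = of_int n" "odd n" by blast
  obtain zm zn where Z: "par z zm zn" using ex z by blast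
  have "real_of_int (zm + zn) = real_of_int n" using Z z(2) by (simp add: par_def inner_add_right)
  then have "zm + zn = n" by (simp only: of_int_eq_iff)
  then have Zo: "odd (zm + zn)" using z(3) by simp
  have "\<exists>x\<in>\<Lambda>. \<exists>n. x \<bullet> A = of_int n \<and> odd n" using half_not_in[OF AB(1)] AB_inner(1) by simp
  then obtain x n where x: "x \<in> \<Lambda>" "x \<bullet> A = of_int n" "odd n" by blast
  obtain xm xn where X: "par x xm xn" using ex x by blast
  have Xo: "odd xm" using X x by (simp add: par_def)
  have "\<exists>x\<in>\<Lambda>. \<exists>n. x \<bullet> B = of_int n \<and> odd n" using half_not_in[OF AB(2)] AB_inner(2) by simp
  then obtain y n where y: "y \<in> \<Lambda>" "y \<bullet> B = of_int n" "odd n" by blast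
  obtain ym yn where Y: "par y ym yn" using ex y by blast
  have Yo: "odd yn" using Y y by (simp add: par_def)
  have "\<exists>v m n. par v m n \<and> odd m \<and> even n"
  proof (cases "odd zm")
    case True then show ?thesis using Z Zo by auto
  next
    case False
    then show ?thesis using X Xo pd[OF X Z] Zo by (cases "even xn") (metis, metis even_add even_diff)
  qed
  then obtain v1 m1 n1 where v1: "par v1 m1 n1" "odd m1" "even n1" by blast
  have "\<exists>v m n. par v m n \<and> even m \<and> odd n"
    using Y Yo pd[OF Y v1(1)] v1 by (cases "even ym") (metis, metis even_diff even_add)
  then obtain v2 m2 n2 where v2: "par v2 m2 n2" "even m2" "odd n2" by blast
  have T: "par (A - \<phi> Winf) 2 0" "par (B - \<phi> Winf) 0 2"
    using T_setD[OF phi_T[OF Winf_plane]] AB L_closed AB_inner by (auto simp: par_def inner_diff_left)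
  have adj: "\<exists>x. par x m n" if t: "par v m' n'" "even (m - m')" "even (n - n')" for v m n m' n'
  proof -
    obtain a where a: "m - m' = 2 * a" using t(2) by (rule evenE)
    obtain b where b: "n - n' = 2 * b" using t(3) by (rule evenE)
    have "par (v + of_int a *\<^sub>R (A - \<phi> Winf) + of_int b *\<^sub>R (B - \<phi> Winf)) (m' + 2 * a) (n' + 2 * b)"
      using t(1) T unfolding par_def by (auto simp: inner_add_left L_closed)
    moreover have "m' + 2 * a = m" "n' + 2 * b = n" using a b by simp_all
    ultimately show ?thesis by auto
  qed
  obtain x1 where x1: "par x1 3 0" using adj[OF v1(1), of 3 0] v1 by auto
  obtain x2 where x2: "par x2 0 3" using adj[OF v2(1), of 0 3] v2 by auto
  have avA: "vertex i \<bullet> A = (if i = 0 then - 2 else if i = 1 then 2 else 0)" "vertex i \<bullet> B = (if i = 0 then - 2 else if i = 1 then 0 else 2)" for i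
    by (simp_all add: vertex_def inner_diff_left G_inner AB_inner)
  let ?x = "\<lambda>i::nat. if i = 0 then - x1 - x2 else if i = 1 then x1 else x2"
  show ?thesis
  proof (intro exI[of _ ?x] allI impI)
    fix i :: nat assume i: "i < 3"
    show "?x i \<in> \<Lambda> \<and> (?x i - (3/2) *\<^sub>R vertex i) \<bullet> A = 0 \<and> (?x i - (3/2) *\<^sub>R vertex i) \<bullet> B = 0"
      using less3[OF i] x1 x2 L_closed(2,4)
      by (elim disjE) (simp_all add: par_def inner_diff_left avA)
  qed
qed

definition xx :: "nat \<Rightarrow> real ^ 24" where
  "xx = (SOME xx. \<forall>i<3. xx i \<in> \<Lambda> \<and> (xx i - (3/2) *\<^sub>R vertex i) \<bullet> A = 0 \<and> (xx i - (3/2) *\<^sub>R vertex i) \<bullet> B = 0)"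

text \<open>Chosen lattice vectors \<open>xx i\<close> whose component in the plane of the
  triangle is \<open>(3/2) vertex i\<close>; \<open>yy i\<close> is the other component, a
  representative of a glue class of \<open>R_perp\<close>.\<close>

definition yy :: "nat \<Rightarrow> real ^ 24" where "yy i = xx i - (3/2) *\<^sub>R vertex i"

lemma xx: "i < 3 \<Longrightarrow> xx i \<in> \<Lambda>" and yy_perp: "i < 3 \<Longrightarrow> yy i \<bullet> A = 0" "i < 3 \<Longrightarrow> yy i \<bullet> B = 0"
  using someI_ex[OF glue_vectors] by (auto simp: xx_def yy_def)

lemma xx_eq: "xx i = yy i + (3/2) *\<^sub>R vertex i" by (simp add: yy_def)

lemma yy_L: "i < 3 \<Longrightarrow> l \<in> L \<Longrightarrow> yy i \<bullet> l \<in> \<int>"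
proof -
  assume i: "i < 3" and l: "l \<in> L"
  have "vertex i \<bullet> l = 0" using perp_vertex(1)[of l i] l by (simp add: L_iff inner_commute[of "vertex i"])
  then have "yy i \<bullet> l = xx i \<bullet> l" by (simp add: yy_def inner_diff_left)
  then show ?thesis using L_int xx i l L_iff by metis
qed

lemma vertex_G: "i < 3 \<Longrightarrow> (3/2) * (vertex i \<bullet> G) \<in> \<int>"
  by (drule less3, elim disjE) (simp_all add: vertex_simps inner_diff_left G_inner AB_inner)

lemma vertex_B: "i < 3 \<Longrightarrow> (3/2) * (vertex i \<bullet> B) \<in> \<int>"
  by (drule less3, elim disjE) (simp_all add: vertex_simps inner_diff_left G_inner AB_inner)

lemma yy_tt: assumes "i < 3" "P \<in> planes" shows "yy i \<bullet> tt P \<in> \<int>"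
proof -
  have "yy i \<bullet> tt P = yy i \<bullet> \<phi> P" using perp_vertex(2)[OF yy_perp[OF assms(1)]] by (simp add: tt_def inner_diff_right)
  also have "\<dots> = xx i \<bullet> \<phi> P - (3/2) * (vertex i \<bullet> (tt P + G))" by (simp add: yy_def inner_diff_left tt_def)
  also have "\<dots> = xx i \<bullet> \<phi> P - (3/2) * (vertex i \<bullet> G)"
    using perp_vertex(1)[OF tt_perp[OF assms(2)], of i] by (simp add: inner_add_right inner_commute)
  finally show ?thesis using vertex_G[OF assms(1)] L_int[OF xx[OF assms(1)] T_setD(1)[OF phi_T[OF assms(2)]]] by simp
qed

lemma yy_yy: assumes "i < 3" "j < 3" shows "yy i \<bullet> yy j + (if i = j then 0 else 1/2) \<in> \<int>"
proof -
  have "xx i \<bullet> xx j = yy i \<bullet> yy j + 9/4 * (vertex i \<bullet> vertex j)"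
    using perp_vertex(1)[OF yy_perp[OF assms(1)], of j] perp_vertex(1)[OF yy_perp[OF assms(2)], of i]
    by (simp add: xx_eq inner_add_left inner_add_right inner_commute)
  then have "yy i \<bullet> yy j + (if i = j then 0 else 1/2) = xx i \<bullet> xx j + (if i = j then - 3 else 2)"
    using vertex_inner[OF assms] by auto
  then show ?thesis using L_int[OF xx[OF assms(1)] xx[OF assms(2)]] by auto
qed

lemma half_not_int: "x \<in> \<int> \<Longrightarrow> x + 1/2 \<notin> (\<int> :: real set)"
proof
  assume i: "x \<in> \<int>" "x + 1/2 \<in> (\<int> :: real set)"
  have "1/2 \<in> (\<int> :: real set)" using Ints_diff[OF i(2,1)] by simp
  then obtain n where "(1/2 :: real) = of_int n" by (auto elim: Ints_cases)
  then have "real_of_int (2 * n) = real_of_int 1" by simp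
  then have "2 * n = 1" by (simp only: of_int_eq_iff)
  then show False by presburger
qed

text \<open>The inner products of glue vectors of different classes are half-integers; this
  distinguishes the three classes.\<close>

lemma yy_not_int: assumes "i < 3" "j < 3" "i \<noteq> j" shows "yy i \<bullet> yy j \<notin> \<int>"
  using half_not_int[of "yy i \<bullet> yy j"] yy_yy[OF assms(1,2)] assms(3) by auto

lemma yy2: "i < 3 \<Longrightarrow> 2 *\<^sub>R yy i \<in> L"
proof -
  assume i: "i < 3"
  have "2 *\<^sub>R yy i = of_int 2 *\<^sub>R xx i - 3 *\<^sub>R vertex i" by (simp add: yy_def scaleR_diff_right)
  also have "\<dots> \<in> \<Lambda>" by (rule L_closed(2)[OF L_closed(5)[OF xx[OF i]] av3[OF i]])
  finally have "2 *\<^sub>R yy i \<in> \<Lambda>" .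
  then show ?thesis using yy_perp[OF i] by (simp add: L_iff)
qed

lemma yy_sum: "yy 0 + yy 1 + yy 2 \<in> L"
proof -
  have "yy 0 + yy 1 + yy 2 = xx 0 + xx 1 + xx 2 - (3/2) *\<^sub>R (vertex 0 + vertex 1 + vertex 2)"
    by (simp add: yy_def algebra_simps)
  then have "yy 0 + yy 1 + yy 2 \<in> \<Lambda>" using xx by (simp add: vertex_sum L_closed del: One_nat_def)
  then show ?thesis using yy_perp by (simp add: L_iff inner_add_left)
qed

text \<open>The residues modulo 2 of the inner products with \<open>A\<close> and \<open>B\<close>
  select at most one of the glue vectors; a vector of \<open>T_set\<close> and \<open>B\<close>
  correct the remaining even inner products.\<close>

lemma Lambda_decomp:
  assumes x: "x \<in> \<Lambda>"
  obtains c k n l where "c = 0 \<or> (\<exists>i<3. c = xx i)" "l \<in> L"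
    "x = c + of_int k *\<^sub>R \<phi> Winf + of_int n *\<^sub>R B + l"
proof -
  have ex: "\<exists>m n. x \<bullet> A = of_int m \<and> x \<bullet> B = of_int n" if "x \<in> \<Lambda>" for x
    using L_int[OF that AB(1)] L_int[OF that AB(2)] by (auto elim!: Ints_cases)
  have avA: "vertex i \<bullet> A = (if i = 0 then - 2 else if i = 1 then 2 else 0)" "vertex i \<bullet> B = (if i = 0 then - 2 else if i = 1 then 0 else 2)" for i
    by (simp_all add: vertex_def inner_diff_left G_inner AB_inner)
  have xxA: "xx i \<bullet> A = of_int (if i = 0 then - 3 else if i = 1 then 3 else 0)" "xx i \<bullet> B = of_int (if i = 0 then - 3 else if i = 1 then 0 else 3)" if "i < 3" for i
    using yy_perp[OF that] by (auto simp: xx_eq inner_add_left avA)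
  obtain m n where mn: "x \<bullet> A = of_int m" "x \<bullet> B = of_int n" using ex x by blast
  have "\<exists>c. (c = 0 \<or> (\<exists>i<3. c = xx i)) \<and> (\<exists>m n. (x - c) \<bullet> A = of_int (2 * m) \<and> (x - c) \<bullet> B = of_int (2 * n))"
  proof -
    have c: ?thesis if t: "c = 0 \<or> (\<exists>i<3. c = xx i)" "c \<bullet> A = of_int m'" "c \<bullet> B = of_int n'" "even (m - m')" "even (n - n')" for c m' n'
    proof -
      obtain a where "m - m' = 2 * a" using t(4) by (rule evenE)
      moreover obtain b where "n - n' = 2 * b" using t(5) by (rule evenE)
      moreover have "(x - c) \<bullet> A = of_int (m - m')" "(x - c) \<bullet> B = of_int (n - n')"
        using t mn by (simp_all add: inner_diff_left)
      ultimately show ?thesis using t(1) by metis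
    qed
    have mem: "xx i = 0 \<or> (\<exists>j<3. xx i = xx j)" if "i < 3" for i using that by blast
    consider "even m" "even n" | "odd m" "even n" | "even m" "odd n" | "odd m" "odd n" by blast
    then show ?thesis
    proof cases
      case 1 then show ?thesis by (intro c[of 0 0 0]) auto
    next
      case 2 then show ?thesis using xxA[of 1] by (intro c[OF mem[of 1], of 3 0]) auto
    next
      case 3 then show ?thesis using xxA[of 2] by (intro c[OF mem[of 2], of 0 3]) auto
    next
      case 4 then show ?thesis using xxA[of 0] by (intro c[OF mem[of 0], of "-3" "-3"]) auto
    qed
  qed
  then obtain c m n where c: "c = 0 \<or> (\<exists>i<3. c = xx i)" "(x - c) \<bullet> A = of_int (2 * m)" "(x - c) \<bullet> B = of_int (2 * n)" by blast
  define l where "l = (x - c) - of_int (2 * m - n) *\<^sub>R \<phi> Winf - of_int (n - m) *\<^sub>R B"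
  have "c \<in> \<Lambda>" using c(1) by (elim disjE exE conjE) (simp_all add: L_closed xx)
  then have "l \<in> \<Lambda>" unfolding l_def using x AB T_setD[OF phi_T[OF Winf_plane]] by (intro L_closed)
  moreover have "l \<bullet> A = 0" "l \<bullet> B = 0"
    unfolding l_def inner_diff_left[of "x - c - _"] inner_diff_left[of "x - c"] c inner_scaleR_left
    using T_setD[OF phi_T[OF Winf_plane]] AB_inner by (simp_all add: algebra_simps)
  ultimately have "l \<in> L" by (simp add: L_iff)
  with c(1) show ?thesis by (rule that[of c l "2 * m - n" "n - m"]) (simp add: l_def)
qed

text \<open>The inner products of \<open>y\<close> with the three glue vectors are half-integers
  with integral sum. So either all are integral and \<open>y\<close> itself is in the unimodular
  lattice, or exactly one is integral, at index \<open>k\<close>, and \<open>y\<close> has the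
  glue class of \<open>k\<close>.\<close>

lemma glue:
  assumes y: "y \<bullet> A = 0" "y \<bullet> B = 0" and yL: "\<And>l. l \<in> L \<Longrightarrow> y \<bullet> l \<in> \<int>" and yt: "y \<bullet> tt Winf \<in> \<int>"
  shows "y \<in> L \<or> (\<exists>k<3. y + (3/2) *\<^sub>R vertex k \<in> \<Lambda>)"
proof -
  have main: "y + r \<in> \<Lambda>" if r: "r = 0 \<or> (\<exists>k<3. r = (3/2) *\<^sub>R vertex k)" and c: "\<And>i. i < 3 \<Longrightarrow> y \<bullet> yy i + r \<bullet> xx i \<in> \<int>" for r
  proof (rule L_unimodular)
    fix z assume "z \<in> \<Lambda>"
    then obtain c' k n l where z: "c' = 0 \<or> (\<exists>i<3. c' = xx i)" "l \<in> L"
      "z = c' + of_int k *\<^sub>R \<phi> Winf + of_int n *\<^sub>R B + l" by (rule Lambda_decomp)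
    have rl: "l \<bullet> r = 0" using r perp_vertex(1)[of l] z(2) by (auto simp: L_iff)
    have rB: "B \<bullet> r \<in> \<int>" using r vertex_B by (auto simp: inner_commute)
    have rW: "\<phi> Winf \<bullet> r \<in> \<int>"
    proof -
      have "tt Winf \<bullet> r = 0" using r perp_vertex(1)[OF tt_perp[OF Winf_plane]] by auto
      then have "\<phi> Winf \<bullet> r = G \<bullet> r" by (simp add: tt_def inner_diff_left)
      then show ?thesis using r vertex_G by (auto simp: inner_commute)
    qed
    have yW: "\<phi> Winf \<bullet> y \<in> \<int>"
      using yt perp_vertex(2)[OF y] by (simp add: tt_def inner_diff_right inner_commute)
    have "c' \<bullet> (y + r) \<in> \<int>"
    proof -
      have "xx i \<bullet> (y + r) = y \<bullet> yy i + r \<bullet> xx i" for i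
        using perp_vertex(1)[OF y, of i] by (simp add: xx_eq[of i] inner_add_left inner_add_right inner_commute)
      then show ?thesis using z(1) c by auto
    qed
    moreover have "z \<bullet> (y + r) = c' \<bullet> (y + r) + of_int k * (\<phi> Winf \<bullet> y + \<phi> Winf \<bullet> r) + of_int n * (B \<bullet> r) + l \<bullet> y"
      using y rl unfolding z(3) by (simp add: inner_add_left inner_add_right inner_commute)
    ultimately show "z \<bullet> (y + r) \<in> \<int>"
      using rB rW yW yL[OF z(2)] by (simp add: inner_commute Ints_mult)
  qed
  have two: "2 * (y \<bullet> yy i) \<in> \<int>" if "i < 3" for i using yL[OF yy2[OF that]] by simp
  have sum: "y \<bullet> yy 0 + y \<bullet> yy 1 + y \<bullet> yy 2 \<in> \<int>" using yL[OF yy_sum] by (simp add: inner_add_right)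
  have "y \<bullet> yy i \<in> \<int> \<or> y \<bullet> yy i + 1/2 \<in> \<int>" if i: "i < 3" for i
  proof -
    obtain n where n: "2 * (y \<bullet> yy i) = of_int n" using two[OF i] by (auto elim: Ints_cases)
    show ?thesis
    proof (cases "even n")
      case True then obtain m where "n = 2 * m" by blast
      then have "y \<bullet> yy i = of_int m" using n by simp
      then show ?thesis by simp
    next
      case False then obtain m where "n = 2 * m + 1" by (meson oddE)
      then have "y \<bullet> yy i + 1/2 = of_int (m + 1)" using n by simp
      then show ?thesis by (metis Ints_of_int)
    qed
  qed
  then have h: "y \<bullet> yy 0 \<in> \<int> \<or> y \<bullet> yy 0 + 1/2 \<in> \<int>" "y \<bullet> yy 1 \<in> \<int> \<or> y \<bullet> yy 1 + 1/2 \<in> \<int>"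
    "y \<bullet> yy 2 \<in> \<int> \<or> y \<bullet> yy 2 + 1/2 \<in> \<int>" by simp_all
  show ?thesis
  proof (cases "\<forall>i<3. y \<bullet> yy i \<in> \<int>")
    case True
    then have "y + 0 \<in> \<Lambda>" by (intro main) auto
    then show ?thesis using y by (simp add: L_iff)
  next
    case False
    have "\<exists>k<3. \<forall>i<3. if i = k then y \<bullet> yy i \<in> \<int> else y \<bullet> yy i + 1/2 \<in> \<int>"
    proof -
      have d: "a \<in> \<int> \<Longrightarrow> b \<in> \<int> \<Longrightarrow> a + b + c \<in> \<int> \<Longrightarrow> c \<in> \<int>" for a b c :: real
        by (metis Ints_add Ints_diff add_diff_cancel_left')
      have d2: "a + 1/2 \<in> \<int> \<Longrightarrow> b + 1/2 \<in> \<int> \<Longrightarrow> a + b + c \<in> \<int> \<Longrightarrow> c \<in> \<int>" for a b c :: real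
      proof -
        assume i: "a + 1/2 \<in> \<int>" "b + 1/2 \<in> \<int>" "a + b + c \<in> \<int>"
        have "(a + b + c) + 1 - (a + 1/2) - (b + 1/2) \<in> \<int>" by (rule Ints_diff[OF Ints_diff[OF Ints_add[OF i(3) Ints_1] i(1)] i(2)])
        moreover have "(a + b + c) + 1 - (a + 1/2) - (b + 1/2) = c" by simp
        ultimately show "c \<in> \<int>" by simp
      qed
      have all3: "(\<forall>i<3. Q i) \<longleftrightarrow> Q 0 \<and> Q 1 \<and> Q (2::nat)" for Q by (rule all_less3)
      have ex3: "(\<exists>i<3. Q i) \<longleftrightarrow> Q 0 \<or> Q 1 \<or> Q (2::nat)" for Q using all3[of "\<lambda>i. \<not> Q i"] by blast
      let ?a = "y \<bullet> yy 0" and ?b = "y \<bullet> yy 1" and ?c = "y \<bullet> yy 2"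
      have s2: "?a + ?c + ?b \<in> \<int>" "?b + ?c + ?a \<in> \<int>" using sum by (simp_all add: add_ac)
      have nn: "\<not> (?a \<in> \<int> \<and> ?b \<in> \<int> \<and> ?c \<in> \<int>)" using False unfolding all3 .
      have "(?a \<in> \<int> \<and> ?b + 1/2 \<in> \<int> \<and> ?c + 1/2 \<in> \<int>) \<or> (?b \<in> \<int> \<and> ?a + 1/2 \<in> \<int> \<and> ?c + 1/2 \<in> \<int>) \<or>
        (?c \<in> \<int> \<and> ?a + 1/2 \<in> \<int> \<and> ?b + 1/2 \<in> \<int>)"
        using h nn d[OF _ _ sum] d[OF _ _ s2(1)] d[OF _ _ s2(2)] d2[OF _ _ sum] d2[OF _ _ s2(1)] d2[OF _ _ s2(2)] by blast
      then show ?thesis unfolding all3 ex3 by auto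
    qed
    then obtain k where k: "k < 3" "\<And>i. i < 3 \<Longrightarrow> if i = k then y \<bullet> yy i \<in> \<int> else y \<bullet> yy i + 1/2 \<in> \<int>" by blast
    have "y + (3/2) *\<^sub>R vertex k \<in> \<Lambda>"
    proof (rule main)
      fix i :: nat assume i: "i < 3"
      have "((3/2) *\<^sub>R vertex k) \<bullet> xx i = 9/4 * (vertex k \<bullet> vertex i)"
        using perp_vertex(1)[OF yy_perp[OF i], of k] by (simp add: xx_eq inner_add_right inner_commute)
      also have "\<dots> = (if i = k then 3 else - 3/2)" using vertex_inner[OF k(1) i] by auto
      finally have e: "((3/2) *\<^sub>R vertex k) \<bullet> xx i = (if i = k then 3 else - 3/2)" .
      show "y \<bullet> yy i + ((3/2) *\<^sub>R vertex k) \<bullet> xx i \<in> \<int>"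
      proof (cases "i = k")
        case True then show ?thesis using k(2)[OF i] unfolding e by simp
      next
        case False
        then have z0: "y \<bullet> yy i + 1/2 \<in> \<int>" using k(2)[OF i] by simp
        have z: "(y \<bullet> yy i + 1/2) - 2 \<in> \<int>" by (rule Ints_diff[OF z0 Ints_numeral])
        have eq: "(y \<bullet> yy i + 1/2) - 2 = y \<bullet> yy i + (if i = k then 3 else - 3/2)" using False by simp
        from z[unfolded eq] show ?thesis unfolding e .
      qed
    qed (use k in auto)
    then show ?thesis using k by blast
  qed
qed

end

section \<open>Lifting symmetries of the planes to the Leech lattice\<close>

text \<open>The indexed form of \<open>isometry_extension\<close>; two indices with the same
  vector have the same image, since the difference of the images has norm 0.\<close>

lemma isometry_extension_indexed:
  fixes e f :: "'i \<Rightarrow> 'a::euclidean_space"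
  assumes S: "span (e ` I) = UNIV" and f: "\<And>i j. i \<in> I \<Longrightarrow> j \<in> I \<Longrightarrow> f i \<bullet> f j = e i \<bullet> e j"
  shows "\<exists>F. orthogonal_transformation F \<and> (\<forall>i\<in>I. F (e i) = f i)"
proof -
  define k where "k x = (SOME i. i \<in> I \<and> e i = x)" for x
  have k: "k x \<in> I" "e (k x) = x" if "x \<in> e ` I" for x
  proof -
    have "\<exists>i. i \<in> I \<and> e i = x" using that by blast
    then show "k x \<in> I" "e (k x) = x" unfolding k_def by (metis (mono_tags, lifting) someI_ex)+
  qed
  have fk: "f (k (e i)) = f i" if i: "i \<in> I" for i
  proof -
    have k': "k (e i) \<in> I" "e (k (e i)) = e i" using k[of "e i"] i by auto
    have "(f (k (e i)) - f i) \<bullet> (f (k (e i)) - f i) = 0"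
      by (simp add: inner_diff_left inner_diff_right f[OF k'(1) k'(1)] f[OF k'(1) i] f[OF i k'(1)] f[OF i i] k'(2))
    then show ?thesis by simp
  qed
  have "f (k x) \<bullet> f (k y) = x \<bullet> y" if "x \<in> e ` I" "y \<in> e ` I" for x y
    using f[OF k(1)[OF that(1)] k(1)[OF that(2)]] k(2)[OF that(1)] k(2)[OF that(2)] by simp
  from isometry_extension[OF S this] obtain F where "orthogonal_transformation F" "\<forall>x\<in>e ` I. F x = f (k x)" by blast
  then show ?thesis using fk by auto
qed

context edge begin

text \<open>\<open>aut\<close> describes symmetries of the planes by their values on planes only,
  so that restricted and unrestricted maps can be used alike.\<close>

definition aut :: "(('k^6) set \<Rightarrow> ('k^6) set) \<Rightarrow> bool" where
  "aut p \<longleftrightarrow> bij_betw p planes planes \<and> (\<forall>P\<in>planes. \<forall>Q\<in>planes. vec.dim (p P \<inter> p Q) = vec.dim (P \<inter> Q))"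

definition vertices :: "(real ^ 24) set" where "vertices = vertex ` {..<3}"

definition Iso :: "(real ^ 24 \<Rightarrow> real ^ 24) \<Rightarrow> bool" where
  "Iso F \<longleftrightarrow> orthogonal_transformation F \<and> F ` \<Lambda> = \<Lambda>"

text \<open>The permutation of the vertices is part of the requirement: the values on the planes
  leave the action on the plane of the triangle open.\<close>

definition lift :: "(('k^6) set \<Rightarrow> ('k^6) set) \<Rightarrow> (real ^ 24 \<Rightarrow> real ^ 24) \<Rightarrow> bool" where
  "lift p F \<longleftrightarrow> Iso F \<and> F ` vertices = vertices \<and> (\<forall>P\<in>planes. F (tt P) = tt (p P))"

lemma aut_in: "aut p \<Longrightarrow> P \<in> planes \<Longrightarrow> p P \<in> planes" by (auto simp: aut_def bij_betw_def)

lemma aut_dim: "aut p \<Longrightarrow> P \<in> planes \<Longrightarrow> Q \<in> planes \<Longrightarrow> vec.dim (p P \<inter> p Q) = vec.dim (P \<inter> Q)"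
  by (auto simp: aut_def)

lemma aut_surj: assumes "aut p" "Q \<in> planes" shows "\<exists>P\<in>planes. p P = Q"
proof -
  have "p ` planes = planes" using assms(1) by (simp add: aut_def bij_betw_def)
  then show ?thesis using assms(2) by (metis imageE)
qed

lemma aut_inner: "aut p \<Longrightarrow> P \<in> planes \<Longrightarrow> Q \<in> planes \<Longrightarrow> tt (p P) \<bullet> tt (p Q) = tt P \<bullet> tt Q"
  by (simp add: tt_inner aut_in aut_dim)

lemma Iso_lin: "Iso F \<Longrightarrow> linear F" by (simp add: Iso_def orthogonal_transformation_def)

lemma Iso_inner: "Iso F \<Longrightarrow> F x \<bullet> F y = x \<bullet> y" by (simp add: Iso_def orthogonal_transformation_def)

lemma Iso_Lambda: "Iso F \<Longrightarrow> x \<in> \<Lambda> \<Longrightarrow> F x \<in> \<Lambda>" by (auto simp: Iso_def)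

lemma Iso_inj: "Iso F \<Longrightarrow> inj F" by (simp add: Iso_def orthogonal_transformation_inj)

lemma lin_agree_perp:
  assumes F: "linear F" "linear F'" and e: "\<And>P. P \<in> planes \<Longrightarrow> F (tt P) = F' (tt P)" and x: "x \<bullet> A = 0" "x \<bullet> B = 0"
  shows "F x = F' x"
proof -
  have 0: "F u0 = F' u0" unfolding u0_def using e[OF Winf_plane] F by (simp add: linear_scale linear_neg)
  have "F (u s) = F' (u s)" if "s \<in> pts" for s
    unfolding u_def using e PsaP[OF ptsD[OF that]] F by (simp add: linear_scale linear_diff)
  then show ?thesis
    by (subst (1 2) expansion[OF x]) (simp add: 0 linear_add[OF F(1)] linear_add[OF F(2)]
       linear_scale[OF F(1)] linear_scale[OF F(2)] linear_sum[OF F(1)] linear_sum[OF F(2)])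
qed

lemma span_tt_vertex: "span (tt ` planes \<union> vertices) = UNIV"
proof -
  let ?S = "span (tt ` planes \<union> vertices)"
  have t: "tt P \<in> ?S" if "P \<in> planes" for P using that by (intro span_base) auto
  have a: "vertex i \<in> ?S" if "i < 3" for i using that by (intro span_base) (auto simp: vertices_def)
  have "u0 \<in> ?S" unfolding u0_def by (intro span_scale t Winf_plane)
  moreover have "u s \<in> ?S" if "s \<in> pts" for s
    unfolding u_def by (intro span_scale span_diff t PsaP ptsD that)
  moreover have "A \<in> ?S" using span_diff[OF a[of 1] a[of 0]] by (simp add: vertex_simps)
  moreover have "B \<in> ?S" using span_diff[OF a[of 2] a[of 0]] by (simp add: vertex_simps)
  ultimately have "insert u0 (u ` pts) \<union> {A, B - (1/2) *\<^sub>R A} \<subseteq> ?S"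
    by (auto intro: span_diff span_scale)
  then have "span (insert u0 (u ` pts) \<union> {A, B - (1/2) *\<^sub>R A}) \<subseteq> ?S" by (intro span_minimal) auto
  then show ?thesis unfolding frame_span by blast
qed

lemma vertex_inj: "i < 3 \<Longrightarrow> j < 3 \<Longrightarrow> vertex i = vertex j \<Longrightarrow> i = j"
  using vertex_inner[of i j] vertex_inner[of i i] by (auto split: if_splits)

lemma extension_with_vertex:
  assumes p: "aut p" and \<pi>: "\<And>i. i < 3 \<Longrightarrow> \<pi> i < (3::nat)" "inj_on \<pi> {..<3}"
  shows "\<exists>F. orthogonal_transformation F \<and> (\<forall>P\<in>planes. F (tt P) = tt (p P)) \<and> (\<forall>i<3. F (vertex i) = vertex (\<pi> i))"
proof -
  let ?I = "Inl ` planes \<union> Inr ` {..<(3::nat)}"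
  let ?e = "case_sum tt vertex" let ?f = "case_sum (tt \<circ> p) (vertex \<circ> \<pi>)"
  have "?e ` ?I = tt ` planes \<union> vertices" by (simp add: image_Un image_image vertices_def)
  then have 1: "span (?e ` ?I) = UNIV" using span_tt_vertex by simp
  have ta: "tt P \<bullet> vertex i = 0" if "P \<in> planes" for P i using perp_vertex(1)[OF tt_perp[OF that]] .
  have "?f i \<bullet> ?f j = ?e i \<bullet> ?e j" if "i \<in> ?I" "j \<in> ?I" for i j
  proof -
    have aa: "vertex (\<pi> m) \<bullet> vertex (\<pi> n) = vertex m \<bullet> vertex n" if "m < 3" "n < 3" for m n
    proof -
      have "\<pi> m = \<pi> n \<longleftrightarrow> m = n" using that \<pi>(2) by (auto dest: inj_onD)
      then show ?thesis using that \<pi>(1) by (simp add: vertex_inner)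
    qed
    show ?thesis using that
      by (auto simp: aut_inner[OF p] aa ta aut_in[OF p] inner_commute[of "vertex _" "tt _"])
  qed
  from isometry_extension_indexed[OF 1 this] obtain F where F: "orthogonal_transformation F" "\<forall>i\<in>?I. F (?e i) = ?f i" by blast
  have "F (tt P) = tt (p P)" if "P \<in> planes" for P using F(2)[rule_format, of "Inl P"] that by simp
  moreover have "F (vertex i) = vertex (\<pi> i)" if "i < 3" for i using F(2)[rule_format, of "Inr i"] that by simp
  ultimately show ?thesis using F(1) by blast
qed

lemma phi_surj: "T \<in> T_set \<Lambda> A B \<Longrightarrow> \<exists>P\<in>planes. T = \<phi> P"
  using corr by (auto simp: edge_correspondence_def bij_betw_def)

lemma image_M:
  assumes p: "aut p" and F: "linear F" "\<And>P. P \<in> planes \<Longrightarrow> F (tt P) = tt (p P)"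
  shows "F ` M = M"
proof
  show "F ` M \<subseteq> M"
  proof
    fix y assume "y \<in> F ` M"
    then obtain x where x: "x \<in> M" "y = F x" by blast
    have "x \<in> {x. F x \<in> M}" using x(1) unfolding Lambda_AB_def[of \<Lambda> A B]
    proof (rule gc_mono_closed)
      show "{T' - T |T T'. T \<in> T_set \<Lambda> A B \<and> T' \<in> T_set \<Lambda> A B} \<subseteq> {x. F x \<in> group_closure {T' - T |T T'. T \<in> T_set \<Lambda> A B \<and> T' \<in> T_set \<Lambda> A B}}"
      proof
        fix z assume "z \<in> {T' - T |T T'. T \<in> T_set \<Lambda> A B \<and> T' \<in> T_set \<Lambda> A B}"
        then obtain P Q where PQ: "P \<in> planes" "Q \<in> planes" "z = \<phi> Q - \<phi> P" using phi_surj by blast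
        then have "z = tt Q - tt P" by (simp add: tt_def)
        then have "F z = tt (p Q) - tt (p P)" using F PQ by (simp add: linear_diff)
        then have "F z \<in> M" using M_tt_diff[OF aut_in[OF p PQ(2)] aut_in[OF p PQ(1)]] by simp
        then show "z \<in> {x. F x \<in> group_closure {T' - T |T T'. T \<in> T_set \<Lambda> A B \<and> T' \<in> T_set \<Lambda> A B}}"
          unfolding Lambda_AB_def by simp
      qed
    qed (use F(1) in \<open>auto simp: linear_0 linear_diff intro: group_closure.diff\<close>)
    then show "y \<in> M" using x by simp
  qed
  show "M \<subseteq> F ` M"
  proof
    fix x assume "x \<in> M"
    then show "x \<in> F ` M" unfolding Lambda_AB_def[of \<Lambda> A B]
    proof (rule gc_mono_closed)
      show "{T' - T |T T'. T \<in> T_set \<Lambda> A B \<and> T' \<in> T_set \<Lambda> A B} \<subseteq> F ` group_closure {T' - T |T T'. T \<in> T_set \<Lambda> A B \<and> T' \<in> T_set \<Lambda> A B}"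
      proof
        fix z assume "z \<in> {T' - T |T T'. T \<in> T_set \<Lambda> A B \<and> T' \<in> T_set \<Lambda> A B}"
        then obtain P Q where PQ: "P \<in> planes" "Q \<in> planes" "z = \<phi> Q - \<phi> P" using phi_surj by blast
        obtain P' Q' where P': "P' \<in> planes" "p P' = P" "Q' \<in> planes" "p Q' = Q"
          using aut_surj[OF p PQ(1)] aut_surj[OF p PQ(2)] by blast
        have "F (tt Q' - tt P') = tt Q - tt P" using linear_diff[OF F(1), of "tt Q'" "tt P'"] F(2) P' by simp
        also have "\<dots> = z" using PQ(3) by (simp add: tt_def)
        finally have "z = F (tt Q' - tt P')" by simp
        moreover have "tt Q' - tt P' \<in> M" by (intro M_tt_diff P')
        ultimately show "z \<in> F ` group_closure {T' - T |T T'. T \<in> T_set \<Lambda> A B \<and> T' \<in> T_set \<Lambda> A B}"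
          unfolding Lambda_AB_def by blast
      qed
      show "0 \<in> F ` group_closure {T' - T |T T'. T \<in> T_set \<Lambda> A B \<and> T' \<in> T_set \<Lambda> A B}"
        using F(1) by (intro image_eqI[of _ _ 0]) (simp_all add: linear_0)
      show "a - b \<in> F ` group_closure {T' - T |T T'. T \<in> T_set \<Lambda> A B \<and> T' \<in> T_set \<Lambda> A B}"
        if "a \<in> F ` group_closure {T' - T |T T'. T \<in> T_set \<Lambda> A B \<and> T' \<in> T_set \<Lambda> A B}"
         "b \<in> F ` group_closure {T' - T |T T'. T \<in> T_set \<Lambda> A B \<and> T' \<in> T_set \<Lambda> A B}" for a b
        using that F(1) by (auto simp: linear_diff[symmetric] intro: group_closure.diff)
    qed
  qed
qed

lemma Iso_of_subset:
  assumes F: "orthogonal_transformation F" and sub: "F ` \<Lambda> \<subseteq> \<Lambda>"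
  shows "Iso F"
proof -
  have "\<Lambda> \<subseteq> F ` \<Lambda>"
  proof
    fix y assume y: "y \<in> \<Lambda>"
    obtain z where z: "y = F z" using orthogonal_transformation_surj[OF F] by (metis surjD)
    have "z \<in> \<Lambda>"
    proof (rule L_unimodular)
      fix x assume "x \<in> \<Lambda>"
      then have "F x \<bullet> F z \<in> \<int>" using sub y z L_int by blast
      then show "x \<bullet> z \<in> \<int>" using F by (simp add: orthogonal_transformation_def)
    qed
    with z show "y \<in> F ` \<Lambda>" by blast
  qed
  with F sub show ?thesis by (auto simp: Iso_def)
qed

lemma perp_image:
  assumes h: "orthogonal_transformation h" and hV: "h ` vertices = vertices" and x: "x \<bullet> A = 0" "x \<bullet> B = 0"
  shows "h x \<bullet> A = 0" "h x \<bullet> B = 0"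
proof -
  have "h x \<bullet> v = 0" if "v \<in> vertices" for v
  proof -
    obtain v' where v': "v' \<in> vertices" "v = h v'" using hV \<open>v \<in> vertices\<close> by blast
    then have "x \<bullet> v' = 0" using perp_vertex(1)[OF x] by (auto simp: vertices_def)
    then show ?thesis using h v' by (simp add: orthogonal_transformation_def)
  qed
  then have "h x \<bullet> vertex i = 0" if "i < 3" for i using that by (auto simp: vertices_def)
  from this[of 0] this[of 1] this[of 2] show "h x \<bullet> A = 0" "h x \<bullet> B = 0"
    by (simp_all add: vertex_simps inner_diff_right)
qed

text \<open>First extend \<open>p\<close> by the identity on the plane of the triangle to an
  isometry \<open>h\<close> of the space. It maps glue vectors of \<open>R_perp\<close> to glue
  vectors and hence induces a permutation \<open>\<pi>\<close> of the three classes. The extension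
  of \<open>p\<close> that permutes the vertices by \<open>\<pi>\<close> preserves the
  lattice.\<close>

lemma lift_exists: assumes p: "aut p" shows "\<exists>F. lift p F"
proof -
  obtain h where h: "orthogonal_transformation h" "\<And>P. P \<in> planes \<Longrightarrow> h (tt P) = tt (p P)" "\<And>i. i < 3 \<Longrightarrow> h (vertex i) = vertex i"
    using extension_with_vertex[OF p, of "\<lambda>i. i"] by auto
  have hl: "linear h" and hi: "\<And>x y. h x \<bullet> h y = x \<bullet> y" using h(1) by (auto simp: orthogonal_transformation_def)
  have hL: "h ` L = L" using image_M[OF p hl h(2)] by (simp add: M_eq_L)
  have hV: "h ` vertices = vertices" using h(3) by (auto simp: vertices_def image_iff)
  have hinj: "inj h" using h(1) by (rule orthogonal_transformation_inj)
  have inL: "x \<in> L" if "h x \<in> L" for x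
  proof -
    obtain y where "y \<in> L" "h x = h y" using hL \<open>h x \<in> L\<close> by blast
    then show ?thesis using hinj by (metis injD)
  qed
  have hy: "h (yy i) \<bullet> A = 0" "h (yy i) \<bullet> B = 0" if "i < 3" for i using perp_image[OF h(1) hV yy_perp[OF that]] .
  have ynL: "yy i \<notin> L" if i: "i < 3" for i
  proof
    assume y: "yy i \<in> L"
    obtain j :: nat where "j < 3" "j \<noteq> i" by (metis one_less_numeral_iff semiring_norm(77) zero_less_numeral zero_neq_one)
    then show False using yy_not_int[of j i] yy_L[OF _ y, of j] i by blast
  qed
  have "\<exists>k<3. h (yy i) + (3/2) *\<^sub>R vertex k \<in> \<Lambda>" if i: "i < 3" for i
  proof -
    have "h (yy i) \<in> L \<or> (\<exists>k<3. h (yy i) + (3/2) *\<^sub>R vertex k \<in> \<Lambda>)"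
    proof (rule glue[OF hy[OF i]])
      fix l assume "l \<in> L"
      then obtain l' where "l' \<in> L" "l = h l'" using hL by blast
      then show "h (yy i) \<bullet> l \<in> \<int>" using yy_L[OF i] hi by simp
    next
      obtain P where P: "P \<in> planes" "p P = Winf" using aut_surj[OF p Winf_plane] by blast
      then have "tt Winf = h (tt P)" using h(2) by simp
      then show "h (yy i) \<bullet> tt Winf \<in> \<int>" using yy_tt[OF i P(1)] hi by simp
    qed
    then show ?thesis using inL ynL[OF i] by blast
  qed
  then obtain \<pi> where \<pi>: "\<And>i. i < 3 \<Longrightarrow> \<pi> i < (3::nat)" "\<And>i. i < 3 \<Longrightarrow> h (yy i) + (3/2) *\<^sub>R vertex (\<pi> i) \<in> \<Lambda>" by metis
  have inj: "inj_on \<pi> {..<3}"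
  proof (rule inj_onI, rule ccontr)
    fix i j assume ij: "i \<in> {..<3}" "j \<in> {..<3}" "\<pi> i = \<pi> j" "i \<noteq> j"
    have "(h (yy i) + (3/2) *\<^sub>R vertex (\<pi> i)) - (h (yy j) + (3/2) *\<^sub>R vertex (\<pi> j)) \<in> \<Lambda>"
      using ij \<pi>(2)[of i] \<pi>(2)[of j] by (intro L_closed(2)) simp_all
    then have "h (yy i - yy j) \<in> \<Lambda>" using ij(3) hl by (simp add: linear_diff)
    then have "h (yy i - yy j) \<in> L" using hy ij hl by (simp add: L_iff linear_diff inner_diff_left)
    then have "yy i - yy j \<in> L" by (rule inL)
    then have "yy j \<bullet> (yy i - yy j) \<in> \<int>" using yy_L ij by simp
    moreover have "yy j \<bullet> yy j \<in> \<int>" using yy_yy[of j j] ij by simp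
    ultimately have "yy j \<bullet> (yy i - yy j) + yy j \<bullet> yy j \<in> \<int>" by (rule Ints_add)
    then have "yy j \<bullet> yy i \<in> \<int>" by (simp add: inner_diff_right)
    then show False using yy_not_int[of j i] ij by simp
  qed
  obtain F where F: "orthogonal_transformation F" "\<And>P. P \<in> planes \<Longrightarrow> F (tt P) = tt (p P)" "\<And>i. i < 3 \<Longrightarrow> F (vertex i) = vertex (\<pi> i)"
    using extension_with_vertex[OF p \<pi>(1) inj] by blast
  have Fl: "linear F" using F(1) by (simp add: orthogonal_transformation_def)
  have Fh: "F x = h x" if "x \<bullet> A = 0" "x \<bullet> B = 0" for x
    by (rule lin_agree_perp[OF Fl hl _ that]) (simp add: F h)
  have "F x \<in> \<Lambda>" if x: "x \<in> \<Lambda>" for x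
  proof -
    obtain c k n l where c: "c = 0 \<or> (\<exists>i<3. c = xx i)" and l: "l \<in> L"
      and xe: "x = c + of_int k *\<^sub>R \<phi> Winf + of_int n *\<^sub>R B + l" by (rule Lambda_decomp[OF x])
    have 1: "F c \<in> \<Lambda>"
    proof (cases "c = 0")
      case True then show ?thesis using Fl L_closed by (simp add: linear_0)
    next
      case False
      then obtain i where i: "i < 3" "c = xx i" using c by blast
      have "F c = h (yy i) + (3/2) *\<^sub>R vertex (\<pi> i)"
        using Fh[OF yy_perp[OF i(1)]] F(3)[OF i(1)] Fl by (simp add: i xx_eq linear_add linear_scale)
      then show ?thesis using \<pi>(2)[OF i(1)] by simp
    qed
    have "F (\<phi> Winf) = \<phi> (p Winf) - (vertex (\<pi> 0) - vertex 0)"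
    proof -
      have "F (\<phi> Winf) = F (tt Winf - vertex 0)" by (rule arg_cong[of _ _ F]) (simp add: tt_def vertex_simps)
      also have "\<dots> = F (tt Winf) - F (vertex 0)" by (rule linear_diff[OF Fl])
      finally show ?thesis using F(2)[OF Winf_plane] F(3)[of 0] by (simp add: tt_def vertex_simps)
    qed
    then have 2: "F (\<phi> Winf) \<in> \<Lambda>"
      using vertex_diff[OF \<pi>(1)[of 0], of 0] T_setD(1)[OF phi_T[OF aut_in[OF p Winf_plane]]] by (simp add: L_closed)
    have "F B = F (vertex 2 - vertex 0)" by (rule arg_cong[of _ _ F]) (simp add: vertex_simps)
    then have "F B = vertex (\<pi> 2) - vertex (\<pi> 0)" using linear_diff[OF Fl, of "vertex 2" "vertex 0"] F(3)[of 2] F(3)[of 0] by simp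
    then have 3: "F B \<in> \<Lambda>" using vertex_diff[OF \<pi>(1) \<pi>(1), of 2 0] by simp
    have 4: "F l \<in> \<Lambda>" using Fh[of l] hL l by (auto simp: L_iff)
    have "F x = F c + of_int k *\<^sub>R F (\<phi> Winf) + of_int n *\<^sub>R F B + F l"
      unfolding xe linear_add[OF Fl] linear_scale[OF Fl] ..
    then show ?thesis using 1 2 3 4 by (simp add: L_closed)
  qed
  then have "Iso F" by (intro Iso_of_subset F) auto
  moreover have "F ` vertices = vertices"
  proof -
    have "\<pi> ` {..<3} = {..<3}" using \<pi>(1) inj by (intro endo_inj_surj) auto
    then have "vertex ` \<pi> ` {..<3} = vertices" by (simp add: vertices_def)
    moreover have "F ` vertices = vertex ` \<pi> ` {..<3}" using F(3) by (auto simp: vertices_def image_iff)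
    ultimately show ?thesis by simp
  qed
  ultimately show ?thesis using F by (auto simp: lift_def)
qed

text \<open>The norm would be the odd integer 9.\<close>

lemma half_vertex_diff_not_in: "i < 3 \<Longrightarrow> j < 3 \<Longrightarrow> (3/2) *\<^sub>R (vertex i - vertex j) \<in> \<Lambda> \<Longrightarrow> i = j"
proof (rule ccontr)
  assume ij: "i < 3" "j < 3" "i \<noteq> j" and "(3/2) *\<^sub>R (vertex i - vertex j) \<in> \<Lambda>"
  moreover have "((3/2) *\<^sub>R (vertex i - vertex j)) \<bullet> ((3/2) *\<^sub>R (vertex i - vertex j)) = of_int 9"
    using ij by (simp add: inner_diff_left inner_diff_right vertex_inner)
  ultimately have "even (9::int)" using even_norm_int by blast
  then show False by simp
qed

text \<open>The two maps agree on the complement of the triangle, hence on \<open>yy i\<close>;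
  their difference on \<open>xx i\<close> is \<open>3/2\<close> times a difference of two
  vertices, and this is a lattice vector only if the vertices agree
  (\<open>half_vertex_diff_not_in\<close>).\<close>

lemma eq_on_tt_plus:
  assumes F: "Iso F" "F ` vertices = vertices" and F': "Iso F'" "F' ` vertices = vertices"
    and e: "\<And>P. P \<in> planes \<Longrightarrow> F (tt P) = F' (tt P)"
  shows "F = F'"
proof -
  have "F (vertex i) = F' (vertex i)" if i: "i < 3" for i
  proof -
    have "F (vertex i) \<in> vertices" "F' (vertex i) \<in> vertices" using F F' i by (auto simp: vertices_def)
    then obtain j j' where j: "j < 3" "F (vertex i) = vertex j" "j' < 3" "F' (vertex i) = vertex j'" by (auto simp: vertices_def)
    have "F (yy i) = F' (yy i)" by (rule lin_agree_perp[OF Iso_lin[OF F(1)] Iso_lin[OF F'(1)] e yy_perp[OF i]])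
    then have "F (xx i) - F' (xx i) = (3/2) *\<^sub>R (vertex j - vertex j')"
      using Iso_lin[OF F(1)] Iso_lin[OF F'(1)] j by (simp add: xx_eq linear_add linear_scale scaleR_diff_right)
    moreover have "F (xx i) - F' (xx i) \<in> \<Lambda>" using Iso_Lambda F F' xx[OF i] by (simp add: L_closed)
    ultimately have "j = j'" using half_vertex_diff_not_in j by simp
    then show ?thesis using j by simp
  qed
  then have "F x = F' x" if "x \<in> tt ` planes \<union> vertices" for x using that e by (auto simp: vertices_def)
  then have "F x = F' x" for x
    using linear_eq_on_span[OF Iso_lin[OF F(1)] Iso_lin[OF F'(1)], of "tt ` planes \<union> vertices" x] span_tt_vertex by auto
  then show ?thesis by blast
qed

lemma lift_unique: "lift p F \<Longrightarrow> lift p F' \<Longrightarrow> F = F'"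
  by (rule eq_on_tt_plus) (auto simp: lift_def)

section \<open>The stabilizer of the triangle lattice\<close>

lemma R_closed: "0 \<in> R_AB A B" "A \<in> R_AB A B" "B \<in> R_AB A B"
  "x \<in> R_AB A B \<Longrightarrow> y \<in> R_AB A B \<Longrightarrow> x - y \<in> R_AB A B" "x \<in> R_AB A B \<Longrightarrow> - x \<in> R_AB A B"
  unfolding R_AB_def by (auto intro: group_closure.base group_closure.diff)

lemma R_sub: "R_AB A B \<subseteq> \<Lambda>"
proof
  fix r assume "r \<in> R_AB A B"
  then show "r \<in> \<Lambda>" unfolding R_AB_def by (rule gc_mono_closed) (use AB L_closed in auto)
qed

lemma R_form: "r \<in> R_AB A B \<Longrightarrow> \<exists>a b. r = of_int a *\<^sub>R A + of_int b *\<^sub>R B"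
proof -
  assume "r \<in> R_AB A B"
  then have "r \<in> {r. \<exists>a b. r = of_int a *\<^sub>R A + of_int b *\<^sub>R B}"
    unfolding R_AB_def
  proof (rule gc_mono_closed)
    have "A = of_int 1 *\<^sub>R A + of_int 0 *\<^sub>R B" "B = of_int 0 *\<^sub>R A + of_int 1 *\<^sub>R B" by simp_all
    then show "{A, B} \<subseteq> {r. \<exists>a b. r = of_int a *\<^sub>R A + of_int b *\<^sub>R B}" by blast
    have "0 = of_int 0 *\<^sub>R A + of_int 0 *\<^sub>R B" by simp
    then show "0 \<in> {r. \<exists>a b. r = of_int a *\<^sub>R A + of_int b *\<^sub>R B}" by blast
  next
    fix x y assume "x \<in> {r. \<exists>a b. r = of_int a *\<^sub>R A + of_int b *\<^sub>R B}" "y \<in> {r. \<exists>a b. r = of_int a *\<^sub>R A + of_int b *\<^sub>R B}"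
    then obtain a b c d where "x = of_int a *\<^sub>R A + of_int b *\<^sub>R B" "y = of_int c *\<^sub>R A + of_int d *\<^sub>R B" by blast
    then have "x - y = of_int (a - c) *\<^sub>R A + of_int (b - d) *\<^sub>R B" by (simp add: algebra_simps)
    then show "x - y \<in> {r. \<exists>a b. r = of_int a *\<^sub>R A + of_int b *\<^sub>R B}" by blast
  qed
  then show ?thesis by blast
qed

lemma vertex_diff_R: "i < 3 \<Longrightarrow> j < 3 \<Longrightarrow> vertex i - vertex j \<in> R_AB A B"
proof -
  assume ij: "i < 3" "j < 3"
  have "A - B \<in> R_AB A B" "B - A \<in> R_AB A B" "- A \<in> R_AB A B" "- B \<in> R_AB A B" using R_closed by simp_all
  then show ?thesis using less3[OF ij(1)] less3[OF ij(2)] R_closed(1-3)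
    by (elim disjE) (simp_all add: vertex_simps)
qed

text \<open>In the hexagonal lattice the form is \<open>4 (a\<^sup>2 + a b + b\<^sup>2)\<close>,
  so there are exactly six vectors of norm 4, the differences of the vertices.\<close>

lemma R_norm4:
  assumes "r \<in> R_AB A B" "r \<bullet> r = 4"
  shows "\<exists>i<3. \<exists>j<3. i \<noteq> j \<and> r = vertex i - vertex j"
proof -
  obtain a b where ab: "r = of_int a *\<^sub>R A + of_int b *\<^sub>R B" using R_form[OF assms(1)] by blast
  have "r \<bullet> r = real_of_int (4 * (a * a + a * b + b * b))"
    by (simp add: ab inner_add_left inner_add_right AB_inner algebra_simps)
  then have "real_of_int (4 * (a * a + a * b + b * b)) = real_of_int 4" using assms(2) by simp
  then have "4 * (a * a + a * b + b * b) = 4" by (simp only: of_int_eq_iff)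
  then have e: "a * a + a * b + b * b = 1" by simp
  have "(2 * a + b) ^ 2 + 3 * b ^ 2 = 4" "(2 * b + a) ^ 2 + 3 * a ^ 2 = 4"
    using e by (simp_all add: power2_eq_square algebra_simps)
  then have "b ^ 2 \<le> 1" "a ^ 2 \<le> 1" using zero_le_power2[of "2 * a + b"] zero_le_power2[of "2 * b + a"] by linarith+
  then have "\<bar>a\<bar> \<le> 1" "\<bar>b\<bar> \<le> 1" by (simp_all add: abs_square_le_1)
  then have "a \<in> {-1, 0, 1}" "b \<in> {-1, 0, 1}" by auto
  then have "(a, b) \<in> {(1, 0), (-1, 0), (0, 1), (0, -1), (1, -1), (-1, 1)}" using e by auto
  then have "a = 1 \<and> b = 0 \<or> a = -1 \<and> b = 0 \<or> a = 0 \<and> b = 1 \<or> a = 0 \<and> b = -1 \<or> a = 1 \<and> b = -1 \<or> a = -1 \<and> b = 1"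
    by simp
  then have d: "r = vertex 1 - vertex 0 \<or> r = vertex 0 - vertex 1 \<or> r = vertex 2 - vertex 0 \<or> r = vertex 0 - vertex 2 \<or> r = vertex 1 - vertex 2 \<or> r = vertex 2 - vertex 1"
    unfolding ab by (elim disjE) (simp_all add: vertex_simps)
  have ex: ?thesis if "i < 3" "j < 3" "i \<noteq> j" "r = vertex i - vertex j" for i j using that by blast
  from d show ?thesis
  proof (elim disjE)
    assume "r = vertex 1 - vertex 0" then show ?thesis by (intro ex[of 1 0]) simp_all
  next
    assume "r = vertex 0 - vertex 1" then show ?thesis by (intro ex[of 0 1]) simp_all
  next
    assume "r = vertex 2 - vertex 0" then show ?thesis by (intro ex[of 2 0]) simp_all
  next
    assume "r = vertex 0 - vertex 2" then show ?thesis by (intro ex[of 0 2]) simp_all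
  next
    assume "r = vertex 1 - vertex 2" then show ?thesis by (intro ex[of 1 2]) simp_all
  next
    assume "r = vertex 2 - vertex 1" then show ?thesis by (intro ex[of 2 1]) simp_all
  qed
qed

lemma span_Lambda: "span \<Lambda> = UNIV"
proof -
  obtain E where E: "span E = UNIV" "\<Lambda> = group_closure E" using leech by (auto simp: leech_lattice_def)
  then have "E \<subseteq> \<Lambda>" by (auto intro: group_closure.base)
  then show ?thesis using span_mono[of E \<Lambda>] E(1) by auto
qed

lemma restrict_Lambda_inj:
  assumes "linear F" "linear F'" "\<And>x. x \<in> \<Lambda> \<Longrightarrow> F x = F' x" shows "F = F'"
proof
  fix x show "F x = F' x" using linear_eq_on_span[OF assms(1,2), of \<Lambda> x] assms(3) span_Lambda by auto
qed

text \<open>Isometries of the lattice that map the triangle to itself up to the central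
  reflection: \<open>e\<close> is the sign.\<close>

definition sgn_type :: "real \<Rightarrow> (real ^ 24 \<Rightarrow> real ^ 24) \<Rightarrow> bool" where
  "sgn_type e F \<longleftrightarrow> Iso F \<and> (\<forall>i<3. \<exists>j<3. F (vertex i) = e *\<^sub>R vertex j)"

lemma carrier_orth: "carrier (orth_group S) =
    {f \<in> Bij S. (\<forall>x\<in>S. \<forall>y\<in>S. f (x + y) = f x + f y) \<and> (\<forall>x\<in>S. \<forall>y\<in>S. f x \<bullet> f y = x \<bullet> y)}"
  by (simp add: orth_group_def)

lemma carrier_circ: "carrier (circ222 \<Lambda> A B) = {g \<in> carrier (orth_group \<Lambda>). g ` R_AB A B = R_AB A B}"
  by (simp add: circ222_def)

lemma Iso_restrict_orth: assumes "Iso F" shows "restrict F \<Lambda> \<in> carrier (orth_group \<Lambda>)"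
proof -
  have "bij_betw F \<Lambda> \<Lambda>" using assms Iso_inj[OF assms] by (auto simp: bij_betw_def Iso_def intro: inj_on_subset)
  then have "restrict F \<Lambda> \<in> Bij \<Lambda>" by (simp add: Bij_def)
  then show ?thesis unfolding carrier_orth using Iso_inner[OF assms] linear_add[OF Iso_lin[OF assms]] L_closed by simp
qed

lemma orth_extend: assumes "g \<in> carrier (orth_group \<Lambda>)" shows "\<exists>F. Iso F \<and> g = restrict F \<Lambda>"
proof -
  have g: "g \<in> extensional \<Lambda>" "g ` \<Lambda> = \<Lambda>" "\<And>x y. x \<in> \<Lambda> \<Longrightarrow> y \<in> \<Lambda> \<Longrightarrow> g x \<bullet> g y = x \<bullet> y"
    using assms unfolding carrier_orth Bij_def bij_betw_def by auto
  obtain F where F: "orthogonal_transformation F" "\<And>x. x \<in> \<Lambda> \<Longrightarrow> F x = g x"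
    using isometry_extension[OF span_Lambda g(3)] by blast
  have "F ` \<Lambda> = g ` \<Lambda>" using F(2) by (intro image_cong) auto
  then have "Iso F" using F(1) g(2) by (simp add: Iso_def)
  moreover have "g = restrict F \<Lambda>" using g(1) F(2) by (auto simp: restrict_def extensional_def fun_eq_iff)
  ultimately show ?thesis by blast
qed

lemma sgn_inj: assumes e: "e = 1 \<or> e = -1" and F: "sgn_type e F" shows "\<exists>\<pi>. (\<forall>i<3. \<pi> i < (3::nat) \<and> F (vertex i) = e *\<^sub>R vertex (\<pi> i)) \<and> inj_on \<pi> {..<3}"
proof -
  obtain \<pi> where \<pi>: "\<And>i. i < 3 \<Longrightarrow> \<pi> i < (3::nat) \<and> F (vertex i) = e *\<^sub>R vertex (\<pi> i)" using F unfolding sgn_type_def by metis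
  have "inj_on \<pi> {..<3}"
  proof (rule inj_onI)
    fix i j assume ij: "i \<in> {..<3}" "j \<in> {..<3}" "\<pi> i = \<pi> j"
    then have "F (vertex i) = F (vertex j)" using \<pi> by simp
    then have "vertex i = vertex j" using F Iso_inj unfolding sgn_type_def by (metis injD)
    then show "i = j" using vertex_inj ij by simp
  qed
  with \<pi> show ?thesis by blast
qed

lemma sgn_plus_vertices: "sgn_type 1 F \<longleftrightarrow> Iso F \<and> F ` vertices = vertices"
proof
  assume F: "sgn_type 1 F"
  obtain \<pi> where \<pi>: "\<And>i. i < 3 \<Longrightarrow> \<pi> i < (3::nat) \<and> F (vertex i) = 1 *\<^sub>R vertex (\<pi> i)" "inj_on \<pi> {..<3}"
    using sgn_inj[OF _ F] by blast
  have "\<pi> ` {..<3} = {..<3}" using \<pi> by (intro endo_inj_surj) auto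
  then have "vertex ` \<pi> ` {..<3} = vertices" by (simp add: vertices_def)
  moreover have "F ` vertices = vertex ` \<pi> ` {..<3}" using \<pi>(1) by (auto simp: vertices_def image_iff)
  ultimately show "Iso F \<and> F ` vertices = vertices" using F by (simp add: sgn_type_def)
next
  assume F: "Iso F \<and> F ` vertices = vertices"
  have "\<exists>j<3. F (vertex i) = 1 *\<^sub>R vertex j" if "i < 3" for i
  proof -
    have "F (vertex i) \<in> F ` vertices" using that by (auto simp: vertices_def)
    then show ?thesis using F by (auto simp: vertices_def)
  qed
  with F show "sgn_type 1 F" by (auto simp: sgn_type_def)
qed

lemma Iso_neg: "Iso F \<Longrightarrow> Iso (\<lambda>x. - F x)"
proof -
  assume F: "Iso F"
  have "orthogonal_transformation (\<lambda>x. - F x)" using F by (simp add: Iso_def orthogonal_transformation_neg)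
  then show ?thesis by (rule Iso_of_subset) (use Iso_Lambda[OF F] L_closed in auto)
qed

lemma sgn_neg: "sgn_type e F \<Longrightarrow> sgn_type (- e) (\<lambda>x. - F x)"
  by (auto simp: sgn_type_def Iso_neg)

lemma sgn_circ: assumes e: "e = 1 \<or> e = -1" and F: "sgn_type e F" shows "restrict F \<Lambda> \<in> carrier (circ222 \<Lambda> A B)"
proof -
  have I: "Iso F" and l: "linear F" using F Iso_lin by (auto simp: sgn_type_def)
  obtain \<pi> where \<pi>: "\<And>i. i < 3 \<Longrightarrow> \<pi> i < (3::nat) \<and> F (vertex i) = e *\<^sub>R vertex (\<pi> i)" "inj_on \<pi> {..<3}"
    using sgn_inj[OF e F] by blast
  have surj: "\<pi> ` {..<3} = {..<3}" using \<pi> by (intro endo_inj_surj) auto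
  have d: "F (vertex i - vertex j) = e *\<^sub>R (vertex (\<pi> i) - vertex (\<pi> j))" if "i < 3" "j < 3" for i j
    using \<pi>(1) that by (simp add: linear_diff[OF l] scaleR_diff_right)
  have eR: "e *\<^sub>R x \<in> R_AB A B" if "x \<in> R_AB A B" for x using e R_closed(5)[OF that] that by auto
  have AB': "A = vertex 1 - vertex 0" "B = vertex 2 - vertex 0" by (simp_all add: vertex_simps)
  have FA: "F A = e *\<^sub>R (vertex (\<pi> 1) - vertex (\<pi> 0))" "F B = e *\<^sub>R (vertex (\<pi> 2) - vertex (\<pi> 0))"
    using d[of 1 0] d[of 2 0] AB'[symmetric] by simp_all
  have "F ` R_AB A B \<subseteq> R_AB A B"
  proof
    fix y assume "y \<in> F ` R_AB A B"
    then obtain x where x: "x \<in> R_AB A B" "y = F x" by blast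
    have "x \<in> {x. F x \<in> R_AB A B}"
      using x(1) unfolding R_AB_def[of A B]
    proof (rule gc_mono_closed)
      have "F A \<in> R_AB A B" "F B \<in> R_AB A B" unfolding FA using \<pi>(1) by (auto intro!: eR vertex_diff_R)
      then show "{A, B} \<subseteq> {x. F x \<in> group_closure {A, B}}" by (simp add: R_AB_def)
    qed (use l in \<open>auto simp: linear_0 linear_diff intro: group_closure.diff\<close>)
    with x show "y \<in> R_AB A B" by simp
  qed
  moreover have "R_AB A B \<subseteq> F ` R_AB A B"
  proof
    have im: "e *\<^sub>R (vertex i - vertex j) \<in> F ` R_AB A B" if ij: "i < 3" "j < 3" for i j
    proof -
      have "i \<in> \<pi> ` {..<3}" "j \<in> \<pi> ` {..<3}" using surj ij by simp_all
      then obtain i' j' where i': "i' < 3" "j' < 3" "\<pi> i' = i" "\<pi> j' = j" by auto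
      have "F (vertex i' - vertex j') = e *\<^sub>R (vertex i - vertex j)" using d[OF i'(1,2)] i' by simp
      then show ?thesis using vertex_diff_R[OF i'(1,2)] by (metis imageI)
    qed
    have sub: "- y \<in> F ` R_AB A B" if "y \<in> F ` R_AB A B" for y
    proof -
      obtain x where "x \<in> R_AB A B" "y = F x" using \<open>y \<in> F ` R_AB A B\<close> by blast
      then have "- x \<in> R_AB A B" "F (- x) = - y" using R_closed(5) linear_neg[OF l] by simp_all
      then show ?thesis by (metis imageI)
    qed
    have "vertex i - vertex j \<in> F ` R_AB A B" if "i < 3" "j < 3" for i j
    proof (cases "e = 1")
      case True then show ?thesis using im[OF that] by simp
    next
      case False
      then have "- (e *\<^sub>R (vertex i - vertex j)) = vertex i - vertex j" using e by simp
      then show ?thesis using sub[OF im[OF that]] by simp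
    qed
    from this[of 1 0] this[of 2 0] have AB'': "A \<in> F ` R_AB A B" "B \<in> F ` R_AB A B" using AB'[symmetric] by simp_all
    fix x assume "x \<in> R_AB A B"
    then show "x \<in> F ` R_AB A B" unfolding R_AB_def[of A B]
    proof (rule gc_mono_closed)
      show "{A, B} \<subseteq> F ` group_closure {A, B}" using AB'' by (simp add: R_AB_def)
      show "0 \<in> F ` group_closure {A, B}" using l by (intro image_eqI[of _ _ 0]) (simp_all add: linear_0)
      show "a - b \<in> F ` group_closure {A, B}" if "a \<in> F ` group_closure {A, B}" "b \<in> F ` group_closure {A, B}" for a b
        using that l by (auto simp: linear_diff[symmetric] intro: group_closure.diff)
    qed
  qed
  ultimately have "F ` R_AB A B = R_AB A B" by blast
  moreover have "restrict F \<Lambda> ` R_AB A B = F ` R_AB A B" using R_sub by (intro image_cong) auto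
  ultimately show ?thesis using Iso_restrict_orth[OF I] by (simp add: carrier_circ)
qed

lemma vertex_sum_distinct: "i < 3 \<Longrightarrow> j < 3 \<Longrightarrow> k < (3::nat) \<Longrightarrow> i \<noteq> j \<Longrightarrow> j \<noteq> k \<Longrightarrow> i \<noteq> k \<Longrightarrow> vertex i + vertex j + vertex k = 0"
  by (drule less3, drule less3, drule less3, elim disjE) (use vertex_sum in \<open>simp_all add: add_ac\<close>)

text \<open>\<open>A\<close> and \<open>B\<close> are mapped to differences of vertices with inner
  product 2. Such a pair of differences has a common first vertex or a common last vertex; these
  are the cases of sign \<open>- 1\<close> and \<open>1\<close>.\<close>

lemma circ_cases: assumes "g \<in> carrier (circ222 \<Lambda> A B)"
  shows "\<exists>F e. (e = 1 \<or> e = -1) \<and> sgn_type e F \<and> g = restrict F \<Lambda>"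
proof -
  have g: "g \<in> carrier (orth_group \<Lambda>)" "g ` R_AB A B = R_AB A B" using assms by (auto simp: carrier_circ)
  obtain F where F: "Iso F" "g = restrict F \<Lambda>" using orth_extend[OF g(1)] by blast
  have l: "linear F" using Iso_lin[OF F(1)] .
  have FR: "F x \<in> R_AB A B" if "x \<in> R_AB A B" for x
  proof -
    have "g x = F x" using F(2) that R_sub by auto
    then show ?thesis using g(2) that by (metis imageI)
  qed
  have "F A \<bullet> F A = 4" "F B \<bullet> F B = 4" "F A \<bullet> F B = 2" using Iso_inner[OF F(1)] AB_inner by simp_all
  then obtain i j k m where ij: "i < 3" "j < 3" "i \<noteq> j" "F A = vertex i - vertex j" and km: "k < 3" "m < 3" "k \<noteq> m" "F B = vertex k - vertex m"
    using R_norm4[OF FR[OF R_closed(2)]] R_norm4[OF FR[OF R_closed(3)]] by auto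
  have in2: "(vertex i - vertex j) \<bullet> (vertex k - vertex m) = 2" using \<open>F A \<bullet> F B = 2\<close> ij km by simp
  have c: "i = k \<and> j \<noteq> m \<or> j = m \<and> i \<noteq> k"
    using in2 ij(1-3) km(1-3) by (simp add: inner_diff_left inner_diff_right vertex_inner split: if_splits)
  have a0: "3 *\<^sub>R vertex 0 = - A - B"
  proof -
    have "3 *\<^sub>R G = A + B" by (simp add: G_def)
    then show ?thesis by (simp add: vertex_simps)
  qed
  have F0: "3 *\<^sub>R F (vertex 0) = - F A - F B"
    using arg_cong[OF a0, of F] l by (simp add: linear_scale linear_diff linear_neg)
  have F1: "F (vertex 1) = F A + F (vertex 0)" "F (vertex 2) = F B + F (vertex 0)"
    by (simp_all add: vertex_simps linear_diff[OF l] linear_neg[OF l])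
  have three: "x + x + x = 3 *\<^sub>R x" for x :: "real^24" using scaleR_add_left[of 2 1 x] scaleR_2[of x] by simp
  have all3: "sgn_type e F" if "a < 3" "b < 3" "c < 3" "F (vertex 0) = e *\<^sub>R vertex a" "F (vertex 1) = e *\<^sub>R vertex b" "F (vertex 2) = e *\<^sub>R vertex c" for e a b c
    unfolding sgn_type_def all_less3 using F(1) that by blast
  show ?thesis
  proof (cases "i = k \<and> j \<noteq> m")
    case True
    have s: "vertex i + vertex j + vertex m = 0" using ij km True by (intro vertex_sum_distinct) auto
    have "3 *\<^sub>R F (vertex 0) = 3 *\<^sub>R (- vertex i)"
    proof -
      have "- (vertex i - vertex j) - (vertex k - vertex m) = (vertex i + vertex j + vertex m) - (vertex i + vertex i + vertex i)" using True by simp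
      then show ?thesis unfolding F0 ij(4) km(4) s three by simp
    qed
    then have "F (vertex 0) = - vertex i" unfolding scaleR_cancel_left by simp
    then have f0: "F (vertex 0) = (-1) *\<^sub>R vertex i" by simp
    then have "F (vertex 1) = (-1) *\<^sub>R vertex j" "F (vertex 2) = (-1) *\<^sub>R vertex m" using F1 ij km True by simp_all
    then have "sgn_type (-1) F" using f0 all3[of i j m "-1"] ij km by blast
    then show ?thesis using F by blast
  next
    case False
    then have jm: "j = m" "i \<noteq> k" using c by auto
    have s: "vertex i + vertex j + vertex k = 0" using ij km jm by (intro vertex_sum_distinct) auto
    have "3 *\<^sub>R F (vertex 0) = 3 *\<^sub>R (vertex j)"
    proof -
      have "- (vertex i - vertex j) - (vertex k - vertex m) = (vertex j + vertex j + vertex j) - (vertex i + vertex j + vertex k)" using jm by simp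
      then show ?thesis unfolding F0 ij(4) km(4) s three by simp
    qed
    then have f0: "F (vertex 0) = 1 *\<^sub>R vertex j" by simp
    then have "F (vertex 1) = 1 *\<^sub>R vertex i" "F (vertex 2) = 1 *\<^sub>R vertex k" using F1 ij km jm by simp_all
    then have "sgn_type 1 F" using f0 all3[of j i k 1] ij km by blast
    then show ?thesis using F by blast
  qed
qed

text \<open>For equal signs this is \<open>eq_on_tt_plus\<close>. For different signs the images
  of \<open>\<phi> Winf\<close> differ by \<open>- vertex j - vertex k\<close>, whose norm is
  \<open>16/3\<close> or \<open>4/3\<close>, so that the difference cannot be a lattice
  vector.\<close>

lemma sgn_tt_unique:
  assumes "e = 1 \<or> e = -1" "e' = 1 \<or> e' = -1" "sgn_type e F" "sgn_type e' F'"
    and t: "\<And>P. P \<in> planes \<Longrightarrow> F (tt P) = F' (tt P)"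
  shows "F = F'"
proof -
  have I: "Iso F" "Iso F'" using assms by (auto simp: sgn_type_def)
  have no: False if XY1: "sgn_type 1 X" "sgn_type (-1) Y" and XYt: "\<And>P. P \<in> planes \<Longrightarrow> X (tt P) = Y (tt P)" for X Y
  proof -
    have XY: "Iso X" "Iso Y" using XY1 by (auto simp: sgn_type_def)
    obtain j k where jk: "j < 3" "X (vertex 0) = vertex j" "k < 3" "Y (vertex 0) = - vertex k"
      using XY1 unfolding sgn_type_def all_less3 by auto
    have p: "\<phi> Winf = tt Winf - vertex 0" by (simp add: tt_def vertex_simps)
    have "X (\<phi> Winf) - Y (\<phi> Winf) = - vertex j - vertex k"
      unfolding p linear_diff[OF Iso_lin[OF XY(1)]] linear_diff[OF Iso_lin[OF XY(2)]] using jk XYt[OF Winf_plane] by simp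
    moreover have "X (\<phi> Winf) - Y (\<phi> Winf) \<in> \<Lambda>"
      using Iso_Lambda XY T_setD(1)[OF phi_T[OF Winf_plane]] by (simp add: L_closed)
    ultimately have "- vertex j - vertex k \<in> \<Lambda>" by simp
    then obtain n where "(- vertex j - vertex k) \<bullet> (- vertex j - vertex k) = 2 * of_int n" using L_even by blast
    moreover have "(- vertex j - vertex k) \<bullet> (- vertex j - vertex k) = (if j = k then 16/3 else 4/3)"
      using jk by (simp add: inner_diff_left inner_diff_right vertex_inner)
    ultimately have "real_of_int (6 * n) = real_of_int (if j = k then 16 else 4)" by (simp split: if_splits)
    then have "6 * n = (if j = k then 16 else 4)" by (simp only: of_int_eq_iff)
    then show False by (simp split: if_splits) presburger+
  qed
  have pp: "X = Y" if "sgn_type 1 X" "sgn_type 1 Y" "\<And>P. P \<in> planes \<Longrightarrow> X (tt P) = Y (tt P)" for X Y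
    using that by (intro eq_on_tt_plus) (auto simp: sgn_plus_vertices)
  consider "e = 1" "e' = 1" | "e = 1" "e' = -1" | "e = -1" "e' = 1" | "e = -1" "e' = -1" using assms(1,2) by blast
  then show ?thesis
  proof cases
    case 1 then show ?thesis using pp assms by blast
  next
    case 2 then show ?thesis using no[of F F'] assms by blast
  next
    case 3 then show ?thesis using no[of F' F] assms by metis
  next
    case 4
    then have "(\<lambda>x. - F x) = (\<lambda>x. - F' x)" using sgn_neg[of "-1" F] sgn_neg[of "-1" F'] assms by (intro pp) simp_all
    then show ?thesis by (simp add: fun_eq_iff)
  qed
qed

lemma sigma_inj: "inj_on (sigma_AB \<Lambda> A B) (carrier (circ222 \<Lambda> A B))"
proof (rule inj_onI)
  fix g g' assume g: "g \<in> carrier (circ222 \<Lambda> A B)" "g' \<in> carrier (circ222 \<Lambda> A B)" and e: "sigma_AB \<Lambda> A B g = sigma_AB \<Lambda> A B g'"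
  obtain F e where F: "e = 1 \<or> e = -1" "sgn_type e F" "g = restrict F \<Lambda>" using circ_cases[OF g(1)] by blast
  obtain F' e' where F': "e' = 1 \<or> e' = -1" "sgn_type e' F'" "g' = restrict F' \<Lambda>" using circ_cases[OF g(2)] by blast
  have l: "linear F" "linear F'" using F(2) F'(2) Iso_lin by (auto simp: sgn_type_def)
  have "F (tt P) = F' (tt P)" if P: "P \<in> planes" for P
  proof -
    have "3 *\<^sub>R tt P \<in> L" using M_3tt[OF P] M_sub_L by blast
    moreover then have "3 *\<^sub>R tt P \<in> \<Lambda>" by (simp add: L_iff)
    ultimately have "F (3 *\<^sub>R tt P) = F' (3 *\<^sub>R tt P)"
      using fun_cong[OF e, of "3 *\<^sub>R tt P"] F(3) F'(3) by (simp add: sigma_AB_def)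
    then show ?thesis using l by (simp add: linear_scale)
  qed
  then have "F = F'" using sgn_tt_unique F F' by blast
  then show "g = g'" using F F' by simp
qed

lemma by_phi_apply:
  assumes "P \<in> planes" shows "by_phi \<Lambda> A B \<phi> f (\<phi> P) = \<phi> (f P)"
proof -
  have "inj_on \<phi> planes" using corr by (simp add: edge_correspondence_def bij_betw_def)
  then show ?thesis using phi_T[OF assms] assms by (simp add: by_phi_def)
qed

text \<open>The restriction of the lift has the property that characterizes \<open>tau_T\<close>,
  and the differences of the elements of \<open>T_set\<close> generate the lattice.\<close>

lemma tau_lift:
  assumes p: "aut p" and F: "lift p F"
  shows "tau_T \<Lambda> A B (by_phi \<Lambda> A B \<phi> p) = restrict F M"
  unfolding tau_T_def
proof (rule the_equality)
  have I: "Iso F" "linear F" and Ft: "\<And>P. P \<in> planes \<Longrightarrow> F (tt P) = tt (p P)" using F Iso_lin by (auto simp: lift_def)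
  have gen: "F (T' - T) = by_phi \<Lambda> A B \<phi> p T' - by_phi \<Lambda> A B \<phi> p T" if tT: "T \<in> T_set \<Lambda> A B" "T' \<in> T_set \<Lambda> A B" for T T'
  proof -
    obtain P Q where PQ: "P \<in> planes" "T = \<phi> P" "Q \<in> planes" "T' = \<phi> Q" using phi_surj[OF tT(1)] phi_surj[OF tT(2)] by blast
    have "T' - T = tt Q - tt P" using PQ by (simp add: tt_def)
    then have "F (T' - T) = tt (p Q) - tt (p P)" using Ft PQ by (simp add: linear_diff[OF I(2)])
    also have "\<dots> = \<phi> (p Q) - \<phi> (p P)" by (simp add: tt_def)
    finally show ?thesis using PQ by (simp add: by_phi_apply)
  qed
  have FM: "F ` M = M" by (rule image_M[OF p I(2) Ft])
  have "bij_betw F M M" using FM Iso_inj[OF I(1)] by (auto simp: bij_betw_def intro: inj_on_subset)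
  then have "restrict F M \<in> Bij M" by (simp add: Bij_def)
  then have "restrict F M \<in> carrier (orth_group M)"
    unfolding carrier_orth using M_closed(3) Iso_inner[OF I(1)] linear_add[OF I(2)] by simp
  moreover have Tin: "T' - T \<in> M" if "T \<in> T_set \<Lambda> A B" "T' \<in> T_set \<Lambda> A B" for T T'
    unfolding Lambda_AB_def using that by (intro group_closure.base) blast
  ultimately show "restrict F M \<in> carrier (orth_group M) \<and>
     (\<forall>T\<in>T_set \<Lambda> A B. \<forall>T'\<in>T_set \<Lambda> A B. restrict F M (T' - T) = by_phi \<Lambda> A B \<phi> p T' - by_phi \<Lambda> A B \<phi> p T)"
    using gen by simp
  fix h assume h: "h \<in> carrier (orth_group M) \<and>
     (\<forall>T\<in>T_set \<Lambda> A B. \<forall>T'\<in>T_set \<Lambda> A B. h (T' - T) = by_phi \<Lambda> A B \<phi> p T' - by_phi \<Lambda> A B \<phi> p T)"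
  have hadd: "h (x + y) = h x + h y" if "x \<in> M" "y \<in> M" for x y using h that by (simp add: carrier_orth)
  have h0: "h 0 = 0" using hadd[OF M_closed(1) M_closed(1)] by simp
  have hd: "h (x - y) = h x - h y" if "x \<in> M" "y \<in> M" for x y
    using hadd[OF M_closed(2)[OF that] that(2)] by simp
  have hF: "x \<in> {x \<in> M. h x = F x}" if "x \<in> M" for x
    using that unfolding Lambda_AB_def[of \<Lambda> A B]
  proof (rule gc_mono_closed)
    show "{T' - T |T T'. T \<in> T_set \<Lambda> A B \<and> T' \<in> T_set \<Lambda> A B} \<subseteq> {x \<in> group_closure {T' - T |T T'. T \<in> T_set \<Lambda> A B \<and> T' \<in> T_set \<Lambda> A B}. h x = F x}"
      using h gen by (auto intro: group_closure.base)
    show "0 \<in> {x \<in> group_closure {T' - T |T T'. T \<in> T_set \<Lambda> A B \<and> T' \<in> T_set \<Lambda> A B}. h x = F x}"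
      using h0 I(2) by (simp add: linear_0)
    fix a b assume "a \<in> {x \<in> group_closure {T' - T |T T'. T \<in> T_set \<Lambda> A B \<and> T' \<in> T_set \<Lambda> A B}. h x = F x}"
      "b \<in> {x \<in> group_closure {T' - T |T T'. T \<in> T_set \<Lambda> A B \<and> T' \<in> T_set \<Lambda> A B}. h x = F x}"
    then have ab: "a \<in> M" "h a = F a" "b \<in> M" "h b = F b" by (auto simp: Lambda_AB_def)
    then have "a - b \<in> M \<and> h (a - b) = F (a - b)" by (simp add: hd M_closed linear_diff[OF I(2)])
    then show "a - b \<in> {x \<in> group_closure {T' - T |T T'. T \<in> T_set \<Lambda> A B \<and> T' \<in> T_set \<Lambda> A B}. h x = F x}"
      by (simp add: Lambda_AB_def)
  qed
  have "h \<in> extensional M" using h by (simp add: carrier_orth Bij_def)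
  then show "h = restrict F M" using hF by (auto simp: extensional_def restrict_def fun_eq_iff)
qed

lemma lift_sgn: "lift p F \<Longrightarrow> sgn_type 1 F" by (auto simp: lift_def sgn_plus_vertices)

text \<open>The composite homomorphism computes lifts: the lift lies in \<open>circ222\<close>,
  and its restriction is the value of \<open>tau_T\<close>.\<close>

lemma edge_hom_lift:
  assumes p: "aut (rho_P x)" and F: "lift (rho_P x) F"
  shows "edge_hom \<Lambda> A B \<phi> x = restrict F \<Lambda>"
proof -
  have c: "restrict F \<Lambda> \<in> carrier (circ222 \<Lambda> A B)" using sgn_circ[OF _ lift_sgn[OF F]] by simp
  have "sigma_AB \<Lambda> A B (restrict F \<Lambda>) = restrict F L"
    unfolding sigma_AB_def by (intro restrict_ext) (simp add: L_iff)
  also have "\<dots> = tau_T \<Lambda> A B (by_phi \<Lambda> A B \<phi> (rho_P x))" using tau_lift[OF p F] by (simp add: M_eq_L)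
  finally have e: "tau_T \<Lambda> A B (by_phi \<Lambda> A B \<phi> (rho_P x)) = sigma_AB \<Lambda> A B (restrict F \<Lambda>)" by simp
  show ?thesis unfolding edge_hom_def e by (rule inv_into_f_f[OF sigma_inj c])
qed

text \<open>An isometry that permutes the vertices maps \<open>T_set\<close>, seen from the centre
  and projected away from the triangle, to itself: \<open>F (tt P) + G\<close> differs from
  \<open>F (\<phi> P)\<close> by a difference of vertices and satisfies the metric
  conditions.\<close>

lemma plus_aut: assumes F: "Iso F" "F ` vertices = vertices" shows "\<exists>p. aut p \<and> lift p F"
proof -
  have T: "\<exists>Q\<in>planes. F (tt P) = tt Q" if F: "Iso F" "F ` vertices = vertices" and P: "P \<in> planes" for F P
  proof -
    have o: "orthogonal_transformation F" using F by (simp add: Iso_def)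
    have pp: "F (tt P) \<bullet> A = 0" "F (tt P) \<bullet> B = 0" using perp_image[OF o F(2) tt_perp[OF P]] .
    have "F (vertex 0) \<in> vertices" using F(2) by (auto simp: vertices_def)
    then obtain j where j: "j < 3" "F (vertex 0) = vertex j" by (auto simp: vertices_def)
    have "F (\<phi> P) \<in> \<Lambda>" using Iso_Lambda[OF F(1)] T_setD(1)[OF phi_T[OF P]] by blast
    moreover have "F (tt P) + G = F (\<phi> P) + (vertex j - vertex 0)"
    proof -
      have "tt P = \<phi> P + vertex 0" by (simp add: tt_def vertex_simps)
      then have "F (tt P) = F (\<phi> P + vertex 0)" by (rule arg_cong)
      also have "\<dots> = F (\<phi> P) + F (vertex 0)" by (rule linear_add[OF Iso_lin[OF F(1)]])
      finally have "F (tt P) = F (\<phi> P) + F (vertex 0)" .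
      then show ?thesis using j by (simp add: vertex_simps)
    qed
    ultimately have "F (tt P) + G \<in> \<Lambda>" using vertex_diff[OF j(1), of 0] by (simp add: L_closed)
    moreover have "(F (tt P) + G) \<bullet> (F (tt P) + G) = 4"
      using Iso_inner[OF F(1), of "tt P" "tt P"] tt_norm[OF P] perp_vertex(2)[OF pp]
      by (simp add: inner_add_left inner_add_right G_inner inner_commute)
    ultimately have "F (tt P) + G \<in> T_set \<Lambda> A B" using pp by (intro T_setI) (simp_all add: inner_add_left G_inner)
    then obtain Q where "Q \<in> planes" "F (tt P) + G = \<phi> Q" using phi_surj by blast
    then show ?thesis by (intro bexI[of _ Q]) (simp_all add: tt_def eq_diff_eq)
  qed
  obtain p where p: "\<And>P. P \<in> planes \<Longrightarrow> p P \<in> planes" "\<And>P. P \<in> planes \<Longrightarrow> F (tt P) = tt (p P)" using T[OF F] by metis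
  let ?F = "inv_into UNIV F"
  have b: "bij F" using F(1) by (simp add: Iso_def orthogonal_transformation_bij)
  have Fi: "F (?F x) = x" "?F (F x) = x" for x using b by (simp_all add: bij_is_surj surj_f_inv_f bij_is_inj)
  have iF: "Iso ?F" "?F ` vertices = vertices"
  proof -
    have "orthogonal_transformation ?F" using F(1) by (simp add: Iso_def orthogonal_transformation_inv)
    moreover have "?F ` F ` S = S" for S by (simp add: image_image Fi)
    ultimately show "Iso ?F" "?F ` vertices = vertices" using F unfolding Iso_def by metis+
  qed
  have inj: "inj_on p planes"
  proof (rule inj_onI)
    fix P Q assume "P \<in> planes" "Q \<in> planes" "p P = p Q"
    then have "F (tt P) = F (tt Q)" using p(2) by simp
    then have "tt P = tt Q" by (metis Fi(2))
    then show "P = Q" using tt_inj \<open>P \<in> planes\<close> \<open>Q \<in> planes\<close> by blast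
  qed
  have surj: "\<exists>P\<in>planes. p P = Q" if Q: "Q \<in> planes" for Q
  proof -
    obtain P where P: "P \<in> planes" "?F (tt Q) = tt P" using T[OF iF Q] by blast
    then have "tt (p P) = tt Q" using p(2)[OF P(1)] Fi(1)[of "tt Q"] by simp
    then show ?thesis using tt_inj[OF p(1)[OF P(1)] Q] P(1) by blast
  qed
  have dims: "vec.dim (p P \<inter> p Q) = vec.dim (P \<inter> Q)" if "P \<in> planes" "Q \<in> planes" for P Q
  proof -
    have "tt (p P) \<bullet> tt (p Q) = tt P \<bullet> tt Q" using that p(2)[symmetric] Iso_inner[OF F(1)] by simp
    then have "(- 2 :: real) ^ vec.dim (p P \<inter> p Q) = (- 2) ^ vec.dim (P \<inter> Q)"
      using that p(1) by (simp add: tt_inner)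
    then have "\<bar>(- 2 :: real) ^ vec.dim (p P \<inter> p Q)\<bar> = \<bar>(- 2) ^ vec.dim (P \<inter> Q)\<bar>" by simp
    then have "(2 :: real) ^ vec.dim (p P \<inter> p Q) = 2 ^ vec.dim (P \<inter> Q)" by (simp add: power_abs)
    then show ?thesis by simp
  qed
  have "p ` planes = planes" using p(1) surj by blast
  then have "aut p" using inj dims by (simp add: aut_def bij_betw_def)
  moreover have "lift p F" using F p(2) by (simp add: lift_def)
  ultimately show ?thesis by blast
qed

end

context char2_field begin

section \<open>Symmetries of the planes are semilinear\<close>

lemma sqv_sqv_plane: assumes "P \<in> planes" shows "sqv ` sqv ` P = (P :: ('k^6) set)"
proof -
  have "sqv ` sqv ` (P \<inter> F4v) = P \<inter> (F4v :: ('k^6) set)"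
    using sqv_sqv_F4v by (force simp: image_image image_iff)
  then have "vec.span (P \<inter> F4v) = sqv ` sqv ` vec.span (P \<inter> (F4v :: ('k^6) set))"
    using SM_span[OF sqv_SM] by metis
  then show ?thesis unfolding plane_span_F4v[OF assms] by simp
qed

lemma SM_plane_inv: assumes m: "m \<in> SM"
  shows "\<exists>m'\<in>SM. \<forall>P\<in>planes. m' ` m ` P = P \<and> m ` m' ` P = P"
  using m
proof (cases rule: SM_cases)
  case lin
  then show ?thesis using LI_inv_image[OF lin] SM_LI[OF LI_inv[OF lin]] by blast
next
  case (semi L)
  let ?i = "inv_into UNIV L"
  obtain n' where n': "n' \<in> LI" "sqv \<circ> ?i = n' \<circ> sqv" using sqv_LI_commute[OF LI_inv[OF semi(1)]] by blast
  have "sqv \<circ> ?i \<in> SM" unfolding n'(2) by (rule SM_sq[OF n'(1)])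
  moreover have "(sqv \<circ> ?i) ` m ` P = P \<and> m ` (sqv \<circ> ?i) ` P = P" if P: "P \<in> planes" for P
  proof -
    have "(sqv \<circ> ?i) ` m ` P = sqv ` ?i ` L ` sqv ` P" unfolding semi(2) by (simp only: image_comp[symmetric])
    moreover have "m ` (sqv \<circ> ?i) ` P = L ` sqv ` sqv ` ?i ` P" unfolding semi(2) by (simp only: image_comp[symmetric])
    ultimately show ?thesis
      using sqv_sqv_plane[OF P] sqv_sqv_plane[OF LI_plane[OF LI_inv[OF semi(1)] P]] by (simp only: LI_inv_image[OF semi(1)])
  qed
  ultimately show ?thesis by blast
qed

text \<open>The Frobenius map in the coordinates \<open>J\<close>. Unlike \<open>sqv\<close>, it
  fixes the coordinate planes.\<close>

definition Fr :: "'k^6 \<Rightarrow> 'k^6" where "Fr v = J (sqv (px v)) (sqv (py v))"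

lemma Fr_J [simp]: "Fr (J x y) = J (sqv x) (sqv y)" by (simp add: Fr_def)

lemma sqv_J: "sqv (J x y) = J (sqv x + sqv y) (sqv y)"
proof -
  have "(a + w * b)\<^sup>2 = a\<^sup>2 + b\<^sup>2 + w * b\<^sup>2" "(a + (w + 1) * b)\<^sup>2 = a\<^sup>2 + b\<^sup>2 + (w + 1) * b\<^sup>2" for a b
  proof -
    have s: "(w+1)\<^sup>2 = w" by (simp add: power2_eq_square ww1)
    show "(a + w * b)\<^sup>2 = a\<^sup>2 + b\<^sup>2 + w * b\<^sup>2" by (simp add: sq_add power_mult_distrib w_sq algebra_simps)
    show "(a + (w + 1) * b)\<^sup>2 = a\<^sup>2 + b\<^sup>2 + (w + 1) * b\<^sup>2"
      unfolding sq_add[of a "(w + 1) * b"] power_mult_distrib s by (simp add: distrib_right)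
  qed
  then show ?thesis by (simp add: vec_eq_iff forall_6 sqv_def)
qed

lemma Fr_SM: "Fr \<in> SM"
proof -
  have I: "mat 1 \<in> Herm" by (rule HermI) (auto simp: mat_def)
  let ?T = "swI UNIV \<circ> U (mat 1) \<circ> swI UNIV"
  have "?T \<in> LI" by (intro LI_comp swI_LI U_LI I)
  moreover have "Fr = ?T \<circ> sqv"
  proof
    fix v obtain x y where v: "v = J x y" by (rule J_cases)
    have "sqv x + sqv y + sqv y = sqv x" by (simp add: vec_eq_iff add.assoc)
    then show "Fr v = (?T \<circ> sqv) v" by (simp add: v sqv_J swI_UNIV_J)
  qed
  ultimately show ?thesis using SM_sq by simp
qed

end

context edge begin

lemma aut_SM: assumes m: "m \<in> SM" shows "aut (\<lambda>P. m ` P)"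
proof -
  from SM_plane_inv[OF m] obtain m' where m': "m' \<in> SM" "\<forall>P\<in>planes. m' ` m ` P = P \<and> m ` m' ` P = P" ..
  have "bij_betw (\<lambda>P. m ` P) planes planes"
  proof (rule bij_betw_byWitness[of _ "\<lambda>P. m' ` P"])
    show "\<forall>P\<in>planes. m' ` m ` P = P" "\<forall>P\<in>planes. m ` m' ` P = P" using m'(2) by auto
    show "(\<lambda>P. m ` P) ` planes \<subseteq> planes" by (rule image_subsetI) (rule SM_plane[OF m])
    show "(\<lambda>P. m' ` P) ` planes \<subseteq> planes" by (rule image_subsetI) (rule SM_plane[OF m'(1)])
  qed
  then show ?thesis by (simp add: aut_def SM_dim_Int[OF m])
qed

lemma aut_comp: assumes "aut p" "aut r" shows "aut (\<lambda>P. p (r P))"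
proof -
  have "bij_betw (p \<circ> r) planes planes" using assms by (auto simp: aut_def intro: bij_betw_trans)
  then show ?thesis using aut_dim[OF assms(1)] aut_dim[OF assms(2)] aut_in[OF assms(2)] by (simp add: aut_def comp_def)
qed

lemma aut_inverse: assumes "aut p" shows "\<exists>p'. aut p' \<and> (\<forall>P\<in>planes. p' (p P) = P \<and> p (p' P) = P)"
proof -
  let ?p = "inv_into planes p"
  have b: "bij_betw p planes planes" using assms by (simp add: aut_def)
  have i: "?p (p P) = P" "p (?p P) = P" "?p P \<in> planes" if "P \<in> planes" for P
    using b that bij_betw_inv_into_left[OF b that] bij_betw_inv_into_right[OF b that] bij_betw_inv_into[OF b]
    by (auto simp: bij_betw_def)
  have "vec.dim (?p P \<inter> ?p Q) = vec.dim (P \<inter> Q)" if "P \<in> planes" "Q \<in> planes" for P Q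
    using aut_dim[OF assms i(3)[OF that(1)] i(3)[OF that(2)]] i(2) that by simp
  then have "aut ?p" using bij_betw_inv_into[OF b] by (simp add: aut_def)
  then show ?thesis using i by blast
qed

text \<open>Such a plane has inner product \<open>1/6\<close> with \<open>u0\<close> and hence
  some nonzero coordinate at a point \<open>s\<close>. The inner products with \<open>Psa s
  0\<close> and \<open>Psa s 1\<close> are \<open>2/3\<close> plus and minus the same nonzero
  number, and among the four possible values this forces one of them to be
  \<open>8/3\<close>.\<close>

lemma plane_meeting_Winf_in_line:
  assumes Q: "Q \<in> planes" and d: "vec.dim (Q \<inter> Winf) = 2"
  shows "\<exists>s\<in>pts. Q = Psa s 0 \<or> Q = Psa s 1"
proof -
  have t0: "tt Q \<bullet> u0 = 1/6" using tt_inner[OF Q Winf_plane] d by (simp add: u0_def)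
  have "\<exists>s\<in>pts. tt Q \<bullet> u s \<noteq> 0"
  proof (rule ccontr)
    assume "\<not> ?thesis"
    then have "tt Q \<bullet> tt Q = 24 * (1/6) * (1/6)"
      using inner_expansion[OF tt_perp[OF Q], of "tt Q"] t0 by simp
    then show False using tt_norm[OF Q] by simp
  qed
  then obtain s where s: "s \<in> pts" "tt Q \<bullet> u s \<noteq> 0" by blast
  have P: "Psa s 0 \<in> planes" "Psa s 1 \<in> planes" using PsaP ptsD[OF s(1)] by simp_all
  have "tt Q \<bullet> tt (Psa s 0) = 2/3 + 4 * (tt Q \<bullet> u s)" "tt Q \<bullet> tt (Psa s 1) = 2/3 - 4 * (tt Q \<bullet> u s)"
    using tt_Psa[OF ptsD[OF s(1)]] t0 by (simp_all add: inner_add_right inner_diff_right)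
  moreover have v: "tt Q \<bullet> tt X = 8/3 \<or> tt Q \<bullet> tt X = - 4/3 \<or> tt Q \<bullet> tt X = 2/3 \<or> tt Q \<bullet> tt X = - 1/3" if X: "X \<in> planes" for X
  proof -
    have "vec.dim (Q \<inter> X) \<le> 3" using vec.dim_subset[of "Q \<inter> X" Q] Q by (auto simp: planes_iff)
    moreover have "n \<in> {0, 1, 2, 3}" if "n \<le> 3" for n :: nat using that by auto
    ultimately have "vec.dim (Q \<inter> X) \<in> {0, 1, 2, 3}" by blast
    then show ?thesis unfolding tt_inner[OF Q X] by (elim insertE emptyE; simp only:) simp_all
  qed
  ultimately have "tt Q \<bullet> tt (Psa s 0) = 8/3 \<or> tt Q \<bullet> tt (Psa s 1) = 8/3"
    using v[OF P(1)] v[OF P(2)] s(2) by argo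
  moreover have "Q = X" if X: "X \<in> planes" "tt Q \<bullet> tt X = 8/3" for X
  proof -
    have "(tt Q - tt X) \<bullet> (tt Q - tt X) = 0"
      using tt_norm[OF Q] tt_norm[OF X(1)] X(2) by (simp add: inner_diff_left inner_diff_right inner_commute)
    then show ?thesis using tt_inj[OF Q X(1)] by simp
  qed
  ultimately show ?thesis using P s(1) by blast
qed

definition fixes0 :: "(('k^6) set \<Rightarrow> ('k^6) set) \<Rightarrow> bool" where
  "fixes0 f \<longleftrightarrow> aut f \<and> f Winf = Winf \<and> f (W 0) = W 0"

text \<open>The permutation of points induced by a symmetry that fixes \<open>Winf\<close> and
  \<open>W 0\<close>.\<close>

definition pmap :: "(('k^6) set \<Rightarrow> ('k^6) set) \<Rightarrow> ('k^3 \<Rightarrow> 'k^3) \<Rightarrow> bool" where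
  "pmap f \<pi> \<longleftrightarrow> (\<forall>s\<in>pts. \<pi> s \<in> pts \<and> f (Psa s 0) = Psa (\<pi> s) 0 \<and> f (Psa s 1) = Psa (\<pi> s) 1)"

lemma pts_not_proportional: "s \<in> pts \<Longrightarrow> s' \<in> pts \<Longrightarrow> s \<noteq> s' \<Longrightarrow> s' \<noteq> c *s s" using pts_proportional[of s s' c] by auto

lemma Psa_inj: assumes "s \<in> pts" "s' \<in> pts" "Psa s 0 = Psa s' 0" shows "s = s'"
proof (rule ccontr)
  assume "s \<noteq> s'"
  then have "vec.dim (Psa s 0 \<inter> Psa s' 0) = 1" using pts_not_proportional assms ptsD by (intro dim_Psa_Psa') auto
  then show False using assms Psa_plane[of s' 0] ptsD by (simp add: planes_iff)
qed

text \<open>The planes that meet \<open>Winf\<close> in a line are permuted. The parameter 0 or 1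
  is recognized by the intersection with \<open>W 0\<close>, and equality of points by the
  dimension of the intersection.\<close>

lemma pmap_exists: assumes f: "fixes0 f" shows "\<exists>\<pi>. pmap f \<pi>"
proof -
  have a: "aut f" and fW: "f Winf = Winf" "f (W 0) = W 0" using f by (auto simp: fixes0_def)
  have im: "\<exists>s'\<in>pts. f (Psa s a) = Psa s' a" if s: "s \<in> pts" and vertex: "a = 0 \<or> a = 1" for s a
  proof -
    have P: "Psa s a \<in> planes" using Psa_plane ptsD[OF s] vertex by blast
    have "vec.dim (f (Psa s a) \<inter> f Winf) = 2"
      using aut_dim[OF a P Winf_plane] dim_Winf_Psa[OF ptsD(2)[OF s], of a] by (simp add: Int_commute)
    then obtain s' where s': "s' \<in> pts" "f (Psa s a) = Psa s' 0 \<or> f (Psa s a) = Psa s' 1"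
      using plane_meeting_Winf_in_line[OF aut_in[OF a P]] fW by auto
    have "vec.dim (W 0 \<inter> f (Psa s a)) = vec.dim (W 0 \<inter> Psa s a)"
      using aut_dim[OF a W_plane[OF Herm_0] P] fW by simp
    moreover have "vec.dim (W 0 \<inter> Psa t b) = (if b = 0 then 1 else 0)" if "t \<in> pts" for t b
      using dim_W_Psa[OF ptsD(2)[OF that], of 0 b] by (simp add: q_def eq_commute[of 0 b])
    ultimately have b: "(if b = 0 then 1 else 0) = (if a = 0 then 1 else (0::nat))" if "f (Psa s a) = Psa s' b" for b
      using s s'(1) that by metis
    have ba: "b = 0 \<longleftrightarrow> a = 0" if "f (Psa s a) = Psa s' b" for b
      using b[OF that] by (cases "b = 0"; cases "a = 0") simp_all
    from s'(2) have "f (Psa s a) = Psa s' a"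
    proof
      assume "f (Psa s a) = Psa s' 0"
      then show ?thesis using ba[of 0] by simp
    next
      assume 1: "f (Psa s a) = Psa s' 1"
      then have "a = 1" using ba[OF 1] vertex by (elim disjE) simp_all
      then show ?thesis using 1 by simp
    qed
    with s'(1) show ?thesis by (rule bexI[rotated])
  qed
  have "\<exists>s'\<in>pts. f (Psa s 0) = Psa s' 0 \<and> f (Psa s 1) = Psa s' 1" if s: "s \<in> pts" for s
  proof -
    obtain s' s'' where s': "s' \<in> pts" "f (Psa s 0) = Psa s' 0" "s'' \<in> pts" "f (Psa s 1) = Psa s'' 1"
    proof -
      have "\<exists>s'\<in>pts. f (Psa s 0) = Psa s' 0" "\<exists>s'\<in>pts. f (Psa s 1) = Psa s' 1"
        by (rule im[OF s], simp)+
      then show ?thesis by (elim bexE) (rule that)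
    qed
    have "vec.dim (Psa s' 0 \<inter> Psa s'' 1) = 2"
      using aut_dim[OF a, of "Psa s 0" "Psa s 1"] PsaP[OF ptsD[OF s]] dim_Psa_Psa[OF ptsD(2)[OF s], of 0 1] s' by simp
    moreover have "vec.dim (Psa s' 0 \<inter> Psa s'' 1) = 1" if "s' \<noteq> s''"
      using pts_not_proportional[OF s'(1,3) that] s' ptsD by (intro dim_Psa_Psa') auto
    ultimately have e: "s' = s''" by (cases "s' = s''") simp_all
    show ?thesis by (intro bexI[of _ s'] conjI s'(2) s'(1)) (simp only: e s'(4))
  qed
  then have "\<exists>\<pi>. \<forall>s\<in>pts. \<pi> s \<in> pts \<and> f (Psa s 0) = Psa (\<pi> s) 0 \<and> f (Psa s 1) = Psa (\<pi> s) 1"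
    unfolding Bex_def by (intro bchoice ballI)
  then show ?thesis unfolding pmap_def .
qed

lemma pmap_inj: assumes f: "fixes0 f" and p: "pmap f \<pi>" shows "inj_on \<pi> pts"
proof (rule inj_onI)
  fix s s' assume s: "s \<in> pts" "s' \<in> pts" "\<pi> s = \<pi> s'"
  then have "f (Psa s 0) = f (Psa s' 0)" using p by (simp add: pmap_def)
  moreover have "inj_on f planes" using f by (auto simp: fixes0_def aut_def bij_betw_def)
  ultimately have "Psa s 0 = Psa s' 0" using s PsaP ptsD by (auto dest: inj_onD)
  then show "s = s'" using Psa_inj s by blast
qed

text \<open>The points of a line are those at which a form of rank one vanishes. The plane of that
  form meets \<open>W 0\<close> in dimension 2 and is disjoint from \<open>Winf\<close>; both
  properties are preserved, so its image is again the graph of a form of rank one.\<close>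

lemma pmap_collinear:
  assumes f: "fixes0 f" and p: "pmap f \<pi>" and s: "a \<in> pts" "b \<in> pts" "c \<in> pts" and d: "det3 a b c = 0"
  shows "det3 (\<pi> a) (\<pi> b) (\<pi> c) = 0"
proof (cases "a = b")
  case True then show ?thesis by simp
next
  case False
  have au: "aut f" and fW: "f Winf = Winf" "f (W 0) = W 0" using f by (auto simp: fixes0_def)
  obtain v where v: "v \<in> F4v" "v \<noteq> 0" "herm a v = 0" "herm b v = 0" "herm c v = 0"
    using det3_0_imp_perp[OF ptsD(1)[OF s(1)] ptsD(1)[OF s(2)] ptsD(2)[OF s(1)] pts_not_proportional[OF s(1,2) False] d] by blast
  have R: "R1 v \<in> Herm" by (rule R1_Herm[OF v(1)])
  have "vec.dim (f (W (R1 v)) \<inter> f Winf) = 0"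
    using aut_dim[OF au W_plane[OF R] Winf_plane] dim_Winf_W[of "R1 v"] by (simp add: Int_commute)
  then have "f (W (R1 v)) \<inter> Winf \<subseteq> {0}" using fW by auto
  then obtain H where H: "H \<in> Herm" "f (W (R1 v)) = W H"
    using plane_disjoint_Winf[OF aut_in[OF au W_plane[OF R]]] by blast
  have "vec.dim (W H \<inter> W 0) = 2"
    using aut_dim[OF au W_plane[OF R] W_plane[OF Herm_0]] dim_W_R1[OF v(2)] H fW by simp
  then obtain v' where v': "v' \<noteq> 0" "\<And>s. q H s = 0 \<Longrightarrow> herm s v' = 0" using rank1_zero_set[OF H(1)] by blast
  have "herm (\<pi> s) v' = 0" if s: "s \<in> pts" "herm s v = 0" for s
  proof -
    have "q (R1 v) s = 0" using q_R1[OF ptsD(1)[OF s(1)] v(1)] s(2) by simp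
    then have "vec.dim (f (W (R1 v)) \<inter> f (Psa s 0)) = 1"
      using aut_dim[OF au W_plane[OF R] PsaP(1)[OF ptsD[OF s(1)]]] dim_W_Psa[OF ptsD(2)[OF s(1)], of "R1 v" 0] by simp
    then have "vec.dim (W H \<inter> Psa (\<pi> s) 0) = 1" using H p s(1) by (simp add: pmap_def)
    moreover have "\<pi> s \<in> pts" using p s(1) by (simp add: pmap_def)
    then have "vec.dim (W H \<inter> Psa (\<pi> s) 0) = (if q H (\<pi> s) = 0 then 1 else 0)" by (intro dim_W_Psa ptsD(2))
    ultimately have "q H (\<pi> s) = 0" by (cases "q H (\<pi> s) = 0") simp_all
    then show ?thesis by (rule v'(2))
  qed
  note this[OF s(1) v(3)] this[OF s(2) v(4)] this[OF s(3) v(5)]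
  then show ?thesis by (rule det3_perp[OF _ _ _ v'(1)])
qed

lemma pmap_collinear_iff:
  assumes f: "fixes0 f" and p: "pmap f \<pi>" and s: "a \<in> pts" "b \<in> pts" "c \<in> pts"
  shows "det3 (\<pi> a) (\<pi> b) (\<pi> c) = 0 \<longleftrightarrow> det3 a b c = 0"
proof
  assume d: "det3 (\<pi> a) (\<pi> b) (\<pi> c) = 0"
  obtain f' where f': "aut f'" "\<And>P. P \<in> planes \<Longrightarrow> f' (f P) = P" "\<And>P. P \<in> planes \<Longrightarrow> f (f' P) = P"
    using aut_inverse[of f] f by (auto simp: fixes0_def)
  have f0: "fixes0 f'"
    using f' f f'(2)[OF Winf_plane] f'(2)[OF W_plane[OF Herm_0]] by (simp add: fixes0_def)
  obtain \<pi>' where p': "pmap f' \<pi>'" using pmap_exists[OF f0] by blast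
  have inv: "\<pi>' (\<pi> s) = s" if "s \<in> pts" for s
  proof -
    have "f' (f (Psa s 0)) = Psa (\<pi>' (\<pi> s)) 0" using p p' that by (simp add: pmap_def)
    then have "Psa (\<pi>' (\<pi> s)) 0 = Psa s 0" using f'(2)[OF PsaP(1)[OF ptsD[OF that]]] by simp
    then show ?thesis using Psa_inj that p p' by (auto simp: pmap_def)
  qed
  have "\<pi> a \<in> pts" "\<pi> b \<in> pts" "\<pi> c \<in> pts" using p s by (auto simp: pmap_def)
  from pmap_collinear[OF f0 p' this d] show "det3 a b c = 0" using inv s by simp
qed (rule pmap_collinear[OF f p s])

text \<open>All frame vectors are fixed, so the vector of each plane is determined by its inner
  products with them.\<close>

lemma aut_identity:
  assumes f: "fixes0 f" and p: "pmap f \<pi>" and id: "\<And>s. s \<in> pts \<Longrightarrow> \<pi> s = s" and Q: "Q \<in> planes"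
  shows "f Q = Q"
proof -
  have au: "aut f" and fW: "f Winf = Winf" using f by (auto simp: fixes0_def)
  have e: "tt (f Q) \<bullet> tt X = tt Q \<bullet> tt X" if "X \<in> planes" "f X = X" for X
    using aut_inner[OF au Q that(1)] that(2) by simp
  have fP: "f (Psa s 0) = Psa s 0" "f (Psa s 1) = Psa s 1" if "s \<in> pts" for s using p id that by (simp_all add: pmap_def)
  have "tt (f Q) - tt Q = 0"
  proof (rule perp_frame_0)
    show "(tt (f Q) - tt Q) \<bullet> A = 0" "(tt (f Q) - tt Q) \<bullet> B = 0"
      using tt_perp[OF Q] tt_perp[OF aut_in[OF au Q]] by (simp_all add: inner_diff_left)
    show "(tt (f Q) - tt Q) \<bullet> u0 = 0" using e[OF Winf_plane fW] by (simp add: u0_def inner_diff_left)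
    show "(tt (f Q) - tt Q) \<bullet> u s = 0" if s: "s \<in> pts" for s
      using e[OF PsaP(1)[OF ptsD[OF s]] fP(1)[OF s]] e[OF PsaP(2)[OF ptsD[OF s]] fP(2)[OF s]]
      by (simp add: u_def inner_diff_left inner_diff_right)
  qed
  then show ?thesis using tt_inj[OF aut_in[OF au Q] Q] by simp
qed

lemma J_in_Psa: "J s 0 \<in> Psa s 0" by (auto simp: Psa_def intro!: exI[of _ 1])

lemma J_in_PsaD: "J (c *s s) 0 \<in> Psa s' 0 \<Longrightarrow> c \<noteq> 0 \<Longrightarrow> s \<in> pts \<Longrightarrow> s' \<in> pts \<Longrightarrow> s' = s"
proof -
  assume a: "J (c *s s) 0 \<in> Psa s' 0" "c \<noteq> 0" "s \<in> pts" "s' \<in> pts"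
  then obtain l where "c *s s = l *s s'" by (auto simp: Psa_def)
  then have "inverse c *s (c *s s) = inverse c *s (l *s s')" by simp
  then have "s = (inverse c * l) *s s'" using a(2) by (simp add: vector_smult_assoc)
  then show ?thesis by (rule pts_proportional[OF a(4,3), symmetric])
qed

text \<open>The effect on the point map of composing with a semilinear isometry that preserves
  \<open>Winf\<close> and \<open>W 0\<close>.\<close>

lemma fixes0_comp:
  assumes f: "fixes0 f" and p: "pmap f \<pi>" and m: "m \<in> SM" "m ` Winf = Winf" "m ` W 0 = W 0"
  shows "fixes0 (\<lambda>P. m ` f P)"
    and "pmap (\<lambda>P. m ` f P) \<pi>' \<Longrightarrow> s \<in> pts \<Longrightarrow> t \<in> pts \<Longrightarrow> m (J (\<pi> s) 0) = J (c *s t) 0 \<Longrightarrow> c \<noteq> 0 \<Longrightarrow> \<pi>' s = t"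
proof -
  have "aut f" "f Winf = Winf" "f (W 0) = W 0" using f by (simp_all add: fixes0_def)
  then show "fixes0 (\<lambda>P. m ` f P)" using aut_comp[OF aut_SM[OF m(1)]] m(2,3) by (simp add: fixes0_def)
  assume a: "pmap (\<lambda>P. m ` f P) \<pi>'" "s \<in> pts" "t \<in> pts" "m (J (\<pi> s) 0) = J (c *s t) 0" "c \<noteq> 0"
  have "m ` Psa (\<pi> s) 0 = Psa (\<pi>' s) 0" using a p by (simp add: pmap_def)
  then have "m (J (\<pi> s) 0) \<in> Psa (\<pi>' s) 0" using J_in_Psa by blast
  then show "\<pi>' s = t" using J_in_PsaD[of c t "\<pi>' s"] a by (simp add: pmap_def)
qed

lemma image_eq_bij: "m \<in> SM \<Longrightarrow> S \<in> planes \<Longrightarrow> (\<And>v. v \<in> S \<Longrightarrow> m v \<in> S) \<Longrightarrow> m ` S = S"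
proof -
  assume m: "m \<in> SM" "S \<in> planes" "\<And>v. v \<in> S \<Longrightarrow> m v \<in> S"
  have "vec.subspace (m ` S)" "vec.subspace S" "vec.dim S = vec.dim (m ` S)"
    using m SM_subspace SM_dim by (auto simp: planes_iff)
  moreover have "m ` S \<subseteq> S" using m by blast
  ultimately show ?thesis using vec.subspace_dim_equal[of "m ` S" S] by simp
qed

text \<open>The successive normalizations are: two disjoint planes to \<open>Winf\<close> and
  \<open>W 0\<close>; the images of the three axis points to these points, by Gaussian
  elimination; the image of the unit point to the unit point, by a diagonal map; and, if
  necessary, the exchange of \<open>w\<close> and \<open>w + 1\<close> by the Frobenius
  map.\<close>

theorem fundamental:
  assumes p: "aut p" shows "\<exists>m\<in>SM. \<forall>P\<in>planes. p P = m ` P"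
proof -
  have W0: "W 0 \<in> planes" by (rule W_plane[OF Herm_0])
  have "vec.dim (p Winf \<inter> p (W 0)) = 0" using aut_dim[OF p Winf_plane W0] by (simp add: dim_Winf_W)
  from NN_plane_pair[OF aut_in[OF p Winf_plane] aut_in[OF p W0] this]
  (* Two disjoint planes become Winf and W 0, so that the map acts on points. *)
  obtain n1 where n1: "n1 \<in> NN" "n1 ` p Winf = Winf" "n1 ` p (W 0) = W 0" by blast
  have n1S: "n1 \<in> SM" using SM_LI NN_LI n1 by blast
  let ?f1 = "\<lambda>P. n1 ` p P"
  have f1: "fixes0 ?f1" using aut_comp[OF aut_SM[OF n1S] p] n1 by (simp add: fixes0_def)
  obtain \<pi>1 where p1: "pmap ?f1 \<pi>1" using pmap_exists[OF f1] by blast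
  (* The axis points and the unit point: a frame of the projective plane. *)
  define e1 e2 e3 uu where "e1 = v3 1 0 0" "e2 = v3 0 1 0" "e3 = v3 0 0 1" "uu = v3 1 1 1"
  have ep: "e1 \<in> pts" "e2 \<in> pts" "e3 \<in> pts" "uu \<in> pts" by (simp_all add: e1_e2_e3_uu_def v3_pts)
  have ax: "ax 1 = e1" "ax 2 = e2" "ax 3 = e3" by (simp_all add: e1_e2_e3_uu_def vec_eq_iff forall_3 axis_def)
  have d0: "det3 e1 e2 e3 \<noteq> 0" by (simp add: e1_e2_e3_uu_def det3_cases)
  let ?a = "\<pi>1 e1" and ?b = "\<pi>1 e2" and ?c = "\<pi>1 e3"
  have vp: "?a \<in> pts" "?b \<in> pts" "?c \<in> pts" using p1 ep by (auto simp: pmap_def)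
  have d1: "det3 ?a ?b ?c \<noteq> 0" using pmap_collinear_iff[OF f1 p1 ep(1-3)] d0 by simp
  have ind: "\<alpha> = 0 \<and> \<beta> = 0 \<and> \<gamma> = 0" if z: "\<alpha> *s ?a + \<beta> *s ?b + \<gamma> *s ?c = 0" for \<alpha> \<beta> \<gamma>
  proof -
    have 0: "det3 0 x y = 0" "det3 x 0 y = 0" "det3 x y 0 = 0" for x y by (simp_all add: det3_cases)
    have "det3 (\<alpha> *s ?a + \<beta> *s ?b + \<gamma> *s ?c) ?b ?c = \<alpha> * det3 ?a ?b ?c" by (simp add: det3_lin)
    moreover have "det3 ?a (\<alpha> *s ?a + \<beta> *s ?b + \<gamma> *s ?c) ?c = \<beta> * det3 ?a ?b ?c" by (simp add: det3_lin)
    moreover have "det3 ?a ?b (\<alpha> *s ?a + \<beta> *s ?b + \<gamma> *s ?c) = \<gamma> * det3 ?a ?b ?c" by (simp add: det3_lin)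
    ultimately show ?thesis using d1 unfolding z 0 by simp
  qed
  obtain n2 \<delta> where n2: "n2 \<in> BL" and dl: "\<delta> \<in> F4" "\<delta> \<noteq> 0"
    and e: "n2 (J ?a 0) = J e1 0" "n2 (J ?b 0) = J e2 0" "n2 (J ?c 0) = J (\<delta> *s e3) 0"
    using frame_to_standard[OF ptsD(1)[OF vp(1)] ptsD(1)[OF vp(2)] ptsD(1)[OF vp(3)] ind] unfolding ax by blast
  have n2S: "n2 \<in> SM" "n2 ` Winf = Winf" "n2 ` W 0 = W 0" using n2 SM_LI[OF BL_LI[OF n2]] by (auto simp: BL_def)
  let ?f2 = "\<lambda>P. n2 ` n1 ` p P"
  have f2: "fixes0 ?f2" by (rule fixes0_comp(1)[OF f1 p1 n2S])
  obtain \<pi>2 where p2: "pmap ?f2 \<pi>2" using pmap_exists[OF f2] by blast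
  have pi2: "\<pi>2 e1 = e1" "\<pi>2 e2 = e2" "\<pi>2 e3 = e3"
    using fixes0_comp(2)[OF f1 p1 n2S p2 ep(1) ep(1), of 1] fixes0_comp(2)[OF f1 p1 n2S p2 ep(2) ep(2), of 1]
      fixes0_comp(2)[OF f1 p1 n2S p2 ep(3) ep(3), of \<delta>] e dl by simp_all
  obtain x y z where u2: "\<pi>2 uu = v3 x y z" by (metis v3_eta)
  have up: "v3 x y z \<in> pts" using p2 ep(4) u2 by (metis pmap_def)
  have "det3 e2 e3 (\<pi>2 uu) \<noteq> 0" "det3 e1 e3 (\<pi>2 uu) \<noteq> 0" "det3 e1 e2 (\<pi>2 uu) \<noteq> 0"
    using pmap_collinear_iff[OF f2 p2 ep(2,3,4)] pmap_collinear_iff[OF f2 p2 ep(1,3,4)] pmap_collinear_iff[OF f2 p2 ep(1,2,4)]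
    by (simp_all add: pi2) (simp_all add: e1_e2_e3_uu_def det3_cases)
  then have nz: "x \<noteq> 0" "y \<noteq> 0" "z \<noteq> 0" unfolding u2 by (simp_all add: e1_e2_e3_uu_def det3_cases)
  have xF: "x \<in> F4" "y \<in> F4" "z \<in> F4" using ptsD(1)[OF up] by (simp_all add: v3_F4v)
  (* No coordinate of the image of the unit point vanishes; divide by them. *)
  let ?d = "v3 (inverse x) (inverse y) (inverse z)"
  let ?D = "Dg ?d"
  have DL: "?D \<in> LI"
  proof (rule Dg_LI)
    show "?d \<in> F4v" using xF by (auto simp: v3_F4v)
    show "?d $ k \<noteq> 0" for k using nz exhaust_3[of k] by auto
  qed
  have DJ: "?D (J v 0) = J (v3 (inverse x * v$1) (inverse y * v$2) (inverse z * v$3)) 0" for v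
    by (simp, simp add: vec_eq_iff forall_3)
  have DS: "?D \<in> SM" "?D ` Winf = Winf" "?D ` W 0 = W 0"
  proof -
    show "?D \<in> SM" by (rule SM_LI[OF DL])
    then show "?D ` Winf = Winf" "?D ` W 0 = W 0"
      by (intro image_eq_bij Winf_plane W0; auto simp: Winf_iff W0_iff vec_eq_iff[of "\<chi> k. _" 0])+
  qed
  let ?f3 = "\<lambda>P. ?D ` n2 ` n1 ` p P"
  have f3: "fixes0 ?f3" by (rule fixes0_comp(1)[OF f2 p2 DS])
  obtain \<pi>3 where p3: "pmap ?f3 \<pi>3" using pmap_exists[OF f3] by blast
  have "?D (J (\<pi>2 e1) 0) = J (inverse x *s e1) 0" "?D (J (\<pi>2 e2) 0) = J (inverse y *s e2) 0"
    "?D (J (\<pi>2 e3) 0) = J (inverse z *s e3) 0" "?D (J (\<pi>2 uu) 0) = J (1 *s uu) 0"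
    unfolding DJ pi2 u2 using nz by (simp_all add: e1_e2_e3_uu_def scale_v3)
  note D4 = this
  have pi3: "\<pi>3 e1 = e1" "\<pi>3 e2 = e2" "\<pi>3 e3 = e3" "\<pi>3 uu = uu"
    using fixes0_comp(2)[OF f2 p2 DS p3 ep(1) ep(1) D4(1)] fixes0_comp(2)[OF f2 p2 DS p3 ep(2) ep(2) D4(2)]
      fixes0_comp(2)[OF f2 p2 DS p3 ep(3) ep(3) D4(3)] fixes0_comp(2)[OF f2 p2 DS p3 ep(4) ep(4) D4(4)] nz by simp_all
  have fin: ?thesis if m: "m \<in> SM" and f: "fixes0 (\<lambda>P. m ` p P)" and \<pi>: "pmap (\<lambda>P. m ` p P) \<pi>"
    and id: "\<pi> e1 = e1" "\<pi> e2 = e2" "\<pi> e3 = e3" "\<pi> uu = uu" "\<pi> (v3 1 w 0) = v3 1 w 0" for m \<pi>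
  proof -
    have "\<pi> s = s" if "s \<in> pts" for s
    proof (rule collineation_id[OF _ pmap_inj[OF f \<pi>] pmap_collinear[OF f \<pi>] _ _ _ _ id(5) that])
      show "\<pi> s \<in> pts" if "s \<in> pts" for s using \<pi> that by (simp add: pmap_def)
    qed (use id in \<open>simp_all add: e1_e2_e3_uu_def\<close>)
    then have m1: "m ` p P = P" if "P \<in> planes" for P using aut_identity[OF f \<pi>] that by blast
    from SM_plane_inv[OF m] obtain m' where m': "m' \<in> SM" "\<forall>P\<in>planes. m' ` m ` P = P \<and> m ` m' ` P = P" ..
    have "p P = m' ` P" if P: "P \<in> planes" for P using m'(2)[rule_format, OF aut_in[OF p P]] m1[OF P] by simp
    then show ?thesis using m'(1) by blast
  qed
  (* On the line through e1 and e2, only (1, w, 0) and (1, w + 1, 0) may still be exchanged. *)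
  have wp: "v3 1 w 0 \<in> pts" "v3 1 1 0 \<in> pts" "v3 1 (w + 1) 0 \<in> pts" by (simp_all add: v3_pts)
  obtain x y z where e3w: "\<pi>3 (v3 1 w 0) = v3 x y z" by (metis v3_eta)
  obtain x' y' z' where e3u: "\<pi>3 (v3 1 1 0) = v3 x' y' z'" by (metis v3_eta)
  have xyz: "v3 x y z \<in> pts" "v3 x' y' z' \<in> pts" using p3 wp e3w e3u by (metis pmap_def)+
  have "det3 e1 e2 (\<pi>3 (v3 1 w 0)) = 0"
    using pmap_collinear[OF f3 p3 ep(1,2) wp(1)] by (simp add: pi3) (simp add: e1_e2_e3_uu_def det3_cases)
  then have z: "z = 0" by (simp add: e3w e1_e2_e3_uu_def det3_cases)
  have "det3 e1 e2 (\<pi>3 (v3 1 1 0)) = 0" "det3 e3 uu (\<pi>3 (v3 1 1 0)) = 0"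
    using pmap_collinear[OF f3 p3 ep(1,2) wp(2)] pmap_collinear[OF f3 p3 ep(3,4) wp(2)]
    by (simp_all add: pi3) (simp_all add: e1_e2_e3_uu_def det3_cases)
  then have "z' = 0" "x' = y'" by (simp_all add: e3u e1_e2_e3_uu_def det3_cases add_eq_0_iff_eq)
  then have e3u': "\<pi>3 (v3 1 1 0) = v3 1 1 0" using xyz(2) e3u by (auto simp: v3_pts)
  have inj3: "inj_on \<pi>3 pts" by (rule pmap_inj[OF f3 p3])
  have "v3 x y z \<noteq> e1" "v3 x y z \<noteq> e2" "v3 x y z \<noteq> v3 1 1 0"
    using inj_onD[OF inj3 _ wp(1) ep(1)] inj_onD[OF inj3 _ wp(1) ep(2)] inj_onD[OF inj3 _ wp(1) wp(2)]
    unfolding e3w pi3 e3u' by (auto simp: e1_e2_e3_uu_def)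
  then have cases: "\<pi>3 (v3 1 w 0) = v3 1 w 0 \<or> \<pi>3 (v3 1 w 0) = v3 1 (w + 1) 0"
    using xyz(1) unfolding e3w z by (auto simp: v3_pts F4_iff e1_e2_e3_uu_def)
  define m3 where "m3 = ?D \<circ> (n2 \<circ> n1)"
  have m3L: "m3 \<in> LI" unfolding m3_def by (intro LI_comp DL BL_LI[OF n2] NN_LI[OF n1(1)])
  have m3im: "m3 ` P = ?D ` n2 ` n1 ` P" for P unfolding m3_def by (simp only: image_comp[symmetric])
  show ?thesis
  proof (cases "\<pi>3 (v3 1 w 0) = v3 1 w 0")
    case True
    show ?thesis by (rule fin[OF SM_LI[OF m3L], of \<pi>3]) (use f3 p3 pi3 True in \<open>simp_all add: m3im\<close>)
  next
    case False
    then have w2': "\<pi>3 (v3 1 w 0) = v3 1 (w + 1) 0" using cases by blast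
    have FS: "Fr \<in> SM" "Fr ` Winf = Winf" "Fr ` W 0 = W 0"
    proof -
      show "Fr \<in> SM" by (rule Fr_SM)
      then show "Fr ` Winf = Winf" "Fr ` W 0 = W 0"
        by (intro image_eq_bij Winf_plane W0; auto simp: Winf_iff W0_iff)+
    qed
    let ?f4 = "\<lambda>P. Fr ` ?D ` n2 ` n1 ` p P"
    have f4: "fixes0 ?f4" by (rule fixes0_comp(1)[OF f3 p3 FS])
    obtain \<pi>4 where p4: "pmap ?f4 \<pi>4" using pmap_exists[OF f4] by blast
    have sq3: "sqv (v3 a b c) = v3 (a\<^sup>2) (b\<^sup>2) (c\<^sup>2)" for a b c by (simp add: sqv_def vec_eq_iff forall_3)
    have F5: "Fr (J (\<pi>3 e1) 0) = J (1 *s e1) 0" "Fr (J (\<pi>3 e2) 0) = J (1 *s e2) 0" "Fr (J (\<pi>3 e3) 0) = J (1 *s e3) 0"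
      "Fr (J (\<pi>3 uu) 0) = J (1 *s uu) 0" "Fr (J (\<pi>3 (v3 1 w 0)) 0) = J (1 *s v3 1 w 0) 0"
      unfolding pi3 w2' by (simp_all add: e1_e2_e3_uu_def sq3 sq_add w_sq)
    have pi4: "\<pi>4 e1 = e1" "\<pi>4 e2 = e2" "\<pi>4 e3 = e3" "\<pi>4 uu = uu" "\<pi>4 (v3 1 w 0) = v3 1 w 0"
      using fixes0_comp(2)[OF f3 p3 FS p4 ep(1) ep(1) F5(1)] fixes0_comp(2)[OF f3 p3 FS p4 ep(2) ep(2) F5(2)]
        fixes0_comp(2)[OF f3 p3 FS p4 ep(3) ep(3) F5(3)] fixes0_comp(2)[OF f3 p3 FS p4 ep(4) ep(4) F5(4)]
        fixes0_comp(2)[OF f3 p3 FS p4 wp(1) wp(1) F5(5)] by simp_all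
    let ?T = "swI UNIV \<circ> U (mat 1) \<circ> swI UNIV"
    obtain m where m: "m \<in> SM" "\<And>P. m ` P = Fr ` m3 ` P"
    proof -
      from Fr_SM show ?thesis
      proof (cases rule: SM_cases)
        case lin
        then show ?thesis using that[OF SM_LI[OF LI_comp[OF lin m3L]]] by (simp only: image_comp[symmetric])
      next
        case (semi T)
        obtain m3' where m3': "m3' \<in> LI" "sqv \<circ> m3 = m3' \<circ> sqv" using sqv_LI_commute[OF m3L] by blast
        have e: "(T \<circ> m3') \<circ> sqv = Fr \<circ> m3" unfolding semi(2) by (simp only: comp_assoc m3'(2))
        have "(T \<circ> m3') \<circ> sqv \<in> SM" by (intro SM_sq LI_comp semi m3')
        then show ?thesis using that[of "Fr \<circ> m3"] unfolding e by (simp only: image_comp[symmetric])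
      qed
    qed
    show ?thesis by (rule fin[OF m(1), of \<pi>4]) (use f4 p4 pi4 in \<open>simp_all add: m(2) m3im\<close>)
  qed
qed

end

context char2_field begin

section \<open>Hyperovals, and the action of the generators\<close>

lemma q_v3: "q H (v3 a b c) =
    (a * H$1$1 + b * H$2$1 + c * H$3$1) * a\<^sup>2 + (a * H$1$2 + b * H$2$2 + c * H$3$2) * b\<^sup>2
    + (a * H$1$3 + b * H$2$3 + c * H$3$3) * c\<^sup>2"
  by (simp add: q_def herm_def vector_matrix_mult_def sum_3 mult_ac)

text \<open>The conic formed by the points \<open>(1, c, g c\<^sup>2)\<close> and \<open>(0, 0,
  1)\<close>, together with its nucleus \<open>(0, 1, 0)\<close>: a hyperoval. The three nonzero
  values of \<open>g\<close> represent the three classes of hyperovals under the special linear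
  group.\<close>

definition hyperoval :: "'k \<Rightarrow> ('k^3) set" where
  "hyperoval g = {v3 1 0 0, v3 0 1 0, v3 0 0 1, v3 1 1 g, v3 1 w (g * (w + 1)), v3 1 (w + 1) (g * w)}"

lemma w_ne: "w \<noteq> 0" "w \<noteq> 1" "w + 1 \<noteq> 0" "w + 1 \<noteq> 1" "w + 1 \<noteq> w" "w \<noteq> w + 1"
  using w_neq w_neq(7)[symmetric] by auto

lemma hyperoval_pts: assumes "g \<in> F4" shows "hyperoval g \<subseteq> pts"
  using assms by (auto simp: hyperoval_def v3_pts)

lemma hyperoval_card: "card (hyperoval g) = 6"
  using w_ne by (simp add: hyperoval_def)

lemma hyperoval_Int: assumes "g \<noteq> g'" shows "card (hyperoval g \<inter> hyperoval g') = 3"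
proof -
  have "hyperoval g \<inter> hyperoval g' = {v3 1 0 0, v3 0 1 0, v3 0 0 1}"
    using assms w_ne by (auto simp: hyperoval_def)
  then show ?thesis by simp
qed

text \<open>In the sum over the six points all off-diagonal entries of \<open>H\<close> cancel,
  because the sums of \<open>c\<close> and \<open>c\<^sup>2\<close> over the nonzero
  \<open>c\<close> vanish, and each diagonal entry occurs an even number of times.\<close>

lemma hyperoval_sum_q:
  assumes "g \<in> F4" "g \<noteq> 0" shows "(\<Sum>s\<in>hyperoval g. q H s) = 0"
proof -
  have ww: "w * (w * x) = x + w * x" for x by (simp add: mult.assoc[symmetric] w2 distrib_right add.commute)
  have "(\<Sum>s\<in>hyperoval g. q H s) = q H (v3 1 0 0) + (q H (v3 0 1 0) + (q H (v3 0 0 1) + (q H (v3 1 1 g)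
      + (q H (v3 1 w (g * (w + 1))) + q H (v3 1 (w + 1) (g * w))))))"
    using w_ne by (simp add: hyperoval_def)
  also have "g = 1 \<or> g = w \<or> g = w + 1" using assms by (simp add: F4_iff)
  then have "q H (v3 1 0 0) + (q H (v3 0 1 0) + (q H (v3 0 0 1) + (q H (v3 1 1 g)
      + (q H (v3 1 w (g * (w + 1))) + q H (v3 1 (w + 1) (g * w)))))) = 0"
    by (elim disjE; simp add: q_v3 ww1 w_sq w2 sq_add; simp add: algebra_simps ww w2)
  finally show ?thesis .
qed

lemma of_nat_0_iff_even: "of_nat n = (0::'k) \<longleftrightarrow> even n"
proof -
  have "of_nat n = (if even n then 0 else (1::'k))" by (induction n) auto
  then show ?thesis by simp
qed

lemma hyperoval_even:
  assumes g: "g \<in> F4" "g \<noteq> 0" and H: "H \<in> Herm" shows "even (card {s \<in> hyperoval g. q H s \<noteq> 0})"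
proof -
  have fin: "finite (hyperoval g)" by (simp add: hyperoval_def)
  have "(\<Sum>s\<in>hyperoval g. q H s) = (\<Sum>s\<in>hyperoval g. if q H s \<noteq> 0 then 1 else 0)"
    using q_F2[OF ptsD(1) H] hyperoval_pts[OF g(1)] by (intro sum.cong) auto
  also have "\<dots> = of_nat (card {s \<in> hyperoval g. q H s \<noteq> 0})"
    using fin by (simp add: sum.If_cases Int_def)
  finally show ?thesis using hyperoval_sum_q[OF g] of_nat_0_iff_even by simp
qed

lemma U_Psa: assumes s: "s \<in> F4v" and H: "H \<in> Herm" shows "U H ` Psa s a = Psa s (a + q H s)"
proof -
  have sub: "U H ` Psa s a \<subseteq> Psa s (a + q H s)" for a
  proof
    fix v assume "v \<in> U H ` Psa s a"
    then obtain t where t: "t \<in> Psa s a" "v = U H t" by blast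
    obtain l y where y: "t = J (l *s s) y" "herm y s = a * l" using t(1) unfolding Psa_def by blast
    have v: "v = J (l *s s) (y + (l *s s) v* H)" "herm y s = a * l" using t(2) y by (simp_all only: U_J)
    have "herm (y + (l *s s) v* H) s = (a + q H s) * l"
      using v(2) by (simp add: herm_simps q_def scalar_vector_matrix_assoc algebra_simps)
    with v(1) show "v \<in> Psa s (a + q H s)" unfolding Psa_def by blast
  qed
  have "Psa s (a + q H s) = U H ` U H ` Psa s (a + q H s)" by (simp add: image_image U_invol)
  also have "\<dots> \<subseteq> U H ` Psa s (a + q H s + q H s)" by (intro image_mono sub)
  also have "a + q H s + q H s = a" by (simp add: add.assoc)
  finally show ?thesis using sub by blast
qed

lemma Dg_Psa: assumes d: "d \<in> F4v" "\<And>k. d $ k \<noteq> 0"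
  shows "Dg d ` Psa s a \<subseteq> Psa (\<chi> k. d $ k * s $ k) a"
proof
  have n: "(d$k * x) * (d$k * y)\<^sup>2 = x * y\<^sup>2" for k x y
  proof -
    have "(d$k * x) * (d$k * y)\<^sup>2 = (d$k * (d$k)\<^sup>2) * (x * y\<^sup>2)"
      by (simp add: power_mult_distrib mult_ac)
    also have "d$k * (d$k)\<^sup>2 = 1" using d F4_norm[of "d$k"] by (simp add: F4v_def)
    finally show ?thesis by simp
  qed
  fix v assume "v \<in> Dg d ` Psa s a"
  then obtain t where t: "t \<in> Psa s a" "v = Dg d t" by blast
  obtain l y where y: "t = J (l *s s) y" "herm y s = a * l" using t(1) unfolding Psa_def by blast
  note v = t(2)[unfolded y(1)] y(2)
  have "v = J (l *s (\<chi> k. d $ k * s $ k)) (\<chi> k. d $ k * y $ k)"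
    unfolding v(1) Dg_J J_eq by (simp add: vec_eq_iff mult_ac)
  moreover have "herm (\<chi> k. d $ k * y $ k) (\<chi> k. d $ k * s $ k) = a * l"
    using v(2) by (simp add: herm_def n)
  ultimately show "v \<in> Psa (\<chi> k. d $ k * s $ k) a" unfolding Psa_def by blast
qed

lemma Fr_Psa: assumes "a = 0 \<or> a = 1" shows "Fr ` Psa s a \<subseteq> Psa (sqv s) a"
proof
  fix v assume "v \<in> Fr ` Psa s a"
  then obtain t where t: "t \<in> Psa s a" "v = Fr t" by blast
  obtain l y where y: "t = J (l *s s) y" "herm y s = a * l" using t(1) unfolding Psa_def by blast
  note v = t(2)[unfolded y(1)] y(2)
  have "v = J (l\<^sup>2 *s sqv s) (sqv y)"
    unfolding v(1) Fr_J J_eq by (simp add: vec_eq_iff sqv_def power_mult_distrib)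
  moreover have "herm (sqv y) (sqv s) = a * l\<^sup>2"
    using v(2) assms by (auto simp: herm_sqv power_mult_distrib)
  ultimately show "v \<in> Psa (sqv s) a" unfolding Psa_def by blast
qed

text \<open>The generators are involutions, and in characteristic 2 an involution has determinant
  1.\<close>

lemma NN_det: assumes n: "n \<in> NN" shows "\<exists>h. n = act h \<and> det h = 1"
proof -
  have inv: "\<exists>h. n = act h \<and> det h = 1" if n: "n \<in> LI" "\<And>v. n (n v) = v" for n
  proof -
    obtain h where h: "n = act h" using LI_imp_act[OF n(1)] by blast
    have "act (h ** h) = act (mat 1)" unfolding act_mult by (rule ext) (simp add: h[symmetric] n act_mat)
    then have "h ** h = mat 1" by (rule act_inj)
    then have "det h * det h = 1" using det_mul[of h h] by simp
    then have "(det h + 1) * (det h + 1) = 0" by (simp add: algebra_simps)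
    then have "det h + 1 + 1 = 0 + 1" by simp
    then have "det h = 1" by (simp only: add.assoc add_self) simp
    then show ?thesis using h by blast
  qed
  have comp: "\<exists>h. m \<circ> n = act h \<and> det h = 1" if "\<exists>h. m = act h \<and> det h = 1" "\<exists>h. n = act h \<and> det h = 1" for m n
  proof -
    from that(1) obtain h where h1: "m = act h" "det h = 1" by blast
    from that(2) obtain h' where h2: "n = act h'" "det h' = 1" by blast
    note h = h1 h2
    have "m \<circ> n = act (h' ** h)" by (simp add: h act_mult)
    moreover have "det (h' ** h) = 1" by (simp add: det_mul h)
    ultimately show ?thesis by blast
  qed
  from n show ?thesis
  proof (induction rule: NN.induct)
    case id
    have "id = act (mat 1)" by (rule ext) (simp add: act_mat)
    then show ?case by (intro exI[of _ "mat 1"]) simp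
  next
    case (U n H)
    show ?case by (rule comp[OF inv[OF U_LI[OF U(2)] U_invol] U(3)])
  next
    case (sw n i)
    show ?case by (rule comp[OF inv[OF swI_LI swI_invol] sw(2)])
  qed
qed

text \<open>The coordinate \<open>\<delta>\<close> acts on one pair of coordinates, that is,
  twice.\<close>

lemma Dg_det: "\<exists>h. Dg (dd \<delta>) = act h \<and> det h = \<delta> * \<delta>"
proof -
  let ?c = "\<chi> i::6. if i = 5 \<or> i = 6 then \<delta> else 1"
  let ?h = "\<chi> i j. if i = j then ?c $ i else 0"
  have a: "act ?h v = (\<chi> i. ?c $ i * v $ i)" for v
    by (simp add: act_def vector_matrix_mult_def vec_eq_iff if_distrib[of "\<lambda>a. _ * a"] mult.commute cong: if_cong)
  have "Dg (dd \<delta>) (J x y) = act ?h (J x y)" for x y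
    unfolding a by (simp add: vec_eq_iff forall_6 dd_def algebra_simps)
  note e = this
  have "Dg (dd \<delta>) = act ?h"
  proof
    fix v obtain x y where "v = J x y" by (rule J_cases)
    then show "Dg (dd \<delta>) v = act ?h v" by (simp only: e)
  qed
  moreover have "det ?h = \<delta> * \<delta>"
  proof -
    have "det ?h = (\<Prod>i\<in>UNIV. ?h $ i $ i)" by (rule det_diagonal) simp
    also have "\<dots> = (\<Prod>i\<in>UNIV. ?c $ i)" by simp
    also have "\<dots> = \<delta> * \<delta>" unfolding UNIV_6 by simp
    finally show ?thesis .
  qed
  ultimately show ?thesis by blast
qed

end

context edge begin

section \<open>Hyperoval vectors and the three vertices\<close>

text \<open>The vector of a set of points; for hyperovals it is a glue vector of
  \<open>R_perp\<close>.\<close>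

definition oval_vec :: "('k^3) set \<Rightarrow> real ^ 24" where "oval_vec K = 12 *\<^sub>R u0 + 2 *\<^sub>R (\<Sum>s\<in>K. u s)"

lemma oval_vec_perp: assumes "K \<subseteq> pts" shows "oval_vec K \<bullet> A = 0" "oval_vec K \<bullet> B = 0"
proof -
  have "(\<Sum>s\<in>K. u s) \<bullet> v = 0" if "\<And>s. s \<in> pts \<Longrightarrow> u s \<bullet> v = 0" for v
    using assms that by (simp add: inner_sum_left subset_iff)
  then show "oval_vec K \<bullet> A = 0" "oval_vec K \<bullet> B = 0"
    using u_perp ptsD by (simp_all add: oval_vec_def inner_add_left u0_perp)
qed

lemma oval_vec_u0: assumes "K \<subseteq> pts" shows "oval_vec K \<bullet> u0 = 1/2"
proof -
  have "(\<Sum>s\<in>K. u s) \<bullet> u0 = (\<Sum>s\<in>K. u s \<bullet> u0)" by (rule inner_sum_left)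
  also have "\<dots> = 0" using assms u0_u ptsD by (intro sum.neutral) (auto simp: inner_commute[of _ u0])
  finally have "(\<Sum>s\<in>K. u s) \<bullet> u0 = 0" .
  then show ?thesis by (simp add: oval_vec_def inner_add_left u0_u0)
qed

lemma oval_vec_u: assumes "K \<subseteq> pts" "s \<in> pts" shows "oval_vec K \<bullet> u s = (if s \<in> K then 1/4 else 0)"
proof -
  have fin: "finite K" using assms(1) finite_subset[OF _ pts_finite] by blast
  have "(\<Sum>t\<in>K. u t) \<bullet> u s = (\<Sum>t\<in>K. if t = s then 1/8 else 0)"
    unfolding inner_sum_left
    using assms u_u[OF ptsD[OF assms(2)]] u_u'[OF _ assms(2)] by (intro sum.cong) auto
  then show ?thesis using fin u0_u[OF ptsD[OF assms(2)]] by (simp add: oval_vec_def inner_add_left)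
qed

lemma oval_vec_inner: assumes "K \<subseteq> pts" "y \<bullet> A = 0" "y \<bullet> B = 0"
  shows "oval_vec K \<bullet> y = 12 * (y \<bullet> u0) + 2 * (\<Sum>s\<in>K. y \<bullet> u s)"
  unfolding oval_vec_def inner_add_left inner_scaleR_left inner_sum_left by (simp only: inner_commute[of _ y])

lemma oval_vec_oval_vec: assumes "K \<subseteq> pts" "K' \<subseteq> pts" shows "oval_vec K \<bullet> oval_vec K' = 6 + card (K \<inter> K') / 2"
proof -
  have fin: "finite K" using assms(1) finite_subset[OF _ pts_finite] by blast
  have "(\<Sum>s\<in>K. oval_vec K' \<bullet> u s) = (\<Sum>s\<in>K. if s \<in> K' then 1/4 else 0)"
    using assms oval_vec_u[OF assms(2)] by (intro sum.cong) auto
  also have "\<dots> = card (K \<inter> K') / 4" using fin by (simp add: sum.If_cases Int_def)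
  finally show ?thesis
    unfolding oval_vec_inner[OF assms(1) oval_vec_perp[OF assms(2)]] oval_vec_u0[OF assms(2)] by simp
qed

definition oval :: "('k^3) set \<Rightarrow> bool" where
  "oval K \<longleftrightarrow> K \<subseteq> pts \<and> card K = 6 \<and> (\<forall>H\<in>Herm. even (card {s \<in> K. q H s \<noteq> 0}))"

lemma oval_hyperoval: "g \<in> F4 \<Longrightarrow> g \<noteq> 0 \<Longrightarrow> oval (hyperoval g)"
  by (simp add: oval_def hyperoval_pts hyperoval_card hyperoval_even)

text \<open>The inner product with \<open>W H\<close> is 2 minus half the number of points at
  which the form of \<open>H\<close> is nonzero, and this number is even.\<close>

lemma oval_int_frame: assumes K: "oval K" and P: "P \<in> frame_planes" shows "oval_vec K \<bullet> tt P \<in> \<int>"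
proof -
  have pts: "K \<subseteq> pts" and fin: "finite K" using K finite_subset[OF _ pts_finite] by (auto simp: oval_def)
  have "P = Winf \<or> (\<exists>H\<in>Herm. P = W H) \<or> (\<exists>s\<in>pts. P = Psa s 0 \<or> P = Psa s 1)"
    using P unfolding frame_planes_def by blast
  then consider "P = Winf" | H where "H \<in> Herm" "P = W H" | s where "s \<in> pts" "P = Psa s 0 \<or> P = Psa s 1" by blast
  then show ?thesis
  proof cases
    case 1 show ?thesis unfolding 1 tt_Winf inner_scaleR_right oval_vec_u0[OF pts] by simp
  next
    case (2 H)
    have "(\<Sum>s\<in>K. tt P \<bullet> u s) = (\<Sum>s\<in>K. 1/8 - (if q H s \<noteq> 0 then 1/4 else 0))"
    proof (rule sum.cong)
      fix s assume "s \<in> K"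
      then have "s \<in> pts" using pts by blast
      from tt_W_u[OF 2(1) ptsD[OF this]] show "tt P \<bullet> u s = 1/8 - (if q H s \<noteq> 0 then 1/4 else 0)"
        unfolding 2(2) sg_def by (cases "q H s = 0") (simp_all only: if_True if_False, simp_all)
    qed simp
    also have "\<dots> = card K / 8 - card {s \<in> K. q H s \<noteq> 0} / 4"
      using fin by (simp add: sum_subtractf sum.If_cases Int_def)
    finally have "(\<Sum>s\<in>K. tt P \<bullet> u s) = 6/8 - card {s \<in> K. q H s \<noteq> 0} / 4"
      using K by (simp add: oval_def)
    moreover have "oval_vec K \<bullet> tt P = 12 * (tt P \<bullet> u0) + 2 * (\<Sum>s\<in>K. tt P \<bullet> u s)"
      by (rule oval_vec_inner[OF pts]) (simp_all add: 2 tt_perp W_plane)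
    moreover have "tt P \<bullet> u0 = 1/24" unfolding 2(2) by (rule tt_W_u0[OF 2(1)])
    ultimately have "oval_vec K \<bullet> tt P = 2 - card {s \<in> K. q H s \<noteq> 0} / 2" by linarith
    moreover have "even (card {s \<in> K. q H s \<noteq> 0})" using K 2(1) by (simp add: oval_def)
    then obtain k where "card {s \<in> K. q H s \<noteq> 0} = 2 * k" by (rule evenE)
    ultimately have "oval_vec K \<bullet> tt P = 2 - of_nat k" by simp
    then show ?thesis by simp
  next
    case (3 s)
    have "oval_vec K \<bullet> tt (Psa s 0) = 4 * (1/2) + 4 * (if s \<in> K then 1/4 else 0)"
      "oval_vec K \<bullet> tt (Psa s 1) = 4 * (1/2) - 4 * (if s \<in> K then 1/4 else 0)"
      unfolding tt_Psa[OF ptsD[OF 3(1)]] inner_add_right inner_diff_right inner_scaleR_right oval_vec_u0[OF pts] oval_vec_u[OF pts 3(1)]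
      by (rule refl)+
    then show ?thesis using 3(2) by (elim disjE) (simp_all only:, simp_all)
  qed
qed

lemma oval_int: assumes K: "oval K" and x: "x \<in> L" shows "oval_vec K \<bullet> x \<in> \<int>"
proof -
  have "x \<in> {x. oval_vec K \<bullet> x \<in> \<int>}" using x unfolding frame_lattice_eq_L[symmetric] frame_lattice_def
    by (rule gc_mono_closed) (use oval_int_frame[OF K] in \<open>auto simp: inner_diff_right\<close>)
  then show ?thesis by simp
qed

lemma even_of_half_int: "x \<in> \<int> \<Longrightarrow> 2 * x = real_of_int n \<Longrightarrow> even n"
proof -
  assume "x \<in> \<int>" "2 * x = real_of_int n"
  then obtain k where "x = real_of_int k" by (auto elim: Ints_cases)
  then have "real_of_int (2 * k) = real_of_int n" using \<open>2 * x = real_of_int n\<close> by simp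
  then have "2 * k = n" by (simp only: of_int_eq_iff)
  then show "even n" by auto
qed

text \<open>By \<open>glue\<close> it remains to exclude that the vector lies in
  \<open>R_perp\<close>. But its inner product with the vector of a hyperoval that meets it in an
  odd number of points is no integer.\<close>

lemma oval_glue:
  assumes K: "oval K" and K': "oval K'" and odd: "odd (card (K \<inter> K'))"
  shows "\<exists>k<3. oval_vec K + (3/2) *\<^sub>R vertex k \<in> \<Lambda>"
proof -
  have pts: "K \<subseteq> pts" "K' \<subseteq> pts" using K K' by (auto simp: oval_def)
  have "oval_vec K \<notin> L"
  proof
    assume "oval_vec K \<in> L"
    then have i: "oval_vec K' \<bullet> oval_vec K \<in> \<int>" by (rule oval_int[OF K'])
    have e: "2 * (oval_vec K' \<bullet> oval_vec K) = real_of_int (12 + int (card (K' \<inter> K)))"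
      unfolding oval_vec_oval_vec[OF pts(2,1)] by simp
    have "even (12 + int (card (K' \<inter> K)))" by (rule even_of_half_int[OF i e])
    then show False using odd by (simp add: Int_commute)
  qed
  moreover have "oval_vec K \<in> L \<or> (\<exists>k<3. oval_vec K + (3/2) *\<^sub>R vertex k \<in> \<Lambda>)"
  proof (rule glue[OF oval_vec_perp[OF pts(1)]])
    show "oval_vec K \<bullet> l \<in> \<int>" if "l \<in> L" for l by (rule oval_int[OF K that])
    show "oval_vec K \<bullet> tt Winf \<in> \<int>" by (rule oval_int_frame[OF K frame_planesI(1)])
  qed
  ultimately show ?thesis by blast
qed

text \<open>For lattice vectors with components \<open>(3/2) vertex k\<close> and \<open>(3/2) vertex
  k'\<close> in the plane of the triangle, these components contribute 3 if \<open>k = k'\<close>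
  and \<open>- 3/2\<close> otherwise to an integral inner product.\<close>

lemma glue_inner:
  assumes y: "y \<bullet> A = 0" "y \<bullet> B = 0" "y' \<bullet> A = 0" "y' \<bullet> B = 0" and k: "k < 3" "k' < 3"
    and L: "y + (3/2) *\<^sub>R vertex k \<in> \<Lambda>" "y' + (3/2) *\<^sub>R vertex k' \<in> \<Lambda>"
  shows "y \<bullet> y' \<in> \<int> \<longleftrightarrow> k = k'"
proof -
  have "(y + (3/2) *\<^sub>R vertex k) \<bullet> (y' + (3/2) *\<^sub>R vertex k') \<in> \<int>" by (rule L_int[OF L])
  then have i: "y \<bullet> y' + (9/4) * (vertex k \<bullet> vertex k') \<in> \<int>"
    using perp_vertex(1)[OF y(1,2)] perp_vertex(1)[OF y(3,4)]
    by (simp add: inner_add_left inner_add_right inner_commute[of "vertex k" y'])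
  show ?thesis
  proof (cases "k = k'")
    case True
    then have "vertex k \<bullet> vertex k' = 4/3" using vertex_inner k by simp
    from i[unfolded this] have "y \<bullet> y' + 3 \<in> \<int>" by simp
    then have "y \<bullet> y' + 3 - 3 \<in> \<int>" by (intro Ints_diff) auto
    then show ?thesis using True by simp
  next
    case False
    then have "vertex k \<bullet> vertex k' = - (2/3)" using vertex_inner k by simp
    from i[unfolded this] have i: "y \<bullet> y' - 3/2 \<in> \<int>" by simp
    have "y \<bullet> y' \<notin> \<int>"
    proof
      assume "y \<bullet> y' \<in> \<int>"
      then have h: "y \<bullet> y' - (y \<bullet> y' - 3/2) \<in> \<int>" using i by (rule Ints_diff)
      have "even (3::int)" by (rule even_of_half_int[OF h]) simp
      then show False by simp
    qed
    then show ?thesis using False by simp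
  qed
qed

text \<open>\<open>F\<close> maps the glue vector of the vertex \<open>vertex k\<close> to that of the
  vertex \<open>F (vertex k)\<close>, and \<open>glue_inner\<close> compares the two.\<close>

lemma oval_criterion:
  assumes F: "Iso F" "F ` vertices = vertices" and K: "K \<subseteq> pts" and k: "k < 3" "oval_vec K + (3/2) *\<^sub>R vertex k \<in> \<Lambda>"
  shows "F (vertex k) = vertex k \<longleftrightarrow> oval_vec K \<bullet> F (oval_vec K) \<in> \<int>"
proof -
  have "vertex k \<in> vertices" using k(1) by (auto simp: vertices_def)
  then have "F (vertex k) \<in> vertices" using F(2) by blast
  then obtain k' where k': "k' < 3" "F (vertex k) = vertex k'" by (auto simp: vertices_def)
  have "F (oval_vec K + (3/2) *\<^sub>R vertex k) \<in> \<Lambda>" by (rule Iso_Lambda[OF F(1) k(2)])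
  then have i: "F (oval_vec K) + (3/2) *\<^sub>R vertex k' \<in> \<Lambda>"
    using Iso_lin[OF F(1)] k'(2) by (simp add: linear_add linear_scale)
  have "orthogonal_transformation F" using F(1) by (simp add: Iso_def)
  note Fo = perp_image[OF this F(2) oval_vec_perp[OF K]]
  from glue_inner[OF oval_vec_perp[OF K] Fo k(1) k'(1) k(2) i]
  have "oval_vec K \<bullet> F (oval_vec K) \<in> \<int> \<longleftrightarrow> k = k'" .
  moreover have "F (vertex k) = vertex k \<longleftrightarrow> k = k'" using k'(2) vertex_inj[OF k(1) k'(1)] by auto
  ultimately show ?thesis by simp
qed

lemma F4_w: "(1::'k) \<in> F4" "w \<in> F4" "w + 1 \<in> F4" by (simp_all add: F4_eq)

lemma hyperoval_glue: assumes g: "g \<in> F4" "g \<noteq> 0" shows "\<exists>k<3. oval_vec (hyperoval g) + (3/2) *\<^sub>R vertex k \<in> \<Lambda>"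
proof -
  (* Another hyperoval of the family, which meets the given one in the three axis points. *)
  define g' where "g' = (if g = 1 then w else 1)"
  have g': "g' \<in> F4" "g' \<noteq> 0" "g \<noteq> g'" using F4_w w_ne by (auto simp: g'_def)
  show ?thesis by (rule oval_glue[OF oval_hyperoval[OF g] oval_hyperoval[OF g'(1,2)]]) (simp add: hyperoval_Int[OF g'(3)])
qed

text \<open>The hyperovals with \<open>g = 1\<close> and \<open>g = w\<close> belong to different
  vertices, since they meet in three points; if two vertices are fixed, so is the third, as the
  sum of all three is 0.\<close>

lemma fixes_vertex_iff:
  assumes F: "Iso F" "F ` vertices = vertices"
  shows "(\<forall>i<3. F (vertex i) = vertex i) \<longleftrightarrow> (\<forall>g\<in>F4. g \<noteq> 0 \<longrightarrow> oval_vec (hyperoval g) \<bullet> F (oval_vec (hyperoval g)) \<in> \<int>)"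
proof
  assume a: "\<forall>i<3. F (vertex i) = vertex i"
  show "\<forall>g\<in>F4. g \<noteq> 0 \<longrightarrow> oval_vec (hyperoval g) \<bullet> F (oval_vec (hyperoval g)) \<in> \<int>"
  proof (intro ballI impI)
    fix g :: 'k assume g: "g \<in> F4" "g \<noteq> 0"
    obtain k where k: "k < 3" "oval_vec (hyperoval g) + (3/2) *\<^sub>R vertex k \<in> \<Lambda>" using hyperoval_glue[OF g] by blast
    show "oval_vec (hyperoval g) \<bullet> F (oval_vec (hyperoval g)) \<in> \<int>"
      using oval_criterion[OF F hyperoval_pts[OF g(1)] k] a k(1) by blast
  qed
next
  assume a: "\<forall>g\<in>F4. g \<noteq> 0 \<longrightarrow> oval_vec (hyperoval g) \<bullet> F (oval_vec (hyperoval g)) \<in> \<int>"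
  obtain k where k: "k < 3" "oval_vec (hyperoval 1) + (3/2) *\<^sub>R vertex k \<in> \<Lambda>" using hyperoval_glue[OF F4_w(1)] by auto
  obtain k' where k': "k' < 3" "oval_vec (hyperoval w) + (3/2) *\<^sub>R vertex k' \<in> \<Lambda>" using hyperoval_glue[OF F4_w(2)] w_ne by auto
  have p: "hyperoval 1 \<subseteq> pts" "hyperoval w \<subseteq> pts" using hyperoval_pts F4_w by blast+
  have f: "F (vertex k) = vertex k" "F (vertex k') = vertex k'"
    using oval_criterion[OF F p(1) k] oval_criterion[OF F p(2) k'] a F4_w w_ne by auto
  have kk: "k \<noteq> k'"
  proof
    assume "k = k'"
    then have i: "oval_vec (hyperoval 1) \<bullet> oval_vec (hyperoval w) \<in> \<int>"
      using glue_inner[OF oval_vec_perp[OF p(1)] oval_vec_perp[OF p(2)] k(1) k'(1) k(2) k'(2)] by blast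
    have "oval_vec (hyperoval 1) \<bullet> oval_vec (hyperoval w) = 6 + 3/2" unfolding oval_vec_oval_vec[OF p] using hyperoval_Int[of 1 w] w_ne by simp
    then have "even (15::int)" by (intro even_of_half_int[OF i]) simp
    then show False by simp
  qed
  show "\<forall>i<3. F (vertex i) = vertex i"
  proof (intro allI impI)
    fix i :: nat assume i: "i < 3"
    show "F (vertex i) = vertex i"
    proof (cases "i = k \<or> i = k'")
      case True then show ?thesis using f by blast
    next
      case False
      then have "vertex k + vertex k' + vertex i = 0" using vertex_sum_distinct[OF k(1) k'(1) i] kk by blast
      then have e: "vertex i = - vertex k - vertex k'" by (simp add: algebra_simps eq_neg_iff_add_eq_0)
      show ?thesis unfolding e using Iso_lin[OF F(1)] f by (simp add: linear_diff linear_neg)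
    qed
  qed
qed

end

context char2_field begin

section \<open>The isometries that fix the triangle pointwise\<close>

text \<open>The identity \<open>(0 1; 1 0) = (1 1; 0 1) (1 0; 1 1) (1 1; 0 1)\<close> for matrices
  over the prime field, applied to one coordinate pair; the lower triangular factor is itself a
  conjugate of the upper triangular one by the swap.\<close>

lemma swI_E: "swI {i} = U (\<chi> k l. if k = i \<and> l = i then 1 else 0) \<circ> swI {i}
    \<circ> U (\<chi> k l. if k = i \<and> l = i then 1 else 0) \<circ> swI {i} \<circ> U (\<chi> k l. if k = i \<and> l = i then 1 else 0)"
proof
  have v: "z v* (\<chi> k l. if k = i \<and> l = i then 1 else 0) = axis i (z$i)" for z :: "'k^3"
  proof -
    have "(\<Sum>k\<in>UNIV. z $ k * (if k = i \<and> l = i then 1 else 0)) = (\<Sum>k\<in>UNIV. if k = i then (if l = i then z$i else 0) else 0)" for l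
      by (intro sum.cong) auto
    then show ?thesis by (simp add: vec_eq_iff vector_matrix_mult_def axis_def)
  qed
  fix t :: "'k^6" obtain x y where t: "t = J x y" by (rule J_cases)
  show "swI {i} t = (U (\<chi> k l. if k = i \<and> l = i then 1 else 0) \<circ> swI {i}
    \<circ> U (\<chi> k l. if k = i \<and> l = i then 1 else 0) \<circ> swI {i} \<circ> U (\<chi> k l. if k = i \<and> l = i then 1 else 0)) t"
    unfolding t comp_apply swI_J U_J v J_eq by (auto simp: vec_eq_iff axis_def add.assoc)
qed

lemma E_Herm: "(\<chi> k l. if k = i \<and> l = i then 1 else 0) \<in> Herm"
  by (rule HermI) auto

lemma bij_image_eq_planes:
  assumes "m \<in> SM" "P \<in> planes" "Q \<in> planes" "m ` P \<subseteq> Q" shows "m ` P = Q"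
proof -
  have "vec.subspace (m ` P)" "vec.subspace Q" "vec.dim Q = vec.dim (m ` P)"
    using assms SM_subspace SM_dim by (auto simp: planes_iff)
  then show ?thesis using vec.subspace_dim_equal[of "m ` P" Q] assms(4) by simp
qed

end

context edge begin

lemma Iso_comp: "Iso F \<Longrightarrow> Iso F' \<Longrightarrow> Iso (F \<circ> F')"
  unfolding Iso_def by (simp only: image_comp[symmetric] orthogonal_transformation_compose simp_thms)

lemma lift_comp: assumes "lift p F" "lift r F'" "aut r" shows "lift (\<lambda>P. p (r P)) (F \<circ> F')"
proof -
  have "Iso (F \<circ> F')" using assms Iso_comp by (simp add: lift_def)
  moreover have "(F \<circ> F') ` vertices = vertices" using assms by (simp only: lift_def image_comp[symmetric])
  ultimately show ?thesis using assms aut_in[OF assms(3)] by (simp add: lift_def)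
qed

text \<open>The lift of the symmetry induced by a semilinear isometry.\<close>

definition sym_lift :: "('k^6 \<Rightarrow> 'k^6) \<Rightarrow> real ^ 24 \<Rightarrow> real ^ 24" where
  "sym_lift m = (SOME F. lift (\<lambda>P. m ` P) F)"

lemma sym_lift_eq: "lift (\<lambda>P. m ` P) F \<Longrightarrow> sym_lift m = F"
  unfolding sym_lift_def by (rule some_equality) (auto intro: lift_unique)

lemma sym_lift_lift: "m \<in> SM \<Longrightarrow> lift (\<lambda>P. m ` P) (sym_lift m)"
  using lift_exists[OF aut_SM] sym_lift_eq by metis

lemma sym_lift_tt: "m \<in> SM \<Longrightarrow> P \<in> planes \<Longrightarrow> sym_lift m (tt P) = tt (m ` P)"
  using sym_lift_lift[of m] by (simp add: lift_def)

lemma sym_lift_Iso: "m \<in> SM \<Longrightarrow> Iso (sym_lift m)" "m \<in> SM \<Longrightarrow> sym_lift m ` vertices = vertices"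
  using sym_lift_lift[of m] by (simp_all add: lift_def)

text \<open>The composite of two semilinear maps need not belong to \<open>SM\<close>, but the
  composite of the lifts is still the unique lift of the composite symmetry.\<close>

lemma sym_lift_comp: assumes "m \<in> SM" "n \<in> SM" shows "sym_lift (m \<circ> n) = sym_lift m \<circ> sym_lift n"
proof (rule sym_lift_eq)
  show "lift (\<lambda>P. (m \<circ> n) ` P) (sym_lift m \<circ> sym_lift n)"
    using lift_comp[OF sym_lift_lift[OF assms(1)] sym_lift_lift[OF assms(2)] aut_SM[OF assms(2)]] by (simp only: image_comp)
qed

lemma sym_lift_id: "sym_lift id = id"
  unfolding id_def by (rule sym_lift_eq) (simp add: lift_def Iso_def orthogonal_transformation_id)

lemma sym_lift_vertex: assumes "m \<in> SM" "i < 3" shows "\<exists>j<3. sym_lift m (vertex i) = vertex j"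
proof -
  have "vertex i \<in> vertices" using assms(2) by (auto simp: vertices_def)
  then have "sym_lift m (vertex i) \<in> vertices" using sym_lift_Iso(2)[OF assms(1)] by blast
  then show ?thesis by (auto simp: vertices_def)
qed

definition fixes_vertices :: "('k^6 \<Rightarrow> 'k^6) \<Rightarrow> bool" where "fixes_vertices m \<longleftrightarrow> (\<forall>i<3. sym_lift m (vertex i) = vertex i)"

lemma fixes_vertices_id: "fixes_vertices id" by (simp add: fixes_vertices_def sym_lift_id)

lemma fixes_vertices_comp: assumes "n \<in> SM" "m \<in> SM" "fixes_vertices n" shows "fixes_vertices (n \<circ> m) \<longleftrightarrow> fixes_vertices m"
proof -
  have "sym_lift (n \<circ> m) (vertex i) = sym_lift m (vertex i)" if "i < 3" for i
  proof -
    obtain j where j: "j < 3" "sym_lift m (vertex i) = vertex j" using sym_lift_vertex[OF assms(2) \<open>i < 3\<close>] by blast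
    have "sym_lift n (vertex j) = vertex j" using assms(3) j(1) by (simp add: fixes_vertices_def)
    then show ?thesis by (simp add: sym_lift_comp[OF assms(1,2)] j(2))
  qed
  then show ?thesis by (simp add: fixes_vertices_def)
qed

lemma fixes_vertices_iff: assumes "m \<in> SM"
  shows "fixes_vertices m \<longleftrightarrow> (\<forall>g\<in>F4. g \<noteq> 0 \<longrightarrow> oval_vec (hyperoval g) \<bullet> sym_lift m (oval_vec (hyperoval g)) \<in> \<int>)"
  unfolding fixes_vertices_def by (rule fixes_vertex_iff[OF sym_lift_Iso[OF assms]])

lemma sym_lift_u0: assumes m: "m \<in> SM" "m ` Winf = Winf" shows "sym_lift m u0 = u0"
  using sym_lift_tt[OF m(1) Winf_plane] Iso_lin[OF sym_lift_Iso(1)[OF m(1)]] m(2) by (simp add: u0_def linear_scale linear_neg)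

lemma sym_lift_u: assumes m: "m \<in> SM" and s: "s \<in> F4v" "s \<noteq> 0"
  shows "sym_lift m (u s) = (1/8) *\<^sub>R (tt (m ` Psa s 0) - tt (m ` Psa s 1))"
  using sym_lift_tt[OF m PsaP(1)[OF s]] sym_lift_tt[OF m PsaP(2)[OF s]] Iso_lin[OF sym_lift_Iso(1)[OF m]]
  by (simp add: u_def linear_scale linear_diff)

lemma sym_lift_oval_vec: assumes m: "m \<in> SM" "m ` Winf = Winf"
  shows "sym_lift m (oval_vec K) = 12 *\<^sub>R u0 + 2 *\<^sub>R (\<Sum>s\<in>K. sym_lift m (u s))"
  using Iso_lin[OF sym_lift_Iso(1)[OF m(1)]] sym_lift_u0[OF m] by (simp add: oval_vec_def linear_add linear_scale linear_sum)

text \<open>\<open>U H\<close> fixes \<open>u0\<close> and changes the sign of \<open>u s\<close>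
  where the form of \<open>H\<close> is nonzero. The inner product of a hyperoval vector with its
  image is therefore \<open>9\<close> minus the number of such points.\<close>

lemma fixes_vertices_U: assumes H: "H \<in> Herm" shows "fixes_vertices (U H)"
proof -
  have m: "U H \<in> SM" "U H ` Winf = Winf" using SM_LI[OF U_LI[OF H]] U_Winf by auto
  have us: "sym_lift (U H) (u s) = sg H s *\<^sub>R u s" if s: "s \<in> pts" for s
  proof -
    have "q H s = 0 \<or> q H s = 1" by (rule q_F2[OF ptsD(1)[OF s] H])
    then show ?thesis unfolding sym_lift_u[OF m(1) ptsD[OF s]] U_Psa[OF ptsD(1)[OF s] H]
      by (elim disjE) (simp_all add: sg_def u_def flip: scaleR_minus_right)
  qed
  have "oval_vec (hyperoval g) \<bullet> sym_lift (U H) (oval_vec (hyperoval g)) \<in> \<int>" if g: "g \<in> F4" "g \<noteq> 0" for g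
  proof -
    have p: "hyperoval g \<subseteq> pts" by (rule hyperoval_pts[OF g(1)])
    have "oval_vec (hyperoval g) \<bullet> sym_lift (U H) (oval_vec (hyperoval g)) = 12 * (oval_vec (hyperoval g) \<bullet> u0) + 2 * (\<Sum>s\<in>hyperoval g. oval_vec (hyperoval g) \<bullet> sym_lift (U H) (u s))"
      unfolding sym_lift_oval_vec[OF m] by (simp only: inner_add_right inner_scaleR_right inner_sum_right)
    also have "(\<Sum>s\<in>hyperoval g. oval_vec (hyperoval g) \<bullet> sym_lift (U H) (u s)) = (\<Sum>s\<in>hyperoval g. 1/4 - (if q H s \<noteq> 0 then 1/2 else 0))"
    proof (rule sum.cong)
      fix s assume s: "s \<in> hyperoval g"
      then have "s \<in> pts" using p by blast
      then have "oval_vec (hyperoval g) \<bullet> sym_lift (U H) (u s) = sg H s * (1/4)"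
        unfolding us[OF \<open>s \<in> pts\<close>] inner_scaleR_right oval_vec_u[OF p \<open>s \<in> pts\<close>] using s by simp
      then show "oval_vec (hyperoval g) \<bullet> sym_lift (U H) (u s) = 1/4 - (if q H s \<noteq> 0 then 1/2 else 0)"
        unfolding sg_def by (cases "q H s = 0") (simp_all only: if_True if_False, simp_all)
    qed simp
    also have "\<dots> = card (hyperoval g) / 4 - card {s \<in> hyperoval g. q H s \<noteq> 0} / 2"
      using finite_subset[OF p pts_finite] by (simp add: sum_subtractf sum.If_cases Int_def)
    also have "12 * (oval_vec (hyperoval g) \<bullet> u0) = 6" unfolding oval_vec_u0[OF p] by simp
    also have "6 + 2 * (card (hyperoval g) / 4 - card {s \<in> hyperoval g. q H s \<noteq> 0} / 2) = 9 - of_nat (card {s \<in> hyperoval g. q H s \<noteq> 0})"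
      by (simp add: hyperoval_card)
    finally show ?thesis by simp
  qed
  then show ?thesis unfolding fixes_vertices_iff[OF m(1)] by blast
qed

text \<open>By \<open>swI_E\<close> the swap is a product of three factors \<open>U E\<close> and
  two swaps. The factors \<open>U E\<close> act trivially on the vertices, so there the swap acts
  like its own square, which is the identity.\<close>

lemma fixes_vertices_swI: "fixes_vertices (swI {i})"
proof -
  define E :: "'k^3^3" where "E = (\<chi> k l. if k = i \<and> l = i then 1 else 0)"
  have E: "E \<in> Herm" unfolding E_def by (rule E_Herm)
  have S: "U E \<in> SM" "swI {i} \<in> SM" by (intro SM_LI U_LI E swI_LI)+
  have sw: "swI {i} = U E \<circ> (swI {i} \<circ> (U E \<circ> (swI {i} \<circ> U E)))"
    using swI_E[of i] unfolding E_def comp_assoc .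
  have 1: "U E \<circ> (swI {i} \<circ> U E) \<in> SM" "swI {i} \<circ> U E \<in> SM" "swI {i} \<circ> (U E \<circ> (swI {i} \<circ> U E)) \<in> SM"
    by (intro SM_LI LI_comp U_LI E swI_LI)+
  have F: "sym_lift (swI {i}) = sym_lift (U E) \<circ> (sym_lift (swI {i}) \<circ> (sym_lift (U E) \<circ> (sym_lift (swI {i}) \<circ> sym_lift (U E))))"
    by (subst (1) sw) (simp only: sym_lift_comp S 1)
  have "swI {i} \<circ> swI {i} = id" using swI_invol by auto
  then have inv: "sym_lift (swI {i}) \<circ> sym_lift (swI {i}) = id" using sym_lift_comp[OF S(2) S(2)] sym_lift_id by simp
  have U: "sym_lift (U E) (vertex j) = vertex j" if "j < 3" for j using fixes_vertices_U[OF E] that by (simp add: fixes_vertices_def)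
  have "sym_lift (swI {i}) (vertex j) = vertex j" if j: "j < 3" for j
  proof -
    obtain k where k: "k < 3" "sym_lift (swI {i}) (vertex j) = vertex k" using sym_lift_vertex[OF S(2) j] by blast
    have kj: "sym_lift (swI {i}) (vertex k) = vertex j" using fun_cong[OF inv, of "vertex j"] k(2) by simp
    have "sym_lift (swI {i}) (vertex j) = sym_lift (U E) (sym_lift (swI {i}) (sym_lift (U E) (sym_lift (swI {i}) (sym_lift (U E) (vertex j)))))"
      using fun_cong[OF F, of "vertex j"] by simp
    also have "\<dots> = vertex j" by (simp only: U[OF j] k(2) U[OF k(1)] kj)
    finally show ?thesis .
  qed
  then show ?thesis by (simp add: fixes_vertices_def)
qed

lemma fixes_vertices_NN: "n \<in> NN \<Longrightarrow> fixes_vertices n"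
proof (induction rule: NN.induct)
  case id show ?case by (rule fixes_vertices_id)
next
  case (U n H)
  then show ?case using fixes_vertices_comp[OF SM_LI[OF U_LI[OF U(2)]] SM_LI[OF NN_LI[OF U(1)]] fixes_vertices_U[OF U(2)]] by blast
next
  case (sw n i)
  then show ?case using fixes_vertices_comp[OF SM_LI[OF swI_LI] SM_LI[OF NN_LI[OF sw(1)]] fixes_vertices_swI] by blast
qed

lemma sym_lift_u_Psa:
  assumes m: "m \<in> SM" and s: "s \<in> F4v" "s \<noteq> 0" and t: "t \<in> F4v" "t \<noteq> 0" and c: "c \<in> F4" "c \<noteq> 0"
    and P: "m ` Psa s 0 \<subseteq> Psa (c *s t) 0" "m ` Psa s 1 \<subseteq> Psa (c *s t) 1"
  shows "sym_lift m (u s) = u t"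
proof -
  have "m ` Psa s 0 = Psa t 0" "m ` Psa s 1 = Psa t 1"
    using bij_image_eq_planes[OF m PsaP(1)[OF s] PsaP(1)[OF t]] bij_image_eq_planes[OF m PsaP(2)[OF s] PsaP(2)[OF t]] P
    unfolding Psa_scale[OF c] by blast+
  then show ?thesis unfolding sym_lift_u[OF m s] by (simp only: u_def)
qed

lemma hyperoval_sum: "(\<Sum>s\<in>hyperoval g. f s) = f (v3 1 0 0) + (f (v3 0 1 0) + (f (v3 0 0 1) + (f (v3 1 1 g)
      + (f (v3 1 w (g * (w + 1))) + f (v3 1 (w + 1) (g * w))))))" for f :: "'k^3 \<Rightarrow> real^24"
  using w_ne by (simp add: hyperoval_def)

text \<open>The diagonal map multiplies the last coordinate of each point by
  \<open>\<delta>\<close>; it carries the hyperoval of \<open>g\<close> to that of \<open>\<delta>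
  g\<close>.\<close>

lemma sym_lift_Dg_oval_vec: assumes d: "\<delta> \<in> F4" "\<delta> \<noteq> 0" and g: "g \<in> F4"
  shows "sym_lift (Dg (dd \<delta>)) (oval_vec (hyperoval g)) = oval_vec (hyperoval (\<delta> * g))"
proof -
  have m: "Dg (dd \<delta>) \<in> SM" by (rule SM_LI[OF Dg_dd_LI[OF d]])
  have W: "Dg (dd \<delta>) ` Winf = Winf" using m Winf_plane
    by (rule image_eq_bij) (auto simp: Winf_iff vec_eq_iff[of "\<chi> k. _" 0])
  have dk: "(\<chi> k. dd \<delta> $ k * v3 a b c $ k) = v3 a b (\<delta> * c)" for a b c by (simp add: vec_eq_iff forall_3 dd_def)
  have P: "Dg (dd \<delta>) ` Psa (v3 a b c) e \<subseteq> Psa (v3 a b (\<delta> * c)) e" for a b c e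
    using Dg_Psa[OF dd_F4v[OF d(1)] dd_nz[OF d(2)], of "v3 a b c" e] unfolding dk .
  have u1: "sym_lift (Dg (dd \<delta>)) (u (v3 a b c)) = u (v3 a b (\<delta> * c))" if "v3 a b c \<in> pts" "v3 a b (\<delta> * c) \<in> pts" for a b c
    by (rule sym_lift_u_Psa[OF m ptsD[OF that(1)] ptsD[OF that(2)], of 1]) (simp_all add: F4_w P)
  have u2: "sym_lift (Dg (dd \<delta>)) (u (v3 0 0 1)) = u (v3 0 0 1)"
  proof -
    have p: "v3 0 0 1 \<in> pts" by (simp add: v3_pts)
    have e: "\<delta> *s v3 0 0 1 = v3 0 0 (\<delta> * 1)" by (simp add: scale_v3)
    show ?thesis by (rule sym_lift_u_Psa[OF m ptsD[OF p] ptsD[OF p] d]) (unfold e, (rule P)+)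
  qed
  have F: "w \<in> F4" "w + 1 \<in> F4" "g * (w + 1) \<in> F4" "g * w \<in> F4" "\<delta> * g \<in> F4" "\<delta> * (g * (w + 1)) \<in> F4" "\<delta> * (g * w) \<in> F4"
    using F4_w g d by (auto intro!: F4_mult)
  have "sym_lift (Dg (dd \<delta>)) (oval_vec (hyperoval g)) = 12 *\<^sub>R u0 + 2 *\<^sub>R (\<Sum>s\<in>hyperoval g. sym_lift (Dg (dd \<delta>)) (u s))"
    by (rule sym_lift_oval_vec[OF m W])
  also have "(\<Sum>s\<in>hyperoval g. sym_lift (Dg (dd \<delta>)) (u s)) = (\<Sum>s\<in>hyperoval (\<delta> * g). u s)"
    unfolding hyperoval_sum using F F4_w g u1[of 1 0 0] u1[of 0 1 0] u1[of 1 1 g] u1[of 1 w "g * (w + 1)"] u1[of 1 "w + 1" "g * w"]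
    by (simp add: v3_pts u2 mult.assoc)
  finally show ?thesis by (simp only: oval_vec_def)
qed

lemma sym_lift_Fr_oval_vec: assumes g: "g \<in> F4" shows "sym_lift Fr (oval_vec (hyperoval g)) = oval_vec (hyperoval (g\<^sup>2))"
proof -
  have m: "Fr \<in> SM" by (rule Fr_SM)
  have W: "Fr ` Winf = Winf" using m Winf_plane by (rule image_eq_bij) (auto simp: Winf_iff)
  have sq3: "sqv (v3 a b c) = v3 (a\<^sup>2) (b\<^sup>2) (c\<^sup>2)" for a b c by (simp add: sqv_def vec_eq_iff forall_3)
  have u1: "sym_lift Fr (u (v3 a b c)) = u (v3 (a\<^sup>2) (b\<^sup>2) (c\<^sup>2))" if "v3 a b c \<in> pts" "v3 (a\<^sup>2) (b\<^sup>2) (c\<^sup>2) \<in> pts" for a b c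
  proof (rule sym_lift_u_Psa[OF m ptsD[OF that(1)] ptsD[OF that(2)], of 1])
    show "Fr ` Psa (v3 a b c) 0 \<subseteq> Psa (1 *s v3 (a\<^sup>2) (b\<^sup>2) (c\<^sup>2)) 0" "Fr ` Psa (v3 a b c) 1 \<subseteq> Psa (1 *s v3 (a\<^sup>2) (b\<^sup>2) (c\<^sup>2)) 1"
      using Fr_Psa[of 0 "v3 a b c"] Fr_Psa[of 1 "v3 a b c"] unfolding sq3 by simp_all
  qed (simp_all add: F4_w)
  have g2: "g\<^sup>2 \<in> F4" using g by (simp add: power2_eq_square F4_mult)
  have F: "w \<in> F4" "w + 1 \<in> F4" "g * (w + 1) \<in> F4" "g * w \<in> F4" "g\<^sup>2 * (w + 1) \<in> F4" "g\<^sup>2 * w \<in> F4"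
    using F4_w g g2 by (auto intro!: F4_mult)
  have w1: "(w + 1)\<^sup>2 = w" by (simp add: power2_eq_square ww1)
  have "sym_lift Fr (oval_vec (hyperoval g)) = 12 *\<^sub>R u0 + 2 *\<^sub>R (\<Sum>s\<in>hyperoval g. sym_lift Fr (u s))"
    by (rule sym_lift_oval_vec[OF m W])
  also have "(\<Sum>s\<in>hyperoval g. sym_lift Fr (u s)) = (\<Sum>s\<in>hyperoval (g\<^sup>2). u s)"
    unfolding hyperoval_sum
    using F F4_w g g2 u1[of 1 0 0] u1[of 0 1 0] u1[of 0 0 1] u1[of 1 1 g] u1[of 1 w "g * (w + 1)"] u1[of 1 "w + 1" "g * w"]
    unfolding power_mult_distrib w1 w_sq by (simp add: v3_pts add_ac)
  finally show ?thesis by (simp only: oval_vec_def)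
qed

text \<open>The two hyperovals share exactly the three axis points, and the inner product is
  \<open>6 + 3/2\<close>.\<close>

lemma oval_vec_not_int: assumes "g \<in> F4" "g' \<in> F4" "g \<noteq> g'" shows "oval_vec (hyperoval g) \<bullet> oval_vec (hyperoval g') \<notin> \<int>"
proof
  assume i: "oval_vec (hyperoval g) \<bullet> oval_vec (hyperoval g') \<in> \<int>"
  have "oval_vec (hyperoval g) \<bullet> oval_vec (hyperoval g') = 6 + 3/2"
    unfolding oval_vec_oval_vec[OF hyperoval_pts[OF assms(1)] hyperoval_pts[OF assms(2)]] hyperoval_Int[OF assms(3)] by simp
  then have "even (15::int)" by (intro even_of_half_int[OF i]) simp
  then show False by simp
qed

lemma fixes_vertices_Dg: assumes d: "\<delta> \<in> F4" "\<delta> \<noteq> 0" shows "fixes_vertices (Dg (dd \<delta>)) \<longleftrightarrow> \<delta> = 1"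
proof
  assume k: "fixes_vertices (Dg (dd \<delta>))"
  have "oval_vec (hyperoval 1) \<bullet> sym_lift (Dg (dd \<delta>)) (oval_vec (hyperoval 1)) \<in> \<int>"
    using k F4_w unfolding fixes_vertices_iff[OF SM_LI[OF Dg_dd_LI[OF d]]] by auto
  then have "oval_vec (hyperoval 1) \<bullet> oval_vec (hyperoval (\<delta> * 1)) \<in> \<int>" unfolding sym_lift_Dg_oval_vec[OF d F4_w(1)] .
  then show "\<delta> = 1" using oval_vec_not_int[OF F4_w(1) d(1)] by auto
next
  assume "\<delta> = 1"
  then have "Dg (dd \<delta>) = id"
    by (intro ext) (simp add: Dg_def dd_def if_distrib[of "\<lambda>a. a * _"] vec_lambda_eta cong: if_cong)
  then show "fixes_vertices (Dg (dd \<delta>))" using fixes_vertices_id by simp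
qed

text \<open>Multiplication by an element of \<open>NN\<close> changes neither side, so
  \<open>LI_decomp\<close> reduces the claim to \<open>Dg (dd \<delta>)\<close>, of determinant
  \<open>\<delta>\<^sup>2\<close>.\<close>

lemma fixes_vertices_det: assumes g: "g \<in> carrier GU" shows "fixes_vertices (act g) \<longleftrightarrow> det g = 1"
proof -
  have gL: "act g \<in> LI" using g act_LI_iff by blast
  obtain n \<delta> where n: "n \<in> NN" and d: "\<delta> \<in> F4" "\<delta> \<noteq> 0" and e: "n \<circ> act g = Dg (dd \<delta>)" using LI_decomp[OF gL] by blast
  obtain h where h: "n = act h" "det h = 1" using NN_det[OF n] by blast
  obtain k where k: "Dg (dd \<delta>) = act k" "det k = \<delta> * \<delta>" using Dg_det by blast
  have "act (g ** h) = act k" unfolding act_mult using e h(1) k(1) by simp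
  then have "g ** h = k" by (rule act_inj)
  then have "det g = \<delta> * \<delta>" using det_mul[of g h] h(2) k(2) by simp
  moreover have "\<delta> * \<delta> = 1 \<longleftrightarrow> \<delta> = 1" using d by (auto simp: F4_iff w2 ww1)
  moreover have "fixes_vertices (n \<circ> act g) \<longleftrightarrow> fixes_vertices (act g)" by (rule fixes_vertices_comp[OF SM_LI[OF NN_LI[OF n]] SM_LI[OF gL] fixes_vertices_NN[OF n]])
  ultimately show ?thesis using fixes_vertices_Dg[OF d] e by simp
qed

text \<open>Up to an element of \<open>NN\<close> a semilinear isometry is \<open>Dg (dd \<delta>)
  \<circ> Fr\<close>. It carries the hyperoval of \<open>g\<close> to that of \<open>\<delta>
  g\<^sup>2\<close>, and some nonzero \<open>g\<close> satisfies \<open>\<delta> g \<noteq>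
  1\<close>.\<close>

lemma fixes_vertices_semi: assumes m: "m \<in> LI" shows "\<not> fixes_vertices (m \<circ> sqv)"
proof -
  obtain T where T: "T \<in> LI" "Fr = T \<circ> sqv"
  proof -
    have "Fr \<in> SM" by (rule Fr_SM)
    then show ?thesis
    proof (cases rule: SM_cases)
      case lin
      have sq3: "sqv (v3 a 0 0) = v3 (a\<^sup>2) 0 0" for a by (simp add: sqv_def vec_eq_iff forall_3)
      have s0: "sqv 0 = (0::'k^3)" by (simp add: sqv_def vec_eq_iff)
      have "Fr (w *s J (v3 1 0 0) 0) = w *s Fr (J (v3 1 0 0) 0)" by (rule LI_scale[OF lin])
      then have "v3 (w\<^sup>2) 0 0 = v3 w 0 0" by (simp add: J_scale scale_v3 sq3 s0)
      then have False using w_ne by (simp add: w_sq)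
      then show ?thesis ..
    next
      case (semi T) then show ?thesis by (rule that)
    qed
  qed
  let ?T = "inv_into UNIV T"
  have iT: "?T \<in> LI" by (rule LI_inv[OF T(1)])
  have "?T \<circ> T = id" using LI_bij[OF T(1)] by (simp add: bij_is_inj)
  then have e1: "m \<circ> sqv = (m \<circ> ?T) \<circ> Fr" unfolding T(2) by (metis comp_assoc comp_id fun.map_id)
  have mT: "m \<circ> ?T \<in> LI" by (rule LI_comp[OF m iT])
  obtain n \<delta> where n: "n \<in> NN" and d: "\<delta> \<in> F4" "\<delta> \<noteq> 0" and e: "n \<circ> (m \<circ> ?T) = Dg (dd \<delta>)" using LI_decomp[OF mT] by blast
  have nS: "n \<in> SM" "m \<circ> sqv \<in> SM" "Dg (dd \<delta>) \<in> SM" "Fr \<in> SM"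
    using SM_LI[OF NN_LI[OF n]] SM_sq[OF m] SM_LI[OF Dg_dd_LI[OF d]] Fr_SM by auto
  have "n \<circ> (m \<circ> sqv) = Dg (dd \<delta>) \<circ> Fr" 
  proof -
    have "n \<circ> (m \<circ> sqv) = (n \<circ> (m \<circ> ?T)) \<circ> Fr" unfolding e1 by (simp only: comp_assoc)
    then show ?thesis unfolding e .
  qed
  then have K: "fixes_vertices (m \<circ> sqv) \<longleftrightarrow> fixes_vertices (Dg (dd \<delta>) \<circ> Fr)" using fixes_vertices_comp[OF nS(1,2) fixes_vertices_NN[OF n]] by simp
  (* Any nonzero g with \<delta> * g \<noteq> 1 serves. *)
  define g where "g = (if \<delta> = 1 then w else 1)"
  have g: "g \<in> F4" "g \<noteq> 0" "g \<noteq> \<delta> * g\<^sup>2" using w_ne F4_w by (auto simp: g_def w_sq)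
  have dg: "g\<^sup>2 \<in> F4" "\<delta> * g\<^sup>2 \<in> F4" using g d by (auto simp: power2_eq_square intro!: F4_mult)
  have F: "sym_lift (Dg (dd \<delta>) \<circ> Fr) (oval_vec (hyperoval g)) = oval_vec (hyperoval (\<delta> * g\<^sup>2))"
    by (simp add: sym_lift_comp[OF nS(3,4)] sym_lift_Fr_oval_vec[OF g(1)] sym_lift_Dg_oval_vec[OF d dg(1)])
  obtain k where k: "k < 3" "oval_vec (hyperoval g) + (3/2) *\<^sub>R vertex k \<in> \<Lambda>" using hyperoval_glue[OF g(1,2)] by blast
  have I: "Iso (sym_lift (Dg (dd \<delta>) \<circ> Fr))" "sym_lift (Dg (dd \<delta>) \<circ> Fr) ` vertices = vertices"
    unfolding sym_lift_comp[OF nS(3,4)] using Iso_comp[OF sym_lift_Iso(1)[OF nS(3)] sym_lift_Iso(1)[OF nS(4)]]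
    by (simp_all only: image_comp[symmetric] sym_lift_Iso nS)
  have "sym_lift (Dg (dd \<delta>) \<circ> Fr) (vertex k) \<noteq> vertex k"
    unfolding oval_criterion[OF I hyperoval_pts[OF g(1)] k] F by (rule oval_vec_not_int[OF g(1) dg(2) g(3)])
  then show ?thesis using k(1) K by (auto simp: fixes_vertices_def)
qed

end

section \<open>The composite homomorphism\<close>

lemma exists_omega:
  assumes "CHAR('k::alg_closed_field) = 2" shows "\<exists>w::'k. w * w = w + 1"
proof -
  have "\<exists>w::'k. poly [:1, 1, 1:] w = 0" by (rule alg_closed_imp_poly_has_root) simp
  then obtain w :: 'k where w: "1 + w * (1 + w) = 0" by auto
  have "of_nat 2 = (0::'k)" using assms by (metis of_nat_CHAR)
  then have two: "(1::'k) + 1 = 0" by simp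
  have d: "x + x = 0" for x :: 'k using two by (metis distrib_left mult.right_neutral mult_zero_right)
  have "w * w = (1 + w * (1 + w)) + (w + 1) - ((1 + 1) + (w + w))" by (simp add: algebra_simps)
  also have "\<dots> = w + 1" unfolding w d by simp
  finally show ?thesis by blast
qed

context char2_field begin

text \<open>The planes are spanned by rational vectors, so the action on rational points
  determines the action on planes.\<close>

lemma perm_planes:
  assumes m: "p \<in> SM" "m \<in> SM" "n \<in> SM" and e: "\<And>K. K \<in> rational_points \<Longrightarrow> p ` K = n ` m ` K" and P: "P \<in> planes"
  shows "p ` P = n ` m ` P"
proof (rule bij_image_eq_planes[OF m(1) P SM_plane[OF m(3) SM_plane[OF m(2) P]]])
  have sub: "vec.subspace (n ` m ` P)" using SM_plane[OF m(3) SM_plane[OF m(2) P]] by (simp add: planes_iff)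
  have "p v \<in> n ` m ` P" if v: "v \<in> P \<inter> F4v" for v
  proof (cases "v = 0")
    case True then show ?thesis using SM_0[OF m(1)] vec.subspace_0[OF sub] by simp
  next
    case False
    then have R: "vec.span {v} \<in> rational_points" using v P unfolding rational_points_iff planes_iff by blast
    have "vec.span {v} \<subseteq> P" using v P by (intro vec.span_minimal) (auto simp: planes_iff)
    moreover have "p v \<in> p ` vec.span {v}" by (intro imageI vec.span_base) simp
    ultimately show ?thesis unfolding e[OF R] by blast
  qed
  then have "vec.span (p ` (P \<inter> F4v)) \<subseteq> n ` m ` P" by (intro vec.span_minimal sub) blast
  then show "p ` P \<subseteq> n ` m ` P" unfolding SM_span[OF m(1)] plane_span_F4v[OF P] .
qed

lemma perm_apply_image: "K \<in> rational_points \<Longrightarrow> perm m K = m ` K" by (simp add: perm_def)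

lemma perm_mult:
  assumes m: "m \<in> SM" "n \<in> SM"
  shows "\<exists>p\<in>SM. perm m \<otimes>\<^bsub>PGammaU\<^esub> perm n = perm p \<and> (\<forall>K\<in>rational_points. p ` K = n ` m ` K) \<and> (\<forall>P\<in>planes. p ` P = n ` m ` P)"
proof -
  obtain p where p: "p \<in> SM" "compose rational_points (perm n) (perm m) = perm p" using perm_SM_comp[OF m(2,1)] by blast
  have e: "p ` K = n ` m ` K" if K: "K \<in> rational_points" for K
    using fun_cong[OF p(2), of K] K SM_rational[OF m(1) K] by (simp add: compose_def perm_apply_image)
  have "perm m \<otimes>\<^bsub>PGammaU\<^esub> perm n = perm p"
    using p(2) by (simp add: PGammaU_def subgroup_generated_def sym_group_def)
  moreover have "p ` P = n ` m ` P" if "P \<in> planes" for P by (rule perm_planes[OF p(1) m e that])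
  ultimately show ?thesis using p(1) e by blast
qed

text \<open>Conversely, two semilinear isometries that agree on the planes differ by a scalar
  (\<open>SM_fix_planes_scalar\<close>), which acts trivially on points.\<close>

lemma perm_eqI_planes:
  assumes m: "m \<in> SM" "n \<in> SM" and e: "\<And>P. P \<in> planes \<Longrightarrow> m ` P = n ` P" shows "perm m = perm n"
proof -
  obtain p where p: "p \<in> SM" "compose rational_points (perm p) (perm n) = (\<lambda>K\<in>rational_points. K)"
    using perm_SM_inv[OF m(2)] by blast
  have pn: "p ` n ` K = K" if K: "K \<in> rational_points" for K
    using fun_cong[OF p(2), of K] K SM_rational[OF m(2) K] by (simp add: compose_def perm_apply_image)
  have pnP: "p ` n ` P = P" if P: "P \<in> planes" for P
    using perm_planes[OF SM_LI[OF LI_id] m(2) p(1) _ P] pn by simp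
  obtain k where k: "k \<in> SM" "\<forall>K\<in>rational_points. k ` K = p ` m ` K" "\<forall>P\<in>planes. k ` P = p ` m ` P"
    using perm_mult[OF m(1) p(1)] by blast
  have "k ` P = P" if "P \<in> planes" for P using k(3) e pnP that by simp
  then obtain c where c: "c \<noteq> 0" "k = (\<lambda>v. c *s v)" using SM_fix_planes_scalar[OF k(1)] by blast
  have "m ` K = n ` K" if K: "K \<in> rational_points" for K
  proof -
    obtain v where v: "K = vec.span {v}" "v \<noteq> 0" "v \<in> F4v" using K unfolding rational_points_iff by blast
    have sub: "k ` K \<subseteq> K" unfolding c(2) v(1) by (auto intro: vec.span_scale)
    have "K \<subseteq> k ` K"
    proof
      fix x assume "x \<in> K"
      then have "inverse c *s x \<in> K" unfolding v(1) by (rule vec.span_scale)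
      moreover have "k (inverse c *s x) = x" using c by (simp add: vector_smult_assoc)
      ultimately show "x \<in> k ` K" by (metis imageI)
    qed
    then have "p ` m ` K = p ` n ` K" using sub k(2) pn[OF K] K by auto
    then show ?thesis using SM_bij[OF p(1)] by (simp add: bij_is_inj inj_image_eq_iff)
  qed
  then show ?thesis unfolding perm_eq_iff by blast
qed

lemma scalars_coset_mult:
  assumes "g \<in> carrier GU" "h \<in> carrier (GU :: ('k^6^6) monoid)"
  shows "(scalars #>\<^bsub>GU\<^esub> g) <#>\<^bsub>GU\<^esub> (scalars #>\<^bsub>GU\<^esub> h) = scalars #>\<^bsub>GU\<^esub> (g ** h)"
proof -
  have c: "mat c ** g ** (mat d ** h) = mat (c * d) ** (g ** h)" for c d
  proof (rule act_inj, rule ext)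
    fix v
    have gL: "act g \<in> LI" using assms(1) act_LI_iff by blast
    have "act (mat c ** g ** (mat d ** h)) v = act h (d *s act g (c *s v))" by (simp add: act_mult act_mat)
    also have "\<dots> = act h (act g ((c * d) *s v))"
      by (simp only: LI_scale[OF gL, symmetric] vector_smult_assoc mult.commute[of d c])
    also have "\<dots> = act (mat (c * d) ** (g ** h)) v" by (simp add: act_mult act_mat)
    finally show "act (mat c ** g ** (mat d ** h)) v = act (mat (c * d) ** (g ** h)) v" .
  qed
  show ?thesis
  proof
    show "(scalars #>\<^bsub>GU\<^esub> g) <#>\<^bsub>GU\<^esub> (scalars #>\<^bsub>GU\<^esub> h) \<subseteq> scalars #>\<^bsub>GU\<^esub> (g ** h)"
    proof
      fix x assume "x \<in> (scalars #>\<^bsub>GU\<^esub> g) <#>\<^bsub>GU\<^esub> (scalars #>\<^bsub>GU\<^esub> h)"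
      then obtain a b where ab: "a \<in> F4" "a \<noteq> 0" "b \<in> F4" "b \<noteq> 0" "x = mat a ** g ** (mat b ** h)"
        unfolding set_mult_def coset_eq by (auto simp: GU_def)
      then show "x \<in> scalars #>\<^bsub>GU\<^esub> (g ** h)" unfolding coset_eq ab(5) c using F4_mult by (metis (mono_tags, lifting) mem_Collect_eq mult_eq_0_iff)
    qed
    show "scalars #>\<^bsub>GU\<^esub> (g ** h) \<subseteq> (scalars #>\<^bsub>GU\<^esub> g) <#>\<^bsub>GU\<^esub> (scalars #>\<^bsub>GU\<^esub> h)"
    proof
      fix x assume "x \<in> scalars #>\<^bsub>GU\<^esub> (g ** h)"
      then obtain a where a: "a \<in> F4" "a \<noteq> 0" "x = mat a ** (g ** h)" unfolding coset_eq by blast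
      have x: "x = mat a ** g ** (mat 1 ** h)" unfolding c a(3) by simp
      have m: "k \<otimes>\<^bsub>GU\<^esub> l = k ** l" for k l :: "'k^6^6" by (simp add: GU_def)
      have "mat a ** g \<in> scalars #>\<^bsub>GU\<^esub> g"
        unfolding coset_eq by (intro CollectI exI[of _ a]) (simp add: a)
      moreover have "mat 1 ** h \<in> scalars #>\<^bsub>GU\<^esub> h"
        unfolding coset_eq by (intro CollectI exI[of _ 1]) (simp add: F4_eq)
      ultimately show "x \<in> (scalars #>\<^bsub>GU\<^esub> g) <#>\<^bsub>GU\<^esub> (scalars #>\<^bsub>GU\<^esub> h)"
        unfolding set_mult_def x m by blast
    qed
  qed
qed

lemma GU_mult_closed: "g \<in> carrier GU \<Longrightarrow> h \<in> carrier GU \<Longrightarrow> g ** h \<in> carrier (GU :: ('k^6^6) monoid)"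
  unfolding act_LI_iff[symmetric] act_mult by (rule LI_comp)

lemma PSU_simps: "carrier PSU = {scalars #>\<^bsub>GU\<^esub> g |g. g \<in> carrier (GU :: ('k^6^6) monoid) \<and> det g = 1}"
  "x \<otimes>\<^bsub>PSU\<^esub> y = x <#>\<^bsub>GU\<^esub> y"
  by (simp_all add: PSU_def PGU_def FactGroup_def)

text \<open>Equality of the permutations means that the two isometries differ by a scalar of the
  field with four elements.\<close>

lemma coset_eqI: assumes g: "g \<in> carrier GU" "h \<in> carrier (GU :: ('k^6^6) monoid)" and e: "perm (act g) = perm (act h)"
  shows "scalars #>\<^bsub>GU\<^esub> g = scalars #>\<^bsub>GU\<^esub> h"
proof -
  have gL: "act g \<in> LI" "act h \<in> LI" using g act_LI_iff by blast+
  let ?i = "inv_into UNIV (act h)"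
  have iL: "?i \<in> LI" by (rule LI_inv[OF gL(2)])
  have "act g ` P = act h ` P" if "P \<in> planes" for P
    using perm_planes[OF SM_LI[OF gL(1)] SM_LI[OF LI_id] SM_LI[OF gL(2)] _ that] e by (simp add: perm_eq_iff)
  then have "(?i \<circ> act g) ` P = P" if "P \<in> planes" for P
    using that LI_inv_image(1)[OF gL(2)] by (simp only: image_comp[symmetric])
  then obtain c where c: "c \<in> F4" "c \<noteq> 0" "?i \<circ> act g = (\<lambda>v. c *s v)"
    using SM_fix_planes_scalar[OF SM_LI[OF LI_comp[OF iL gL(1)]]] by blast
  have "act g v = act (mat c ** h) v" for v
  proof -
    have "act g v = act h (?i (act g v))" using LI_bij[OF gL(2)] by (simp add: bij_is_surj surj_f_inv_f)
    also have "?i (act g v) = c *s v" using fun_cong[OF c(3), of v] by simp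
    finally show ?thesis by (simp add: act_mult act_mat)
  qed
  then have gh: "g = mat c ** h" by (intro act_inj ext)
  have mm: "mat a ** (mat c ** h) = mat (a * c) ** h" for a
    by (rule act_inj) (simp add: act_mult act_mat fun_eq_iff vector_smult_assoc mult.commute)
  show ?thesis
  proof (rule subset_antisym)
    show "scalars #>\<^bsub>GU\<^esub> g \<subseteq> scalars #>\<^bsub>GU\<^esub> h"
    proof
      fix x assume "x \<in> scalars #>\<^bsub>GU\<^esub> g"
      then obtain a where "a \<in> F4" "a \<noteq> 0" "x = mat (a * c) ** h" unfolding coset_eq gh mm by blast
      then show "x \<in> scalars #>\<^bsub>GU\<^esub> h" unfolding coset_eq using c by (auto intro!: exI[of _ "a * c"] F4_mult)
    qed
    show "scalars #>\<^bsub>GU\<^esub> h \<subseteq> scalars #>\<^bsub>GU\<^esub> g"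
    proof
      fix x assume "x \<in> scalars #>\<^bsub>GU\<^esub> h"
      then obtain a where a: "a \<in> F4" "a \<noteq> 0" "x = mat a ** h" unfolding coset_eq by blast
      have e: "a * inverse c * c = a" using c(2) by simp
      have "x = mat (a * inverse c) ** g" unfolding gh mm a(3) e ..
      moreover have "a * inverse c \<in> F4" "a * inverse c \<noteq> 0" using a c by (simp_all add: F4_inverse_eq F4_mult power2_eq_square)
      ultimately show "x \<in> scalars #>\<^bsub>GU\<^esub> g" unfolding coset_eq by blast
    qed
  qed
qed

end

context edge begin

abbreviation "edge_map \<equiv> edge_hom \<Lambda> A B \<phi>"

lemma aut_cong: "aut p \<Longrightarrow> (\<And>P. P \<in> planes \<Longrightarrow> p P = r P) \<Longrightarrow> aut r"
  unfolding aut_def using bij_betw_cong[of planes p r planes] by simp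

lemma lift_cong: "lift p F \<Longrightarrow> (\<And>P. P \<in> planes \<Longrightarrow> p P = r P) \<Longrightarrow> lift r F"
  by (simp add: lift_def)

lemma edge_map_perm: assumes m: "m \<in> SM" shows "edge_map (perm m) = restrict (sym_lift m) \<Lambda>"
proof (rule edge_hom_lift)
  show "aut (rho_P (perm m))" by (rule aut_cong[OF aut_SM[OF m]]) (simp add: rho_P_perm[OF m])
  show "lift (rho_P (perm m)) (sym_lift m)" by (rule lift_cong[OF sym_lift_lift[OF m]]) (simp add: rho_P_perm[OF m])
qed

lemma circ_mult: "x \<otimes>\<^bsub>circ222 \<Lambda> A B\<^esub> y = compose \<Lambda> y x" "x \<otimes>\<^bsub>dot222 \<Lambda> A B\<^esub> y = compose \<Lambda> y x"
  by (simp_all add: circ222_def dot222_def orth_group_def sym_group_def)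

lemma compose_restrict: "(\<And>x. x \<in> \<Lambda> \<Longrightarrow> F x \<in> \<Lambda>) \<Longrightarrow> compose \<Lambda> (restrict F' \<Lambda>) (restrict F \<Lambda>) = restrict (F' \<circ> F) \<Lambda>"
  by (auto simp: compose_def restrict_def)

lemma edge_map_circ: assumes "m \<in> SM" shows "edge_map (perm m) \<in> carrier (circ222 \<Lambda> A B)"
  unfolding edge_map_perm[OF assms] by (rule sgn_circ[OF _ lift_sgn[OF sym_lift_lift[OF assms]]]) simp

lemma edge_map_hom: "edge_map \<in> hom PGammaU (circ222 \<Lambda> A B)"
proof (rule homI)
  fix x :: "('k^6) set \<Rightarrow> ('k^6) set" assume "x \<in> carrier PGammaU"
  then show "edge_map x \<in> carrier (circ222 \<Lambda> A B)" using edge_map_circ unfolding carrier_PGammaU by blast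
next
  fix x y :: "('k^6) set \<Rightarrow> ('k^6) set" assume "x \<in> carrier PGammaU" "y \<in> carrier PGammaU"
  then obtain m n where m: "m \<in> SM" "n \<in> SM" "x = perm m" "y = perm n" unfolding carrier_PGammaU by blast
  obtain p where p: "p \<in> SM" "perm m \<otimes>\<^bsub>PGammaU\<^esub> perm n = perm p" "\<forall>P\<in>planes. p ` P = n ` m ` P"
    using perm_mult[OF m(1,2)] by blast
  have "lift (\<lambda>P. n ` m ` P) (sym_lift n \<circ> sym_lift m)" by (rule lift_comp[OF sym_lift_lift[OF m(2)] sym_lift_lift[OF m(1)] aut_SM[OF m(1)]])
  then have "lift (\<lambda>P. p ` P) (sym_lift n \<circ> sym_lift m)" by (rule lift_cong) (simp add: p(3))
  then have F: "sym_lift p = sym_lift n \<circ> sym_lift m" by (rule sym_lift_eq)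
  show "edge_map (x \<otimes>\<^bsub>PGammaU\<^esub> y) = edge_map x \<otimes>\<^bsub>circ222 \<Lambda> A B\<^esub> edge_map y"
    unfolding m(3,4) p(2) edge_map_perm[OF p(1)] edge_map_perm[OF m(1)] edge_map_perm[OF m(2)] circ_mult F
    by (rule compose_restrict[symmetric]) (rule Iso_Lambda[OF sym_lift_Iso(1)[OF m(1)]])
qed

lemma edge_map_eqD: assumes m: "m \<in> SM" "n \<in> SM" "edge_map (perm m) = edge_map (perm n)" shows "perm m = perm n"
proof (rule perm_eqI_planes[OF m(1,2)])
  fix P :: "('k^6) set" assume P: "P \<in> planes"
  have "sym_lift m x = sym_lift n x" if "x \<in> \<Lambda>" for x
    using fun_cong[OF m(3)[unfolded edge_map_perm[OF m(1)] edge_map_perm[OF m(2)]], of x] that by simp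
  then have "sym_lift m = sym_lift n" by (rule restrict_Lambda_inj[OF Iso_lin[OF sym_lift_Iso(1)[OF m(1)]] Iso_lin[OF sym_lift_Iso(1)[OF m(2)]]])
  then have "tt (m ` P) = tt (n ` P)" using sym_lift_tt[OF m(1) P] sym_lift_tt[OF m(2) P] by simp
  then show "m ` P = n ` P" by (rule tt_inj[OF SM_plane[OF m(1) P] SM_plane[OF m(2) P]])
qed

lemma edge_map_inj: "inj_on edge_map (carrier PGammaU)"
  unfolding carrier_PGammaU by (rule inj_onI) (use edge_map_eqD in blast)

text \<open>The isometries of the lattice that are lifts.\<close>

definition plus :: "(real ^ 24 \<Rightarrow> real ^ 24) \<Rightarrow> bool" where "plus F \<longleftrightarrow> Iso F \<and> F ` vertices = vertices"

lemma plus_sym_lift: assumes "plus F" shows "\<exists>m\<in>SM. sym_lift m = F"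
proof -
  have "Iso F" "F ` vertices = vertices" using assms by (simp_all add: plus_def)
  from plus_aut[OF this] obtain p where p: "aut p" "lift p F" by blast
  obtain m where m: "m \<in> SM" "\<forall>P\<in>planes. p P = m ` P" using fundamental[OF p(1)] by blast
  have "lift (\<lambda>P. m ` P) F" by (rule lift_cong[OF p(2)]) (simp add: m(2))
  then show ?thesis using m(1) sym_lift_eq by blast
qed

text \<open>Every isometry of the lattice that permutes the vertices induces a symmetry of the
  planes, which is semilinear by \<open>fundamental\<close>.\<close>

lemma edge_map_image: "edge_map ` carrier PGammaU = {restrict F \<Lambda> |F. plus F}"
proof
  show "edge_map ` carrier PGammaU \<subseteq> {restrict F \<Lambda> |F. plus F}"
  proof
    fix f assume "f \<in> edge_map ` carrier PGammaU"
    then obtain m where m: "m \<in> SM" "f = edge_map (perm m)" unfolding carrier_PGammaU by blast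
    have "plus (sym_lift m)" using sym_lift_Iso[OF m(1)] by (simp add: plus_def)
    then show "f \<in> {restrict F \<Lambda> |F. plus F}" unfolding m(2) edge_map_perm[OF m(1)] by blast
  qed
  show "{restrict F \<Lambda> |F. plus F} \<subseteq> edge_map ` carrier PGammaU"
  proof
    fix f assume "f \<in> {restrict F \<Lambda> |F. plus F}"
    then obtain F where F: "plus F" "f = restrict F \<Lambda>" by blast
    obtain m where m: "m \<in> SM" "sym_lift m = F" using plus_sym_lift[OF F(1)] by blast
    have "f = edge_map (perm m)" unfolding edge_map_perm[OF m(1)] m(2) F(2) ..
    then show "f \<in> edge_map ` carrier PGammaU" unfolding carrier_PGammaU using m(1) by blast
  qed
qed

lemma plus_comp: "plus F \<Longrightarrow> plus F' \<Longrightarrow> plus (F \<circ> F')"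
  unfolding plus_def using Iso_comp by (auto simp only: image_comp[symmetric])

lemma plus_inv: assumes "plus F" shows "\<exists>F'. plus F' \<and> F \<circ> F' = id"
proof -
  let ?F = "inv_into UNIV F"
  have o: "orthogonal_transformation F" using assms by (simp add: plus_def Iso_def)
  have b: "bij F" using orthogonal_transformation_bij[OF o] .
  have i: "?F ` F ` S = S" for S using b by (simp add: bij_is_inj image_inv_f_f)
  have "?F ` \<Lambda> = \<Lambda>" "?F ` vertices = vertices" using i[of \<Lambda>] i[of vertices] assms by (simp_all add: plus_def Iso_def)
  moreover have "orthogonal_transformation ?F" using orthogonal_transformation_inv[OF o] .
  moreover have "F \<circ> ?F = id" using b by (intro ext) (simp add: bij_is_surj surj_f_inv_f)
  ultimately show ?thesis by (auto simp: plus_def Iso_def)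
qed

text \<open>For \<open>e = 1\<close> this is the image of the composite homomorphism, for \<open>e
  = - 1\<close> it turns out to be its other coset.\<close>

definition coset_of :: "real \<Rightarrow> (real ^ 24 \<Rightarrow> real ^ 24) set" where
  "coset_of e = {restrict (\<lambda>x. e *\<^sub>R F x) \<Lambda> |F. plus F}"

lemma coset_translate:
  assumes e: "e = 1 \<or> e = -1" and F: "plus F"
  shows "{restrict H \<Lambda> |H. plus H} #>\<^bsub>circ222 \<Lambda> A B\<^esub> restrict (\<lambda>x. e *\<^sub>R F x) \<Lambda> = coset_of e"
proof -
  have c: "compose \<Lambda> (restrict (\<lambda>x. e *\<^sub>R F x) \<Lambda>) (restrict H \<Lambda>) = restrict (\<lambda>x. e *\<^sub>R (F \<circ> H) x) \<Lambda>" if "plus H" for H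
    using that compose_restrict[of H "\<lambda>x. e *\<^sub>R F x"] Iso_Lambda by (simp add: plus_def comp_def)
  show ?thesis
  proof
    show "{restrict H \<Lambda> |H. plus H} #>\<^bsub>circ222 \<Lambda> A B\<^esub> restrict (\<lambda>x. e *\<^sub>R F x) \<Lambda> \<subseteq> coset_of e"
      unfolding r_coset_def circ_mult coset_of_def using c plus_comp[OF F] by blast
    show "coset_of e \<subseteq> {restrict H \<Lambda> |H. plus H} #>\<^bsub>circ222 \<Lambda> A B\<^esub> restrict (\<lambda>x. e *\<^sub>R F x) \<Lambda>"
    proof
      fix f assume "f \<in> coset_of e"
      then obtain K where K: "plus K" "f = restrict (\<lambda>x. e *\<^sub>R K x) \<Lambda>" unfolding coset_of_def by blast
      obtain F' where F': "plus F'" "F \<circ> F' = id" using plus_inv[OF F] by blast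
      have H: "plus (F' \<circ> K)" by (rule plus_comp[OF F'(1) K(1)])
      have "F \<circ> (F' \<circ> K) = K" unfolding comp_assoc[symmetric] F'(2) by simp
      then have "f = compose \<Lambda> (restrict (\<lambda>x. e *\<^sub>R F x) \<Lambda>) (restrict (F' \<circ> K) \<Lambda>)" unfolding c[OF H] K(2) by simp
      then show "f \<in> {restrict H \<Lambda> |H. plus H} #>\<^bsub>circ222 \<Lambda> A B\<^esub> restrict (\<lambda>x. e *\<^sub>R F x) \<Lambda>"
        unfolding r_coset_def circ_mult using H by blast
    qed
  qed
qed

lemma plus_id: "plus (\<lambda>x. x)" by (simp add: plus_def Iso_def orthogonal_transformation_id)

lemma plus_in_coset: "plus F \<Longrightarrow> restrict (\<lambda>x. e *\<^sub>R F x) \<Lambda> \<in> coset_of e"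
  unfolding coset_of_def by blast

lemma circ_carrier: "carrier (circ222 \<Lambda> A B) = coset_of 1 \<union> coset_of (-1)"
proof
  show "carrier (circ222 \<Lambda> A B) \<subseteq> coset_of 1 \<union> coset_of (-1)"
  proof
    fix g assume "g \<in> carrier (circ222 \<Lambda> A B)"
    then obtain F e where F: "e = 1 \<or> e = -1" "sgn_type e F" "g = restrict F \<Lambda>" using circ_cases by blast
    from F(1) show "g \<in> coset_of 1 \<union> coset_of (-1)"
    proof
      assume e: "e = 1"
      then have "plus F" using F(2) by (simp add: plus_def sgn_plus_vertices)
      then have "g \<in> coset_of 1" unfolding coset_of_def F(3) by (auto intro!: exI[of _ F])
      then show ?thesis ..
    next
      assume e: "e = -1"
      then have "sgn_type 1 (\<lambda>x. - F x)" using sgn_neg[OF F(2)] by simp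
      then have "plus (\<lambda>x. - F x)" by (simp add: plus_def sgn_plus_vertices)
      then have "g \<in> coset_of (-1)" unfolding coset_of_def F(3) by (auto intro!: exI[of _ "\<lambda>x. - F x"])
      then show ?thesis ..
    qed
  qed
  have 1: "restrict F \<Lambda> \<in> carrier (circ222 \<Lambda> A B)" "restrict (\<lambda>x. - F x) \<Lambda> \<in> carrier (circ222 \<Lambda> A B)" if "plus F" for F
  proof -
    have s: "sgn_type 1 F" using that by (simp add: plus_def sgn_plus_vertices)
    show "restrict F \<Lambda> \<in> carrier (circ222 \<Lambda> A B)" using sgn_circ[OF _ s] by simp
    show "restrict (\<lambda>x. - F x) \<Lambda> \<in> carrier (circ222 \<Lambda> A B)" using sgn_circ[OF _ sgn_neg[OF s]] by simp
  qed
  show "coset_of 1 \<union> coset_of (-1) \<subseteq> carrier (circ222 \<Lambda> A B)" unfolding coset_of_def using 1 by auto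
qed

text \<open>\<open>-1\<close> does not permute the vertices: \<open>- vertex 0\<close> has inner
  product \<open>- 4/3\<close> with \<open>vertex 0\<close>, vertices have \<open>4/3\<close> or
  \<open>- 2/3\<close>.\<close>

lemma coset_ne: "coset_of 1 \<noteq> coset_of (-1)"
proof
  assume e: "coset_of 1 = coset_of (-1)"
  have "restrict (\<lambda>x. 1 *\<^sub>R x) \<Lambda> \<in> coset_of 1" by (rule plus_in_coset[OF plus_id])
  then have "restrict (\<lambda>x. 1 *\<^sub>R x) \<Lambda> \<in> coset_of (-1)" by (simp only: e)
  then have "\<exists>F. restrict (\<lambda>x. 1 *\<^sub>R x) \<Lambda> = restrict (\<lambda>x. (-1) *\<^sub>R F x) \<Lambda> \<and> plus F"
    unfolding coset_of_def mem_Collect_eq .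
  then obtain F where F': "restrict (\<lambda>x. 1 *\<^sub>R x) \<Lambda> = restrict (\<lambda>x. (-1) *\<^sub>R F x) \<Lambda> \<and> plus F" by (rule exE)
  note F = conjunct2[OF F'] conjunct1[OF F']
  have "x = - F x" if "x \<in> \<Lambda>" for x using fun_cong[OF F(2), of x] that by simp
  moreover have l: "linear (\<lambda>x. - F x)" using F(1) Iso_lin[OF Iso_neg] by (simp add: plus_def)
  ultimately have "(\<lambda>x. x) = (\<lambda>x. - F x)" by (intro restrict_Lambda_inj linear_ident l)
  then have a: "vertex 0 = - F (vertex 0)" by (rule fun_cong)
  have "vertex 0 \<in> vertices" by (auto simp: vertices_def)
  then have "F (vertex 0) \<in> vertices" using F(1) by (auto simp: plus_def)
  then obtain j where j: "j < 3" "F (vertex 0) = vertex j" by (auto simp: vertices_def)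
  have "vertex 0 \<bullet> vertex 0 = - (vertex 0 \<bullet> vertex j)" using arg_cong[OF a, of "\<lambda>z. vertex 0 \<bullet> z"] j(2) by simp
  then show False using vertex_inner[of 0 0] vertex_inner[of 0 j] j(1) by (auto split: if_splits)
qed

lemma edge_map_index: "card (rcosets\<^bsub>circ222 \<Lambda> A B\<^esub> (edge_map ` carrier PGammaU)) = 2"
proof -
  have "rcosets\<^bsub>circ222 \<Lambda> A B\<^esub> (edge_map ` carrier PGammaU) = {coset_of 1, coset_of (-1)}"
  proof
    show "rcosets\<^bsub>circ222 \<Lambda> A B\<^esub> (edge_map ` carrier PGammaU) \<subseteq> {coset_of 1, coset_of (-1)}"
    proof
      fix S assume "S \<in> rcosets\<^bsub>circ222 \<Lambda> A B\<^esub> (edge_map ` carrier PGammaU)"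
      then obtain a where a: "a \<in> coset_of 1 \<union> coset_of (-1)" "S = {restrict H \<Lambda> |H. plus H} #>\<^bsub>circ222 \<Lambda> A B\<^esub> a"
        unfolding RCOSETS_def circ_carrier edge_map_image by blast
      then obtain e F where F: "e = 1 \<or> e = -1" "plus F" "a = restrict (\<lambda>x. e *\<^sub>R F x) \<Lambda>" unfolding coset_of_def by blast
      have "S = coset_of e" unfolding a(2) F(3) by (rule coset_translate[OF F(1,2)])
      then show "S \<in> {coset_of 1, coset_of (-1)}" using F(1) by blast
    qed
    have "coset_of e \<in> rcosets\<^bsub>circ222 \<Lambda> A B\<^esub> (edge_map ` carrier PGammaU)" if e: "e = 1 \<or> e = -1" for e
    proof -
      have "restrict (\<lambda>x. e *\<^sub>R x) \<Lambda> \<in> carrier (circ222 \<Lambda> A B)"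
        unfolding circ_carrier using e plus_in_coset[OF plus_id, of e] by blast
      then show ?thesis unfolding RCOSETS_def edge_map_image coset_translate[OF e plus_id, symmetric] by blast
    qed
    then show "{coset_of 1, coset_of (-1)} \<subseteq> rcosets\<^bsub>circ222 \<Lambda> A B\<^esub> (edge_map ` carrier PGammaU)" by blast
  qed
  then show ?thesis using coset_ne by simp
qed

lemma carrier_dot: "carrier (dot222 \<Lambda> A B) = {g \<in> carrier (orth_group \<Lambda>). g A = A \<and> g B = B}"
  by (simp add: dot222_def)

text \<open>The centre of the triangle is a linear combination of \<open>A\<close> and
  \<open>B\<close>.\<close>

lemma fix_AB_iff: assumes "linear F" shows "(\<forall>i<3. F (vertex i) = vertex i) \<longleftrightarrow> F A = A \<and> F B = B"
proof
  assume a: "\<forall>i<3. F (vertex i) = vertex i"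
  have f: "F (vertex 0) = vertex 0" "F (vertex 1) = vertex 1" "F (vertex 2) = vertex 2" using a by simp_all
  have "F (vertex 1 - vertex 0) = vertex 1 - vertex 0" "F (vertex 2 - vertex 0) = vertex 2 - vertex 0" using f assms by (simp_all only: linear_diff)
  then show "F A = A \<and> F B = B" by (simp add: vertex_simps)
next
  assume a: "F A = A \<and> F B = B"
  have "F G = G" unfolding G_def using a assms by (simp add: linear_scale linear_add)
  then have "F (vertex 0) = vertex 0" "F (vertex 1) = vertex 1" "F (vertex 2) = vertex 2" using a assms by (simp_all add: vertex_simps linear_neg linear_diff)
  then show "\<forall>i<3. F (vertex i) = vertex i" by (simp add: all_less3)
qed

lemma edge_map_dot: assumes m: "m \<in> SM" shows "edge_map (perm m) \<in> carrier (dot222 \<Lambda> A B) \<longleftrightarrow> fixes_vertices m"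
  unfolding edge_map_perm[OF m] carrier_dot fixes_vertices_def fix_AB_iff[OF Iso_lin[OF sym_lift_Iso(1)[OF m]]]
  using Iso_restrict_orth[OF sym_lift_Iso(1)[OF m]] AB by simp

text \<open>An isometry that fixes \<open>A\<close> and \<open>B\<close> fixes the three vertices,
  so it is a lift; it comes from a linear isometry by \<open>fixes_vertices_semi\<close>, which has
  determinant 1 by \<open>fixes_vertices_det\<close>.\<close>

lemma dot_image: assumes "f \<in> carrier (dot222 \<Lambda> A B)" shows "\<exists>g\<in>carrier GU. det g = 1 \<and> f = edge_map (perm (act g))"
proof -
  have f: "f \<in> carrier (orth_group \<Lambda>)" "f A = A" "f B = B" using assms by (auto simp: carrier_dot)
  obtain F where F: "Iso F" "f = restrict F \<Lambda>" using orth_extend[OF f(1)] by blast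
  have "F A = A" "F B = B" using f(2,3) AB unfolding F(2) by simp_all
  then have a: "\<forall>i<3. F (vertex i) = vertex i" using fix_AB_iff[OF Iso_lin[OF F(1)]] by blast
  then have "F ` vertices = vertices" unfolding vertices_def image_image by (intro image_cong) auto
  then have "plus F" using F(1) by (simp add: plus_def)
  then obtain m where m: "m \<in> SM" "sym_lift m = F" using plus_sym_lift by blast
  have K: "fixes_vertices m" using a m(2) by (simp add: fixes_vertices_def)
  from m(1) have "m \<in> LI"
  proof (cases rule: SM_cases)
    case (semi m') then show ?thesis using K fixes_vertices_semi by blast
  qed
  then obtain g where g: "g \<in> carrier GU" "m = act g" using LI_imp_act by blast
  have "det g = 1" using K fixes_vertices_det[OF g(1)] g(2) by simp
  moreover have "f = edge_map (perm (act g))" using edge_map_perm[OF m(1)] m(2) F(2) g(2) by simp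
  ultimately show ?thesis using g(1) by blast
qed

lemma edge_map_PSU: "(\<lambda>V. edge_map (pgu_perm V)) \<in> iso PSU (dot222 \<Lambda> A B)"
proof (rule isoI)
  have gS: "act g \<in> SM" if "g \<in> carrier GU" for g :: "'k^6^6" using that act_LI_iff SM_LI by blast
  have car: "edge_map (perm (act g)) \<in> carrier (dot222 \<Lambda> A B)" if "g \<in> carrier GU" "det g = 1" for g :: "'k^6^6"
    using edge_map_dot[OF gS[OF that(1)]] fixes_vertices_det[OF that(1)] that(2) by blast
  show "(\<lambda>V. edge_map (pgu_perm V)) \<in> hom PSU (dot222 \<Lambda> A B)"
  proof (rule homI)
    fix x :: "('k^6^6) set" assume "x \<in> carrier PSU"
    then obtain g where g: "g \<in> carrier GU" "det g = 1" "x = scalars #>\<^bsub>GU\<^esub> g" unfolding PSU_simps by blast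
    show "edge_map (pgu_perm x) \<in> carrier (dot222 \<Lambda> A B)"
      unfolding g(3) pgu_perm_coset[OF g(1)] by (rule car[OF g(1,2)])
  next
    fix x y :: "('k^6^6) set" assume "x \<in> carrier PSU" "y \<in> carrier PSU"
    then obtain g h where g: "g \<in> carrier GU" "x = scalars #>\<^bsub>GU\<^esub> g" and h: "h \<in> carrier GU" "y = scalars #>\<^bsub>GU\<^esub> h"
      unfolding PSU_simps by blast
    have gh: "g ** h \<in> carrier GU" by (rule GU_mult_closed[OF g(1) h(1)])
    have F: "sym_lift (act (g ** h)) = sym_lift (act h) \<circ> sym_lift (act g)"
      unfolding act_mult by (rule sym_lift_comp[OF gS[OF h(1)] gS[OF g(1)]])
    show "edge_map (pgu_perm (x \<otimes>\<^bsub>PSU\<^esub> y)) = edge_map (pgu_perm x) \<otimes>\<^bsub>dot222 \<Lambda> A B\<^esub> edge_map (pgu_perm y)"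
      unfolding PSU_simps g(2) h(2) scalars_coset_mult[OF g(1) h(1)] pgu_perm_coset[OF g(1)] pgu_perm_coset[OF h(1)]
        pgu_perm_coset[OF gh] edge_map_perm[OF gS[OF g(1)]] edge_map_perm[OF gS[OF h(1)]] edge_map_perm[OF gS[OF gh]] circ_mult F
      by (rule compose_restrict[symmetric]) (rule Iso_Lambda[OF sym_lift_Iso(1)[OF gS[OF g(1)]]])
  qed
  show "bij_betw (\<lambda>V. edge_map (pgu_perm V)) (carrier PSU) (carrier (dot222 \<Lambda> A B))"
    unfolding bij_betw_def
  proof
    show "inj_on (\<lambda>V. edge_map (pgu_perm V)) (carrier PSU)"
    proof (rule inj_onI)
      fix x y :: "('k^6^6) set" assume "x \<in> carrier PSU" "y \<in> carrier PSU" and e: "edge_map (pgu_perm x) = edge_map (pgu_perm y)"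
      then obtain g h where g: "g \<in> carrier GU" "x = scalars #>\<^bsub>GU\<^esub> g" and h: "h \<in> carrier GU" "y = scalars #>\<^bsub>GU\<^esub> h"
        unfolding PSU_simps by blast
      have "perm (act g) = perm (act h)"
        using e unfolding g(2) h(2) pgu_perm_coset[OF g(1)] pgu_perm_coset[OF h(1)] by (rule edge_map_eqD[OF gS[OF g(1)] gS[OF h(1)]])
      then show "x = y" unfolding g(2) h(2) by (rule coset_eqI[OF g(1) h(1)])
    qed
    show "(\<lambda>V. edge_map (pgu_perm V)) ` carrier PSU = carrier (dot222 \<Lambda> A B)"
    proof
      show "(\<lambda>V. edge_map (pgu_perm V)) ` carrier PSU \<subseteq> carrier (dot222 \<Lambda> A B)"
        unfolding PSU_simps using car pgu_perm_coset by auto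
      show "carrier (dot222 \<Lambda> A B) \<subseteq> (\<lambda>V. edge_map (pgu_perm V)) ` carrier PSU"
      proof
        fix f assume "f \<in> carrier (dot222 \<Lambda> A B)"
        then obtain g where g: "g \<in> carrier GU" "det g = 1" "f = edge_map (perm (act g))" using dot_image by blast
        have "f = edge_map (pgu_perm (scalars #>\<^bsub>GU\<^esub> g))" unfolding pgu_perm_coset[OF g(1)] by (rule g(3))
        then show "f \<in> (\<lambda>V. edge_map (pgu_perm V)) ` carrier PSU" unfolding PSU_simps using g by blast
      qed
    qed
  qed
qed

end

theorem theorem1p5:
  fixes \<Lambda> :: "(real ^ 24) set" and A B :: "real ^ 24"
    and \<phi> :: "('k::alg_closed_field ^ 6) set \<Rightarrow> real ^ 24"
  assumes "CHAR('k) = 2"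
    and "leech_lattice \<Lambda>"
    and "(A, B) \<in> edge_pairs \<Lambda>"
    and "edge_correspondence \<Lambda> A B \<phi>"
  shows "edge_hom \<Lambda> A B \<phi> \<in> hom PGammaU (circ222 \<Lambda> A B) \<and>
    inj_on (edge_hom \<Lambda> A B \<phi>) (carrier PGammaU) \<and>
    card (rcosets\<^bsub>circ222 \<Lambda> A B\<^esub> (edge_hom \<Lambda> A B \<phi> ` carrier PGammaU)) = 2 \<and>
    (\<lambda>U. edge_hom \<Lambda> A B \<phi> (pgu_perm U)) \<in> iso PSU (dot222 \<Lambda> A B)"
proof -
  obtain w :: 'k where "w * w = w + 1" using exists_omega[OF assms(1)] by blast
  then interpret edge w \<Lambda> A B \<phi> by unfold_locales (rule assms | assumption)+
  show ?thesis by (intro conjI edge_map_hom edge_map_inj edge_map_index edge_map_PSU)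
qed

end
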